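(* Let $M$ be a closed connected smooth Riemannian manifold and let $G:T^*M\to\mathbb{R}$ be continuous, convex in $p$, and superlinear in $p$ ($G(x,p)/\|p\|_x\to+\infty$ as $\|p\|_x\to\infty$). Fix a continuous function $\sigma:M\to(0,+\infty)$. Then the operator $\mathbb{P}^\sigma_G:C(M)\to C(M)$, $$\mathbb{P}^\sigma_G\varphi(x)=\inf_{\mu\in\mathfrak M(L_G)}\left\{\frac{\int_M\sigma(y)h_G(y,x)\,d\mu(y)}{\int_M\sigma(y)\,d\mu(y)}+\frac{\int_M\sigma(y)\varphi(y)\,d\mu(y)}{\int_M\sigma(y)\,d\mu(y)}\right\},$$ has the following properties: (i) $\|\mathbb{P}^\sigma_G\varphi_1-\mathbb{P}^\sigma_G\varphi_2\|_\infty\le\|\varphi_1-\varphi_2\|_\infty$ for all $\varphi_1,\varphi_2\in C(M)$. (ii) For any $\varphi\in C(M)$, the function $\mathbb{P}^\sigma_G\varphi:M\to\mathbb{R}$ is a viscosity solution of $G(x,d_xu)=c(G)$ in $M$. (iii) A continuous function $u:M\to\mathbb{R}$ is a viscosity solution of $G(x,d_xu)=c(G)$ in $M$ if and only if it is a fixed point of $\mathbb{P}^\sigma_G$, i.e. for all $x \in M$ $$u(x)=\inf_{\mu\in\mathfrak M(L_G)}\left\{\frac{\int_M\sigma(y)h_G(y,x)\,d\mu(y)}{\int_M\sigma(y)\,d\mu(y)}+\frac{\int_M\sigma(y)u(y)\,d\mu(y)}{\int_M\sigma(y)\,d\mu(y)}\right\}.$$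
   Context: $C(M)$ is the space of continuous real functions on $M$ with the sup norm $\|\cdot\|_\infty$. The critical value of $G$ is $c(G)=\inf_{f\in C^1(M)}\max_{x\in M}G(x,d_xf)$; it is the only constant $c$ for which $G(x,d_xu)=c$ admits viscosity solutions on $M$. The Lagrangian is $L_G(x,v)=\sup_{p\in T_x^*M}(p(v)-G(x,p))$ on $TM$. A Borel probability measure $\tilde\mu$ on $TM$ is closed if $\int_{TM}\|v\|_x\,d\tilde\mu<\infty$ and $\int_{TM}d_x\varphi(v)\,d\tilde\mu(x,v)=0$ for all $\varphi\in C^1(M)$. A Mather measure of $L_G$ is a closed probability measure $\tilde\mu$ with $\int_{TM}L_G\,d\tilde\mu=-c(G)$. A projected Mather measure is $\mu=\pi_\#\tilde\mu$ with $\tilde\mu$ a Mather measure and $\pi:TM\to M$ the canonical projection; $\mathfrak M(L_G)$ is the set of all projected Mather measures. The Peierls barrier of $L_G$ is $h_G(x,y)=\liminf_{t\to+\infty}[h_t(x,y)+c(G)t]$, where $h_t(x,y)=\inf\int_0^tL_G(\gamma(s),\dot\gamma(s))\,ds$ over absolutely continuous $\gamma:[0,t]\to M$ with $\gamma(0)=x$, $\gamma(t)=y$. *)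

theory Defs
  imports "HOL-Probability.Probability"
begin

section \<open>Functions of class \<open>C\<^sup>k\<close> and absolutely continuous functions\<close>

text \<open>
  On an open subset of a Euclidean space, being of class \<open>C\<^sup>k\<^sup>+\<^sup>1\<close> means being differentiable with
  all directional derivatives of class \<open>C\<^sup>k\<close>.
\<close>

primrec Ck_on :: "nat \<Rightarrow> 'a::euclidean_space set \<Rightarrow> ('a \<Rightarrow> 'b::real_normed_vector) \<Rightarrow> bool" where
  "Ck_on 0 S f \<longleftrightarrow> continuous_on S f"
| "Ck_on (Suc k) S f \<longleftrightarrow> (\<forall>x\<in>S. f differentiable (at x)) \<and>
     (\<forall>v. Ck_on k S (\<lambda>x. frechet_derivative f (at x) v))"

definition smooth_on :: "'a::euclidean_space set \<Rightarrow> ('a \<Rightarrow> 'b::real_normed_vector) \<Rightarrow> bool" where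
  "smooth_on S f \<longleftrightarrow> (\<forall>k. Ck_on k S f)"

definition abs_continuous_on :: "real \<Rightarrow> real \<Rightarrow> (real \<Rightarrow> 'a::real_normed_vector) \<Rightarrow> bool" where
  "abs_continuous_on a b f \<longleftrightarrow>
     (\<forall>\<epsilon>>0. \<exists>\<delta>>0. \<forall>I::(real \<times> real) set.
        finite I \<and> (\<forall>(s, t)\<in>I. a \<le> s \<and> s \<le> t \<and> t \<le> b) \<and>
        disjoint_family_on (\<lambda>(s, t). {s<..<t}) I \<and> (\<Sum>(s, t)\<in>I. t - s) < \<delta> \<longrightarrow>
        (\<Sum>(s, t)\<in>I. norm (f t - f s)) < \<epsilon>)"

text \<open>
  Integral with values in the extended reals, the integral of the positive part minus that of the
  negative part; \<^const>\<open>e2ennreal\<close> sends negative numbers to \<open>0\<close>.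
\<close>

definition ereal_integral :: "'a measure \<Rightarrow> ('a \<Rightarrow> ereal) \<Rightarrow> ereal" where
  "ereal_integral M f =
     enn2ereal (\<integral>\<^sup>+ x. e2ennreal (f x) \<partial>M) - enn2ereal (\<integral>\<^sup>+ x. e2ennreal (- f x) \<partial>M)"

section \<open>Smooth manifolds\<close>

text \<open>The manifold is the whole type \<open>'m\<close>; a chart is given by its domain and its coordinate map.\<close>

type_synonym ('m, 'e) chart = "'m set \<times> ('m \<Rightarrow> 'e)"

definition chart_inv :: "('m, 'e) chart \<Rightarrow> 'e \<Rightarrow> 'm" where
  "chart_inv c = inv_into (fst c) (snd c)"

definition smooth_atlas :: "('m::topological_space, 'e::euclidean_space) chart set \<Rightarrow> bool" where
  "smooth_atlas A \<longleftrightarrow>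
     (\<forall>c\<in>A. open (fst c) \<and> open (snd c ` fst c) \<and>
        homeomorphism (fst c) (snd c ` fst c) (snd c) (chart_inv c)) \<and>
     (\<Union>c\<in>A. fst c) = UNIV \<and>
     (\<forall>c\<in>A. \<forall>d\<in>A. smooth_on (snd c ` (fst c \<inter> fst d)) (snd d \<circ> chart_inv c))"

text \<open>
  The tangent space at \<open>x\<close> is represented by the model space \<open>'e\<close>, a vector being identified with
  its coordinates in one chosen chart around \<open>x\<close>. A cotangent vector is then an element of
  \<open>'e \<Rightarrow>\<^sub>L real\<close>. The underlying sets of the tangent and cotangent bundles are thus the types
  \<open>'m \<times> 'e\<close> and \<open>'m \<times> ('e \<Rightarrow>\<^sub>L real)\<close>, but their topologies, defined below from all charts, are not
  the product topologies: the chosen chart need not vary continuously with \<open>x\<close>.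
\<close>

definition chart_at :: "('m, 'e) chart set \<Rightarrow> 'm \<Rightarrow> ('m, 'e) chart" where
  "chart_at A x = (SOME c. c \<in> A \<and> x \<in> fst c)"

text \<open>The differential at \<open>x\<close> of the change of coordinates from the chart \<open>c\<close> to the chart \<open>d\<close>.\<close>

definition coord_change ::
    "('m, 'e::euclidean_space) chart \<Rightarrow> ('m, 'e) chart \<Rightarrow> 'm \<Rightarrow> 'e \<Rightarrow>\<^sub>L 'e" where
  "coord_change c d x = Blinfun (frechet_derivative (snd d \<circ> chart_inv c) (at (snd c x)))"

text \<open>
  Inverse bundle charts: the point of the tangent (cotangent) bundle which has
  coordinates \<open>(y, w)\<close> in the chart \<open>c\<close>.
\<close>

definition tangent_of_chart ::
    "('m, 'e::euclidean_space) chart set \<Rightarrow> ('m, 'e) chart \<Rightarrow> 'e \<times> 'e \<Rightarrow> 'm \<times> 'e" where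
  "tangent_of_chart A c = (\<lambda>(y, w). let x = chart_inv c y in
     (x, blinfun_apply (coord_change c (chart_at A x) x) w))"

definition cotangent_of_chart ::
    "('m, 'e::euclidean_space) chart set \<Rightarrow> ('m, 'e) chart \<Rightarrow>
      'e \<times> ('e \<Rightarrow>\<^sub>L real) \<Rightarrow> 'm \<times> ('e \<Rightarrow>\<^sub>L real)" where
  "cotangent_of_chart A c = (\<lambda>(y, q). let x = chart_inv c y in
     (x, q o\<^sub>L coord_change (chart_at A x) c x))"

definition tangent_topology ::
    "('m, 'e::euclidean_space) chart set \<Rightarrow> ('m \<times> 'e) topology" where
  "tangent_topology A = topology (\<lambda>W. \<forall>c\<in>A.
     open ((snd c ` fst c \<times> UNIV) \<inter> tangent_of_chart A c -` W))"

definition cotangent_topology ::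
    "('m, 'e::euclidean_space) chart set \<Rightarrow> ('m \<times> ('e \<Rightarrow>\<^sub>L real)) topology" where
  "cotangent_topology A = topology (\<lambda>W. \<forall>c\<in>A.
     open ((snd c ` fst c \<times> UNIV) \<inter> cotangent_of_chart A c -` W))"

lemma istopology_final:
  fixes F :: "'c \<Rightarrow> 'a::topological_space \<Rightarrow> 'b"
  shows "istopology (\<lambda>W. \<forall>c\<in>A. open (D c \<inter> F c -` W))"
  unfolding istopology_def
proof (intro conjI allI impI)
  fix S T
  assume "\<forall>c\<in>A. open (D c \<inter> F c -` S)" and "\<forall>c\<in>A. open (D c \<inter> F c -` T)"
  moreover have "D c \<inter> F c -` (S \<inter> T) = (D c \<inter> F c -` S) \<inter> (D c \<inter> F c -` T)" for c
    by auto
  ultimately show "\<forall>c\<in>A. open (D c \<inter> F c -` (S \<inter> T))"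
    by auto
next
  fix K
  assume "\<forall>W\<in>K. \<forall>c\<in>A. open (D c \<inter> F c -` W)"
  then have "\<forall>c\<in>A. open (\<Union>W\<in>K. D c \<inter> F c -` W)"
    by (intro ballI open_UN) blast
  moreover have "D c \<inter> F c -` (\<Union>K) = (\<Union>W\<in>K. D c \<inter> F c -` W)" for c
    by auto
  ultimately show "\<forall>c\<in>A. open (D c \<inter> F c -` (\<Union>K))"
    by (simp only:)
qed

lemma openin_tangent_topology:
  "openin (tangent_topology A) W \<longleftrightarrow>
     (\<forall>c\<in>A. open ((snd c ` fst c \<times> UNIV) \<inter> tangent_of_chart A c -` W))"
  unfolding tangent_topology_def by (subst topology_inverse' [OF istopology_final]) (rule refl)

lemma openin_cotangent_topology:
  "openin (cotangent_topology A) W \<longleftrightarrow>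
     (\<forall>c\<in>A. open ((snd c ` fst c \<times> UNIV) \<inter> cotangent_of_chart A c -` W))"
  unfolding cotangent_topology_def by (subst topology_inverse' [OF istopology_final]) (rule refl)

definition tangent_borel ::
    "('m, 'e::euclidean_space) chart set \<Rightarrow> ('m \<times> 'e) measure" where
  "tangent_borel A = sigma UNIV {W. openin (tangent_topology A) W}"

definition C1_functions :: "('m, 'e::euclidean_space) chart set \<Rightarrow> ('m \<Rightarrow> real) set" where
  "C1_functions A = {f. \<forall>c\<in>A. Ck_on 1 (snd c ` fst c) (f \<circ> chart_inv c)}"

definition differential ::
    "('m, 'e::euclidean_space) chart set \<Rightarrow> ('m \<Rightarrow> real) \<Rightarrow> 'm \<Rightarrow> 'e \<Rightarrow>\<^sub>L real" where
  "differential A f x =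
     Blinfun (frechet_derivative (f \<circ> chart_inv (chart_at A x)) (at (snd (chart_at A x) x)))"

text \<open>Meaningful where \<open>\<gamma>\<close> is differentiable, i.e. almost everywhere on an absolutely continuous curve.\<close>

definition velocity ::
    "('m, 'e::euclidean_space) chart set \<Rightarrow> (real \<Rightarrow> 'm) \<Rightarrow> real \<Rightarrow> 'e" where
  "velocity A \<gamma> s = vector_derivative (snd (chart_at A (\<gamma> s)) \<circ> \<gamma>) (at s)"

definition abs_continuous_curve ::
    "('m::topological_space, 'e::euclidean_space) chart set \<Rightarrow> real \<Rightarrow> (real \<Rightarrow> 'm) \<Rightarrow> bool" where
  "abs_continuous_curve A t \<gamma> \<longleftrightarrow> continuous_on {0..t} \<gamma> \<and>
     (\<forall>c\<in>A. \<forall>a b. 0 \<le> a \<and> a \<le> b \<and> b \<le> t \<and> \<gamma> ` {a..b} \<subseteq> fst c \<longrightarrow>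
        abs_continuous_on a b (snd c \<circ> \<gamma>))"

section \<open>Riemannian metrics\<close>

definition riemannian_metric ::
    "('m, 'e::euclidean_space) chart set \<Rightarrow> ('m \<Rightarrow> 'e \<Rightarrow> 'e \<Rightarrow> real) \<Rightarrow> bool" where
  "riemannian_metric A g \<longleftrightarrow>
     (\<forall>x. bilinear (g x) \<and> (\<forall>v w. g x v w = g x w v) \<and> (\<forall>v. v \<noteq> 0 \<longrightarrow> g x v v > 0)) \<and>
     (\<forall>c\<in>A. \<forall>v w. smooth_on (snd c ` fst c)
        (\<lambda>y. g (chart_inv c y) (snd (tangent_of_chart A c (y, v))) (snd (tangent_of_chart A c (y, w)))))"

definition tangent_norm :: "('m \<Rightarrow> 'e \<Rightarrow> 'e \<Rightarrow> real) \<Rightarrow> 'm \<Rightarrow> 'e \<Rightarrow> real" where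
  "tangent_norm g x v = sqrt (g x v v)"

definition cotangent_norm ::
    "('m \<Rightarrow> 'e \<Rightarrow> 'e \<Rightarrow> real) \<Rightarrow> 'm \<Rightarrow> ('e::euclidean_space \<Rightarrow>\<^sub>L real) \<Rightarrow> real" where
  "cotangent_norm g x p = (SUP v\<in>{v. tangent_norm g x v \<le> 1}. blinfun_apply p v)"

section \<open>Hamiltonians, Mather measures and the Peierls barrier\<close>

definition superlinear ::
    "('m \<Rightarrow> 'e \<Rightarrow> 'e \<Rightarrow> real) \<Rightarrow> ('m \<Rightarrow> ('e::euclidean_space \<Rightarrow>\<^sub>L real) \<Rightarrow> real) \<Rightarrow> bool" where
  "superlinear g G \<longleftrightarrow> (\<forall>x. filterlim (\<lambda>p. G x p / cotangent_norm g x p) at_top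
     (filtercomap (cotangent_norm g x) at_top))"

definition critical_value ::
    "('m, 'e::euclidean_space) chart set \<Rightarrow> ('m \<Rightarrow> ('e \<Rightarrow>\<^sub>L real) \<Rightarrow> real) \<Rightarrow> real" where
  "critical_value A G = (INF f\<in>C1_functions A. SUP x. G x (differential A f x))"

definition lagrangian ::
    "('m \<Rightarrow> ('e::euclidean_space \<Rightarrow>\<^sub>L real) \<Rightarrow> real) \<Rightarrow> 'm \<Rightarrow> 'e \<Rightarrow> real" where
  "lagrangian G x v = (SUP p. blinfun_apply p v - G x p)"

definition closed_measure ::
    "('m, 'e::euclidean_space) chart set \<Rightarrow> ('m \<Rightarrow> 'e \<Rightarrow> 'e \<Rightarrow> real) \<Rightarrow>
      ('m \<times> 'e) measure \<Rightarrow> bool" where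
  "closed_measure A g \<mu> \<longleftrightarrow> prob_space \<mu> \<and> sets \<mu> = sets (tangent_borel A) \<and>
     integrable \<mu> (\<lambda>(x, v). tangent_norm g x v) \<and>
     (\<forall>f\<in>C1_functions A. (\<integral>(x, v). blinfun_apply (differential A f x) v \<partial>\<mu>) = 0)"

definition mather_measure ::
    "('m, 'e::euclidean_space) chart set \<Rightarrow> ('m \<Rightarrow> 'e \<Rightarrow> 'e \<Rightarrow> real) \<Rightarrow>
      ('m \<Rightarrow> ('e \<Rightarrow>\<^sub>L real) \<Rightarrow> real) \<Rightarrow> ('m \<times> 'e) measure \<Rightarrow> bool" where
  "mather_measure A g G \<mu> \<longleftrightarrow> closed_measure A g \<mu> \<and>
     has_bochner_integral \<mu> (\<lambda>(x, v). lagrangian G x v) (- critical_value A G)"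

definition projected_mather_measures ::
    "('m::topological_space, 'e::euclidean_space) chart set \<Rightarrow> ('m \<Rightarrow> 'e \<Rightarrow> 'e \<Rightarrow> real) \<Rightarrow>
      ('m \<Rightarrow> ('e \<Rightarrow>\<^sub>L real) \<Rightarrow> real) \<Rightarrow> 'm measure set" where
  "projected_mather_measures A g G = {distr \<mu> borel fst | \<mu>. mather_measure A g G \<mu>}"

text \<open>
  The action of an absolutely continuous curve may be \<open>+\<infinity>\<close>, hence the extended reals. Lebesgue
  rather than Borel measure is used because the velocity is arbitrary on a null set.
\<close>

definition minimal_action ::
    "('m::topological_space, 'e::euclidean_space) chart set \<Rightarrow>
      ('m \<Rightarrow> ('e \<Rightarrow>\<^sub>L real) \<Rightarrow> real) \<Rightarrow> real \<Rightarrow> 'm \<Rightarrow> 'm \<Rightarrow> ereal" where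
  "minimal_action A G t x y =
     (INF \<gamma>\<in>{\<gamma>. abs_continuous_curve A t \<gamma> \<and> \<gamma> 0 = x \<and> \<gamma> t = y}.
        ereal_integral (lebesgue_on {0..t}) (\<lambda>s. ereal (lagrangian G (\<gamma> s) (velocity A \<gamma> s))))"

definition peierls_barrier ::
    "('m::topological_space, 'e::euclidean_space) chart set \<Rightarrow>
      ('m \<Rightarrow> ('e \<Rightarrow>\<^sub>L real) \<Rightarrow> real) \<Rightarrow> 'm \<Rightarrow> 'm \<Rightarrow> ereal" where
  "peierls_barrier A G x y =
     Liminf at_top (\<lambda>t::real. minimal_action A G t x y + ereal (critical_value A G * t))"

definition viscosity_solution ::
    "('m::topological_space, 'e::euclidean_space) chart set \<Rightarrow>
      ('m \<Rightarrow> ('e \<Rightarrow>\<^sub>L real) \<Rightarrow> real) \<Rightarrow> real \<Rightarrow> ('m \<Rightarrow> real) \<Rightarrow> bool" where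
  "viscosity_solution A G a u \<longleftrightarrow> continuous_on UNIV u \<and>
     (\<forall>f\<in>C1_functions A. \<forall>x.
        ((\<forall>\<^sub>F y in nhds x. u y - f y \<le> u x - f x) \<longrightarrow> G x (differential A f x) \<le> a) \<and>
        ((\<forall>\<^sub>F y in nhds x. u y - f y \<ge> u x - f x) \<longrightarrow> G x (differential A f x) \<ge> a))"

definition weighted_peierls ::
    "('m::topological_space, 'e::euclidean_space) chart set \<Rightarrow> ('m \<Rightarrow> 'e \<Rightarrow> 'e \<Rightarrow> real) \<Rightarrow>
      ('m \<Rightarrow> ('e \<Rightarrow>\<^sub>L real) \<Rightarrow> real) \<Rightarrow> ('m \<Rightarrow> real) \<Rightarrow> ('m \<Rightarrow> real) \<Rightarrow> 'm \<Rightarrow> ereal" where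
  "weighted_peierls A g G \<sigma> \<phi> x = (INF \<mu>\<in>projected_mather_measures A g G.
     ereal_integral \<mu> (\<lambda>y. ereal (\<sigma> y) * peierls_barrier A G y x) / ereal (\<integral>y. \<sigma> y \<partial>\<mu>) +
     ereal ((\<integral>y. \<sigma> y * \<phi> y \<partial>\<mu>) / (\<integral>y. \<sigma> y \<partial>\<mu>)))"

end

theory Submission
  imports Defs
begin

text \<open>
  Write \<open>c\<close> for the critical value, \<open>h\<^sub>t\<close> for the minimal action and \<open>k\<close> for the Peierls barrier.
  A continuous function is a viscosity subsolution at level \<open>c\<close> iff it is dominated, i.e.
  \<open>u(y) - u(x) \<le> h\<^sub>t(x, y) + c t\<close>; by convexity it is then a uniform limit of C1 functions that are almost
  subsolutions. A dominated function for which equality is almost attained at every end point and time is a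
  viscosity solution. This makes \<open>k\<close> finite and every \<open>k(y, \<cdot>)\<close> a solution.

  Conversely, from every point a solution \<open>u\<close> decreases along small steps at rate \<open>L + c\<close>, and the empirical
  measures of chains of such steps ending at \<open>x\<close> converge to a Mather measure on which
  \<open>k(\<cdot>, x) + u = u(x)\<close>. Since \<open>u(x) \<le> k(y, x) + u(y)\<close> always, \<open>u\<close> is a fixed point.

  The infimum defining the operator is a solution because the sublevel sets of a difference of two subsolutions
  are invariant for Mather measures: the differentials of C1 approximations of both converge to \<open>L + c\<close> in
  \<open>L\<^sup>1\<close>. So a Mather measure splits into Mather measures on whose supports the functions \<open>k(y, \<cdot>)\<close> agree
  up to constants and small errors, and averages of such functions are again almost calibrated.
\<close>

section \<open>Absolutely continuous functions\<close>

text \<open>Two obstacles shape the rest. Mather measures must arise as limits in a compact part of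
  the tangent bundle; to this end the supersolution test is made to yield single straight steps in
  charts, with velocities bounded through the local Lipschitz constant of the solution. The nth
  chain has tolerance 1/(n+1)^2 per unit of time and total time about n, so the accumulated error
  vanishes, and dividing by the total time removes the boundary terms. The second obstacle is that
  an average of solutions is in general only a subsolution, since each member is calibrated by its
  own curves; members that differ by a constant share them. The cells of the splitting are therefore
  cut out by the functions k(y, i) - k(y, x) of y, for finitely many i, each the difference of the
  subsolutions - k(., x) and - k(., i). The normalised weight does not disturb this: the excess over
  the average integrates to zero, so some piece has an average no larger than the whole.\<close>

abbreviation disj_ivs :: "(real \<times> real) set => bool" where
 "disj_ivs \<equiv> disjoint_family_on (%(s, t). {s<..<t})"

text \<open>The outer measure \<open>m\<close> of \<open>S\<close> satisfies
  \<open>m <= kap * m\<close>: cover \<open>S\<close> finely by small balls inside an open set of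
  measure close to \<open>m\<close>, select disjoint ones by Vitali, and replace the trace of
  \<open>S\<close> on each ball by its cover \<open>T\<close>. As \<open>S\<close> need not be
  measurable, all estimates go through measurable supersets.\<close>

lemma negligible_if_density_bounded:
 fixes S :: "real set"
 assumes "bounded S" "0 <= kap" "kap < 1"
  and dens: "!!x d. x \<in> S ==> d > 0 ==> EX a r T. x \<in> ball a r & 0 < r & r < d &
   S Int ball a r \<subseteq> T & T \<in> lmeasurable & measure lebesgue T <= kap * measure lebesgue (ball a r)"
 shows "negligible S"
proof -
 let ?X = "{measure lebesgue T | T. S \<subseteq> T & T \<in> lmeasurable}"
 define m where "m = Inf ?X"
 have bdd: "bdd_below ?X" by (rule bdd_belowI[of _ 0]) auto
 obtain R where R: "S \<subseteq> cball 0 R"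
  using bounded_subset_ballD[OF assms(1), of 0] by (meson ball_subset_cball order_trans)
 have ne: "?X ~= {}" using R by (auto intro!: exI[of _ "cball 0 R"])
 have m0: "0 <= m" unfolding m_def using ne by (intro cInf_greatest) auto
 \<comment> \<open>\<open>eta\<close> is spent twice: on the superset \<open>T\<close> of
   \<open>S\<close> and on the open set \<open>U\<close> around \<open>T\<close>.\<close>
 have key: "m <= kap * (m + 2 * eta)" if "eta > 0" for eta
 proof -
  obtain T where T: "S \<subseteq> T" "T \<in> lmeasurable" "measure lebesgue T < m + eta"
   using cInf_lessD[OF ne, of "m + eta"] `eta > 0` unfolding m_def by auto
  obtain U where U: "open U" "T \<subseteq> U" "U - T \<in> lmeasurable" "emeasure lebesgue (U - T) < ennreal eta"
   using sets_lebesgue_outer_open[OF fmeasurableD[OF T(2)] `eta > 0`] by metis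
  have UT: "U = T \<union> (U - T)" using U by auto
  have Ulm: "U \<in> lmeasurable" using fmeasurable.Un[OF T(2) U(3)] UT by metis
  have "measure lebesgue (U - T) < eta"
   using U(3,4) `eta > 0` by (simp add: emeasure_eq_measure2 ennreal_less_iff)
  moreover have "measure lebesgue U <= measure lebesgue T + measure lebesgue (U - T)"
   using measure_Un_le[OF fmeasurableD[OF T(2)] fmeasurableD[OF U(3)]] UT by metis
  ultimately have Um: "measure lebesgue U < measure lebesgue T + eta" by simp
  define Q where "Q i T \<longleftrightarrow> S Int ball (fst i) (snd i) \<subseteq> T & T \<in> lmeasurable &
    measure lebesgue T <= kap * measure lebesgue (ball (fst i) (snd i))" for i :: "real \<times> real" and T
  define K where "K = {i. 0 < snd i & ball (fst i) (snd i) \<subseteq> U & (EX T. Q i T)}"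
  obtain C where C: "countable C" "C \<subseteq> K"
    "pairwise (%i j. disjnt (ball (fst i) (snd i)) (ball (fst j) (snd j))) C"
    "negligible (S - (\<Union>i \<in> C. ball (fst i) (snd i)))"
  proof (rule Vitali_covering_theorem_balls[of S K fst snd])
   fix x d :: real assume "x \<in> S" "0 < d"
   then obtain e where e: "e > 0" "ball x e \<subseteq> U" using U T by (meson openE subsetD)
   obtain a r T' where *: "x \<in> ball a r" "0 < r" "r < min d (e/2)" "S Int ball a r \<subseteq> T'"
    "T' \<in> lmeasurable" "measure lebesgue T' <= kap * measure lebesgue (ball a r)"
    using dens[OF `x \<in> S`, of "min d (e/2)"] `0 < d` e by auto
   have "ball a r \<subseteq> ball x e" using * by (auto simp: dist_real_def)
   hence "(a, r) \<in> K" using * e unfolding K_def Q_def by auto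
   thus "EX i. i \<in> K & x \<in> ball (fst i) (snd i) & snd i < d"
    using * by (intro exI[of _ "(a, r)"]) auto
  qed
  have "ALL i:C. EX T. Q i T" using C(2) by (auto simp: K_def)
  then obtain W where W: "!!i. i \<in> C ==> Q i (W i)" by metis
  let ?B = "%i. ball (fst i) (snd i)"
  let ?Y = "%i. W i Int ?B i"
  have disjB: "disjoint_family_on ?B C"
   using C(3) by (auto simp: disjoint_family_on_def pairwise_def disjnt_def)
  hence disjY: "disjoint_family_on ?Y C"
   by (rule disjoint_family_on_bisimulation) auto
  have Wm: "W i \<in> lmeasurable" if "i \<in> C" for i using W[OF that] by (simp add: Q_def)
  have "emeasure lebesgue (\<Union>i\<in>C. ?Y i) = (\<integral>\<^sup>+i. emeasure lebesgue (?Y i) \<partial>count_space C)"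
   using C(1) disjY Wm by (intro emeasure_UN_countable) (auto intro!: sets.Int fmeasurableD)
  also have "... <= (\<integral>\<^sup>+i. ennreal kap * emeasure lebesgue (?B i) \<partial>count_space C)"
  proof (rule nn_integral_mono)
   fix i assume "i \<in> space (count_space C)"
   hence i: "i \<in> C" by simp
   have "emeasure lebesgue (?Y i) <= emeasure lebesgue (W i)"
    using Wm[OF i] by (intro emeasure_mono) (auto intro: fmeasurableD)
   also have "... = ennreal (measure lebesgue (W i))" using Wm[OF i] by (simp add: emeasure_eq_measure2)
   also have "... <= ennreal (kap * measure lebesgue (?B i))"
    using W[OF i] by (intro ennreal_leI) (simp add: Q_def)
   also have "... = ennreal kap * emeasure lebesgue (?B i)"
    using `0 <= kap` by (simp add: ennreal_mult'' emeasure_eq_measure2)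
   finally show "emeasure lebesgue (?Y i) <= ennreal kap * emeasure lebesgue (?B i)" .
  qed
  also have "... = ennreal kap * (\<integral>\<^sup>+i. emeasure lebesgue (?B i) \<partial>count_space C)"
   by (rule nn_integral_cmult) simp
  also have "... = ennreal kap * emeasure lebesgue (\<Union>i\<in>C. ?B i)"
   using C(1) disjB by (subst emeasure_UN_countable) auto
  also have "... <= ennreal kap * emeasure lebesgue U"
   using C(2) Ulm by (intro mult_left_mono emeasure_mono) (auto simp: K_def)
  also have "... = ennreal (kap * measure lebesgue U)"
   using Ulm `0 <= kap` by (simp add: ennreal_mult'' emeasure_eq_measure2)
  finally have em: "emeasure lebesgue (\<Union>i\<in>C. ?Y i) <= ennreal (kap * measure lebesgue U)" .
  have Ysets: "(\<Union>i\<in>C. ?Y i) \<in> sets lebesgue"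
   using C(1) Wm by (intro sets.countable_UN'') (auto intro: fmeasurableD)
  have Ylm: "(\<Union>i\<in>C. ?Y i) \<in> lmeasurable"
   using Ysets le_less_trans[OF em ennreal_less_top] by (intro fmeasurableI) auto
  have Nlm: "S - (\<Union>i\<in>C. ?B i) \<in> lmeasurable" "measure lebesgue (S - (\<Union>i\<in>C. ?B i)) = 0"
   using C(4) by (auto simp: negligible_imp_measurable negligible_imp_measure0)
  let ?Z = "(\<Union>i\<in>C. ?Y i) \<union> (S - (\<Union>i\<in>C. ?B i))"
  have "S \<subseteq> ?Z"
  proof
   fix x assume x: "x \<in> S"
   show "x \<in> ?Z"
   proof (cases "EX i:C. x \<in> ?B i")
    case True
    then obtain i where "i \<in> C" "x \<in> ?B i" by auto
    with x W[of i] show ?thesis by (force simp: Q_def)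
   qed (use x in auto)
  qed
  moreover have "?Z \<in> lmeasurable" by (rule fmeasurable.Un[OF Ylm Nlm(1)])
  ultimately have "m <= measure lebesgue ?Z"
   unfolding m_def by (intro cInf_lower bdd) auto
  also have "... <= measure lebesgue (\<Union>i\<in>C. ?Y i) + 0"
   using measure_Un_le[of "\<Union>i\<in>C. ?Y i" lebesgue "S - (\<Union>i\<in>C. ?B i)"] Ylm Nlm by (simp add: fmeasurableD)
  also have "... <= kap * measure lebesgue U"
   using em Ylm `0 <= kap` by (simp add: emeasure_eq_measure2)
  also have "... <= kap * (m + 2 * eta)"
   using Um T(3) `0 <= kap` by (intro mult_left_mono) auto
  finally show ?thesis .
 qed
 have "m <= kap * m"
 proof (rule field_le_epsilon)
  fix e :: real assume "e > 0"
  have "m <= kap * (m + 2 * (e / 2))" using key[of "e/2"] `e > 0` by simp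
  also have "... <= kap * m + e" using `e > 0` `kap < 1` by (simp add: algebra_simps mult_left_le_one_le assms(2))
  finally show "m <= kap * m + e" .
 qed
 hence "(1 - kap) * m <= 0" by (simp add: algebra_simps)
 hence "m <= 0" using `kap < 1` by (simp add: mult_le_0_iff)
 show "negligible S"
  unfolding negligible_outer_le
 proof (intro allI impI)
  fix e :: real assume "e > 0"
  hence "Inf ?X < e" using `m <= 0` unfolding m_def by simp
  thus "EX T. S \<subseteq> T & T \<in> lmeasurable & measure lebesgue T <= e"
   using cInf_lessD[OF ne, of e] by (auto intro: less_imp_le)
 qed
qed

text \<open>Each steep interval has an image under \<open>F\<close> that is longer by a factor
  \<open>q\<close>. Disjoint Vitali intervals have disjoint images by monotonicity, and these all
  lie between \<open>F s\<close> and \<open>F t\<close>, which bounds the total length of the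
  intervals. Since \<open>F\<close> may jump, the image of an interval is taken to be the interval
  between the values at its end points.\<close>

lemma mono_steep_set_measure:
 fixes F :: "real => real"
 assumes "mono F" "q > 0" "s < t" "S \<subseteq> {s<..<t}"
  and steep: "!!x d. x \<in> S ==> d > 0 ==> EX s' t'. x \<in> {s'<..<t'} & t' - s' < d & q * (t' - s') < F t' - F s'"
 shows "EX T:lmeasurable. S \<subseteq> T & measure lebesgue T <= (F t - F s) / q"
proof -
 define K where "K = {i::real\<times>real. 0 < snd i & ball (fst i) (snd i) \<subseteq> {s<..<t} &
  q * (2 * snd i) < F (fst i + snd i) - F (fst i - snd i)}"
 let ?B = "%i::real\<times>real. ball (fst i) (snd i)"
 obtain C where C: "countable C" "C \<subseteq> K" "pairwise (%i j. disjnt (?B i) (?B j)) C"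
   "negligible (S - (\<Union>i \<in> C. ?B i))"
 proof (rule Vitali_covering_theorem_balls[of S K fst snd])
  fix x d :: real assume "x \<in> S" "0 < d"
  hence x: "s < x" "x < t" using assms(4) by auto
  define d' where "d' = min d (min (x - s) (t - x))"
  have "d' > 0" using x `0 < d` by (auto simp: d'_def)
  then obtain s' t' where *: "x \<in> {s'<..<t'}" "t' - s' < d'" "q * (t' - s') < F t' - F s'"
   using steep[OF `x \<in> S`] by blast
  define i where "i = ((s' + t') / 2, (t' - s') / 2)"
  have B: "?B i = {s'<..<t'}" unfolding i_def by (auto simp: ball_eq_greaterThanLessThan field_simps)
  have "fst i + snd i = t'" "fst i - snd i = s'" "2 * snd i = t' - s'" "0 < snd i"
   using * by (auto simp: i_def field_simps)
  hence "i \<in> K" unfolding K_def mem_Collect_eq B using * x by (auto simp: d'_def)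
  thus "EX i. i \<in> K & x \<in> ?B i & snd i < d"
   using * by (intro exI[of _ i]) (auto simp: B, auto simp: i_def d'_def)
 qed
 have disjB: "disjoint_family_on ?B C"
  using C(3) by (auto simp: disjoint_family_on_def pairwise_def disjnt_def)
 let ?J = "%i::real\<times>real. {F (fst i - snd i)<..<F (fst i + snd i)}"
 have disjJ: "disjoint_family_on ?J C"
  unfolding disjoint_family_on_def
 proof (intro ballI impI)
  fix i j assume ij: "i \<in> C" "j \<in> C" "i ~= j"
  have pos: "0 < snd i" "0 < snd j" using ij C(2) by (auto simp: K_def)
  have "?B i Int ?B j = {}" using disjB ij by (auto simp: disjoint_family_on_def)
  hence "fst i + snd i <= fst j - snd j \<or> fst j + snd j <= fst i - snd i"
   using pos unfolding ball_eq_greaterThanLessThan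
   by (subst (asm) Int_greaterThanLessThan) (auto simp: max_def min_def split: if_splits)
  hence "F (fst i + snd i) <= F (fst j - snd j) \<or> F (fst j + snd j) <= F (fst i - snd i)"
   using `mono F` by (auto dest: monoD)
  thus "?J i Int ?J j = {}" by auto
 qed
 have "emeasure lebesgue (\<Union>i\<in>C. ?B i) = (\<integral>\<^sup>+i. emeasure lebesgue (?B i) \<partial>count_space C)"
  using C(1) disjB by (intro emeasure_UN_countable) auto
 also have "... <= (\<integral>\<^sup>+i. ennreal (1 / q) * emeasure lebesgue (?J i) \<partial>count_space C)"
 proof (rule nn_integral_mono)
  fix i assume "i \<in> space (count_space C)"
  hence i: "0 < snd i" "q * (2 * snd i) < F (fst i + snd i) - F (fst i - snd i)"
   using C(2) by (auto simp: K_def)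
  have m: "F (fst i - snd i) <= F (fst i + snd i)" using i `mono F` by (auto intro: monoD)
  have "emeasure lebesgue (?B i) = ennreal (2 * snd i)"
   using i by (simp add: ball_eq_greaterThanLessThan)
  also have "... <= ennreal (1 / q * (F (fst i + snd i) - F (fst i - snd i)))"
   using i `q > 0` by (intro ennreal_leI) (auto simp: field_simps)
  also have "... = ennreal (1 / q) * emeasure lebesgue (?J i)"
   using m `q > 0` by (subst ennreal_mult) auto
  finally show "emeasure lebesgue (?B i) <= ennreal (1 / q) * emeasure lebesgue (?J i)" .
 qed
 also have "... = ennreal (1/q) * (\<integral>\<^sup>+i. emeasure lebesgue (?J i) \<partial>count_space C)"
  by (rule nn_integral_cmult) simp
 also have "... = ennreal (1/q) * emeasure lebesgue (\<Union>i\<in>C. ?J i)"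
  using C(1) disjJ by (subst emeasure_UN_countable) auto
 also have "... <= ennreal (1/q) * emeasure lebesgue {F s..F t}"
 proof (intro mult_left_mono emeasure_mono)
  show "(\<Union>i\<in>C. ?J i) \<subseteq> {F s..F t}"
  proof
   fix y assume "y \<in> (\<Union>i\<in>C. ?J i)"
   then obtain i where i: "i \<in> C" "y \<in> ?J i" by blast
   hence "0 < snd i" "{fst i - snd i<..<fst i + snd i} \<subseteq> {s<..<t}"
    using C(2) by (auto simp: K_def ball_eq_greaterThanLessThan)
   hence "s <= fst i - snd i" "fst i + snd i <= t"
    by (auto simp: greaterThanLessThan_subseteq_greaterThanLessThan)
   hence "F s <= F (fst i - snd i)" "F (fst i + snd i) <= F t"
    using `mono F` by (auto dest: monoD)
   thus "y \<in> {F s..F t}" using i by auto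
  qed
 qed auto
 also have "... = ennreal ((F t - F s) / q)"
  using `s < t` `q > 0` monoD[OF `mono F`, of s t] by (simp add: ennreal_mult'[symmetric])
 finally have em: "emeasure lebesgue (\<Union>i\<in>C. ?B i) <= ennreal ((F t - F s) / q)" .
 have Bs: "(\<Union>i\<in>C. ?B i) \<in> lmeasurable"
  by (intro fmeasurableI sets.countable_UN'' le_less_trans[OF em]) (auto simp: C(1))
 have N: "S - (\<Union>i\<in>C. ?B i) \<in> lmeasurable" "measure lebesgue (S - (\<Union>i\<in>C. ?B i)) = 0"
  using C(4) by (auto simp: negligible_imp_measurable negligible_imp_measure0)
 have "measure lebesgue ((\<Union>i\<in>C. ?B i) \<union> (S - (\<Union>i\<in>C. ?B i))) <= measure lebesgue (\<Union>i\<in>C. ?B i) + 0"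
  using measure_Un_le[of "\<Union>i\<in>C. ?B i" lebesgue "S - (\<Union>i\<in>C. ?B i)"] Bs N by (simp add: fmeasurableD)
 also have "... <= (F t - F s) / q"
  using em Bs `s < t` `q > 0` monoD[OF `mono F`, of s t] by (simp add: emeasure_eq_measure2)
 finally have "measure lebesgue ((\<Union>i\<in>C. ?B i) \<union> (S - (\<Union>i\<in>C. ?B i))) <= (F t - F s) / q" .
 moreover have "S \<subseteq> (\<Union>i\<in>C. ?B i) \<union> (S - (\<Union>i\<in>C. ?B i))" by auto
 ultimately show ?thesis
  using fmeasurable.Un[OF Bs N(1)] by (intro bexI[of _ "(\<Union>i\<in>C. ?B i) \<union> (S - (\<Union>i\<in>C. ?B i))"] conjI)
qed


text \<open>Lebesgue's differentiation theorem. At a point of continuity without derivative the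
  difference quotients are unbounded or oscillate across rationals \<open>p < q\<close>. The
  unbounded set \<open>I n\<close> is null by \<open>mono_steep_set_measure\<close> with large
  \<open>q\<close>. Points of the oscillating set \<open>E p q n\<close> lie in short intervals on
  which \<open>F\<close> grows by less than \<open>p\<close> times the length; the points of the
  set, being steep with slope \<open>q\<close>, fill at most the fraction \<open>p / q\<close> of
  these, so \<open>negligible_if_density_bounded\<close> applies. The discontinuities are
  countable.\<close>

lemma mono_differentiable_ae:
 fixes F :: "real => real"
 assumes "mono F"
 shows "negligible {x. ~ F differentiable (at x)}"
proof -
 define Q where "Q x y = (F y - F x) / (y - x)" for x y
 define hi where "hi q x \<longleftrightarrow> (ALL d>0. EX y. y ~= x & \<bar>y - x\<bar> < d & q < Q x y)" for q x
 define lo where "lo p x \<longleftrightarrow> (ALL d>0. EX y. y ~= x & \<bar>y - x\<bar> < d & Q x y < p)" for p x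
 have Qpos: "0 <= Q x y" for x y
  using monoD[OF assms, of x y] monoD[OF assms, of y x]
  unfolding Q_def by (cases x y rule: linorder_cases) (auto simp: divide_nonpos_nonpos)
 have steep: "EX s t. x \<in> {s<..<t} & t - s < d & q * (t - s) < F t - F s"
  if "hi q x" "q > 0" "d > 0" for q x d
 proof -
  obtain y where y: "y ~= x" "\<bar>y - x\<bar> < d / 2" "q < Q x y"
   using `hi q x` `d > 0` unfolding hi_def by (meson half_gt_zero)
  define z where "z = \<bar>F y - F x\<bar> - q * \<bar>y - x\<bar>"
  have Q': "Q x y = \<bar>F y - F x\<bar> / \<bar>y - x\<bar>"
   using Qpos[of x y] by (metis Q_def abs_divide abs_of_nonneg)
  have "z > 0" using y(1,3) unfolding z_def Q' by (simp add: field_simps)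
  \<comment> \<open>The interval must contain \<open>x\<close> in its interior, so it is prolonged
    past \<open>x\<close> by \<open>tht\<close>; the slack \<open>z\<close> in the slope inequality
    pays for \<open>q * tht\<close>.\<close>
  define tht where "tht = min (d / 2) (z / (2 * q))"
  have th: "tht > 0" "tht <= d / 2" "q * tht < z"
  proof -
   show "tht > 0" "tht <= d/2" using `z > 0` `q > 0` `d > 0` by (auto simp: tht_def)
   have "q * tht <= q * (z / (2 * q))" using `q > 0` by (intro mult_left_mono) (auto simp: tht_def)
   thus "q * tht < z" using `q > 0` `z > 0` by simp
  qed
  show ?thesis
  proof (cases "x < y")
   case True
   have "F (x - tht) <= F x" "F x <= F y" using th True by (auto intro: monoD[OF assms])
   thus ?thesis using True y th unfolding z_def
    by (intro exI[of _ "x - tht"] exI[of _ y]) (auto simp: algebra_simps)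
  next
   case False
   hence "F x <= F (x + tht)" "F y <= F x" using th by (auto intro: monoD[OF assms])
   thus ?thesis using False y th unfolding z_def
    by (intro exI[of _ y] exI[of _ "x + tht"]) (auto simp: algebra_simps)
  qed
 qed
 \<comment> \<open>Here prolonging the interval past \<open>x\<close> adds to the growth of
   \<open>F\<close>, against the estimate; continuity at \<open>x\<close> keeps the addition below
   the slack. In the steep case the same addition only helps.\<close>
 have flat: "EX s t. x \<in> {s<..<t} & t - s < d & F t - F s < p * (t - s)"
  if "lo p x" "d > 0" "isCont F x" for p x d
 proof -
  obtain y where y: "y ~= x" "\<bar>y - x\<bar> < d / 2" "Q x y < p"
   using `lo p x` `d > 0` unfolding lo_def by (meson half_gt_zero)
  have "p > 0" using Qpos[of x y] y(3) by simp
  define z where "z = p * \<bar>y - x\<bar> - \<bar>F y - F x\<bar>"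
  have Q': "Q x y = \<bar>F y - F x\<bar> / \<bar>y - x\<bar>"
   using Qpos[of x y] by (metis Q_def abs_divide abs_of_nonneg)
  have "z > 0" using y(1,3) unfolding z_def Q' by (simp add: field_simps)
  obtain tht0 where t0: "tht0 > 0" "!!x'. \<bar>x' - x\<bar> < tht0 ==> \<bar>F x' - F x\<bar> < z"
   using `isCont F x` `z > 0` unfolding continuous_at_eps_delta dist_real_def by metis
  define tht where "tht = min (d / 2) (tht0 / 2)"
  have th: "tht > 0" "tht <= d / 2" "tht < tht0" using t0 `d > 0` by (auto simp: tht_def)
  have pt: "p * tht > 0" using `p > 0` th by simp
  show ?thesis
  proof (cases "x < y")
   case True
   have "F x <= F y" using True by (auto intro: monoD[OF assms])
   moreover have "\<bar>F (x - tht) - F x\<bar> < z" using t0(2)[of "x - tht"] th by simp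
   ultimately show ?thesis using True y th pt unfolding z_def
    by (intro exI[of _ "x - tht"] exI[of _ y]) (auto simp: algebra_simps)
  next
   case False
   hence "F y <= F x" by (auto intro: monoD[OF assms])
   moreover have "\<bar>F (x + tht) - F x\<bar> < z" using t0(2)[of "x + tht"] th by simp
   ultimately show ?thesis using False y th pt unfolding z_def
    by (intro exI[of _ y] exI[of _ "x + tht"]) (auto simp: algebra_simps)
  qed
 qed
 define E where "E p q n = {x. isCont F x & lo p x & hi q x & \<bar>x\<bar> < real n}" for p q n
 have negE: "negligible (E p q n)" if "p < q" for p q n
 proof (cases "E p q n = {}")
  case False
  then obtain x0 where "lo p x0" by (auto simp: E_def)
  then obtain y0 where "Q x0 y0 < p" unfolding lo_def by (meson zero_less_one)
  hence "p > 0" using Qpos[of x0 y0] by simp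
  show ?thesis
  proof (rule negligible_if_density_bounded[where kap = "p / q"])
   show "bounded (E p q n)" unfolding bounded_iff E_def by (intro exI[of _ "real n"]) auto
   show "0 <= p / q" "p / q < 1" using `p > 0` that by auto
   fix x d :: real assume x: "x \<in> E p q n" and "d > 0"
   then obtain s t where st: "x \<in> {s<..<t}" "t - s < d" "F t - F s < p * (t - s)"
    using flat[of p x d] by (auto simp: E_def)
   have "s < t" using st by auto
   have "EX T:lmeasurable. E p q n Int {s<..<t} \<subseteq> T & measure lebesgue T <= (F t - F s) / q"
    using steep[of q] `p > 0` that `s < t`
    by (intro mono_steep_set_measure assms) (auto simp: E_def)
   then obtain T where T: "T \<in> lmeasurable" "E p q n Int {s<..<t} \<subseteq> T"
     "measure lebesgue T <= (F t - F s) / q" by blast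
   have B: "ball ((s + t) / 2) ((t - s) / 2) = {s<..<t}"
    by (auto simp: ball_eq_greaterThanLessThan field_simps)
   have "(F t - F s) / q <= p * (t - s) / q" using st `p > 0` that by (intro divide_right_mono) auto
   hence "measure lebesgue T <= p / q * measure lebesgue {s<..<t}" using T `s < t` by simp
   thus "EX a r T. x \<in> ball a r & 0 < r & r < d & E p q n Int ball a r \<subseteq> T &
     T \<in> lmeasurable & measure lebesgue T <= p / q * measure lebesgue (ball a r)"
    using st T `s < t`
    by (intro exI[of _ "(s+t)/2"] exI[of _ "(t-s)/2"] exI[of _ T]) (simp add: B)
  qed
 qed simp
 define I where "I n = {x. (ALL q. hi q x) & \<bar>x\<bar> < real n}" for n
 have negI: "negligible (I n)" for n
 proof (cases "n = 0")
  case False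
  show ?thesis unfolding negligible_outer_le
  proof (intro allI impI)
   fix e :: real assume "e > 0"
   define q where "q = (F (real n) - F (- real n) + 1) / e"
   have mn: "F (- real n) <= F (real n)" by (intro monoD[OF assms]) simp
   have "q > 0" using mn `e > 0` unfolding q_def by (intro divide_pos_pos) auto
   have "EX T:lmeasurable. I n \<subseteq> T & measure lebesgue T <= (F (real n) - F (- real n)) / q"
    using steep[of q] `q > 0` False
    by (intro mono_steep_set_measure assms) (auto simp: I_def)
   moreover have "(F (real n) - F (- real n)) / q <= e"
    using mn `e > 0` unfolding q_def by (simp add: field_simps)
   ultimately show "EX T. I n \<subseteq> T & T \<in> lmeasurable & measure lebesgue T <= e"
    by (meson order_trans)
  qed
 qed (simp add: I_def)
 \<comment> \<open>The difference quotients are nonnegative and eventually bounded above; a gap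
   between their lower and upper limit would contain two rationals \<open>p < q\<close>, so both
   limits agree and are finite.\<close>
 have ndiff: "F differentiable (at x)" if "isCont F x" and nhi: "~ (ALL q. hi q x)"
  and pq: "!!p q. p \<in> \<rat> ==> q \<in> \<rat> ==> p < q ==> ~ (lo p x & hi q x)" for x
 proof -
  let ?f = "%y. ereal (Q x y)"
  have not_lo: "\<forall>\<^sub>F y in at x. p <= Q x y" if "~ lo p x" for p
   using that unfolding lo_def eventually_at dist_real_def by (meson not_le_imp_less)
  have not_hi: "\<forall>\<^sub>F y in at x. Q x y <= q" if "~ hi q x" for q
   using that unfolding hi_def eventually_at dist_real_def by (meson not_le_imp_less)
  obtain q0 where q0: "~ hi q0 x" using nhi by blast
  have Ls: "Limsup (at x) ?f <= ereal q0"
   by (intro Limsup_bounded) (use not_hi[OF q0] in auto)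
  have Li: "0 <= Liminf (at x) ?f" by (intro Liminf_bounded) (auto simp: Qpos)
  have le: "Liminf (at x) ?f <= Limsup (at x) ?f" by (rule Liminf_le_Limsup) simp
  have "~ Liminf (at x) ?f < Limsup (at x) ?f"
  proof
   assume "Liminf (at x) ?f < Limsup (at x) ?f"
   then obtain q where q: "Liminf (at x) ?f < ereal (of_rat q)" "ereal (of_rat q) < Limsup (at x) ?f"
    using ereal_dense3 by blast
   then obtain p where p: "Liminf (at x) ?f < ereal (of_rat p)" "ereal (of_rat p) < ereal (of_rat q)"
    using ereal_dense3 by blast
   have "lo (of_rat p) x"
   proof (rule ccontr)
    assume "~ lo (of_rat p) x"
    from not_lo[OF this] have "ereal (of_rat p) <= Liminf (at x) ?f"
     by (intro Liminf_bounded) auto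
    thus False using p by simp
   qed
   moreover have "hi (of_rat q) x"
   proof (rule ccontr)
    assume "~ hi (of_rat q) x"
    from not_hi[OF this] have "Limsup (at x) ?f <= ereal (of_rat q)"
     by (intro Limsup_bounded) auto
    thus False using q by simp
   qed
   ultimately show False using pq[of "of_rat p" "of_rat q"] p by auto
  qed
  hence eq: "Liminf (at x) ?f = Limsup (at x) ?f" using le by simp
  have "\<bar>Limsup (at x) ?f\<bar> ~= \<infinity>" using Ls Li eq by (cases "Limsup (at x) ?f") auto
  then obtain l where l: "Limsup (at x) ?f = ereal l" by (metis ereal_real')
  have "(?f \<longlongrightarrow> ereal l) (at x)"
   using eq l by (subst tendsto_iff_Liminf_eq_Limsup) auto
  hence "((%y. (F y - F x) / (y - x)) \<longlongrightarrow> l) (at x)" unfolding Q_def by simp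
  hence "(F has_field_derivative l) (at x)" by (simp add: has_field_derivative_iff)
  thus ?thesis using real_differentiable_def by blast
 qed
 have "{x. ~ F differentiable (at x)} \<subseteq>
   {x. ~ isCont F x} \<union> (\<Union>n. I n) \<union> (\<Union>(p, q)\<in>{(p, q). p \<in> \<rat> & q \<in> \<rat> & p < q}. \<Union>n. E p q n)" (is "_ \<subseteq> ?R")
 proof
  fix x assume x: "x \<in> {x. ~ F differentiable (at x)}"
  obtain n where "\<bar>x\<bar> < real n" using reals_Archimedean2 by blast
  show "x \<in> ?R"
  proof (cases "isCont F x & ~ (ALL q. hi q x)")
   case True
   then obtain p q where "p \<in> \<rat>" "q \<in> \<rat>" "p < q" "lo p x" "hi q x"
    using x ndiff[of x] by blast
   hence "x \<in> E p q n" "(p, q) \<in> {(p, q). p \<in> \<rat> & q \<in> \<rat> & p < q}"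
    using True `\<bar>x\<bar> < real n` by (auto simp: E_def)
   thus ?thesis by blast
  next
   case False
   thus ?thesis using `\<bar>x\<bar> < real n` unfolding I_def by blast
  qed
 qed
 moreover have "negligible ?R"
 proof -
  have "countable {x. ~ isCont F x}" by (intro mono_ctble_discont assms)
  hence "negligible {x. ~ isCont F x}"
   using countable_imp_null_set_lborel by (auto simp: negligible_iff_null_sets intro: null_sets_completionI)
  moreover have "negligible (\<Union>n. I n)" by (intro negligible_countable_Union) (auto simp: negI)
  moreover have "negligible (\<Union>(p, q)\<in>{(p, q). p \<in> \<rat> & q \<in> \<rat> & p < q}. \<Union>n. E p q n)"
  proof (rule negligible_countable_Union)
   have "countable {(p, q). p \<in> \<rat> & q \<in> \<rat> & (p::real) < q}"
    by (rule countable_subset[of _ "\<rat> \<times> \<rat>"]) (auto intro: countable_rat)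
   thus "countable ((%(p, q). \<Union>n. E p q n) ` {(p, q). p \<in> \<rat> & q \<in> \<rat> & p < q})" by simp
   fix X assume "X \<in> (%(p, q). \<Union>n. E p q n) ` {(p, q). p \<in> \<rat> & q \<in> \<rat> & p < q}"
   then obtain p q where "p < q" "X = (\<Union>n. E p q n)" by auto
   thus "negligible X" using negE by (auto intro!: negligible_countable_Union)
  qed
  ultimately show ?thesis by (intro negligible_Un)
 qed
 ultimately show ?thesis by (rule negligible_subset[rotated])
qed

section \<open>Absolute continuity: differentiability almost everywhere and the fundamental theorem
  of calculus\<close>

lemma abs_continuous_onD:
 assumes "abs_continuous_on a b f" "eps > 0"
 obtains dlt where "dlt > 0" "!!I. finite I & (ALL (s, t):I. a <= s & s <= t & t <= b) &
    disj_ivs I & (\<Sum>(s, t)\<in>I. t - s) < dlt ==>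
    (\<Sum>(s, t)\<in>I. norm (f t - f s)) < eps"
 using assms(1)[unfolded abs_continuous_on_def, rule_format, OF assms(2)] by blast

lemma sum_disjoint_intervals_le:
 fixes a b :: real
 assumes "finite I" "ALL (s, t):I. s <= t" "disj_ivs I"
  and "(\<Union>(s, t)\<in>I. {s<..<t}) \<subseteq> U" "U \<in> lmeasurable"
 shows "(\<Sum>(s, t)\<in>I. t - s) <= measure lebesgue U"
proof -
 have "(\<Sum>(s, t)\<in>I. t - s) = (\<Sum>i\<in>I. measure lebesgue ((%(s, t). {s<..<t}) i))"
  using assms(2) by (intro sum.cong) auto
 also have "... = measure lebesgue (\<Union>i\<in>I. (%(s, t). {s<..<t}) i)"
  using assms(1,2,3) by (intro measure_finite_Union[symmetric]) (auto simp: emeasure_lborel_Ioo)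
 also have "... <= measure lebesgue U"
  using assms by (intro measure_mono_fmeasurable) auto
 finally show ?thesis .
qed

lemma abs_continuous_on_subinterval:
 assumes "abs_continuous_on a b f" "a <= a'" "b' <= b"
 shows "abs_continuous_on a' b' f"
proof -
 have "EX dlt>0. ALL I. finite I & (ALL (s, t):I. a' <= s & s <= t & t <= b') &
    disj_ivs I & (\<Sum>(s, t)\<in>I. t - s) < dlt -->
    (\<Sum>(s, t)\<in>I. norm (f t - f s)) < eps" if "eps > 0" for eps
 proof -
  obtain dlt where "dlt > 0" and d: "!!I. finite I & (ALL (s, t):I. a <= s & s <= t & t <= b) &
    disj_ivs I & (\<Sum>(s, t)\<in>I. t - s) < dlt ==>
    (\<Sum>(s, t)\<in>I. norm (f t - f s)) < eps"
   by (rule abs_continuous_onD[OF assms(1) `eps > 0`], rule that, assumption, blast)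
  show ?thesis
  proof (intro exI[of _ dlt] conjI allI impI `dlt > 0`)
   fix I :: "(real \<times> real) set"
   assume "finite I & (ALL (s, t):I. a' <= s & s <= t & t <= b') &
    disj_ivs I & (\<Sum>(s, t)\<in>I. t - s) < dlt"
   thus "(\<Sum>(s, t)\<in>I. norm (f t - f s)) < eps" using assms(2,3) by (intro d) fastforce
  qed
 qed
 thus ?thesis unfolding abs_continuous_on_def by blast
qed

text \<open>Phrased by increments so that it serves coordinate functions, Lipschitz images of a
  curve and, with \<open>f\<close> the identity, Lipschitz functions of time.\<close>

lemma abs_continuous_on_lipschitz_compose:
 assumes "abs_continuous_on a b f" "0 <= C"
  and lip: "!!s t. a <= s ==> s <= t ==> t <= b ==> norm (h t - h s) <= C * norm (f t - f s)"
 shows "abs_continuous_on a b h"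
proof -
 have "EX dlt>0. ALL I. finite I & (ALL (s, t):I. a <= s & s <= t & t <= b) &
    disj_ivs I & (\<Sum>(s, t)\<in>I. t - s) < dlt -->
    (\<Sum>(s, t)\<in>I. norm (h t - h s)) < eps" if "eps > 0" for eps
 proof -
  have C1: "eps / (C + 1) > 0" using `eps > 0` assms(2) by simp
  obtain dlt where "dlt > 0" and d: "!!I. finite I & (ALL (s, t):I. a <= s & s <= t & t <= b) &
    disj_ivs I & (\<Sum>(s, t)\<in>I. t - s) < dlt ==>
    (\<Sum>(s, t)\<in>I. norm (f t - f s)) < eps / (C + 1)"
   by (rule abs_continuous_onD[OF assms(1) C1], rule that, assumption, blast)
  show ?thesis
  proof (intro exI[of _ dlt] conjI allI impI `dlt > 0`)
   fix I :: "(real \<times> real) set"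
   assume I: "finite I & (ALL (s, t):I. a <= s & s <= t & t <= b) &
    disj_ivs I & (\<Sum>(s, t)\<in>I. t - s) < dlt"
   have "(\<Sum>(s, t)\<in>I. norm (h t - h s)) <= (\<Sum>(s, t)\<in>I. C * norm (f t - f s))"
    using I lip by (intro sum_mono) auto
   also have "... = C * (\<Sum>(s, t)\<in>I. norm (f t - f s))"
    by (simp add: sum_distrib_left case_prod_beta)
   also have "... <= C * (eps / (C + 1))"
    using d[OF I] assms(2) by (intro mult_left_mono) auto
   also have "... < eps" using `eps > 0` assms(2) by (simp add: field_simps)
   finally show "(\<Sum>(s, t)\<in>I. norm (h t - h s)) < eps" .
  qed
 qed
 thus ?thesis unfolding abs_continuous_on_def by blast
qed

lemma abs_continuous_on_ident: "abs_continuous_on a b (%x::real. x)"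
 unfolding abs_continuous_on_def
proof (intro allI impI)
 fix eps :: real assume "eps > 0"
 show "EX dlt>0. ALL I. finite I & (ALL (s, t):I. a <= s & s <= t & t <= b) &
    disj_ivs I & (\<Sum>(s, t)\<in>I. t - s) < dlt -->
    (\<Sum>(s, t)\<in>I. norm (t - s)) < eps"
 proof (intro exI[of _ eps] conjI allI impI `eps > 0`)
  fix I :: "(real \<times> real) set"
  assume I: "finite I & (ALL (s, t):I. a <= s & s <= t & t <= b) &
    disj_ivs I & (\<Sum>(s, t)\<in>I. t - s) < eps"
  hence "(\<Sum>(s, t)\<in>I. norm (t - s)) = (\<Sum>(s, t)\<in>I. t - s)" by (intro sum.cong) auto
  thus "(\<Sum>(s, t)\<in>I. norm (t - s)) < eps" using I by simp
 qed
qed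


text \<open>Jordan decomposition: the variation \<open>V\<close> of \<open>F\<close> up to
  \<open>x\<close> and the sum \<open>V + F\<close> are both monotone, hence differentiable almost
  everywhere, and \<open>F\<close> is their difference. The bound \<open>B\<close> makes
  \<open>V\<close> finite.\<close>

lemma abs_continuous_on_differentiable_short:
 fixes F :: "real => real"
 assumes ac: "abs_continuous_on a b F" and "a <= b"
  and var: "!!I. finite I ==> ALL (s, t):I. a <= s & s <= t & t <= b ==>
    disj_ivs I ==> (\<Sum>(s, t)\<in>I. norm (F t - F s)) < B"
 shows "negligible {s\<in>{a..b}. ~ F differentiable (at s)}"
proof -
 \<comment> \<open>Freezing \<open>F\<close> outside the interval makes both functions monotone on
   the whole line, as \<open>mono_differentiable_ae\<close> asks.\<close>
 define clip where "clip x = max a (min b x)" for x :: real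
 have clip: "a <= clip x" "clip x <= b" for x using `a <= b` by (auto simp: clip_def)
 have clip_mono: "clip x <= clip y" if "x <= y" for x y using that by (auto simp: clip_def)
 define fam where "fam x = {I. finite I & (ALL (s, t):I. a <= s & s <= t & t <= clip x) &
    disj_ivs I}" for x
 define v where "v I = (\<Sum>(s, t)\<in>I. norm (F t - F s))" for I
 define V where "V x = (SUP I\<in>fam x. v I)" for x
 have vB: "v I <= B" if "I \<in> fam x" for I x
 proof -
  have "ALL (s, t):I. a <= s & s <= t & t <= b" using that clip(2)[of x] unfolding fam_def by fastforce
  hence "v I < B" unfolding v_def using that by (intro var) (auto simp: fam_def)
  thus ?thesis by simp
 qed
 have bdd: "bdd_above (v ` fam x)" for x using vB by (auto intro!: bdd_aboveI)
 have ne: "fam x ~= {}" for x by (auto simp: fam_def disjoint_family_on_def intro!: exI[of _ "{}"])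
 have inc: "V x + \<bar>F (clip y) - F (clip x)\<bar> <= V y" if "x <= y" for x y
 proof -
  have "v I <= V y - \<bar>F (clip y) - F (clip x)\<bar>" if I: "I \<in> fam x" for I
  proof (cases "clip x = clip y")
   case True
   hence "I \<in> fam y" using I by (simp add: fam_def)
   thus ?thesis using True bdd unfolding V_def by (simp add: cSUP_upper)
  next
   case False
   hence lt: "clip x < clip y" using clip_mono[OF `x <= y`] by simp
   have Ib: "!!s t. (s, t) \<in> I ==> a <= s & s <= t & t <= clip x" and "finite I"
    using I unfolding fam_def by auto
   have nin: "(clip x, clip y) \<notin> I" using Ib lt by fastforce
   have "disj_ivs (insert (clip x, clip y) I)"
    using I nin Ib unfolding fam_def
    by (subst disjoint_family_on_insert) (force)+
   hence "insert (clip x, clip y) I \<in> fam y"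
    using Ib lt clip(1)[of x] `finite I` unfolding fam_def by fastforce
   hence "v (insert (clip x, clip y) I) <= V y" using bdd unfolding V_def by (intro cSUP_upper)
   thus ?thesis using nin `finite I` by (simp add: v_def)
  qed
  hence "V x <= V y - \<bar>F (clip y) - F (clip x)\<bar>"
   unfolding V_def[of x] using ne by (intro cSUP_least)
  thus ?thesis by simp
 qed
 have "mono V"
 proof (rule monoI)
  fix x y :: real assume "x <= y"
  show "V x <= V y" using inc[OF `x <= y`] by linarith
 qed
 moreover have "mono (%x. V x + F (clip x))"
 proof (rule monoI)
  fix x y :: real assume "x <= y"
  show "V x + F (clip x) <= V y + F (clip y)" using inc[OF `x <= y`] by linarith
 qed
 ultimately have neg: "negligible ({x. ~ V differentiable (at x)} \<union>
   {x. ~ (%x. V x + F (clip x)) differentiable (at x)} \<union> {a, b})" (is "negligible ?N")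
  by (intro negligible_Un mono_differentiable_ae) auto
 have "F differentiable (at s)" if "s \<in> {a..b}" "s \<notin> ?N" for s
 proof -
  have "(%x. (V x + F (clip x)) - V x) differentiable (at s)"
   using that(2) by (intro differentiable_diff) auto
  hence "(%x. F (clip x)) differentiable (at s)" by simp
  then obtain D where "((%x. F (clip x)) has_derivative D) (at s)" unfolding differentiable_def by auto
  hence "(F has_derivative D) (at s)"
  proof (rule has_derivative_transform_within_open)
   show "open {a<..<b}" "s \<in> {a<..<b}" using that by auto
  qed (auto simp: clip_def)
  thus ?thesis unfolding differentiable_def by blast
 qed
 thus ?thesis by (intro negligible_subset[OF neg]) auto
qed

text \<open>With tolerance 1 the increments over disjoint families in an interval shorter than
  \<open>dlt\<close> sum to less than 1, so the variation is bounded there; Bolzano bisection glues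
  such intervals.\<close>

lemma abs_continuous_on_differentiable_real:
 fixes F :: "real => real"
 assumes ac: "abs_continuous_on a b F" and "a <= b"
 shows "negligible {s\<in>{a..b}. ~ F differentiable (at s)}"
proof -
 obtain dlt where "dlt > 0" and d: "!!I. finite I & (ALL (s, t):I. a <= s & s <= t & t <= b) &
   disj_ivs I & (\<Sum>(s, t)\<in>I. t - s) < dlt ==>
   (\<Sum>(s, t)\<in>I. norm (F t - F s)) < 1"
  by (rule abs_continuous_onD[OF ac zero_less_one], rule that, assumption, blast)
 define P where "P a' b' \<longleftrightarrow> (a <= a' & a' <= b' & b' <= b -->
   negligible {s\<in>{a'..b'}. ~ F differentiable (at s)})" for a' b'
 have "P a b" using `a <= b`
 proof (induction rule: Bolzano)
  case (trans x y z)
  have "{s\<in>{x..z}. ~ F differentiable (at s)} \<subseteq>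
   {s\<in>{x..y}. ~ F differentiable (at s)} \<union> {s\<in>{y..z}. ~ F differentiable (at s)}" by auto
  thus ?case using trans unfolding P_def
   by (meson negligible_Un negligible_subset order_trans)
 next
  case (local x)
  show ?case
  proof (intro exI[of _ dlt] conjI allI impI `dlt > 0`)
   fix a' b' assume *: "a' <= x & x <= b' & b' - a' < dlt"
   show "P a' b'" unfolding P_def
   proof
    assume **: "a <= a' & a' <= b' & b' <= b"
    show "negligible {s\<in>{a'..b'}. ~ F differentiable (at s)}"
    proof (rule abs_continuous_on_differentiable_short[where B = 1])
     show "abs_continuous_on a' b' F" using ac ** by (auto intro: abs_continuous_on_subinterval)
     fix I :: "(real \<times> real) set"
     assume I: "finite I" "ALL (s, t):I. a' <= s & s <= t & t <= b'" "disj_ivs I"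
     have "(\<Sum>(s, t)\<in>I. t - s) <= measure lebesgue {a'..b'}"
      using I by (intro sum_disjoint_intervals_le) force+
     thus "(\<Sum>(s, t)\<in>I. norm (F t - F s)) < 1"
      using I * ** by (intro d) fastforce
    qed (use ** in auto)
   qed
  qed
 qed
 thus ?thesis using `a <= b` by (simp add: P_def)
qed

lemma abs_continuous_on_differentiable_ae:
 fixes f :: "real => 'a::euclidean_space"
 assumes ac: "abs_continuous_on a b f" and "a <= b"
 shows "negligible {s\<in>{a..b}. ~ f differentiable (at s)}"
proof -
 have "negligible {s\<in>{a..b}. ~ (%s. f s \<bullet> i) differentiable (at s)}" if "i \<in> Basis" for i
 proof (rule abs_continuous_on_differentiable_real[OF abs_continuous_on_lipschitz_compose[OF ac, of 1]])
  show "norm (f t \<bullet> i - f s \<bullet> i) <= 1 * norm (f t - f s)" for s t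
   using Cauchy_Schwarz_ineq2[of "f t - f s" i] that by (simp add: inner_diff_left)
 qed (use `a <= b` in auto)
 hence "negligible (\<Union>i\<in>Basis. {s\<in>{a..b}. ~ (%s. f s \<bullet> i) differentiable (at s)})"
  by (intro negligible_Union) auto
 thus ?thesis
  by (rule negligible_subset) (auto simp: differentiable_componentwise_within[of f])
qed

text \<open>Proved directly for the gauge integral. Tags outside \<open>N\<close> get the usual
  straddle estimate. Tags in \<open>N\<close> get gauge balls inside an open set of measure below
  \<open>dlt\<close>, so absolute continuity makes the increments of \<open>F\<close> over their
  intervals small in sum, while the value 0 of \<open>g'\<close> on \<open>N\<close> removes them
  from the Riemann sum.\<close>

lemma abs_continuous_on_has_integral:
 fixes F :: "real => real"
 assumes ac: "abs_continuous_on a b F" and "a <= b" and "negligible N"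
  and der: "!!s. s \<in> {a..b} - N ==> (F has_real_derivative g s) (at s)"
 shows "(g has_integral (F b - F a)) {a..b}"
proof -
 define g' where "g' x = (if x \<in> N then 0 else g x)" for x
 have "(g' has_integral (F b - F a)) (cbox a b)"
  unfolding has_integral
 proof (intro allI impI)
  fix e :: real assume "e > 0"
  define eps where "eps = e / (2 * (b - a + 1))"
  have "eps > 0" using `e > 0` `a <= b` by (simp add: eps_def)
  have e2: "eps * (b - a) < e / 2" using `e > 0` `a <= b` by (simp add: eps_def field_simps)
  obtain dlt where "dlt > 0" and d: "!!I. finite I & (ALL (s, t):I. a <= s & s <= t & t <= b) &
    disj_ivs I & (\<Sum>(s, t)\<in>I. t - s) < dlt ==>
    (\<Sum>(s, t)\<in>I. norm (F t - F s)) < e / 2"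
   by (rule abs_continuous_onD[OF ac half_gt_zero[OF `e > 0`]], rule that, assumption, blast)
  have Nm: "N \<in> sets lebesgue" using `negligible N` by (simp add: negligible_imp_sets)
  obtain U where U: "open U" "N \<subseteq> U" "U - N \<in> lmeasurable" "emeasure lebesgue (U - N) < ennreal dlt"
   using sets_lebesgue_outer_open[OF Nm `dlt > 0`] by metis
  have UN: "U = N \<union> (U - N)" using U by auto
  have Ulm: "U \<in> lmeasurable"
   using fmeasurable.Un[OF negligible_imp_measurable[OF `negligible N`] U(3)] UN by metis
  have "measure lebesgue U <= measure lebesgue N + measure lebesgue (U - N)"
   using measure_Un_le[OF Nm fmeasurableD[OF U(3)]] UN by metis
  hence Um: "measure lebesgue U < dlt"
   using U(3,4) `dlt > 0` negligible_imp_measure0[OF `negligible N`]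
   by (simp add: emeasure_eq_measure2 ennreal_less_iff)
  have "EX r>0. (x \<in> N --> ball x r \<subseteq> U) &
    (x \<in> {a..b} - N --> (ALL y. \<bar>y - x\<bar> < r --> \<bar>F y - F x - g x * (y - x)\<bar> <= eps * \<bar>y - x\<bar>))" for x
  proof (cases "x \<in> N")
   case True
   thus ?thesis using U by (auto simp: open_contains_ball)
  next
   case False
   show ?thesis
   proof (cases "x \<in> {a..b}")
    case True
    have "(F has_derivative (*) (g x)) (at x)"
     using der[of x] True False by (simp add: has_field_derivative_def)
    thus ?thesis using False `eps > 0` unfolding has_derivative_at_alt by force
   qed (use False in "auto intro!: exI[of _ 1]")
  qed
  then obtain r where r: "!!x. r x > 0" "!!x. x \<in> N ==> ball x (r x) \<subseteq> U"
   "!!x y. x \<in> {a..b} - N ==> \<bar>y - x\<bar> < r x ==> \<bar>F y - F x - g x * (y - x)\<bar> <= eps * \<bar>y - x\<bar>"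
   by metis
  show "EX gam. gauge gam & (ALL \<D>. \<D> tagged_division_of cbox a b & gam fine \<D> -->
    norm ((\<Sum>(x,k) \<in> \<D>. measure lborel k *\<^sub>R g' x) - (F b - F a)) < e)"
  proof (intro exI[of _ "%x. ball x (r x)"] conjI allI impI)
   show "gauge (%x. ball x (r x))" using r(1) by (intro gauge_ball_dependent) auto
   fix p assume "p tagged_division_of cbox a b & (%x. ball x (r x)) fine p"
   hence p: "p tagged_division_of {a..b}" and fine: "!!x k. (x, k) \<in> p ==> k \<subseteq> ball x (r x)"
    by (auto simp: fine_def)
   have "finite p" using p by auto
   have kint: "EX s t. k = {s..t} & s <= x & x <= t & a <= s & t <= b" if xk: "(x, k) \<in> p" for x k
   proof -
    obtain s t where "k = cbox s t" using tagged_division_ofD(4)[OF p xk] by blast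
    moreover have "x \<in> k" "k \<subseteq> {a..b}" using tagged_division_ofD(2,3)[OF p xk] by auto
    ultimately show ?thesis by auto
   qed
   let ?\<Delta> = "%k. F (Sup k) - F (Inf k)"
   have sumF: "(\<Sum>(x,k)\<in>p. ?\<Delta> k) = F b - F a"
    by (rule additive_tagged_division_1[OF `a <= b` p])
   have sumc: "(\<Sum>(x,k)\<in>p. measure lborel k) = b - a"
    using additive_content_tagged_division[of p a b] p `a <= b` by simp
   define p1 where "p1 = {i \<in> p. fst i \<in> N}"
   have "finite p1" using `finite p` by (simp add: p1_def)
   have b2: "\<bar>measure lborel k * g' x - ?\<Delta> k\<bar> <= eps * measure lborel k" if xk: "(x, k) \<in> p - p1" for x k
   proof -
    have xk': "(x, k) \<in> p" "x \<notin> N" using xk by (auto simp: p1_def)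
    obtain s t where st: "k = {s..t}" "s <= x" "x <= t" "a <= s" "t <= b" using kint[OF xk'(1)] by auto
    have "{s..t} \<subseteq> ball x (r x)" using fine[OF xk'(1)] st by simp
    moreover have "s \<in> {s..t}" "t \<in> {s..t}" using st by auto
    ultimately have "s \<in> ball x (r x)" "t \<in> ball x (r x)" by blast+
    hence "\<bar>F t - F x - g x * (t - x)\<bar> <= eps * \<bar>t - x\<bar>" "\<bar>F s - F x - g x * (s - x)\<bar> <= eps * \<bar>s - x\<bar>"
     using r(3)[of x t] r(3)[of x s] xk' st by (auto simp: dist_real_def)
    hence "\<bar>(F t - F s) - g x * (t - s)\<bar> <= eps * (t - s)"
     using st by (simp add: algebra_simps abs_le_iff)
    moreover have "Sup k = t" "Inf k = s" "measure lborel k = t - s" using st by auto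
    ultimately show ?thesis using xk' by (simp add: g'_def mult.commute abs_minus_commute)
   qed
   have b1: "(\<Sum>(x,k)\<in>p1. \<bar>?\<Delta> k\<bar>) < e / 2"
   proof -
    \<comment> \<open>Absolute continuity speaks of sets of pairs of end points, so the tags are
      forgotten. Two tagged intervals with the same end points do not overlap, hence are degenerate
      and contribute nothing.\<close>
    let ?j = "%(x::real, k::real set). (Inf k, Sup k)"
    let ?v = "%(s, t). norm (F t - F s)"
    have sk: "EX s t. k = {s..t} & s <= t & a <= s & t <= b & Inf k = s & Sup k = t & {s<..<t} \<subseteq> U"
     if "(x, k) \<in> p1" for x k
    proof -
     have xk': "(x, k) \<in> p" "x \<in> N" using that by (auto simp: p1_def)
     obtain s t where st: "k = {s..t}" "s <= x" "x <= t" "a <= s" "t <= b" using kint[OF xk'(1)] by auto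
     have "{s<..<t} \<subseteq> U" using fine[OF xk'(1)] r(2)[OF xk'(2)] st by fastforce
     thus ?thesis using st by (intro exI[of _ s] exI[of _ t]) auto
    qed
    have disj: "{Inf k<..<Sup k} Int {Inf k'<..<Sup k'} = {}"
     if "(x, k) \<in> p1" "(x', k') \<in> p1" "(x, k) ~= (x', k')" for x k x' k'
    proof -
     have "interior k Int interior k' = {}"
      using tagged_division_ofD(5)[OF p, of x k x' k'] that by (auto simp: p1_def)
     moreover note sk[OF that(1)] sk[OF that(2)]
     ultimately show ?thesis by (elim exE conjE) (simp add: interior_atLeastAtMost_real)
    qed
    have "(\<Sum>i\<in>?j ` p1. ?v i) = (\<Sum>i\<in>p1. ?v (?j i))"
    proof (subst sum.reindex_nontrivial)
     fix i i' assume i: "i \<in> p1" "i' \<in> p1" "i ~= i'" "?j i = ?j i'"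
     obtain x k x' k' where ii: "i = (x, k)" "i' = (x', k')" by (cases i; cases i') auto
     have "Inf k <= Sup k" using sk[of x k] i ii by auto
     moreover have "{Inf k<..<Sup k} = {}" using disj[of x k x' k'] i ii by auto
     ultimately show "?v (?j i) = 0" using ii by auto
    qed (auto simp: `finite p1` comp_def)
    also have "... = (\<Sum>(x,k)\<in>p1. \<bar>?\<Delta> k\<bar>)" by (intro sum.cong) auto
    finally have eq: "(\<Sum>(s, t)\<in>?j ` p1. norm (F t - F s)) = (\<Sum>(x,k)\<in>p1. \<bar>?\<Delta> k\<bar>)" .
    have dj: "disj_ivs (?j ` p1)"
     unfolding disjoint_family_on_def
    proof (intro ballI impI)
     fix m n assume mn: "m \<in> ?j ` p1" "n \<in> ?j ` p1" "m ~= n"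
     then obtain x k x' k' where *: "(x, k) \<in> p1" "(x', k') \<in> p1" "m = (Inf k, Sup k)" "n = (Inf k', Sup k')"
      by auto
     hence "(x, k) ~= (x', k')" using mn by auto
     thus "(case m of (s, t) => {s<..<t}) Int (case n of (s, t) => {s<..<t}) = {}"
      using disj[OF *(1,2)] * by simp
    qed
    have rng: "ALL (s, t):?j ` p1. a <= s & s <= t & t <= b" using sk by fastforce
    have "(\<Sum>(s, t)\<in>?j ` p1. t - s) <= measure lebesgue U"
    proof (rule sum_disjoint_intervals_le)
     show "(\<Union>(s, t)\<in>?j ` p1. {s<..<t}) \<subseteq> U" using sk by fastforce
    qed (use `finite p1` rng dj Ulm in auto)
    hence "(\<Sum>(s, t)\<in>?j ` p1. norm (F t - F s)) < e / 2"
     using `finite p1` rng dj Um by (intro d) auto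
    thus ?thesis using eq by simp
   qed
   have "(\<Sum>(x,k) \<in> p. measure lborel k *\<^sub>R g' x) - (F b - F a)
     = (\<Sum>(x,k)\<in>p. measure lborel k * g' x - ?\<Delta> k)"
    by (simp add: sumF[symmetric] sum_subtractf case_prod_beta)
   also have "\<bar>...\<bar> <= (\<Sum>(x,k)\<in>p. \<bar>measure lborel k * g' x - ?\<Delta> k\<bar>)"
    by (simp add: case_prod_beta sum_abs)
   also have "... = (\<Sum>(x,k)\<in>p - p1. \<bar>measure lborel k * g' x - ?\<Delta> k\<bar>) + (\<Sum>(x,k)\<in>p1. \<bar>measure lborel k * g' x - ?\<Delta> k\<bar>)"
    using `finite p` by (intro sum.subset_diff) (auto simp: p1_def)
   also have "(\<Sum>(x,k)\<in>p1. \<bar>measure lborel k * g' x - ?\<Delta> k\<bar>) = (\<Sum>(x,k)\<in>p1. \<bar>?\<Delta> k\<bar>)"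
    by (intro sum.cong) (auto simp: p1_def g'_def)
   also have "(\<Sum>(x,k)\<in>p - p1. \<bar>measure lborel k * g' x - ?\<Delta> k\<bar>) <= (\<Sum>(x,k)\<in>p - p1. eps * measure lborel k)"
    using b2 by (intro sum_mono) auto
   also have "... <= (\<Sum>(x,k)\<in>p. eps * measure lborel k)"
    using `finite p` `eps > 0` by (intro sum_mono2) auto
   also have "... = eps * (b - a)" by (simp add: sumc[symmetric] sum_distrib_left case_prod_beta)
   finally show "norm ((\<Sum>(x,k) \<in> p. measure lborel k *\<^sub>R g' x) - (F b - F a)) < e"
    using b1 e2 by simp
  qed
 qed
 hence "(g' has_integral (F b - F a)) {a..b}" by simp
 thus ?thesis
  by (rule has_integral_spike[OF `negligible N`, rotated]) (auto simp: g'_def)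
qed

section \<open>Weak limits of empirical measures\<close>

lemma compact_UNIV_bool_seq: "compact (UNIV :: (nat => bool) set)"
proof -
 have "compactin (product_topology (%_. euclidean :: bool topology) (UNIV :: nat set))
   (PiE UNIV (%_. UNIV))"
  by (subst compactin_PiE) (auto simp: finite_imp_compact)
 thus ?thesis by (simp add: euclidean_product_topology PiE_UNIV_domain)
qed

text \<open>The reindexing \<open>\<pi>\<close> covers both the base four encoding and the
  extraction of the digits of one coordinate.\<close>

lemma continuous_on_bool_series:
 fixes a :: "nat => real"
 assumes "summable a" "!!i. 0 <= a i" 
 shows "continuous_on UNIV (%b :: nat => bool. \<Sum>i. of_bool (b (\<pi> i)) * a i)"
proof -
 have "uniform_limit UNIV (%n (b :: nat => bool). \<Sum>i<n. of_bool (b (\<pi> i)) * a i)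
   (%b. \<Sum>i. of_bool (b (\<pi> i)) * a i) sequentially"
  by (rule Weierstrass_m_test[where M = a]) (use assms in auto)
 moreover have "continuous_on UNIV (%b :: nat => bool. \<Sum>i<n. of_bool (b (\<pi> i)) * a i)" for n
 proof (intro continuous_intros)
  fix i
  have "continuous_on UNIV (%b :: nat => bool. b (\<pi> i))"
   by (rule continuous_on_product_coordinates)
  moreover have "continuous_on UNIV (of_bool :: bool => real)"
   unfolding continuous_on_open_vimage[OF open_UNIV] by (auto intro: discrete_topology_class.open_discrete)
  ultimately show "continuous_on UNIV (%b :: nat => bool. of_bool (b (\<pi> i)) :: real)"
   using continuous_on_compose2[of UNIV of_bool UNIV "%b. b (\<pi> i)"] by auto
 qed
 ultimately show ?thesis
  by (intro uniform_limit_theorem) auto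
qed

text \<open>After the first differing digit the remaining terms sum to at most a third of that
  digit's weight, so they cannot compensate it; in base two they could.\<close>

lemma inj_bool_series: "inj (%b :: nat => bool. \<Sum>i. of_bool (b i) * (1/4 :: real) ^ i)"
proof (rule injI, rule ccontr)
 fix b b' :: "nat => bool"
 assume eq: "(\<Sum>i. of_bool (b i) * (1/4 :: real) ^ i) = (\<Sum>i. of_bool (b' i) * (1/4) ^ i)" and "b ~= b'"
 define d where "d i = (of_bool (b i) - of_bool (b' i)) * (1/4 :: real) ^ i" for i
 have sumg: "summable (%i. (1/4 :: real) ^ i)" by (rule summable_geometric) simp
 have sb: "summable (%i. of_bool (b i) * (1/4 :: real) ^ i)" for b :: "nat => bool"
  by (rule summable_comparison_test'[OF sumg, of 0]) auto
 have sd: "summable d" unfolding d_def using summable_diff[OF sb[of b] sb[of b']] by (simp add: algebra_simps)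
 have "(\<Sum>i. d i) = 0"
  unfolding d_def using suminf_diff[OF sb[of b] sb[of b']] eq by (simp add: algebra_simps)
 define m where "m = (LEAST i. b i ~= b' i)"
 have "EX i. b i ~= b' i" using `b ~= b'` by auto
 hence m: "b m ~= b' m" unfolding m_def by (rule LeastI_ex)
 have "d i = 0" if "i < m" for i using not_less_Least[of i "%i. b i ~= b' i"] that by (auto simp: d_def m_def)
 hence "(\<Sum>i<Suc m. d i) = d m" by simp
 hence "(\<Sum>i. d i) = (\<Sum>i. d (i + Suc m)) + d m"
  using suminf_split_initial_segment[OF sd, of "Suc m"] by simp
 moreover have "\<bar>\<Sum>i. d (i + Suc m)\<bar> <= (\<Sum>i. (1/4 :: real) ^ (i + Suc m))"
 proof -
  have sa: "summable (%i. \<bar>d (i + Suc m)\<bar>)"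
   by (rule summable_comparison_test'[OF summable_ignore_initial_segment[OF sumg, of "Suc m"], of 0])
    (auto simp: d_def)
  have "\<bar>\<Sum>i. d (i + Suc m)\<bar> <= (\<Sum>i. \<bar>d (i + Suc m)\<bar>)" by (rule summable_rabs[OF sa])
  also have "... <= (\<Sum>i. (1/4 :: real) ^ (i + Suc m))"
   by (rule suminf_le[OF _ sa summable_ignore_initial_segment[OF sumg, of "Suc m"]]) (auto simp: d_def)
  finally show ?thesis .
 qed
 moreover have "(\<Sum>i. (1/4 :: real) ^ (i + Suc m)) = (1/4) ^ m / 3"
  using suminf_mult[OF sumg, of "(1/4) ^ Suc m"] suminf_geometric[of "1/4 :: real"]
  by (simp add: power_add mult.commute)
 moreover have "\<bar>d m\<bar> = (1/4) ^ m" using m by (cases "b m"; cases "b' m") (auto simp: d_def)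
 ultimately show False using `(\<Sum>i. d i) = 0` zero_less_power[of "1/4 :: real" m] by linarith
qed

text \<open>The partial sums equal \<open>\<lfloor>2 ^ n * x\<rfloor> / 2 ^ n\<close>, by halving
  integer parts.\<close>

lemma binary_expansion:
 fixes x :: real
 assumes "0 <= x" "x < 1"
 shows "(\<Sum>i. of_bool (odd \<lfloor>2 ^ Suc i * x\<rfloor>) * (1/2 :: real) ^ Suc i) = x"
proof -
 have part: "(\<Sum>i<n. of_bool (odd \<lfloor>2 ^ Suc i * x\<rfloor>) * (1/2 :: real) ^ Suc i) = \<lfloor>2 ^ n * x\<rfloor> / 2 ^ n" for n
 proof (induction n)
  case 0
  have "\<lfloor>x\<rfloor> = 0" using assms by (simp add: floor_eq_iff)
  thus ?case by simp
 next
  case (Suc n)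
  let ?f = "\<lfloor>2 ^ Suc n * x\<rfloor>"
  have "\<lfloor>2 ^ n * x\<rfloor> = ?f div 2"
   using floor_divide_real_eq_div[of 2 "2 ^ Suc n * x"] by simp
  moreover have "?f = 2 * (?f div 2) + of_bool (odd ?f)" by (simp add: odd_iff_mod_2_eq_one[symmetric] mod_2_eq_odd[symmetric])
  ultimately have "real_of_int ?f = 2 * real_of_int \<lfloor>2 ^ n * x\<rfloor> + of_bool (odd ?f)"
   by (metis (mono_tags) of_int_add of_int_mult of_int_numeral of_int_of_bool)
  thus ?case using Suc by (simp add: field_simps power_one_over)
 qed
 have "(%n. \<lfloor>2 ^ n * x\<rfloor> / 2 ^ n) \<longlonglongrightarrow> x"
 proof (rule LIMSEQ_I)
  fix r :: real assume "r > 0"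
  obtain n0 where n0: "(1/2 :: real) ^ n0 < r" using real_arch_pow_inv[of r "1/2"] `r > 0` by auto
  have "norm (\<lfloor>2 ^ n * x\<rfloor> / 2 ^ n - x) < r" if "n0 <= n" for n
  proof -
   have "\<bar>\<lfloor>2 ^ n * x\<rfloor> - 2 ^ n * x\<bar> <= 1" by linarith
   moreover have "\<lfloor>2 ^ n * x\<rfloor> / 2 ^ n - x = (\<lfloor>2 ^ n * x\<rfloor> - 2 ^ n * x) / 2 ^ n" by (simp add: field_simps)
   ultimately have "norm (\<lfloor>2 ^ n * x\<rfloor> / 2 ^ n - x) <= (1/2) ^ n"
    by (simp add: abs_divide power_one_over divide_right_mono)
   also have "... <= (1/2) ^ n0" using that by (intro power_decreasing) auto
   finally show ?thesis using n0 by simp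
  qed
  thus "EX no. ALL n>=no. norm (\<lfloor>2 ^ n * x\<rfloor> / 2 ^ n - x) < r" by blast
 qed
 hence "(%i. of_bool (odd \<lfloor>2 ^ Suc i * x\<rfloor>) * (1/2 :: real) ^ Suc i) sums x"
  unfolding sums_def part .
 thus ?thesis by (rule sums_unique[symmetric])
qed

text \<open>Every compact subset of a Euclidean space is a continuous image of a compact set of reals:
  interleave the binary digits of the coordinates and read the digits in base four.\<close>

lemma compact_image_of_real_compact:
 fixes Q :: "'b::euclidean_space set"
 assumes "compact Q"
 obtains C :: "real set" and dlt where "compact C" "continuous_on C dlt" "dlt ` C = Q"
proof -
 obtain R where R: "R > 0" "Q \<subseteq> ball 0 R"
  using bounded_subset_ballD[OF compact_imp_bounded[OF assms], of 0] by auto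
 obtain f :: "'b => nat" where f: "inj_on f Basis"
  using finite_imp_inj_to_nat_seg[OF finite_Basis] by blast
 define e where "e b = (\<Sum>i. of_bool (b i) * (1/4 :: real) ^ i)" for b :: "nat => bool"
 \<comment> \<open>The bits at the places \<open>prod_encode (f j, i)\<close> are the binary digits
   of coordinate \<open>j\<close>, rescaled from the unit interval to the interval from
   \<open>- R\<close> to \<open>R\<close>.\<close>
 define p :: "(nat => bool) => 'b" where "p b = (\<Sum>j\<in>Basis. (2 * R * (\<Sum>i. of_bool (b (prod_encode (f j, i))) * (1/2) ^ Suc i) - R) *\<^sub>R j)" for b
 have conte: "continuous_on UNIV e" unfolding e_def
  by (rule continuous_on_bool_series[where \<pi> = "%i. i"]) (auto simp: summable_geometric)
 have contp: "continuous_on UNIV p" unfolding p_def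
  by (intro continuous_intros continuous_on_bool_series) (auto simp: summable_geometric)
 have surj: "EX b. p b = x" if "x \<in> Q" for x
 proof -
  define z where "z j = (x \<bullet> j + R) / (2 * R)" for j
  have z: "0 <= z j" "z j < 1" if "j \<in> Basis" for j
  proof -
   have "norm x < R" using `x \<in> Q` R by auto
   hence "\<bar>x \<bullet> j\<bar> < R" using Basis_le_norm[OF that, of x] by linarith
   thus "0 <= z j" "z j < 1" using R(1) by (auto simp: z_def field_simps)
  qed
  define b where "b n = odd \<lfloor>2 ^ Suc (snd (prod_decode n)) * z (the_inv_into Basis f (fst (prod_decode n)))\<rfloor>" for n
  have "(\<Sum>i. of_bool (b (prod_encode (f j, i))) * (1/2) ^ Suc i) = z j" if "j \<in> Basis" for j
   unfolding b_def using binary_expansion[OF z[OF that]] the_inv_into_f_f[OF f that] by simp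
  hence "p b = (\<Sum>j\<in>Basis. (2 * R * z j - R) *\<^sub>R j)" unfolding p_def by (intro sum.cong) auto
  also have "... = (\<Sum>j\<in>Basis. (x \<bullet> j) *\<^sub>R j)" using R(1) by (intro sum.cong) (auto simp: z_def)
  also have "... = x" by (rule euclidean_representation)
  finally show ?thesis by blast
 qed
 \<comment> \<open>Not every bit sequence decodes into \<open>Q\<close>. The preimage
   \<open>B\<close> of \<open>Q\<close> is closed in the Cantor space, hence compact, and
   \<open>e\<close> embeds it into the line.\<close>
 define B where "B = {b. p b \<in> Q}"
 have "closed B"
  using contp compact_imp_closed[OF assms] unfolding B_def
  by (simp add: closed_vimage[unfolded vimage_def])
 hence cB: "compact B" using compact_UNIV_bool_seq closed_Int_compact[of B UNIV] by simp
 have inv: "inv e (e b) = b" for b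
  using inj_bool_series unfolding e_def[abs_def] by (rule inv_f_f)
 show ?thesis
 proof
  show "compact (e ` B)" using cB conte by (intro compact_continuous_image) (auto intro: continuous_on_subset)
  have "continuous_on (e ` B) (inv e)"
   using cB conte inv by (intro continuous_on_inv) (auto intro: continuous_on_subset)
  thus "continuous_on (e ` B) (p o inv e)"
   using contp by (intro continuous_on_compose) (auto intro: continuous_on_subset)
  show "(p o inv e) ` (e ` B) = Q" using surj by (auto simp: image_image inv B_def image_iff)
 qed
qed

text \<open>By Helly's selection theorem, transported along the surjection above.\<close>

lemma empirical_measures_weak_limit:
 fixes Q :: "'b::euclidean_space set" and zet :: "nat => nat => 'b" and N :: "nat => nat"
 assumes "compact Q" and N: "!!n. 0 < N n" and zet: "!!n k. k < N n ==> zet n k \<in> Q"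
 obtains r M where "strict_mono r" "prob_space M" "sets M = sets borel" "AE x in M. x \<in> Q"
  "!!F :: 'b => real. continuous_on Q F ==>
    (%j. (\<Sum>k<N (r j). F (zet (r j) k)) / N (r j)) \<longlonglongrightarrow> (\<integral>x. indicator Q x * F x \<partial>M)"
proof -
 obtain C :: "real set" and dlt where C: "compact C" "continuous_on C dlt" "dlt ` C = Q"
  using compact_image_of_real_compact[OF assms(1)] by metis
 have "EX t:C. dlt t = zet n k" if "k < N n" for n k using zet[OF that] C(3) by auto
 hence "ALL n k. EX t. k < N n --> t \<in> C & dlt t = zet n k" by blast
 then obtain t where t: "!!n k. k < N n ==> t n k \<in> C & dlt (t n k) = zet n k" by metis
 have "Q ~= {}" using zet[OF N, of 0] by auto
 hence "C ~= {}" using C(3) by auto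
 \<comment> \<open>The uniform distribution on the \<open>N n\<close> points, lifted along
   \<open>dlt\<close> to the line, where Helly's theorem is available.\<close>
 define nu where "nu n = distr (measure_pmf (pmf_of_set {..<N n})) borel (t n)" for n
 have rd: "real_distribution (nu n)" for n
  unfolding nu_def by (intro prob_space.real_distribution_distr) (auto simp: prob_space_measure_pmf)
 have intnu: "(\<integral>x. F x \<partial>nu n) = (\<Sum>k<N n. F (t n k)) / N n" if "F \<in> borel_measurable borel" for F :: "real => real" and n
  unfolding nu_def using N[of n] that by (subst integral_distr) (auto simp: integral_pmf_of_set lessThan_empty_iff)
 obtain B where B: "B > 0" "C \<subseteq> ball 0 B"
  using bounded_subset_ballD[OF compact_imp_bounded[OF C(1)], of 0] by auto
 have "tight nu" unfolding tight_def
 proof (intro conjI allI impI rd)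
  fix eps :: real assume "eps > 0"
  have "measure (nu n) {-B<..B} = 1" for n
  proof -
   have "t n -` {-B<..B} Int set_pmf (pmf_of_set {..<N n}) = set_pmf (pmf_of_set {..<N n})"
    using t[of _ n] B(2) N[of n] by (force simp: set_pmf_of_set lessThan_empty_iff)
   hence "measure (measure_pmf (pmf_of_set {..<N n})) (t n -` {-B<..B}) = 1"
    by (metis measure_Int_set_pmf measure_pmf.prob_space space_measure_pmf Int_UNIV_left measure_pmf_UNIV)
   thus ?thesis unfolding nu_def by (subst measure_distr) auto
  qed
  thus "EX a b. a < b & (ALL n. 1 - eps < measure (nu n) {a<..b})"
   using `eps > 0` B(1) by (intro exI[of _ "-B"] exI[of _ B]) auto
 qed
 then obtain r M where r: "strict_mono r" "real_distribution M" "weak_conv_m (nu o id o r) M"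
  using tight_imp_convergent_subsubsequence[of nu id] by (auto simp: strict_mono_id)
 interpret M: real_distribution M by (rule r(2))
 have conv0: "(%j. \<integral>x. F x \<partial>nu (r j)) \<longlonglongrightarrow> (\<integral>x. F x \<partial>M)"
  if "continuous_on UNIV F" "!!x. \<bar>F x\<bar> <= K" for F :: "real => real" and K
  using weak_conv_imp_integral_bdd_continuous_conv[OF _ r(2,3), of F K] rd that
  by (auto simp: comp_def continuous_on_eq_continuous_at)
 have AEC: "AE x in M. x \<in> C"
 proof -
  \<comment> \<open>A bounded continuous function vanishing exactly on \<open>C\<close>: its
    integrals are zero along the sequence, hence in the limit, so \<open>M\<close> lives on
    \<open>C\<close>.\<close>
  let ?F = "%x. min 1 (infdist x C)"
  have c: "continuous_on UNIV ?F" by (intro continuous_intros)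
  have "(%j. \<integral>x. ?F x \<partial>nu (r j)) \<longlonglongrightarrow> (\<integral>x. ?F x \<partial>M)"
   by (rule conv0[OF c, of 1]) (auto simp: infdist_nonneg abs_le_iff min_le_iff_disj intro: order_trans[OF _ infdist_nonneg])
  moreover have "(\<integral>x. ?F x \<partial>nu n) = 0" for n
   using t[of _ n] borel_measurable_continuous_onI[OF c] by (subst intnu) auto
  ultimately have "(\<integral>x. ?F x \<partial>M) = 0" by (simp add: LIMSEQ_const_iff)
  moreover have "integrable M ?F"
   using borel_measurable_continuous_onI[OF c] infdist_nonneg
   by (intro M.integrable_const_bound[of _ 1]) (auto simp: infdist_nonneg)
  ultimately have "AE x in M. ?F x = 0"
   by (subst (asm) integral_nonneg_eq_0_iff_AE) (auto simp: infdist_nonneg)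
  thus ?thesis
  proof eventually_elim
   fix x assume "?F x = 0"
   hence "infdist x C = 0" by (auto simp: min_def split: if_splits)
   thus "x \<in> C" using C(1) `C ~= {}` by (simp add: in_closed_iff_infdist_zero compact_imp_closed)
  qed
 qed
 have Cb: "C \<in> sets borel" using C(1) by (simp add: borel_compact)
 have Qb: "Q \<in> sets borel" using assms(1) by (simp add: borel_compact)
 define D where "D x = (if x \<in> C then dlt x else 0)" for x
 have "(%x. indicator C x *\<^sub>R dlt x) \<in> borel_measurable borel"
  using borel_measurable_continuous_on_indicator[OF Cb C(2)] .
 moreover have "(%x. indicator C x *\<^sub>R dlt x) = D" by (auto simp: D_def indicator_def)
 ultimately have Dm: "D \<in> borel_measurable borel" by simp
 let ?M = "distr M borel D"
 show ?thesis
 proof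
  show "strict_mono r" by (rule r(1))
  show "prob_space ?M" using Dm by (intro M.prob_space_distr) auto
  show "sets ?M = sets borel" by simp
  show "AE x in ?M. x \<in> Q"
  proof -
   have "AE x in M. D x \<in> Q" using AEC by eventually_elim (use C(3) in "auto simp: D_def")
   thus ?thesis using Dm Qb by (subst AE_distr_iff) auto
  qed
  fix F :: "'b => real" assume F: "continuous_on Q F"
  have cF: "continuous_on C (%x. F (dlt x))"
   using continuous_on_compose2[OF F C(2)] C(3) by auto
  have "bounded ((%x. F (dlt x)) ` C)" using compact_continuous_image[OF cF C(1)] compact_imp_bounded by blast
  then obtain K where K: "K >= 0" "!!x. x \<in> C ==> norm (F (dlt x)) <= K"
   unfolding bounded_iff by (metis abs_ge_zero image_eqI norm_ge_zero order_trans linear)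
  \<comment> \<open>Weak convergence tests with bounded continuous functions on the whole line, so
    the composition of \<open>F\<close> with \<open>dlt\<close> is extended from \<open>C\<close> by
    Tietze.\<close>
  obtain H where H: "continuous_on UNIV H" "!!x. x \<in> C ==> H x = F (dlt x)" "!!x. norm (H x) <= K"
   using Tietze[of C "%x. F (dlt x)" UNIV] cF C(1) K by (auto simp: compact_imp_closed)
  have "(%j. \<integral>x. H x \<partial>nu (r j)) \<longlonglongrightarrow> (\<integral>x. H x \<partial>M)" using H by (intro conv0[of H K]) auto
  moreover have "(\<integral>x. H x \<partial>nu n) = (\<Sum>k<N n. F (zet n k)) / N n" for n
  proof -
   have "(\<Sum>k<N n. H (t n k)) = (\<Sum>k<N n. F (zet n k))"
    using t[of _ n] H(2) by (intro sum.cong) auto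
   thus ?thesis using borel_measurable_continuous_onI[OF H(1)] by (simp add: intnu)
  qed
  moreover have "(\<integral>x. H x \<partial>M) = (\<integral>x. indicator Q x * F x \<partial>?M)"
  proof -
   have Fm: "(%x. indicator Q x * F x) \<in> borel_measurable borel"
    using borel_measurable_continuous_on_indicator[OF Qb F] by simp
   have "(\<integral>x. indicator Q x * F x \<partial>?M) = (\<integral>x. indicator Q (D x) * F (D x) \<partial>M)"
    using Dm Fm by (subst integral_distr) auto
   also have "... = (\<integral>x. H x \<partial>M)"
   proof (rule integral_cong_AE)
    show "(%x. indicator Q (D x) * F (D x)) \<in> borel_measurable M"
     using measurable_compose[OF Dm Fm] by simp
    show "H \<in> borel_measurable M" using borel_measurable_continuous_onI[OF H(1)] by simp
    show "AE x in M. indicator Q (D x) * F (D x) = H x"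
     using AEC by eventually_elim (use C(3) H(2) in "auto simp: D_def")
   qed
   finally show ?thesis by simp
  qed
  ultimately show "(%j. (\<Sum>k<N (r j). F (zet (r j) k)) / N (r j)) \<longlonglongrightarrow> (\<integral>x. indicator Q x * F x \<partial>?M)"
   by simp
 qed
qed

section \<open>Functions of class C1 on a compact manifold\<close>

text \<open>Carries a gradient for the inner product along with the function, so that the calculus
  rules produce explicit vectors to be inserted into the Hamiltonian of a chart.\<close>

definition C1_grad :: "'e::euclidean_space set => ('e => real) => ('e => 'e) => bool" where
 "C1_grad S F D \<longleftrightarrow> (ALL x:S. (F has_derivative (%w. D x \<bullet> w)) (at x)) & continuous_on S D"

lemma linear_functional_inner:
 fixes f :: "'e::euclidean_space => real"
 assumes "linear f"
 shows "f w = (\<Sum>b\<in>Basis. f b *\<^sub>R b) \<bullet> w"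
proof -
 have "f w = f (\<Sum>b\<in>Basis. (w \<bullet> b) *\<^sub>R b)" by (simp add: euclidean_representation)
 also have "... = (\<Sum>b\<in>Basis. (w \<bullet> b) * f b)" using assms by (simp add: linear_sum linear_scale)
 also have "... = (\<Sum>b\<in>Basis. f b *\<^sub>R b) \<bullet> w"
  by (simp add: inner_sum_left mult.commute inner_commute[of w])
 finally show ?thesis .
qed

lemma Ck_on_1_iff: "Ck_on 1 S F \<longleftrightarrow> (EX D. C1_grad S F D)"
proof
 assume "Ck_on 1 S F"
 hence d: "!!x. x \<in> S ==> F differentiable (at x)"
  and c: "!!v. continuous_on S (%x. frechet_derivative F (at x) v)" by auto
 define D where "D x = (\<Sum>b\<in>Basis. frechet_derivative F (at x) b *\<^sub>R b)" for x
 have "(F has_derivative (%w. D x \<bullet> w)) (at x)" if "x \<in> S" for x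
 proof -
  have "(F has_derivative frechet_derivative F (at x)) (at x)" by (rule frechet_derivative_works[THEN iffD1, OF d[OF that]])
  moreover have "frechet_derivative F (at x) = (%w. D x \<bullet> w)"
   unfolding D_def using linear_functional_inner[OF linear_frechet_derivative[OF d[OF that]]] by blast
  ultimately show ?thesis by simp
 qed
 moreover have "continuous_on S D" unfolding D_def by (intro continuous_intros c)
 ultimately show "EX D. C1_grad S F D" unfolding C1_grad_def by blast
next
 assume "EX D. C1_grad S F D"
 then obtain D where D: "!!x. x \<in> S ==> (F has_derivative (%w. D x \<bullet> w)) (at x)" "continuous_on S D"
  unfolding C1_grad_def by blast
 have "continuous_on S (%x. frechet_derivative F (at x) v)" for v
 proof -
  have "continuous_on S (%x. D x \<bullet> v)" by (intro continuous_intros D)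
  thus ?thesis
   by (rule continuous_on_eq) (use frechet_derivative_at[OF D(1)] in metis)
 qed
 thus "Ck_on 1 S F" using D(1) by (auto simp: differentiable_def)
qed

lemma C1_grad_subset: "C1_grad S F D ==> T \<subseteq> S ==> C1_grad T F D"
 unfolding C1_grad_def using continuous_on_subset by blast

lemma C1_grad_continuous: "C1_grad S F D ==> continuous_on S F"
 unfolding C1_grad_def by (meson continuous_at_imp_continuous_on has_derivative_continuous)

lemma C1_grad_cong_open:
 assumes "C1_grad S F D" "open S" "!!x. x \<in> S ==> F x = F' x"
 shows "C1_grad S F' D"
 unfolding C1_grad_def
proof (intro conjI ballI)
 fix x assume x: "x \<in> S"
 hence "(F has_derivative (%w. D x \<bullet> w)) (at x)" using assms(1) by (auto simp: C1_grad_def)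
 thus "(F' has_derivative (%w. D x \<bullet> w)) (at x)"
  by (rule has_derivative_transform_within_open[OF _ assms(2) x assms(3)])
qed (use assms(1) in "auto simp: C1_grad_def")

text \<open>Gradients are determined by the function, so every local one agrees with the field built
  from \<open>frechet_derivative\<close>.\<close>

lemma C1_grad_local:
 assumes "open S" "!!y. y \<in> S ==> EX U D. open U & y \<in> U & C1_grad U F D"
 shows "EX D. C1_grad S F D"
proof -
 define D where "D x = (\<Sum>b\<in>Basis. frechet_derivative F (at x) b *\<^sub>R b)" for x
 have *: "D z = D' z" if "C1_grad U F D'" "z \<in> U" for U D' z
 proof -
  have "(%w. D' z \<bullet> w) = frechet_derivative F (at z)"
   using that by (intro frechet_derivative_at) (auto simp: C1_grad_def)
  hence "D z = (\<Sum>b\<in>Basis. (D' z \<bullet> b) *\<^sub>R b)" unfolding D_def by metis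
  thus ?thesis by (simp add: euclidean_representation)
 qed
 have "C1_grad S F D" unfolding C1_grad_def
 proof (intro conjI ballI continuous_at_imp_continuous_on)
  fix y assume "y \<in> S"
  then obtain U D' where U: "open U" "y \<in> U" "C1_grad U F D'" using assms(2) by blast
  hence "isCont D' y" by (auto simp: C1_grad_def continuous_on_eq_continuous_at)
  thus "isCont D y"
   using U * by (subst isCont_cong[where g = D']) (auto simp: eventually_nhds)
  show "(F has_derivative (%w. D y \<bullet> w)) (at y)"
   using U *[OF U(3,2)] by (auto simp: C1_grad_def)
 qed
 thus ?thesis by blast
qed

lemma C1_grad_const: "C1_grad S (%_. k) (%_. 0)"
proof -
 have "(\<bullet>) (0::'a) = (%_. 0)" by auto
 thus ?thesis unfolding C1_grad_def by simp
qed

lemma C1_grad_add: "C1_grad S F D ==> C1_grad S F' D' ==> C1_grad S (%x. F x + F' x) (%x. D x + D' x)"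
 unfolding C1_grad_def by (auto intro!: derivative_eq_intros continuous_intros simp: inner_add_left)

lemma C1_grad_mult:
 "C1_grad S F D ==> C1_grad S F' D' ==>
  C1_grad S (%x. F x * F' x) (%x. F x *\<^sub>R D' x + F' x *\<^sub>R D x)"
 using C1_grad_continuous[of S F D] C1_grad_continuous[of S F' D'] unfolding C1_grad_def
 by (auto intro!: derivative_eq_intros continuous_intros simp: inner_add_left algebra_simps)

lemma C1_grad_compose:
 assumes "C1_grad S F D" "!!x. x \<in> S ==> (phi has_real_derivative phi' (F x)) (at (F x))"
  and "continuous_on (F ` S) phi'"
 shows "C1_grad S (%x. phi (F x)) (%x. phi' (F x) *\<^sub>R D x)"
 unfolding C1_grad_def
proof (intro conjI ballI)
 have "continuous_on S (%x. phi' (F x))"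
  using continuous_on_compose[OF C1_grad_continuous[OF assms(1)] assms(3)] by (simp add: comp_def)
 thus "continuous_on S (%x. phi' (F x) *\<^sub>R D x)"
  using assms(1) by (auto intro!: continuous_intros simp: C1_grad_def)
 fix x assume "x \<in> S"
 hence "(F has_derivative (%w. D x \<bullet> w)) (at x)" using assms(1) by (auto simp: C1_grad_def)
 from has_derivative_compose[OF this, of phi "(*) (phi' (F x))"] assms(2)[OF `x \<in> S`]
 show "((%x. phi (F x)) has_derivative (%w. (phi' (F x) *\<^sub>R D x) \<bullet> w)) (at x)"
  by (simp add: has_field_derivative_def)
qed

section \<open>Cut-off functions of class C1\<close>

definition pos_sq :: "real => real" where "pos_sq t = (max 0 t)\<^sup>2"

lemma pos_sq_nonneg: "0 <= pos_sq t" by (simp add: pos_sq_def)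

lemma pos_sq_eq_0: "t <= 0 ==> pos_sq t = 0" by (simp add: pos_sq_def)

lemma DERIV_pos_sq: "(pos_sq has_real_derivative 2 * max 0 t) (at t)"
proof (cases t "0 :: real" rule: linorder_cases)
 case less
 have "((%t. 0 :: real) has_real_derivative 0) (at t)" by simp
 hence "(pos_sq has_real_derivative 0) (at t)"
  by (rule has_field_derivative_transform_within_open[of _ _ _ "{..<0}"])
   (use less in "auto simp: pos_sq_def")
 thus ?thesis using less by simp
next
 case greater
 have "((%t. t\<^sup>2 :: real) has_real_derivative 2 * t) (at t)"
  by (auto intro!: derivative_eq_intros)
 hence "(pos_sq has_real_derivative 2 * t) (at t)"
  by (rule has_field_derivative_transform_within_open[of _ _ _ "{0<..}"])
   (use greater in "auto simp: pos_sq_def")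
 thus ?thesis using greater by simp
next
 case equal
 have "((%h. pos_sq h / h) \<longlongrightarrow> 0) (at 0)"
 proof (rule Lim_null_comparison)
  show "\<forall>\<^sub>F h in at 0. norm (pos_sq h / h) <= \<bar>h\<bar>"
   by (rule always_eventually) (auto simp: pos_sq_def max_def power2_eq_square)
  show "((%h::real. \<bar>h\<bar>) \<longlongrightarrow> 0) (at 0)" by (rule tendsto_rabs_zero[OF tendsto_ident_at])
 qed
 hence "(pos_sq has_real_derivative 0) (at 0)"
  by (simp add: DERIV_def pos_sq_def)
 thus ?thesis using equal by simp
qed

lemma continuous_on_pos_sq_deriv: "continuous_on S (%t::real. 2 * max 0 t)"
 by (intro continuous_intros)

lemma C1_grad_pos_sq: "C1_grad S F D ==> C1_grad S (%x. pos_sq (F x)) (%x. (2 * max 0 (F x)) *\<^sub>R D x)"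
 by (rule C1_grad_compose[where phi' = "%t. 2 * max 0 t"]) (auto intro: DERIV_pos_sq continuous_on_pos_sq_deriv)

lemma C1_grad_linear: "C1_grad S (%z. p \<bullet> (z - y)) (%_. p)"
 unfolding C1_grad_def by (auto intro!: derivative_eq_intros)

lemma C1_grad_norm_sq: "C1_grad S (%z. (z - y) \<bullet> (z - y)) (%z. 2 *\<^sub>R (z - y))"
 unfolding C1_grad_def
 by (auto intro!: derivative_eq_intros continuous_intros simp: inner_commute)

lemma C1_grad_cmult: "C1_grad S F D ==> C1_grad S (%x. k * F x) (%x. k *\<^sub>R D x)"
 using C1_grad_mult[OF C1_grad_const[of S k], of F D] by simp

text \<open>The inner \<open>pos_sq\<close> vanishes up to distance \<open>r / 2\<close> and is at
  least 1 from distance \<open>r / sqrt 2\<close> on; the outer one turns this into the values 1 and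
  0.\<close>

definition bump :: "'e::euclidean_space => real => 'e => real" where
 "bump y r z = pos_sq (1 - pos_sq (4 / r\<^sup>2 * ((z - y) \<bullet> (z - y)) - 1))"

lemma bump_C1: "EX D. C1_grad UNIV (bump y r) D"
proof -
 have "C1_grad UNIV (%z. 4 / r\<^sup>2 * ((z - y) \<bullet> (z - y)) + (- 1)) (%z. (4 / r\<^sup>2) *\<^sub>R (2 *\<^sub>R (z - y)) + 0)"
  by (intro C1_grad_add C1_grad_cmult C1_grad_norm_sq C1_grad_const)
 thus ?thesis
  unfolding bump_def diff_conv_add_uminus[of _ "1::real"]
  using C1_grad_pos_sq[OF C1_grad_add[OF C1_grad_const[of _ 1] C1_grad_cmult[OF C1_grad_pos_sq, of _ _ _ "-1"]]]
  by (force simp: bump_def)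
qed

lemma bump_eq_1:
 assumes "z \<in> cball y (r / 2)" "r > 0"
 shows "bump y r z = 1"
proof -
 have "norm (z - y) <= r / 2" using assms by (simp add: dist_norm norm_minus_commute)
 hence "(norm (z - y))\<^sup>2 <= (r / 2)\<^sup>2" by (intro power_mono) auto
 hence "4 / r\<^sup>2 * ((z - y) \<bullet> (z - y)) <= 1" using assms by (simp add: power2_norm_eq_inner[symmetric] field_simps)
 thus ?thesis unfolding bump_def by (subst pos_sq_eq_0) (auto simp: pos_sq_def)
qed

lemma bump_eq_0:
 assumes "z \<notin> cball y r" "r > 0"
 shows "bump y r z = 0"
proof -
 have "norm (z - y) > r" using assms by (simp add: dist_norm norm_minus_commute)
 hence "(norm (z - y))\<^sup>2 > r\<^sup>2" using assms by (intro power_strict_mono) auto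
 hence "r\<^sup>2 <= 2 * (norm (z - y))\<^sup>2" using zero_le_power2[of "norm (z - y)"] by linarith
 hence "4 / r\<^sup>2 * ((z - y) \<bullet> (z - y)) - 1 >= 1" using assms by (simp add: power2_norm_eq_inner[symmetric] field_simps)
 hence "1 <= pos_sq (4 / r\<^sup>2 * ((z - y) \<bullet> (z - y)) - 1)" unfolding pos_sq_def by simp
 thus ?thesis unfolding bump_def by (subst pos_sq_eq_0) auto
qed

lemma bump_nonneg: "0 <= bump y r z" by (simp add: bump_def pos_sq_nonneg)

lemma has_derivative_eventually_eq:
 assumes "(f has_derivative f') (at x)" "\<forall>\<^sub>F y in nhds x. f y = g y"
 shows "(g has_derivative f') (at x)"
proof -
 obtain S where "open S" "x \<in> S" "!!y. y \<in> S ==> f y = g y"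
  using assms(2) unfolding eventually_nhds by (elim exE conjE) simp
 thus ?thesis using has_derivative_transform_within_open[OF assms(1)] by simp
qed

section \<open>Charts, differentials and C1 functions on a compact manifold\<close>

locale compact_manifold =
 fixes A :: "('m::{t2_space, second_countable_topology}, 'e::euclidean_space) chart set"
 assumes compact_UNIV: "compact (UNIV :: 'm set)" and atlas: "smooth_atlas A"
begin

abbreviation rng :: "('m, 'e) chart => 'e set" where "rng c \<equiv> snd c ` fst c"
abbreviation C1 where "C1 \<equiv> C1_functions A"
abbreviation dif where "dif \<equiv> differential A"
abbreviation toc where "toc \<equiv> tangent_of_chart A"
abbreviation ci :: "('m, 'e) chart => 'e => 'm" where "ci \<equiv> chart_inv"
abbreviation ch :: "'m => ('m, 'e) chart" where "ch x \<equiv> chart_at A x"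
abbreviation ctr :: "'m => 'e" where "ctr x \<equiv> snd (ch x) x"

lemma chart_facts:
 assumes "c \<in> A"
 shows open_dom: "open (fst c)" and open_rng: "open (rng c)"
  and chart_continuous: "continuous_on (fst c) (snd c)"
  and chart_inv_continuous: "continuous_on (rng c) (ci c)"
  and chart_inv_chart: "x \<in> fst c ==> ci c (snd c x) = x"
  and chart_chart_inv: "y \<in> rng c ==> snd c (ci c y) = y"
  and chart_inv_in: "y \<in> rng c ==> ci c y \<in> fst c"
proof -
 have *: "open (fst c)" "open (rng c)" "homeomorphism (fst c) (rng c) (snd c) (ci c)"
  using atlas assms unfolding smooth_atlas_def by auto
 thus "open (fst c)" "open (rng c)" by auto
 show "continuous_on (fst c) (snd c)" "continuous_on (rng c) (ci c)"
  using *(3) by (auto simp: homeomorphism_def)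
 show "x \<in> fst c ==> ci c (snd c x) = x" using *(3) by (auto simp: homeomorphism_def)
 show "y \<in> rng c ==> snd c (ci c y) = y" using *(3) by (auto simp: homeomorphism_def)
 show "y \<in> rng c ==> ci c y \<in> fst c" using *(3) by (auto simp: homeomorphism_def)
qed

lemma chart_at: "ch x \<in> A" "x \<in> fst (ch x)"
proof -
 have "EX c. c \<in> A & x \<in> fst c" using atlas unfolding smooth_atlas_def by blast
 hence "ch x \<in> A & x \<in> fst (ch x)" unfolding chart_at_def by (rule someI_ex)
 thus "ch x \<in> A" "x \<in> fst (ch x)" by auto
qed

lemma isCont_chart: "c \<in> A ==> x \<in> fst c ==> isCont (snd c) x"
 using chart_continuous open_dom by (metis continuous_on_eq_continuous_at)

lemma open_chart_image:
 assumes "c \<in> A" "open V" "V \<subseteq> rng c"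
 shows "open (ci c ` V)"
proof -
 have "ci c ` V = fst c Int snd c -` V"
 proof (intro set_eqI iffI)
  fix x assume "x \<in> ci c ` V"
  then obtain y where y: "x = ci c y" "y \<in> V" by (elim imageE)
  hence "y \<in> rng c" using assms(3) by (rule_tac subsetD)
  thus "x \<in> fst c Int snd c -` V"
   using y chart_chart_inv[OF assms(1)] chart_inv_in[OF assms(1)] by simp
 next
  fix x assume "x \<in> fst c Int snd c -` V"
  thus "x \<in> ci c ` V" using chart_inv_chart[OF assms(1)] by force
 qed
 thus ?thesis
  using continuous_open_preimage[OF chart_continuous open_dom] assms by simp
qed

lemma transition_open:
 assumes "c \<in> A" "d \<in> A"
 shows "open (snd c ` (fst c Int fst d))"
proof -
 have "snd c ` (fst c Int fst d) = rng c Int ci c -` (fst d)"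
  using chart_inv_chart[OF assms(1)] by force
 thus ?thesis
  using continuous_open_preimage[OF chart_inv_continuous[OF assms(1)] open_rng[OF assms(1)] open_dom[OF assms(2)]]
  by simp
qed

lemma transition_eventually:
 assumes "c \<in> A" "d \<in> A" "x \<in> fst c" "x \<in> fst d"
 shows "\<forall>\<^sub>F y in nhds (snd c x). y \<in> rng c & ci c y \<in> fst d"
proof -
 have "snd c x \<in> snd c ` (fst c Int fst d)" using assms by auto
 hence "\<forall>\<^sub>F y in nhds (snd c x). y \<in> snd c ` (fst c Int fst d)"
  using transition_open[OF assms(1,2)] by (rule eventually_nhds_in_open[rotated])
 thus ?thesis
  by (rule eventually_mono) (use chart_inv_chart[OF assms(1)] in auto)
qed

lemma transition_derivative:
 assumes "c \<in> A" "d \<in> A" "x \<in> fst c" "x \<in> fst d"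
 shows "((snd d o ci c) has_derivative blinfun_apply (coord_change c d x)) (at (snd c x))"
  and "continuous_on (snd c ` (fst c Int fst d))
    (%y. frechet_derivative (snd d o ci c) (at y) v)"
  and "blinfun_apply (coord_change c d x) = frechet_derivative (snd d o ci c) (at (snd c x))"
proof -
 have "smooth_on (snd c ` (fst c Int fst d)) (snd d o ci c)"
  using atlas assms unfolding smooth_atlas_def by blast
 hence "Ck_on (Suc 0) (snd c ` (fst c Int fst d)) (snd d o ci c)"
  unfolding smooth_on_def by blast
 hence *: "ALL y:snd c ` (fst c Int fst d). (snd d o ci c) differentiable (at y)"
  and **: "!!v. continuous_on (snd c ` (fst c Int fst d)) (%y. frechet_derivative (snd d o ci c) (at y) v)"
  unfolding Ck_on.simps by (blast, blast)
 show "continuous_on (snd c ` (fst c Int fst d)) (%y. frechet_derivative (snd d o ci c) (at y) v)"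
  by (rule **)
 have d: "(snd d o ci c) differentiable (at (snd c x))" using * assms by auto
 show eq: "blinfun_apply (coord_change c d x) = frechet_derivative (snd d o ci c) (at (snd c x))"
  unfolding coord_change_def
  by (rule bounded_linear_Blinfun_apply[OF has_derivative_bounded_linear[OF frechet_derivative_works[THEN iffD1, OF d]]])
 show "((snd d o ci c) has_derivative blinfun_apply (coord_change c d x)) (at (snd c x))"
  unfolding eq by (rule frechet_derivative_works[THEN iffD1, OF d])
qed

lemma coord_change_inverse:
 assumes "c \<in> A" "d \<in> A" "x \<in> fst c" "x \<in> fst d"
 shows "blinfun_apply (coord_change d c x) (blinfun_apply (coord_change c d x) w) = w"
proof -
 have x: "(snd d o ci c) (snd c x) = snd d x" using chart_inv_chart[OF assms(1,3)] by simp
 have T2: "((snd c o ci d) has_derivative blinfun_apply (coord_change d c x)) (at ((snd d o ci c) (snd c x)))"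
  unfolding x by (rule transition_derivative(1)[OF assms(2,1,4,3)])
 have ev: "\<forall>\<^sub>F y in nhds (snd c x). ((snd c o ci d) o (snd d o ci c)) y = y"
  using transition_eventually[OF assms]
  by (rule eventually_mono) (simp add: chart_inv_chart[OF assms(2)] chart_chart_inv[OF assms(1)])
 have "((%y. y) has_derivative (blinfun_apply (coord_change d c x) o blinfun_apply (coord_change c d x))) (at (snd c x))"
  by (rule has_derivative_eventually_eq[OF diff_chain_at[OF transition_derivative(1)[OF assms] T2] ev])
 hence "blinfun_apply (coord_change d c x) o blinfun_apply (coord_change c d x) = (%y. y)"
  by (rule has_derivative_unique) (rule has_derivative_ident)
 thus ?thesis by (metis comp_apply)
qed

lemma differential_eqI:
 assumes "((f o ci (ch x)) has_derivative blinfun_apply B) (at (ctr x))"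
 shows "dif f x = B"
proof -
 have "blinfun_apply B = frechet_derivative (f o ci (ch x)) (at (ctr x))"
  by (rule frechet_derivative_at[OF assms])
 thus ?thesis unfolding differential_def by (metis blinfun_apply_inverse)
qed

lemma differential_chart:
 assumes "c \<in> A" "x \<in> fst c" "((f o ci c) has_derivative (%w. p \<bullet> w)) (at (snd c x))"
 shows "dif f x = blinfun_inner_right p o\<^sub>L coord_change (ch x) c x"
proof (rule differential_eqI)
 note cx = chart_at[of x]
 have x: "(snd c o ci (ch x)) (ctr x) = snd c x" using chart_inv_chart[OF cx] by simp
 have T2: "((f o ci c) has_derivative (%w. p \<bullet> w)) (at ((snd c o ci (ch x)) (ctr x)))"
  unfolding x by (rule assms(3))
 have ev: "\<forall>\<^sub>F y in nhds (ctr x). ((f o ci c) o (snd c o ci (ch x))) y = (f o ci (ch x)) y"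
  using transition_eventually[OF cx(1) assms(1) cx(2) assms(2)]
  by (rule eventually_mono) (simp add: chart_inv_chart[OF assms(1)])
 have "((f o ci (ch x)) has_derivative ((%w. p \<bullet> w) o blinfun_apply (coord_change (ch x) c x))) (at (ctr x))"
  by (rule has_derivative_eventually_eq[OF diff_chain_at[OF transition_derivative(1)[OF cx(1) assms(1) cx(2) assms(2)] T2] ev])
 moreover have "((%w. p \<bullet> w) o blinfun_apply (coord_change (ch x) c x)) =
   blinfun_apply (blinfun_inner_right p o\<^sub>L coord_change (ch x) c x)"
  by (auto simp: fun_eq_iff)
 ultimately show "((f o ci (ch x)) has_derivative
   blinfun_apply (blinfun_inner_right p o\<^sub>L coord_change (ch x) c x)) (at (ctr x))" by simp
qed

lemma C1_functions_iff: "f \<in> C1 \<longleftrightarrow> (ALL c:A. EX D. C1_grad (rng c) (f o ci c) D)"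
 unfolding C1_functions_def mem_Collect_eq Ck_on_1_iff ..

lemma C1_gradE:
 assumes "f \<in> C1" "c \<in> A"
 obtains D where "C1_grad (rng c) (f o ci c) D"
 using assms C1_functions_iff by blast

lemma has_derivative_differential:
 assumes "f \<in> C1"
 shows "((f o ci (ch x)) has_derivative blinfun_apply (dif f x)) (at (ctr x))"
proof -
 obtain D where "C1_grad (rng (ch x)) (f o ci (ch x)) D" using C1_gradE[OF assms chart_at(1)] .
 hence d: "(f o ci (ch x)) differentiable (at (ctr x))"
  using chart_at(2)[of x] unfolding C1_grad_def differentiable_def by blast
 have "blinfun_apply (dif f x) = frechet_derivative (f o ci (ch x)) (at (ctr x))"
  unfolding differential_def
  by (rule bounded_linear_Blinfun_apply[OF has_derivative_bounded_linear[OF frechet_derivative_works[THEN iffD1, OF d]]])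
 thus ?thesis using frechet_derivative_works[THEN iffD1, OF d] by simp
qed

lemma C1_functions_continuous:
 assumes "f \<in> C1"
 shows "continuous_on UNIV f"
proof (intro continuous_at_imp_continuous_on ballI)
 fix x
 obtain D where "C1_grad (rng (ch x)) (f o ci (ch x)) D" using C1_gradE[OF assms chart_at(1)] .
 hence "continuous_on (rng (ch x)) (f o ci (ch x))" by (rule C1_grad_continuous)
 hence "isCont (f o ci (ch x)) (ctr x)"
  using open_rng[OF chart_at(1)] chart_at(2)[of x] by (metis continuous_on_eq_continuous_at imageI)
 hence "isCont ((f o ci (ch x)) o snd (ch x)) x"
  using continuous_at_compose[OF isCont_chart[OF chart_at, of x]] by blast
 moreover have "\<forall>\<^sub>F y in nhds x. ((f o ci (ch x)) o snd (ch x)) y = f y"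
  using eventually_nhds_in_open[OF open_dom[OF chart_at(1)] chart_at(2)[of x]]
  by (rule eventually_mono) (simp add: chart_inv_chart[OF chart_at(1)])
 ultimately show "isCont f x" by (simp add: isCont_cong)
qed

lemma C1_const: "(%_. k) \<in> C1"
 unfolding C1_functions_iff using C1_grad_const by (auto simp: comp_def)

lemma C1_add: "f \<in> C1 ==> f' \<in> C1 ==> (%x. f x + f' x) \<in> C1"
 unfolding C1_functions_iff comp_def
proof
 fix c assume "ALL c:A. EX D. C1_grad (rng c) (%x. f (ci c x)) D"
  "ALL c:A. EX D. C1_grad (rng c) (%x. f' (ci c x)) D" "c \<in> A"
 then obtain D D' where "C1_grad (rng c) (%x. f (ci c x)) D" "C1_grad (rng c) (%x. f' (ci c x)) D'"
  by blast
 from C1_grad_add[OF this] show "EX D. C1_grad (rng c) (%x. f (ci c x) + f' (ci c x)) D" by blast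
qed

lemma C1_mult: "f \<in> C1 ==> f' \<in> C1 ==> (%x. f x * f' x) \<in> C1"
 unfolding C1_functions_iff comp_def
proof
 fix c assume "ALL c:A. EX D. C1_grad (rng c) (%x. f (ci c x)) D"
  "ALL c:A. EX D. C1_grad (rng c) (%x. f' (ci c x)) D" "c \<in> A"
 then obtain D D' where "C1_grad (rng c) (%x. f (ci c x)) D" "C1_grad (rng c) (%x. f' (ci c x)) D'"
  by blast
 from C1_grad_mult[OF this] show "EX D. C1_grad (rng c) (%x. f (ci c x) * f' (ci c x)) D" by blast
qed

lemma C1_sum: "finite I ==> (!!i. i \<in> I ==> f i \<in> C1) ==> (%x. \<Sum>i\<in>I. f i x) \<in> C1"
 by (induction I rule: finite_induct) (auto intro: C1_const C1_add)

lemma C1_compose: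
 assumes "f \<in> C1" "!!x. (phi has_real_derivative phi' (f x)) (at (f x))"
  and "continuous_on (range f) phi'"
 shows "(%x. phi (f x)) \<in> C1"
 unfolding C1_functions_iff
proof
 fix c assume "c \<in> A"
 then obtain D where "C1_grad (rng c) (f o ci c) D" using C1_gradE[OF assms(1)] by blast
 hence "C1_grad (rng c) (%y. phi ((f o ci c) y)) (%y. phi' ((f o ci c) y) *\<^sub>R D y)"
  by (rule C1_grad_compose) (use assms(2,3) in "auto intro: continuous_on_subset")
 thus "EX D. C1_grad (rng c) ((%x. phi (f x)) o ci c) D" unfolding comp_def by blast
qed

lemma differential_const: "dif (%_. k) x = 0"
 by (rule differential_eqI) (simp add: comp_def zero_blinfun.rep_eq)

lemma differential_add:
 assumes "f \<in> C1" "f' \<in> C1"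
 shows "dif (%x. f x + f' x) x = dif f x + dif f' x"
 using has_derivative_add[OF has_derivative_differential[OF assms(1)] has_derivative_differential[OF assms(2)], of x]
 by (intro differential_eqI) (simp add: comp_def plus_blinfun.rep_eq)

lemma differential_mult:
 assumes "f \<in> C1" "f' \<in> C1"
 shows "dif (%x. f x * f' x) x = f x *\<^sub>R dif f' x + f' x *\<^sub>R dif f x"
 using has_derivative_mult[OF has_derivative_differential[OF assms(1)] has_derivative_differential[OF assms(2)], of x]
 by (intro differential_eqI)
  (simp add: comp_def plus_blinfun.rep_eq scaleR_blinfun.rep_eq chart_inv_chart[OF chart_at] mult.commute)

lemma differential_sum:
 "finite I ==> (!!i. i \<in> I ==> f i \<in> C1) ==>
  dif (%x. \<Sum>i\<in>I. f i x) x = (\<Sum>i\<in>I. dif (f i) x)"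
 by (induction I rule: finite_induct) (auto simp: differential_const differential_add C1_sum)

lemma differential_compose:
 assumes "f \<in> C1" "(phi has_real_derivative d) (at (f x))"
 shows "dif (%x. phi (f x)) x = d *\<^sub>R dif f x"
proof (rule differential_eqI)
 have "((f o ci (ch x)) has_derivative blinfun_apply (dif f x)) (at (ctr x))"
  by (rule has_derivative_differential[OF assms(1)])
 from has_derivative_compose[OF this, of phi "(*) d"]
 show "(((%x. phi (f x)) o ci (ch x)) has_derivative blinfun_apply (d *\<^sub>R dif f x)) (at (ctr x))"
  using assms(2) chart_inv_chart[OF chart_at, of x]
  by (simp add: has_field_derivative_def comp_def scaleR_blinfun.rep_eq)
qed

lemma C1_grad_transition:
 assumes "c \<in> A" "d \<in> A" "C1_grad V F D" "open V"
 shows "EX D'. C1_grad (rng d Int ci d -` (fst c Int snd c -` V)) (F o (snd c o ci d)) D'"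
proof -
 let ?S = "rng d Int ci d -` (fst c Int snd c -` V)"
 let ?T = "snd c o ci d"
 let ?T' = "%y. frechet_derivative ?T (at y)"
 define D' where "D' y = (\<Sum>b\<in>Basis. (D (?T y) \<bullet> ?T' y b) *\<^sub>R b)" for y
 have S: "?S \<subseteq> snd d ` (fst d Int fst c)"
 proof
  fix y assume y: "y \<in> ?S"
  show "y \<in> snd d ` (fst d Int fst c)"
   by (rule image_eqI[of _ _ "ci d y"]) (use y chart_chart_inv[OF assms(2)] chart_inv_in[OF assms(2)] in simp_all)
 qed
 have cT': "continuous_on ?S (%y. ?T' y v)" for v
 proof (cases "fst d Int fst c = {}")
  case True
  hence "?S = {}" using S by auto
  thus ?thesis by (metis continuous_on_empty)
 next
  case False
  then obtain x where "x \<in> fst d" "x \<in> fst c" by auto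
  from transition_derivative(2)[OF assms(2,1) this, of v] show ?thesis
   by (rule continuous_on_subset[OF _ S])
 qed
 have cD: "continuous_on V D" and dF: "!!x. x \<in> V ==> (F has_derivative (%w. D x \<bullet> w)) (at x)"
  using assms(3) by (auto simp: C1_grad_def)
 have cT: "continuous_on ?S ?T"
  using chart_continuous[OF assms(1)] chart_inv_continuous[OF assms(2)]
  by (intro continuous_on_compose) (auto intro: continuous_on_subset)
 have "continuous_on ?S (%y. D (?T y))"
  by (rule continuous_on_compose2[OF cD cT]) auto
 hence "continuous_on ?S D'" unfolding D'_def by (intro continuous_intros cT')
 moreover have "((F o ?T) has_derivative (%w. D' y \<bullet> w)) (at y)" if y: "y \<in> ?S" for y
 proof -
  define x where "x = ci d y"
  have x: "x \<in> fst d" "x \<in> fst c" "snd d x = y" "?T y \<in> V"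
   using y chart_chart_inv[OF assms(2)] chart_inv_in[OF assms(2)] by (auto simp: x_def)
  have T: "(?T has_derivative ?T' y) (at y)"
   using transition_derivative(1,3)[OF assms(2,1) x(1,2)] x(3) by simp
  have "((F o ?T) has_derivative ((%w. D (?T y) \<bullet> w) o ?T' y)) (at y)"
   by (rule diff_chain_at[OF T dF[OF x(4)]])
  moreover have "((%w. D (?T y) \<bullet> w) o ?T' y) = (%w. D' y \<bullet> w)"
  proof
   fix w
   have "linear (%w. D (?T y) \<bullet> ?T' y w)"
    using has_derivative_linear[OF T] by (simp add: linear_iff inner_add_right)
   from linear_functional_inner[OF this, of w]
   show "((%w. D (?T y) \<bullet> w) o ?T' y) w = D' y \<bullet> w" by (simp add: D'_def)
  qed
  ultimately show ?thesis by simp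
 qed
 ultimately show ?thesis unfolding C1_grad_def by blast
qed

text \<open>Seen in another chart \<open>d\<close>, a point either corresponds to one in the domain
  of \<open>c\<close>, where the chain rule applies, or avoids the image of \<open>K\<close>, near
  which the function is zero. That image is closed because it is compact in a Hausdorff
  space.\<close>

lemma C1_extension:
 assumes "c \<in> A" "C1_grad (rng c) F D" "compact K" "K \<subseteq> rng c" "!!y. y \<in> rng c - K ==> F y = 0"
 shows "(%x. if x \<in> fst c then F (snd c x) else 0) \<in> C1" (is "?f \<in> _")
 unfolding C1_functions_iff
proof
 fix d assume d: "d \<in> A"
 let ?K = "ci c ` K"
 have "compact ?K" using chart_inv_continuous[OF assms(1)] assms by (intro compact_continuous_image) (auto intro: continuous_on_subset)
 hence "closed ?K" by (rule compact_imp_closed)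
 show "EX D. C1_grad (rng d) (?f o ci d) D"
 proof (rule C1_grad_local[OF open_rng[OF d]])
  fix y assume y: "y \<in> rng d"
  show "EX U D. open U & y \<in> U & C1_grad U (?f o ci d) D"
  proof (cases "ci d y \<in> fst c")
   case True
   let ?S = "rng d Int ci d -` (fst c Int snd c -` rng c)"
   obtain D' where D': "C1_grad ?S (F o (snd c o ci d)) D'"
    using C1_grad_transition[OF assms(1) d assms(2) open_rng[OF assms(1)]] by blast
   have S': "?S = rng d Int ci d -` fst c" by auto
   have op: "open ?S" unfolding S'
    by (rule continuous_open_preimage[OF chart_inv_continuous[OF d] open_rng[OF d] open_dom[OF assms(1)]])
   have "C1_grad ?S (?f o ci d) D'"
    by (rule C1_grad_cong_open[OF D' op]) auto
   thus ?thesis using op y True by blast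
  next
   case False
   let ?S = "rng d Int ci d -` (- ?K)"
   have op: "open ?S" using `closed ?K`
    by (intro continuous_open_preimage chart_inv_continuous open_rng d) auto
   have "(?f o ci d) z = 0" if "z \<in> ?S" for z
   proof (cases "ci d z \<in> fst c")
    case True
    have "snd c (ci d z) \<notin> K"
    proof
     assume "snd c (ci d z) \<in> K"
     hence "ci d z \<in> ?K" using chart_inv_chart[OF assms(1) True] by (metis imageI)
     thus False using that by auto
    qed
    thus ?thesis using assms(5)[of "snd c (ci d z)"] True by auto
   qed auto
   hence "C1_grad ?S (?f o ci d) (%_. 0)"
    by (intro C1_grad_cong_open[OF C1_grad_const[of _ 0] op]) auto
   moreover have "y \<in> ?S" using False y chart_inv_in[OF assms(1)] assms(4) by auto
   ultimately show ?thesis using op by blast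
  qed
 qed
qed

text \<open>The viscosity conditions quantify over C1 functions on the whole manifold; a cut-off
  makes test functions given near one point of a chart global.\<close>

lemma C1_local_extension:
 assumes "c \<in> A" "open U" "y \<in> U" "U \<subseteq> rng c" "C1_grad U F D"
 obtains f where "f \<in> C1" "\<forall>\<^sub>F z in nhds y. f (ci c z) = F z"
proof -
 from open_contains_cball_eq[OF assms(2), THEN spec, THEN iffD1, OF assms(3)]
 obtain r where r: "r > 0" "cball y r \<subseteq> U" by (elim exE conjE)
 obtain Db where Db: "C1_grad UNIV (bump y r) Db" using bump_C1 by blast
 define F' where "F' z = (if z \<in> U then F z * bump y r z else 0)" for z
 have "EX D'. C1_grad (rng c) F' D'"
 proof (rule C1_grad_local[OF open_rng[OF assms(1)]])
  fix z assume "z \<in> rng c"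
  show "EX V D. open V & z \<in> V & C1_grad V F' D"
  proof (cases "z \<in> U")
   case True
   have "C1_grad U F' (%x. F x *\<^sub>R Db x + bump y r x *\<^sub>R D x)"
    by (rule C1_grad_cong_open[OF C1_grad_mult[OF assms(5) C1_grad_subset[OF Db]] assms(2)])
     (auto simp: F'_def)
   thus ?thesis using True assms(2) by blast
  next
   case False
   have "C1_grad (- cball y r) F' (%_. 0)"
    by (rule C1_grad_cong_open[OF C1_grad_const[of _ 0]])
     (use r bump_eq_0 in "auto simp: F'_def")
   thus ?thesis using False r by (intro exI[of _ "- cball y r"] exI[of _ "%_. 0"]) auto
  qed
 qed
 then obtain D' where D': "C1_grad (rng c) F' D'" by blast
 let ?f = "%x. if x \<in> fst c then F' (snd c x) else 0"
 have "?f \<in> C1"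
  by (rule C1_extension[OF assms(1) D', of "cball y r"])
   (use r assms bump_eq_0[OF _ r(1)] in "auto simp: F'_def")
 moreover have "\<forall>\<^sub>F z in nhds y. ?f (ci c z) = F z"
 proof -
  have "\<forall>\<^sub>F z in nhds y. z \<in> ball y (r/2)" using r by (intro eventually_nhds_in_open) auto
  thus ?thesis
  proof (rule eventually_mono)
   fix z assume z: "z \<in> ball y (r/2)"
   hence "dist y z < r / 2" by simp
   hence "z \<in> cball y (r/2)" "z \<in> cball y r" using r(1) by (auto simp: mem_cball)
   hence zU: "z \<in> U" "bump y r z = 1" using r bump_eq_1 by auto
   hence "z \<in> rng c" using assms(4) by (rule_tac subsetD)
   thus "?f (ci c z) = F z"
    using zU chart_inv_in[OF assms(1)] chart_chart_inv[OF assms(1)] by (simp add: F'_def)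
  qed
 qed
 ultimately show ?thesis by (rule that)
qed

text \<open>Finitely many of the neighbourhoods cover, and since \<open>Q\<close> persists for
  smaller \<open>eta\<close> the least of their constants serves everywhere. Thresholds in time are
  fed in as \<open>1 / eta\<close>.\<close>

lemma uniform_by_compactness:
 assumes "!!z0. EX eta>0. \<forall>\<^sub>F z in nhds z0. Q eta z"
  and mono: "!!eta eta' z. Q eta z ==> 0 < eta' ==> eta' <= eta ==> Q eta' z"
 shows "EX eta>0::real. ALL z::'m. Q eta z"
proof -
 have "ALL z0. EX eta. 0 < eta & (\<forall>\<^sub>F z in nhds z0. Q eta z)" using assms(1) by simp
 from choice[OF this] obtain eta where eta: "!!z0. eta z0 > 0" "!!z0. \<forall>\<^sub>F z in nhds z0. Q (eta z0) z" by blast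
 have "ALL z0. EX U. open U & z0 \<in> U & (ALL z:U. Q (eta z0) z)" using eta(2) unfolding eventually_nhds by simp
 from choice[OF this] obtain U where U: "!!z0. open (U z0)" "!!z0. z0 \<in> U z0" "!!z0 z. z \<in> U z0 ==> Q (eta z0) z"
  by blast
 obtain X where X: "finite X" "UNIV \<subseteq> (\<Union>x\<in>X. U x)"
 proof (rule compactE_image[OF compact_UNIV, of UNIV U])
  show "UNIV \<subseteq> (\<Union>x\<in>UNIV. U x)" using U(2) by (intro subsetI UN_I[of _ UNIV]) auto
 qed (use U(1) in auto)
 hence "X ~= {}" by auto
 define e where "e = Min (eta ` X)"
 have "e > 0" unfolding e_def using X(1) `X ~= {}` eta(1) by simp
 moreover have "Q e z" for z
 proof -
  obtain x where x: "x \<in> X" "z \<in> U x" using X(2) by blast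
  have "e <= eta x" unfolding e_def using X(1) x(1) by simp
  thus ?thesis using mono[OF U(3)[OF x(2)] `e > 0`] by simp
 qed
 ultimately show ?thesis by (intro exI[of _ e] conjI allI)
qed

lemma bounded_continuous:
 fixes u :: "'m => real"
 assumes "continuous_on UNIV u"
 obtains B where "B > 0" "!!x. \<bar>u x\<bar> <= B"
proof -
 have "bounded (range u)" using compact_continuous_image[OF assms compact_UNIV] compact_imp_bounded by blast
 then obtain B where "!!x. \<bar>u x\<bar> <= B" unfolding bounded_iff by auto
 hence "!!x. \<bar>u x\<bar> <= \<bar>B\<bar> + 1" by (meson abs_ge_self add_increasing2 order_trans zero_le_one)
 thus ?thesis using that[of "\<bar>B\<bar> + 1"] by auto
qed

lemma chart_ball_exists:
 assumes "open V" "ctr x \<in> V"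
 obtains r where "r > 0" "cball (ctr x) r \<subseteq> V Int rng (ch x)"
proof -
 have o: "open (V Int rng (ch x))" and i: "ctr x \<in> V Int rng (ch x)"
  using assms open_rng[OF chart_at(1)] chart_at(2) by auto
 from open_contains_cball_eq[OF o, THEN spec, THEN iffD1, OF i]
 obtain r where "r > 0" "cball (ctr x) r \<subseteq> V Int rng (ch x)"
  by (elim exE conjE)
 thus ?thesis by (rule that)
qed

lemma finite_chart_cover:
 assumes "!!x. 0 < rho x" "!!x. ball (ctr x) (rho x) \<subseteq> rng (ch x)"
 obtains X where "finite X" "!!z. EX x:X. z \<in> fst (ch x) & snd (ch x) z \<in> ball (ctr x) (rho x)"
proof -
 define N where "N x = ci (ch x) ` ball (ctr x) (rho x)" for x
 have op: "open (N x)" for x using open_chart_image[OF chart_at(1) open_ball assms(2)] by (simp add: N_def)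
 have mem: "x \<in> N x" for x
  unfolding N_def by (rule image_eqI[of _ _ "ctr x"]) (simp_all add: assms(1) chart_inv_chart[OF chart_at])
 obtain X where X: "finite X" "UNIV \<subseteq> (\<Union>x\<in>X. N x)"
 proof (rule compactE_image[OF compact_UNIV, of UNIV N])
  show "UNIV \<subseteq> (\<Union>x\<in>UNIV. N x)" using mem by (intro subsetI UN_I[of _ UNIV]) auto
 qed (use op in auto)
 show ?thesis
 proof
  fix z
  have "z \<in> (\<Union>x\<in>X. N x)" using X(2) by (rule subsetD) simp
  then obtain x where xX: "x \<in> X" and "z \<in> N x" by (elim UN_E)
  then obtain y where x: "x \<in> X" "z = ci (ch x) y" "y \<in> ball (ctr x) (rho x)"
   unfolding N_def by (elim imageE) simp
  hence "y \<in> rng (ch x)" using assms(2)[of x] by (rule_tac subsetD)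
  hence "z \<in> fst (ch x)" "snd (ch x) z = y"
   using chart_chart_inv[OF chart_at(1)] chart_inv_in[OF chart_at(1)] x(2) by simp_all
  thus "EX x:X. z \<in> fst (ch x) & snd (ch x) z \<in> ball (ctr x) (rho x)"
   using x by (intro bexI[of _ x]) simp_all
 qed (rule X(1))
qed

end

section \<open>Convexity and the Legendre transform in charts\<close>

text \<open>Separate the point of the graph over \<open>p\<close> from the strict epigraph. The
  hyperplane is not vertical: with \<open>s = 0\<close> the functional \<open>alp\<close> would be
  nonnegative on all differences \<open>q - p\<close>, which \<open>q = p - alp\<close>
  refutes.\<close>

lemma convex_on_subgradient:
 fixes f :: "'e::euclidean_space => real"
 assumes "convex_on UNIV f"
 shows "EX w. ALL q. f p + w \<bullet> (q - p) <= f q"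
proof -
 let ?E = "{z :: 'e \<times> real. f (fst z) < snd z}"
 have conv: "convex ?E"
 proof (rule convexI)
  fix z z' :: "'e \<times> real" and u v :: real
  assume z: "z \<in> ?E" "z' \<in> ?E" and uv: "0 <= u" "0 <= v" "u + v = 1"
  have "f (u *\<^sub>R fst z + v *\<^sub>R fst z') <= u * f (fst z) + v * f (fst z')"
   using assms uv unfolding convex_on_def by auto
  also have "... < u * snd z + v * snd z'"
  proof (cases "u = 0")
   case True
   thus ?thesis using z uv by simp
  next
   case False
   hence "u * f (fst z) < u * snd z" using z uv by simp
   moreover have "v * f (fst z') <= v * snd z'" using z uv by (intro mult_left_mono) auto
   ultimately show ?thesis by simp
  qed
  finally show "u *\<^sub>R z + v *\<^sub>R z' \<in> ?E" by simp
 qed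
 have "?E ~= {}" by (auto intro!: exI[of _ 0] exI[of _ "f 0 + 1"])
 moreover have "{(p, f p)} Int ?E = {}" by auto
 ultimately obtain a b where ab: "a ~= 0" "ALL x:{(p, f p)}. a \<bullet> x <= b" "ALL x:?E. b <= a \<bullet> x"
  using separating_hyperplane_sets[OF convex_singleton conv, of "(p, f p)"] by blast
 define alp s where "alp = fst a" and "s = snd a"
 have key: "alp \<bullet> p + s * f p <= alp \<bullet> q + s * t" if "f q < t" for q t
 proof -
  have "a \<bullet> (p, f p) <= b" using ab(2) by simp
  also have "b <= a \<bullet> (q, t)" using ab(3) that by auto
  finally show ?thesis by (simp add: alp_def s_def inner_prod_def)
 qed
 have "s >= 0" using key[of p "f p + 1"] by (simp add: algebra_simps)
 moreover have "s ~= 0"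
 proof
  assume "s = 0"
  hence "0 <= alp \<bullet> (q - p)" for q using key[of q "f q + 1"] by (simp add: inner_diff_right)
  from this[of "p - alp"] have "alp \<bullet> alp <= 0" by simp
  hence "alp = 0" using inner_eq_zero_iff inner_ge_zero by (metis order_antisym)
  thus False using ab(1) `s = 0` by (simp add: alp_def s_def prod_eq_iff)
 qed
 ultimately have "s > 0" by simp
 have "f p + (- (1 / s) *\<^sub>R alp) \<bullet> (q - p) <= f q" for q
 proof (rule field_le_epsilon)
  fix e :: real assume "e > 0"
  have "alp \<bullet> p + s * f p <= alp \<bullet> q + s * (f q + e)" using key[of q "f q + e"] `e > 0` by simp
  hence "s * f p - alp \<bullet> (q - p) <= s * (f q + e)" by (simp add: inner_diff_right algebra_simps)
  hence "(s * f p - alp \<bullet> (q - p)) / s <= f q + e" using `s > 0` by (simp add: field_simps)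
  moreover have "(s * f p - alp \<bullet> (q - p)) / s = f p + (- (1 / s) *\<^sub>R alp) \<bullet> (q - p)"
   using `s > 0` by (simp add: field_simps)
  ultimately show "f p + (- (1 / s) *\<^sub>R alp) \<bullet> (q - p) <= f q + e" by simp
 qed
 thus ?thesis by blast
qed

lemma uniform_near_point:
 fixes f :: "'a::heine_borel => 'b::metric_space => real"
 assumes "continuous_on (S \<times> T) (%(y, p). f y p)" "open S" "y0 \<in> S" "compact P" "P \<subseteq> T" "eps > 0"
 shows "EX r>0. cball y0 r \<subseteq> S & (ALL y:cball y0 r. ALL y':cball y0 r. ALL p:P. \<bar>f y p - f y' p\<bar> <= eps)"
proof -
 from open_contains_cball_eq[OF assms(2), THEN spec, THEN iffD1, OF assms(3)]
 obtain r0 where r0: "r0 > 0" "cball y0 r0 \<subseteq> S" by (elim exE conjE)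
 let ?f = "%z. f (fst z) (snd z)"
 have "continuous_on (cball y0 r0 \<times> P) ?f"
  using continuous_on_subset[OF assms(1), of "cball y0 r0 \<times> P"] r0 assms(5) by (auto simp: case_prod_beta)
 hence "uniformly_continuous_on (cball y0 r0 \<times> P) ?f"
  using assms(4) by (intro compact_uniformly_continuous compact_Times) auto
 then obtain d where d: "d > 0" "!!z z'. z \<in> cball y0 r0 \<times> P ==> z' \<in> cball y0 r0 \<times> P ==> dist z' z < d ==> dist (?f z') (?f z) < eps"
  unfolding uniformly_continuous_on_def using `eps > 0` by meson
 define r where "r = min r0 (d / 3)"
 have r: "r > 0" "r <= r0" "r <= d / 3" using r0 d by (auto simp: r_def)
 have "\<bar>f y p - f y' p\<bar> <= eps" if "y \<in> cball y0 r" "y' \<in> cball y0 r" "p \<in> P" for y y' p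
 proof -
  have "dist y y' <= dist y0 y + dist y0 y'" by (metis dist_commute dist_triangle)
  also have "... < d" using that r d(1) by auto
  finally have "dist (y, p) (y', p) < d" by (simp add: dist_Pair_Pair)
  moreover have "(y, p) \<in> cball y0 r0 \<times> P" "(y', p) \<in> cball y0 r0 \<times> P" using that r by auto
  ultimately have "dist (?f (y, p)) (?f (y', p)) < eps" by (intro d(2)) auto
  thus ?thesis by (simp add: dist_real_def)
 qed
 moreover have "cball y0 r \<subseteq> S" using r r0 by (meson order_trans subset_cball)
 ultimately show ?thesis using r(1) by blast
qed

locale hamiltonian = compact_manifold A
 for A :: "('m::{t2_space, second_countable_topology}, 'e::euclidean_space) chart set" +
 fixes g :: "'m => 'e => 'e => real" and G :: "'m => ('e \<Rightarrow>\<^sub>L real) => real"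
 assumes metric: "riemannian_metric A g"
  and G_continuous: "continuous_map (cotangent_topology A) euclideanreal (%(x, p). G x p)"
  and G_convex: "!!x. convex_on UNIV (G x)"
  and G_superlinear: "superlinear g G"
begin

text \<open>The Hamiltonian and the Lagrangian in a chart, with covectors written as vectors acting by the
  inner product.\<close>

definition Hc :: "('m, 'e) chart => 'e => 'e => real" where
 "Hc c y p = G (ci c y) (blinfun_inner_right p o\<^sub>L coord_change (ch (ci c y)) c (ci c y))"

definition Lc :: "('m, 'e) chart => 'e => 'e => real" where
 "Lc c y w = (SUP p. p \<bullet> w - Hc c y p)"

lemma Hc_continuous:
 assumes "c \<in> A"
 shows "continuous_on (rng c \<times> UNIV) (%(y, p). Hc c y p)"
proof -
 have top: "topspace (cotangent_topology A) = UNIV"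
 proof -
  have "openin (cotangent_topology A) UNIV"
   unfolding openin_cotangent_topology using open_rng by (auto intro!: open_Times)
  thus ?thesis using openin_subset by blast
 qed
 let ?G = "%(x, p). G x p"
 have "continuous_on (rng c \<times> UNIV) (?G o cotangent_of_chart A c)"
 proof (subst continuous_on_open_vimage)
  show "open (rng c \<times> (UNIV :: ('e \<Rightarrow>\<^sub>L real) set))" using open_rng[OF assms] by (intro open_Times) auto
  show "ALL B. open B --> open ((?G o cotangent_of_chart A c) -` B Int rng c \<times> UNIV)"
  proof (intro allI impI)
   fix B :: "real set" assume "open B"
   hence "openin (cotangent_topology A) {z \<in> topspace (cotangent_topology A). ?G z \<in> B}"
    using G_continuous unfolding continuous_map_def by auto
   hence "openin (cotangent_topology A) (?G -` B)" by (simp add: top vimage_def)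
   hence "open ((rng c \<times> UNIV) Int cotangent_of_chart A c -` (?G -` B))"
    using assms unfolding openin_cotangent_topology by (rule bspec)
   thus "open ((?G o cotangent_of_chart A c) -` B Int rng c \<times> UNIV)"
    by (simp add: vimage_comp Int_commute)
  qed
 qed
 hence "continuous_on (rng c \<times> UNIV) (%z. (?G o cotangent_of_chart A c) (fst z, blinfun_inner_right (snd z)))"
  by (rule continuous_on_compose2)
   (auto intro!: continuous_intros bounded_linear.continuous_on[OF bounded_linear_blinfun_inner_right])
 thus ?thesis
  by (simp add: cotangent_of_chart_def Let_def Hc_def case_prod_beta)
qed

lemma Hc_continuous_in_p:
 assumes "c \<in> A" "y \<in> rng c"
 shows "continuous_on S (Hc c y)"
proof -
 have "continuous_on UNIV (%p. (%(y, p). Hc c y p) (y, p))"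
  by (rule continuous_on_compose2[OF Hc_continuous[OF assms(1)]]) (use assms in "auto intro!: continuous_intros")
 thus ?thesis by (auto intro: continuous_on_subset)
qed

lemma Hc_convex: "convex_on UNIV (Hc c y)"
proof (rule convex_onI)
 fix t :: real and p q :: 'e assume t: "0 < t" "t < 1"
 let ?T = "%p. blinfun_inner_right p o\<^sub>L coord_change (ch (ci c y)) c (ci c y)"
 have "?T ((1 - t) *\<^sub>R p + t *\<^sub>R q) = (1 - t) *\<^sub>R ?T p + t *\<^sub>R ?T q"
  by (rule blinfun_eqI) (simp add: inner_add_left blinfun.add_left blinfun.scaleR_left)
 thus "Hc c y ((1 - t) *\<^sub>R p + t *\<^sub>R q) <= (1 - t) * Hc c y p + t * Hc c y q"
  unfolding Hc_def using convex_onD[OF G_convex, of t "?T p" "?T q"] t by simp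
qed simp

lemma covector_chart:
 assumes "c \<in> A" "x \<in> fst c"
 shows "EX p. q = blinfun_inner_right p o\<^sub>L coord_change (ch x) c x"
proof -
 let ?T = "%w. blinfun_apply q (blinfun_apply (coord_change c (ch x) x) w)"
 have "linear ?T" by (simp add: linear_iff blinfun.add_right blinfun.scaleR_right)
 hence T: "?T w = (\<Sum>b\<in>Basis. ?T b *\<^sub>R b) \<bullet> w" for w by (rule linear_functional_inner)
 have "q = blinfun_inner_right (\<Sum>b\<in>Basis. ?T b *\<^sub>R b) o\<^sub>L coord_change (ch x) c x"
 proof (rule blinfun_eqI)
  fix v
  have "blinfun_apply q v = ?T (blinfun_apply (coord_change (ch x) c x) v)"
   using coord_change_inverse[OF chart_at(1) assms(1) chart_at(2) assms(2)] by simp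
  also have "... = (\<Sum>b\<in>Basis. ?T b *\<^sub>R b) \<bullet> blinfun_apply (coord_change (ch x) c x) v" by (rule T)
  finally show "blinfun_apply q v =
    blinfun_apply (blinfun_inner_right (\<Sum>b\<in>Basis. ?T b *\<^sub>R b) o\<^sub>L coord_change (ch x) c x) v" by simp
 qed
 thus ?thesis by blast
qed

text \<open>The constants depend on \<open>x\<close>, which is enough because superlinearity is a
  condition on single fibres.\<close>

lemma tangent_norm_bounds:
 obtains a b where "0 < a" "0 < b" "!!v. a * norm v <= tangent_norm g x v" "!!v. tangent_norm g x v <= b * norm v"
proof -
 have bil: "bilinear (g x)" and pos: "!!v. v ~= 0 ==> g x v v > 0"
  using metric unfolding riemannian_metric_def by auto
 have bb: "bounded_bilinear (g x)" using bil by (simp add: bilinear_conv_bounded_bilinear)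
 then obtain K where K: "K > 0" "!!v w. norm (g x v w) <= norm v * norm w * K"
  using bounded_bilinear.pos_bounded by blast
 have scale: "g x (t *\<^sub>R v) (t *\<^sub>R v) = t\<^sup>2 * g x v v" for t v
  using bil by (simp add: bilinear_lmul bilinear_rmul power2_eq_square)
 have "continuous_on (sphere 0 1) (%v. g x v v)"
  by (rule bounded_bilinear.continuous_on[OF bb]) (auto intro: continuous_intros)
 then obtain v0 where v0: "v0 \<in> sphere 0 1" "!!v. v \<in> sphere 0 1 ==> g x v0 v0 <= g x v v"
  using continuous_attains_inf[of "sphere (0::'e) 1" "%v. g x v v"] by (auto simp: sphere_eq_empty)
 define m where "m = g x v0 v0"
 have "v0 ~= 0" using v0(1) by auto
 hence "m > 0" using pos[of v0] by (simp add: m_def)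
 have low: "m * (norm v)\<^sup>2 <= g x v v" for v
 proof (cases "v = 0")
  case False
  have "m <= g x ((1 / norm v) *\<^sub>R v) ((1 / norm v) *\<^sub>R v)"
   unfolding m_def by (rule v0(2)) (use False in simp)
  also have "... = g x v v / (norm v)\<^sup>2" by (simp add: scale power_one_over)
  finally show ?thesis using False by (simp add: field_simps)
 qed (use scale[of 0 0] in simp)
 show ?thesis
 proof
  show "0 < sqrt m" using `m > 0` by simp
  show "0 < sqrt K" using K by simp
  fix v :: 'e
  have "sqrt m * norm v = sqrt (m * (norm v)\<^sup>2)" by (simp add: real_sqrt_mult)
  also have "... <= sqrt (g x v v)" using low by simp
  finally show "sqrt m * norm v <= tangent_norm g x v" by (simp add: tangent_norm_def)
  have "g x v v <= K * (norm v)\<^sup>2" using K(2)[of v v] by (simp add: power2_eq_square mult.commute)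
  hence "sqrt (g x v v) <= sqrt (K * (norm v)\<^sup>2)" by simp
  thus "tangent_norm g x v <= sqrt K * norm v" by (simp add: tangent_norm_def real_sqrt_mult)
 qed
qed

text \<open>Translates superlinearity from the cotangent norm of the metric to the Euclidean norm of
  the coordinates, at one point.\<close>

lemma Hc_superlinear:
 assumes "c \<in> A" "y \<in> rng c" "K >= 0"
 shows "EX R>0. ALL p. norm p >= R --> K * norm p <= Hc c y p"
proof -
 define x where "x = ci c y"
 have x: "x \<in> fst c" "snd c x = y" using chart_inv_in chart_chart_inv assms by (auto simp: x_def)
 obtain a b where ab: "0 < a" "0 < b" "!!v. a * norm v <= tangent_norm g x v" "!!v. tangent_norm g x v <= b * norm v"
  by (rule tangent_norm_bounds[of x]) blast
 let ?q = "%p. blinfun_inner_right p o\<^sub>L coord_change (ch x) c x"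
 let ?T = "coord_change c (ch x) x"
 \<comment> \<open>With this \<open>tau\<close> the vector \<open>v\<close>, the image of
   \<open>p\<close> rescaled to length \<open>tau\<close>, has tangent norm at most 1 and so
   competes in the supremum that defines the cotangent norm. The added 1 avoids a zero
   denominator.\<close>
 define tau where "tau = 1 / (b * (norm ?T + 1))"
 have "norm ?T + 1 > 0" by (meson add_nonneg_pos norm_ge_zero zero_less_one)
 hence "tau > 0" using ab(2) by (simp add: tau_def)
 have cn: "tau * norm p <= cotangent_norm g x (?q p)" for p
 proof (cases "p = 0")
  case True
  have "0 \<in> {v. tangent_norm g x v <= 1}" using ab(4)[of 0] by simp
  hence "cotangent_norm g x (?q p) = (SUP v\<in>{v. tangent_norm g x v <= 1}. (0::real))"
   unfolding cotangent_norm_def using True by simp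
  also have "... = 0" using `0 \<in> {v. tangent_norm g x v <= 1}` by (intro cSUP_const) auto
  finally show ?thesis using True by simp
 next
  case False
  define v where "v = blinfun_apply ?T ((tau / norm p) *\<^sub>R p)"
  have "norm v <= norm ?T * norm ((tau / norm p) *\<^sub>R p)" unfolding v_def by (rule norm_blinfun)
  also have "... = norm ?T * tau" using False `tau > 0` by simp
  also have "... <= (norm ?T + 1) * tau" using `tau > 0` by (intro mult_right_mono) auto
  also have "... = 1 / b" using `norm ?T + 1 > 0` ab(2) by (simp add: tau_def)
  finally have "b * norm v <= 1" using ab(2) by (simp add: field_simps)
  hence v1: "tangent_norm g x v <= 1" using ab(4)[of v] by simp
  have "blinfun_apply (?q p) v = p \<bullet> ((tau / norm p) *\<^sub>R p)"
   unfolding v_def using coord_change_inverse[OF assms(1) chart_at(1) x(1) chart_at(2)] by simp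
  also have "... = tau * norm p" using False by (simp add: dot_square_norm power2_eq_square)
  finally have qv: "blinfun_apply (?q p) v = tau * norm p" .
  have "bdd_above ((%v. blinfun_apply (?q p) v) ` {v. tangent_norm g x v <= 1})"
  proof (rule bdd_aboveI2)
   fix v assume "v \<in> {v. tangent_norm g x v <= 1}"
   hence "norm v <= 1 / a" using ab(3)[of v] ab(1) by (simp add: field_simps)
   have "blinfun_apply (?q p) v <= norm (?q p) * norm v" using norm_blinfun[of "?q p" v] by simp
   also have "... <= norm (?q p) * (1 / a)" using `norm v <= 1 / a` by (intro mult_left_mono) auto
   finally show "blinfun_apply (?q p) v <= norm (?q p) * (1 / a)" .
  qed
  hence "blinfun_apply (?q p) v <= cotangent_norm g x (?q p)"
   unfolding cotangent_norm_def using v1 by (intro cSUP_upper) auto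
  thus ?thesis using qv by simp
 qed
 have "filterlim (%p. G x p / cotangent_norm g x p) at_top (filtercomap (cotangent_norm g x) at_top)"
  using G_superlinear unfolding superlinear_def by blast
 hence "\<forall>\<^sub>F q in filtercomap (cotangent_norm g x) at_top. K / tau <= G x q / cotangent_norm g x q"
  unfolding filterlim_at_top by blast
 then obtain B where B: "!!q. B <= cotangent_norm g x q ==> K / tau <= G x q / cotangent_norm g x q"
  unfolding eventually_filtercomap eventually_at_top_linorder by blast
 have "K * norm p <= Hc c y p" if "norm p >= (\<bar>B\<bar> + 1) / tau" for p
 proof -
  have "\<bar>B\<bar> + 1 <= tau * norm p" using that `tau > 0` by (simp add: field_simps)
  hence n: "B <= cotangent_norm g x (?q p)" "0 < cotangent_norm g x (?q p)" using cn[of p] by auto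
  have "K * norm p = K / tau * (tau * norm p)" using `tau > 0` by simp
  also have "... <= K / tau * cotangent_norm g x (?q p)"
   using cn[of p] `K >= 0` `tau > 0` by (intro mult_left_mono) auto
  also have "... <= G x (?q p)" using B[OF n(1)] n(2) by (simp add: field_simps)
  finally show ?thesis by (simp add: Hc_def x_def)
 qed
 moreover have "(\<bar>B\<bar> + 1) / tau > 0" using `tau > 0` by simp
 ultimately show ?thesis by blast
qed

text \<open>Superlinearity is assumed fibre by fibre; local uniformity comes from convexity. At 0
  and on the sphere of radius \<open>R\<close> the Hamiltonian is uniformly close to its values over
  \<open>y0\<close>, and along a ray a convex function grows beyond the sphere at least at the mean
  rate reached on it.\<close>

lemma Hc_superlinear_locally:
 assumes "c \<in> A" "y0 \<in> rng c" "K >= 0"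
 shows "EX R>0. EX r>0. cball y0 r \<subseteq> rng c &
  (ALL y:cball y0 r. ALL p. norm p >= R --> K * norm p <= Hc c y p - Hc c y 0)"
proof -
 define h0 where "h0 = \<bar>Hc c y0 0\<bar>"
 obtain R0 where R0: "R0 > 0" "!!p. norm p >= R0 ==> (K + 2 + h0) * norm p <= Hc c y0 p"
  using Hc_superlinear[OF assms(1,2), of "K + 2 + h0"] assms(3) by (auto simp: h0_def)
 define R where "R = max 1 R0"
 have R: "R >= 1" "R >= R0" by (auto simp: R_def)
 \<comment> \<open>The surplus 2 absorbs the two errors of size 1 made in passing from
   \<open>y0\<close> to \<open>y\<close>, one at 0 and one on the sphere.\<close>
 have sph: "K * R + 2 <= Hc c y0 p - Hc c y0 0" if "norm p = R" for p
 proof -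
  have "(K + 2 + h0) * R <= Hc c y0 p" using R0(2)[of p] that R by simp
  moreover have "2 * 1 <= 2 * R" "h0 * 1 <= h0 * R" using R(1) by (auto intro!: mult_left_mono simp: h0_def simp del: mult_1_right)
  moreover have "Hc c y0 0 <= h0" by (simp add: h0_def)
  ultimately show ?thesis by (simp add: algebra_simps)
 qed
 have "EX r>0. cball y0 r \<subseteq> rng c & (ALL y:cball y0 r. ALL y':cball y0 r. ALL p:cball 0 R. \<bar>Hc c y p - Hc c y' p\<bar> <= 1)"
  by (rule uniform_near_point[OF Hc_continuous[OF assms(1)] open_rng[OF assms(1)] assms(2)]) auto
 then obtain r where r: "r > 0" "cball y0 r \<subseteq> rng c"
  "!!y y' p. y \<in> cball y0 r ==> y' \<in> cball y0 r ==> p \<in> cball 0 R ==> \<bar>Hc c y p - Hc c y' p\<bar> <= 1" by blast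
 have "K * norm p <= Hc c y p - Hc c y 0" if y: "y \<in> cball y0 r" and p: "norm p >= R" for y p
 proof -
  define s where "s = R / norm p"
  have np: "norm p > 0" using p R by linarith
  have s: "0 < s" "s <= 1" using np p R by (auto simp: s_def)
  have n: "norm (s *\<^sub>R p) = R" using np R by (simp add: s_def)
  have "\<bar>Hc c y (s *\<^sub>R p) - Hc c y0 (s *\<^sub>R p)\<bar> <= 1" "\<bar>Hc c y 0 - Hc c y0 0\<bar> <= 1"
   using r(3)[of y y0 "s *\<^sub>R p"] r(3)[of y y0 0] y r(1) n R by auto
  hence "K * R <= Hc c y (s *\<^sub>R p) - Hc c y 0" using sph[OF n] by linarith
  also have "Hc c y (s *\<^sub>R p) <= (1 - s) * Hc c y 0 + s * Hc c y p"
   using convex_onD[OF Hc_convex[of c y], of s 0 p] s by simp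
  finally have "K * R <= s * (Hc c y p - Hc c y 0)" by (simp add: algebra_simps)
  moreover have "K * R = s * (K * norm p)" using np by (simp add: s_def)
  ultimately show ?thesis using s(1) by simp
 qed
 thus ?thesis using r R R0(1) by (intro exI[of _ R] conjI exI[of _ r]) auto
qed

lemma Hc_sublevel_bounded_locally:
 assumes "c \<in> A" "y0 \<in> rng c"
 shows "EX R>0. EX r>0. cball y0 r \<subseteq> rng c & (ALL y:cball y0 r. ALL p. Hc c y p <= a --> norm p <= R)"
proof -
 obtain R r where R: "R > 0" "r > 0" "cball y0 r \<subseteq> rng c"
  "!!y p. y \<in> cball y0 r ==> norm p >= R ==> 1 * norm p <= Hc c y p - Hc c y 0"
  using Hc_superlinear_locally[OF assms, of 1] by auto
 have "EX r>0. cball y0 r \<subseteq> rng c & (ALL y:cball y0 r. ALL y':cball y0 r. ALL p:{0}. \<bar>Hc c y p - Hc c y' p\<bar> <= 1)"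
  by (rule uniform_near_point[OF Hc_continuous[OF assms(1)] open_rng[OF assms(1)] assms(2)]) auto
 then obtain r' where r': "r' > 0" "!!y y'. y \<in> cball y0 r' ==> y' \<in> cball y0 r' ==> \<bar>Hc c y 0 - Hc c y' 0\<bar> <= 1" by auto
 define B where "B = max R (\<bar>a\<bar> + \<bar>Hc c y0 0\<bar> + 1)"
 have "norm p <= B" if y: "y \<in> cball y0 (min r r')" and "Hc c y p <= a" for y p
 proof (rule ccontr)
  assume "~ norm p <= B"
  hence n: "norm p >= R" "norm p > \<bar>a\<bar> + \<bar>Hc c y0 0\<bar> + 1" by (auto simp: B_def)
  have "norm p <= Hc c y p - Hc c y 0" using R(4)[of y p] y n by auto
  moreover have "\<bar>Hc c y 0 - Hc c y0 0\<bar> <= 1" using r'(2)[of y y0] y r'(1) by auto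
  ultimately show False using n(2) that(2) by linarith
 qed
 moreover have "B > 0" using R by (auto simp: B_def)
 moreover have "cball y0 (min r r') \<subseteq> rng c" using R(3) by (auto simp: subset_iff)
 ultimately show ?thesis using R r' by (intro exI[of _ B] conjI exI[of _ "min r r'"]) auto
qed

text \<open>Growth at rate \<open>W + 1\<close> beats the pairing with any \<open>w\<close> of norm
  at most \<open>W\<close>, so the maximising covectors lie in one ball, uniformly in
  \<open>y\<close> and \<open>w\<close>.\<close>

lemma Lc_attained_locally:
 assumes "c \<in> A" "y0 \<in> rng c" "W >= 0"
 shows "EX R>0. EX r>0. cball y0 r \<subseteq> rng c & (ALL y:cball y0 r. ALL w. norm w <= W -->
  (EX p. norm p <= R & Lc c y w = p \<bullet> w - Hc c y p) & (ALL q. q \<bullet> w - Hc c y q <= Lc c y w))"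
proof -
 obtain R r where R: "R > 0" "r > 0" "cball y0 r \<subseteq> rng c"
  "!!y p. y \<in> cball y0 r ==> norm p >= R ==> (W + 1) * norm p <= Hc c y p - Hc c y 0"
  using Hc_superlinear_locally[OF assms(1,2), of "W + 1"] assms(3) by auto
 have "(EX p. norm p <= R & Lc c y w = p \<bullet> w - Hc c y p) & (ALL q. q \<bullet> w - Hc c y q <= Lc c y w)"
  if y: "y \<in> cball y0 r" and w: "norm w <= W" for y w
 proof -
  have yr: "y \<in> rng c" using y R(3) by (rule_tac subsetD)
  have "continuous_on (cball 0 R) (%p. p \<bullet> w - Hc c y p)"
   by (intro continuous_intros Hc_continuous_in_p assms yr)
  then obtain p where p: "p \<in> cball 0 R" "!!q. q \<in> cball 0 R ==> q \<bullet> w - Hc c y q <= p \<bullet> w - Hc c y p"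
   using continuous_attains_sup[of "cball (0::'e) R" "%p. p \<bullet> w - Hc c y p"] R(1) by auto
  have all: "q \<bullet> w - Hc c y q <= p \<bullet> w - Hc c y p" for q
  proof (cases "norm q <= R")
   case False
   have "q \<bullet> w <= norm q * norm w" by (rule norm_cauchy_schwarz)
   also have "... <= norm q * W" using w by (intro mult_left_mono) auto
   finally have "q \<bullet> w <= W * norm q" by (simp add: mult.commute)
   moreover have "(W + 1) * norm q <= Hc c y q - Hc c y 0" using R(4)[OF y, of q] False by simp
   ultimately have "q \<bullet> w - Hc c y q <= - Hc c y 0 - norm q" by (simp add: algebra_simps)
   also have "... <= 0 \<bullet> w - Hc c y 0" by simp
   also have "... <= p \<bullet> w - Hc c y p" using p(2)[of 0] R(1) by simp
   finally show ?thesis .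
  qed (use p in auto)
  have L: "Lc c y w = p \<bullet> w - Hc c y p"
   unfolding Lc_def by (rule cSup_eq_maximum) (use all in auto)
  show ?thesis using L all p(1) by (auto intro!: exI[of _ p])
 qed
 thus ?thesis using R by (intro exI[of _ R] conjI exI[of _ r]) auto
qed

lemma Lc_ge:
 assumes "c \<in> A" "y \<in> rng c"
 shows "p \<bullet> w - Hc c y p <= Lc c y w"
proof -
 obtain R r where "r > 0" "ALL y:cball y r. ALL w'. norm w' <= norm w -->
   (EX p. norm p <= R & Lc c y w' = p \<bullet> w' - Hc c y p) & (ALL q. q \<bullet> w' - Hc c y q <= Lc c y w')"
  using Lc_attained_locally[OF assms, of "norm w"] by auto
 thus ?thesis by simp
qed

text \<open>A maximiser for one argument competes for the other, and maximisers stay in a fixed ball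
  where \<open>Hc\<close> varies uniformly little in \<open>y\<close>; hence the one-sided estimate
  \<open>half\<close>, used in both directions.\<close>

lemma Lc_continuous:
 assumes "c \<in> A"
 shows "continuous_on (rng c \<times> UNIV) (%(y, w). Lc c y w)"
 unfolding continuous_on_iff
proof (intro ballI allI impI)
 fix z0 :: "'e \<times> 'e" and eps :: real assume "z0 \<in> rng c \<times> UNIV" "eps > 0"
 then obtain y0 w0 where z0: "z0 = (y0, w0)" "y0 \<in> rng c" by auto
 obtain R r where R: "R > 0" "r > 0" "cball y0 r \<subseteq> rng c"
  "!!y w. y \<in> cball y0 r ==> norm w <= norm w0 + 1 ==> EX p. norm p <= R & Lc c y w = p \<bullet> w - Hc c y p"
  "!!y w q. y \<in> cball y0 r ==> norm w <= norm w0 + 1 ==> q \<bullet> w - Hc c y q <= Lc c y w"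
  using Lc_attained_locally[OF assms z0(2), of "norm w0 + 1"] by auto
 have "EX r>0. cball y0 r \<subseteq> rng c & (ALL y:cball y0 r. ALL y':cball y0 r. ALL p:cball 0 R. \<bar>Hc c y p - Hc c y' p\<bar> <= eps / 4)"
  by (rule uniform_near_point[OF Hc_continuous[OF assms(1)] open_rng[OF assms(1)] z0(2)]) (use `eps > 0` in auto)
 then obtain r' where r': "r' > 0" "!!y y' p. y \<in> cball y0 r' ==> y' \<in> cball y0 r' ==> norm p <= R ==> \<bar>Hc c y p - Hc c y' p\<bar> <= eps / 4"
  by auto
 define d where "d = Min {r, r', 1, eps / (4 * R)}"
 have d: "d > 0" "d <= r" "d <= r'" "d <= 1" "d <= eps / (4 * R)" using R(1,2) r'(1) `eps > 0` by (auto simp: d_def)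
 have half: "Lc c y1 w1 <= Lc c y2 w2 + eps / 2"
  if "y1 \<in> cball y0 d" "y2 \<in> cball y0 d" "norm w1 <= norm w0 + 1" "norm w2 <= norm w0 + 1" "norm (w1 - w2) <= d" for y1 y2 w1 w2
 proof -
  note w1 = that(3)
  have y: "y1 \<in> cball y0 r" "y2 \<in> cball y0 r" "y1 \<in> cball y0 r'" "y2 \<in> cball y0 r'" using that d by auto
  obtain p where p: "norm p <= R" "Lc c y1 w1 = p \<bullet> w1 - Hc c y1 p" using R(4)[OF y(1) w1] by auto
  have "p \<bullet> (w1 - w2) <= norm p * norm (w1 - w2)" by (rule norm_cauchy_schwarz)
  also have "... <= R * (eps / (4 * R))" using p(1) that(5) d R(1) by (intro mult_mono) auto
  also have "... = eps / 4" using R(1) by simp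
  finally have "p \<bullet> w1 <= p \<bullet> w2 + eps / 4" by (simp add: inner_diff_right)
  moreover have "Hc c y2 p <= Hc c y1 p + eps / 4" using r'(2)[OF y(3,4) p(1)] by linarith
  moreover have "p \<bullet> w2 - Hc c y2 p <= Lc c y2 w2" by (rule R(5)[OF y(2) that(4)])
  ultimately show ?thesis using p(2) by linarith
 qed
 show "EX d>0. ALL x':rng c \<times> UNIV. dist x' z0 < d --> dist (case x' of (y, w) => Lc c y w) (case z0 of (y, w) => Lc c y w) < eps"
 proof (intro exI[of _ d] conjI ballI impI d(1))
  fix z assume "z \<in> rng c \<times> UNIV" "dist z z0 < d"
  obtain y w where z: "z = (y, w)" by (cases z)
  have "dist y y0 < d" "dist w w0 < d" using `dist z z0 < d` dist_fst_le[of z z0] dist_snd_le[of z z0] by (auto simp: z z0)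
  hence y: "y \<in> cball y0 d" "y0 \<in> cball y0 d" "norm (w - w0) <= d" "norm (w0 - w) <= d"
   using d(1) by (auto simp: dist_commute dist_norm norm_minus_commute)
  have w: "norm w <= norm w0 + 1" using norm_triangle_ineq2[of w w0] y(3) d(4) by linarith
  have "Lc c y w <= Lc c y0 w0 + eps / 2" "Lc c y0 w0 <= Lc c y w + eps / 2"
   using half[of y y0 w w0] half[of y0 y w0 w] y w by auto
  thus "dist (case z of (y, w) => Lc c y w) (case z0 of (y, w) => Lc c y w) < eps"
   using `eps > 0` by (simp add: z z0 dist_real_def abs_le_iff)
 qed
qed

text \<open>For a subgradient \<open>w\<close> of the Hamiltonian at \<open>p\<close> Fenchel's
  inequality is an equality, so the hypothesis at this single velocity already gives the
  bound.\<close>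

lemma Hc_le_if_Fenchel:
 assumes "c \<in> A" "y \<in> rng c" "!!w. p \<bullet> w <= Lc c y w + a"
 shows "Hc c y p <= a"
proof -
 obtain w where w: "!!q. Hc c y p + w \<bullet> (q - p) <= Hc c y q" using convex_on_subgradient[OF Hc_convex] by metis
 have "Lc c y w <= p \<bullet> w - Hc c y p" unfolding Lc_def
 proof (rule cSUP_least)
  fix q show "q \<bullet> w - Hc c y q <= p \<bullet> w - Hc c y p" using w[of q] by (simp add: inner_diff_right inner_commute)
 qed simp
 thus ?thesis using assms(3)[of w] by simp
qed

lemma G_differential:
 assumes "c \<in> A" "x \<in> fst c" "((f o ci c) has_derivative (%w. p \<bullet> w)) (at (snd c x))"
 shows "G x (dif f x) = Hc c (snd c x) p"
 using differential_chart[OF assms] by (simp add: Hc_def chart_inv_chart[OF assms(1,2)])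

lemma lagrangian_chart:
 assumes "c \<in> A" "x \<in> fst c"
 shows "lagrangian G x (blinfun_apply (coord_change c (ch x) x) w) = Lc c (snd c x) w"
proof -
 let ?q = "%p. blinfun_inner_right p o\<^sub>L coord_change (ch x) c x"
 have r: "range ?q = UNIV" using covector_chart[OF assms] by (auto simp: image_iff)
 have "lagrangian G x (blinfun_apply (coord_change c (ch x) x) w) =
   (SUP q\<in>range ?q. blinfun_apply q (blinfun_apply (coord_change c (ch x) x) w) - G x q)"
  unfolding r lagrangian_def ..
 also have "... = (SUP p. p \<bullet> w - Hc c (snd c x) p)"
  unfolding image_image Hc_def chart_inv_chart[OF assms]
  by (simp add: coord_change_inverse[OF assms(1) chart_at(1) assms(2) chart_at(2)])
 finally show ?thesis by (simp add: Lc_def)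
qed

lemma tangent_chart:
 assumes "c \<in> A" "x \<in> fst c"
 shows "blinfun_apply (coord_change c (ch x) x) (blinfun_apply (coord_change (ch x) c x) v) = v"
 by (rule coord_change_inverse[OF chart_at(1) assms(1) chart_at(2) assms(2)])

lemma Fenchel: "blinfun_apply q v <= lagrangian G x v + G x q"
proof -
 let ?c = "ch x"
 obtain p where p: "q = blinfun_inner_right p o\<^sub>L coord_change ?c ?c x" using covector_chart[OF chart_at] by blast
 define w where "w = blinfun_apply (coord_change ?c ?c x) v"
 have v: "v = blinfun_apply (coord_change ?c ?c x) w" using tangent_chart[OF chart_at] by (simp add: w_def)
 have "p \<bullet> w - Hc ?c (snd ?c x) p <= Lc ?c (snd ?c x) w" by (rule Lc_ge) (use chart_at in auto)
 moreover have "Hc ?c (snd ?c x) p = G x q" by (simp add: Hc_def chart_inv_chart[OF chart_at] p)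
 moreover have "lagrangian G x v = Lc ?c (snd ?c x) w" unfolding v by (rule lagrangian_chart[OF chart_at])
 moreover have "blinfun_apply q v = p \<bullet> w" by (simp add: p w_def)
 ultimately show ?thesis by simp
qed

lemma continuous_by_charts:
 fixes u :: "'m => 'b::topological_space"
 assumes "!!c. c \<in> A ==> EX h. continuous_on (rng c) h & (ALL x:fst c. u x = h (snd c x))"
 shows "continuous_on UNIV u"
proof (intro continuous_at_imp_continuous_on ballI)
 fix x
 obtain h where h: "continuous_on (rng (ch x)) h" "ALL z:fst (ch x). u z = h (snd (ch x) z)"
  using assms[OF chart_at(1)] by blast
 have "continuous_on (fst (ch x)) (%z. h (snd (ch x) z))"
  by (rule continuous_on_compose2[OF h(1) chart_continuous[OF chart_at(1)]]) auto
 hence "continuous_on (fst (ch x)) u" by (rule continuous_on_eq) (use h(2) in auto)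
 thus "isCont u x" using open_dom[OF chart_at(1)] chart_at(2) continuous_on_eq_continuous_at by blast
qed

lemma G_differential_continuous:
 assumes "f \<in> C1"
 shows "continuous_on UNIV (%x. G x (dif f x))"
proof (rule continuous_by_charts)
 fix c assume c: "c \<in> A"
 obtain D where D: "C1_grad (rng c) (f o ci c) D" using C1_gradE[OF assms c] .
 have "continuous_on (rng c) (%y. (%(y, p). Hc c y p) (y, D y))"
  by (rule continuous_on_compose2[OF Hc_continuous[OF c]]) (use D in "auto intro!: continuous_intros simp: C1_grad_def")
 moreover have "ALL x:fst c. G x (dif f x) = Hc c (snd c x) (D (snd c x))"
  using G_differential[OF c] D unfolding C1_grad_def by blast
 ultimately show "EX h. continuous_on (rng c) h & (ALL x:fst c. G x (dif f x) = h (snd c x))"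
  by (intro exI[of _ "%y. Hc c y (D y)"]) auto
qed

lemma lagrangian_0_continuous: "continuous_on UNIV (%x. lagrangian G x 0)"
proof (rule continuous_by_charts)
 fix c assume c: "c \<in> A"
 have "continuous_on (rng c) (%y. (%(y, p). Lc c y p) (y, 0))"
  by (rule continuous_on_compose2[OF Lc_continuous[OF c]]) (auto intro!: continuous_intros)
 moreover have "ALL x:fst c. lagrangian G x 0 = Lc c (snd c x) 0"
  using lagrangian_chart[OF c, of _ 0] by simp
 ultimately show "EX h. continuous_on (rng c) h & (ALL x:fst c. lagrangian G x 0 = h (snd c x))"
  by (intro exI[of _ "%y. Lc c y 0"]) auto
qed

lemma lagrangian_lower_bound: "EX \<Lambda>>=0. ALL x v. - \<Lambda> <= lagrangian G x v"
proof -
 obtain B where B: "B > 0" "!!x. \<bar>G x (dif (%_. 0) x)\<bar> <= B"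
  using bounded_continuous[OF G_differential_continuous[OF C1_const[of 0]]] by blast
 have "- B <= lagrangian G x v" for x v
  using Fenchel[of 0 v x] B(2)[of x] by (simp add: differential_const abs_le_iff)
 thus ?thesis using B(1) by (intro exI[of _ B]) auto
qed

lemma G_lower_bound: "EX B. ALL x p. - B <= G x p"
proof -
 obtain B where B: "B > 0" "!!x. \<bar>lagrangian G x 0\<bar> <= B" using bounded_continuous[OF lagrangian_0_continuous] by blast
 have "- B <= G x p" for x p using Fenchel[of p 0 x] B(2)[of x] by (simp add: abs_le_iff)
 thus ?thesis by blast
qed

section \<open>The critical value\<close>

abbreviation mather where "mather \<equiv> mather_measure A g G"
abbreviation cv :: real where "cv \<equiv> critical_value A G"

lemma critical_value_le:
 assumes "f \<in> C1" "!!x. G x (dif f x) <= a"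
 shows "cv <= a"
proof -
 obtain B where B: "!!x p. - B <= G x p" using G_lower_bound by blast
 have bdd: "bdd_below ((%f. SUP x. G x (dif f x)) ` C1)"
 proof (rule bdd_belowI2)
  fix f assume f: "f \<in> C1"
  obtain K where K: "!!x. \<bar>G x (dif f x)\<bar> <= K"
   using bounded_continuous[OF G_differential_continuous[OF f]] by blast
  have "bdd_above (range (%x. G x (dif f x)))"
   by (rule bdd_aboveI2[where M = K]) (use K in "auto simp: abs_le_iff")
  from cSUP_upper[OF _ this, of undefined] show "- B <= (SUP x. G x (dif f x))"
   using B[of undefined "dif f undefined"] by simp
 qed
 have "cv <= (SUP x. G x (dif f x))"
  unfolding critical_value_def by (rule cINF_lower[OF bdd assms(1)])
 also have "... <= a" by (rule cSUP_least) (use assms(2) in auto)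
 finally show ?thesis .
qed

lemma critical_value_approx:
 assumes "eps > 0"
 obtains f where "f \<in> C1" "!!x. G x (dif f x) <= cv + eps"
proof -
 have "(INF f\<in>C1. SUP x. G x (dif f x)) < cv + eps"
  using assms by (simp add: critical_value_def)
 moreover have "C1 ~= {}" using C1_const by blast
 ultimately obtain f where f: "f \<in> C1" "(SUP x. G x (dif f x)) < cv + eps"
  using cInf_lessD[of "(%f. SUP x. G x (dif f x)) ` C1" "cv + eps"] by auto
 obtain K where K: "!!x. \<bar>G x (dif f x)\<bar> <= K"
  using bounded_continuous[OF G_differential_continuous[OF f(1)]] by blast
 have "bdd_above (range (%x. G x (dif f x)))"
  by (rule bdd_aboveI2[where M = K]) (use K in "auto simp: abs_le_iff")
 hence "G x (dif f x) <= (SUP x. G x (dif f x))" for x by (intro cSUP_upper) auto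
 hence "G x (dif f x) <= cv + eps" for x using f(2) by (meson less_imp_le order_trans)
 thus ?thesis using that f(1) by blast
qed

end

section \<open>Viscosity subsolutions\<close>

lemma C1_grad_sum:
 "finite I ==> (!!i. i \<in> I ==> C1_grad S (F i) (D i)) ==> C1_grad S (%x. \<Sum>i\<in>I. F i x) (%x. \<Sum>i\<in>I. D i x)"
 by (induction I rule: finite_induct) (auto intro: C1_grad_const C1_grad_add)

section \<open>Soft minima\<close>

text \<open>Log-sum-exp: it lies below the minimum by at most \<open>ln (card I) / bet\<close>, and
  its gradient is the convex combination of the gradients with the Gibbs weights
  \<open>softweight\<close>. Convexity of the Hamiltonian thus carries sublevel bounds from the
  pieces to the soft minimum.\<close>

definition softmin :: "real => 'i set => ('i => real) => real" where
 "softmin bet I v = - ln (\<Sum>i\<in>I. exp (- bet * v i)) / bet"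

definition softweight :: "real => 'i set => ('i => real) => 'i => real" where
 "softweight bet I v i = exp (- bet * v i) / (\<Sum>j\<in>I. exp (- bet * v j))"

lemma softmin_sum_pos: "finite I ==> I ~= {} ==> 0 < (\<Sum>i\<in>I. exp (- bet * v i :: real))"
 by (intro sum_pos) auto

lemma softweight_nonneg: "0 <= softweight bet I v i"
 unfolding softweight_def by (intro divide_nonneg_nonneg sum_nonneg) auto

lemma softweight_sum:
 assumes "finite I" "I ~= {}"
 shows "(\<Sum>i\<in>I. softweight bet I v i) = 1"
 using softmin_sum_pos[OF assms, of bet v] unfolding softweight_def
 by (simp add: sum_divide_distrib[symmetric])

lemma softmin_le:
 assumes "finite I" "i \<in> I" "bet > 0"
 shows "softmin bet I v <= v i"
proof -
 have "exp (- bet * v i) <= (\<Sum>j\<in>I. exp (- bet * v j))"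
  using assms by (intro member_le_sum) auto
 hence "- bet * v i <= ln (\<Sum>j\<in>I. exp (- bet * v j))"
  using softmin_sum_pos[of I bet v] assms by (subst ln_ge_iff) auto
 thus ?thesis using assms(3) unfolding softmin_def by (simp add: field_simps)
qed

lemma softmin_ge:
 assumes "finite I" "I ~= {}" "bet > 0" "!!i. i \<in> I ==> m <= v i"
 shows "m - ln (card I) / bet <= softmin bet I v"
proof -
 have "(\<Sum>j\<in>I. exp (- bet * v j)) <= (\<Sum>j\<in>I. exp (- bet * m))"
  using assms by (intro sum_mono) auto
 also have "... = card I * exp (- bet * m)" by simp
 finally have "ln (\<Sum>j\<in>I. exp (- bet * v j)) <= ln (card I * exp (- bet * m))"
  using softmin_sum_pos[OF assms(1,2), of bet v] by (intro ln_mono) auto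
 also have "... = ln (card I) - bet * m"
  using assms by (simp add: ln_mult card_gt_0_iff)
 finally have "m * bet - ln (card I) <= - ln (\<Sum>i\<in>I. exp (- bet * v i))" by (simp add: mult.commute)
 hence "(m * bet - ln (card I)) / bet <= - ln (\<Sum>i\<in>I. exp (- bet * v i)) / bet"
  using assms(3) by (intro divide_right_mono) auto
 thus ?thesis using assms(3) unfolding softmin_def by (simp add: diff_divide_distrib)
qed

lemma C1_grad_softmin:
 assumes "finite I" "I ~= {}" "bet > 0" "!!i. i \<in> I ==> C1_grad S (F i) (D i)"
 shows "C1_grad S (%x. softmin bet I (%i. F i x)) (%x. \<Sum>i\<in>I. softweight bet I (%i. F i x) i *\<^sub>R D i x)"
proof -
 let ?Z = "%x. \<Sum>i\<in>I. exp (- bet * F i x)"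
 have Zpos: "0 < ?Z x" for x by (rule softmin_sum_pos[OF assms(1,2)])
 have 1: "C1_grad S (%x. exp (- bet * F i x)) (%x. exp (- bet * F i x) *\<^sub>R (- bet) *\<^sub>R D i x)" if "i \<in> I" for i
  by (rule C1_grad_compose[OF C1_grad_cmult[OF assms(4)[OF that]], where phi = exp and phi' = exp])
   (auto intro!: continuous_intros derivative_eq_intros)
 have 2: "C1_grad S ?Z (%x. \<Sum>i\<in>I. exp (- bet * F i x) *\<^sub>R (- bet) *\<^sub>R D i x)"
  by (rule C1_grad_sum[OF assms(1) 1])
 have 3: "C1_grad S (%x. ln (?Z x)) (%x. (1 / ?Z x) *\<^sub>R (\<Sum>i\<in>I. exp (- bet * F i x) *\<^sub>R (- bet) *\<^sub>R D i x))"
  by (rule C1_grad_compose[OF 2, where phi = ln and phi' = "%t. 1 / t"])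
   (use Zpos in "auto intro!: continuous_intros DERIV_ln_divide simp: image_iff dest: less_imp_neq", metis Zpos less_irrefl minus_mult_left)
 have 4: "C1_grad S (%x. (- 1 / bet) * ln (?Z x))
   (%x. (- 1 / bet) *\<^sub>R (1 / ?Z x) *\<^sub>R (\<Sum>i\<in>I. exp (- bet * F i x) *\<^sub>R (- bet) *\<^sub>R D i x))"
  by (rule C1_grad_cmult[OF 3])
 have "(%x. (- 1 / bet) *\<^sub>R (1 / ?Z x) *\<^sub>R (\<Sum>i\<in>I. exp (- bet * F i x) *\<^sub>R (- bet) *\<^sub>R D i x)) =
   (%x. \<Sum>i\<in>I. softweight bet I (%i. F i x) i *\<^sub>R D i x)"
  using assms(3) by (auto simp: fun_eq_iff scaleR_sum_right softweight_def intro!: sum.cong)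
 moreover have "(%x. (- 1 / bet) * ln (?Z x)) = (%x. softmin bet I (%i. F i x))"
  by (auto simp: softmin_def)
 ultimately show ?thesis using 4 by simp
qed

text \<open>Jensen's inequality, with the bound asked only at nonzero weights: in a partition of
  unity the local pieces are controlled on the supports only.\<close>

lemma convex_on_sum_le:
 fixes f :: "'a::real_vector => real"
 assumes "convex_on UNIV f" "finite I" "(\<Sum>i\<in>I. kap i) = 1" "!!i. i \<in> I ==> 0 <= kap i"
  and "!!i. i \<in> I ==> kap i ~= 0 ==> f (q i) <= a"
 shows "f (\<Sum>i\<in>I. kap i *\<^sub>R q i) <= a"
proof -
 have "I ~= {}" using assms(3) by auto
 have "f (\<Sum>i\<in>I. kap i *\<^sub>R q i) <= (\<Sum>i\<in>I. kap i * f (q i))"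
  using convex_on_sum[OF assms(2) `I ~= {}` assms(1,3)] assms(4) by auto
 also have "... <= (\<Sum>i\<in>I. kap i * a)"
 proof (rule sum_mono)
  fix i assume i: "i \<in> I"
  show "kap i * f (q i) <= kap i * a"
   using assms(4)[OF i] assms(5)[OF i] by (cases "kap i = 0") (auto intro: mult_left_mono)
 qed
 also have "... = a" using assms(3) by (simp add: sum_distrib_right[symmetric])
 finally show ?thesis .
qed

text \<open>The net is taken from \<open>Z\<close> itself, so that properties of the members of
  \<open>Z\<close> pass to it.\<close>

lemma finite_net:
 fixes Z :: "'a::euclidean_space set"
 assumes "bounded Z" "eta > 0"
 obtains P where "finite P" "P \<subseteq> Z" "!!z. z \<in> Z ==> EX p:P. dist p z < eta"
proof -
 have "compact (closure Z)" using assms(1) by (simp add: compact_closure)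
 moreover have "closure Z \<subseteq> (\<Union>p\<in>Z. ball p eta)"
 proof
  fix z assume "z \<in> closure Z"
  then obtain p where "p \<in> Z" "dist p z < eta" using assms(2) unfolding closure_approachable by blast
  thus "z \<in> (\<Union>p\<in>Z. ball p eta)" by auto
 qed
 ultimately obtain P where P: "P \<subseteq> Z" "finite P" "closure Z \<subseteq> (\<Union>p\<in>P. ball p eta)"
  using compactE_image[of "closure Z" Z "%p. ball p eta"] by (metis open_ball)
 show ?thesis
 proof (rule that[OF P(2,1)])
  fix z assume "z \<in> Z"
  hence "z \<in> (\<Union>p\<in>P. ball p eta)" using P(3) closure_subset by blast
  thus "EX p:P. dist p z < eta" by auto
 qed
qed

section \<open>Functions supported in one chart\<close>

context compact_manifold
begin

lemma eventually_chart:
 assumes "c \<in> A" "x \<in> fst c" "\<forall>\<^sub>F y in nhds (snd c x). P y"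
 shows "\<forall>\<^sub>F z in nhds x. z \<in> fst c & P (snd c z)"
proof -
 obtain S where S: "open S" "snd c x \<in> S" "!!y. y \<in> S ==> P y"
  using assms(3) unfolding eventually_nhds by (elim exE conjE) simp
 have "open (fst c Int snd c -` S)"
  by (rule continuous_open_preimage[OF chart_continuous[OF assms(1)] open_dom[OF assms(1)] S(1)])
 hence "\<forall>\<^sub>F z in nhds x. z \<in> fst c Int snd c -` S"
  by (rule eventually_nhds_in_open) (use assms(2) S(2) in auto)
 thus ?thesis by (rule eventually_mono) (use S(3) in auto)
qed

lemma eventually_chart_inv:
 assumes "c \<in> A" "x \<in> fst c" "\<forall>\<^sub>F z in nhds x. P z"
 shows "\<forall>\<^sub>F y in nhds (snd c x). y \<in> rng c & P (ci c y)"
proof -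
 obtain S where S: "open S" "x \<in> S" "!!y. y \<in> S ==> P y"
  using assms(3) unfolding eventually_nhds by (elim exE conjE) simp
 have "open (rng c Int ci c -` S)"
  by (rule continuous_open_preimage[OF chart_inv_continuous[OF assms(1)] open_rng[OF assms(1)] S(1)])
 hence "\<forall>\<^sub>F y in nhds (snd c x). y \<in> rng c Int ci c -` S"
  by (rule eventually_nhds_in_open) (use assms(2) S(2) chart_inv_chart[OF assms(1,2)] in auto)
 thus ?thesis by (rule eventually_mono) (use S(3) in auto)
qed

lemma differential_eventually_0:
 assumes "\<forall>\<^sub>F z in nhds x. f z = 0"
 shows "dif f x = 0"
proof (rule differential_eqI)
 have "\<forall>\<^sub>F y in nhds (ctr x). 0 = (f o ci (ch x)) y"
  using eventually_chart_inv[OF chart_at assms] by (rule eventually_mono) simp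
 thus "((f o ci (ch x)) has_derivative blinfun_apply 0) (at (ctr x))"
  by (rule has_derivative_eventually_eq[rotated]) (simp add: zero_blinfun.rep_eq)
qed

lemma differential_cong_eventually:
 assumes "c \<in> A" "x \<in> fst c" "\<forall>\<^sub>F z in nhds x. f z = F (snd c z)" "(F has_derivative (%w. p \<bullet> w)) (at (snd c x))"
 shows "((f o ci c) has_derivative (%w. p \<bullet> w)) (at (snd c x))"
proof -
 have "\<forall>\<^sub>F y in nhds (snd c x). F y = (f o ci c) y"
  using eventually_chart_inv[OF assms(1-3)]
  by (rule eventually_mono) (simp add: chart_chart_inv[OF assms(1)])
 thus ?thesis by (rule has_derivative_eventually_eq[OF assms(4)])
qed

definition chart_bump :: "'m => real => ('e => real) => 'm => real" where
 "chart_bump x r F z = (if z \<in> fst (ch x) then F (snd (ch x) z) * bump (ctr x) r (snd (ch x) z) else 0)"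

lemma chart_bump_C1:
 assumes "r > 0" "cball (ctr x) r \<subseteq> rng (ch x)" "C1_grad (rng (ch x)) F D"
 shows "chart_bump x r F \<in> C1"
proof -
 obtain Db where Db: "C1_grad UNIV (bump (ctr x) r) Db" using bump_C1 by blast
 show ?thesis unfolding chart_bump_def[abs_def]
  by (rule C1_extension[OF chart_at(1) C1_grad_mult[OF assms(3) C1_grad_subset[OF Db subset_UNIV]] _ assms(2)])
   (use bump_eq_0[OF _ assms(1)] in auto)
qed

lemma chart_bump_eq:
 assumes "r > 0" "z \<in> fst (ch x)" "snd (ch x) z \<in> cball (ctr x) (r / 2)"
 shows "chart_bump x r F z = F (snd (ch x) z)"
 using bump_eq_1[OF assms(3,1)] assms(2) by (simp add: chart_bump_def)

lemma chart_bump_eventually_0: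
 assumes "r > 0" "cball (ctr x) r \<subseteq> rng (ch x)" "~ (z \<in> fst (ch x) & snd (ch x) z \<in> cball (ctr x) r)"
 shows "\<forall>\<^sub>F z' in nhds z. chart_bump x r F z' = 0"
proof -
 define K where "K = ci (ch x) ` cball (ctr x) r"
 have "compact K" unfolding K_def
  using continuous_on_subset[OF chart_inv_continuous[OF chart_at(1)] assms(2)] by (rule compact_continuous_image) simp
 hence "open (- K)" by (simp add: compact_imp_closed open_Compl)
 moreover have "z \<in> - K"
 proof
  assume "z \<in> K"
  then obtain y where y: "z = ci (ch x) y" "y \<in> cball (ctr x) r" unfolding K_def by (elim imageE)
  hence "y \<in> rng (ch x)" using assms(2) by (rule_tac subsetD)
  thus False using assms(3) y chart_chart_inv[OF chart_at(1)] chart_inv_in[OF chart_at(1)] by simp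
 qed
 ultimately have "\<forall>\<^sub>F z' in nhds z. z' \<in> - K" by (rule eventually_nhds_in_open)
 thus ?thesis
 proof (rule eventually_mono)
  fix z' assume z': "z' \<in> - K"
  show "chart_bump x r F z' = 0"
  proof (cases "z' \<in> fst (ch x)")
   case True
   have "snd (ch x) z' \<notin> cball (ctr x) r"
   proof
    assume "snd (ch x) z' \<in> cball (ctr x) r"
    hence "ci (ch x) (snd (ch x) z') \<in> K" unfolding K_def by (rule imageI)
    thus False using z' chart_inv_chart[OF chart_at(1) True] by simp
   qed
   hence "bump (ctr x) r (snd (ch x) z') = 0" by (rule bump_eq_0[OF _ assms(1)])
   thus ?thesis by (simp add: chart_bump_def)
  qed (simp add: chart_bump_def)
 qed
qed

end

section \<open>Subsolutions: Lipschitz bounds in charts and C1 approximation\<close>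

context hamiltonian
begin

definition vsub :: "('m => real) => real => bool" where
 "vsub u a \<longleftrightarrow> continuous_on UNIV u & (ALL f:C1. ALL x.
   (\<forall>\<^sub>F y in nhds x. u y - f y <= u x - f x) --> G x (dif f x) <= a)"

definition vsup :: "('m => real) => real => bool" where
 "vsup u a \<longleftrightarrow> continuous_on UNIV u & (ALL f:C1. ALL x.
   (\<forall>\<^sub>F y in nhds x. u y - f y >= u x - f x) --> G x (dif f x) >= a)"

lemma viscosity_solution_iff: "viscosity_solution A G a u \<longleftrightarrow> vsub u a & vsup u a"
 unfolding viscosity_solution_def vsub_def vsup_def by blast

lemma chart_test_function:
 assumes "c \<in> A" "open U" "y \<in> U" "U \<subseteq> rng c" "C1_grad U F D"
 obtains f where "f \<in> C1" "\<forall>\<^sub>F z in nhds (ci c y). z \<in> fst c & f z = F (snd c z)"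
  "f (ci c y) = F y" "G (ci c y) (dif f (ci c y)) = Hc c y (D y)"
proof -
 obtain f where f: "f \<in> C1" "\<forall>\<^sub>F z in nhds y. f (ci c z) = F z"
  by (rule C1_local_extension[OF assms])
 have y: "y \<in> rng c" using assms(3,4) by (rule_tac subsetD)
 define x where "x = ci c y"
 have x: "x \<in> fst c" "snd c x = y" using chart_inv_in[OF assms(1) y] chart_chart_inv[OF assms(1) y] by (auto simp: x_def)
 have "\<forall>\<^sub>F z in nhds x. z \<in> fst c & f (ci c (snd c z)) = F (snd c z)"
  by (rule eventually_chart[OF assms(1) x(1)]) (use f(2) x(2) in simp)
 hence ev: "\<forall>\<^sub>F z in nhds x. z \<in> fst c & f z = F (snd c z)"
  by (rule eventually_mono) (use chart_inv_chart[OF assms(1)] in auto)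
 have "((f o ci c) has_derivative (%w. D y \<bullet> w)) (at (snd c x))"
  by (rule differential_cong_eventually[OF assms(1) x(1), of _ F])
   (use ev assms(3,5) x(2) in "auto elim: eventually_mono simp: C1_grad_def")
 from G_differential[OF assms(1) x(1) this] have "G x (dif f x) = Hc c y (D y)" by (simp add: x)
 moreover have "f x = F y" using eventually_nhds_x_imp_x[OF ev] x by simp
 ultimately show ?thesis using that f(1) ev unfolding x_def by blast
qed

lemma vsub_chart:
 assumes "vsub u a" "c \<in> A" "open U" "y \<in> U" "U \<subseteq> rng c" "C1_grad U F D"
  and max: "\<forall>\<^sub>F z in nhds y. u (ci c z) - F z <= u (ci c y) - F y"
 shows "Hc c y (D y) <= a"
proof -
 obtain f where f: "f \<in> C1" "\<forall>\<^sub>F z in nhds (ci c y). z \<in> fst c & f z = F (snd c z)"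
  "f (ci c y) = F y" "G (ci c y) (dif f (ci c y)) = Hc c y (D y)"
  by (rule chart_test_function[OF assms(2-6)])
 have y: "y \<in> rng c" using assms(4,5) by (rule_tac subsetD)
 have "\<forall>\<^sub>F z in nhds (ci c y). z \<in> fst c & u (ci c (snd c z)) - F (snd c z) <= u (ci c y) - F y"
  by (rule eventually_chart[OF assms(2) chart_inv_in[OF assms(2) y]])
   (use max chart_chart_inv[OF assms(2) y] in simp)
 with f(2) have "\<forall>\<^sub>F z in nhds (ci c y). u z - f z <= u (ci c y) - f (ci c y)"
  by eventually_elim (use f(3) chart_inv_chart[OF assms(2)] in auto)
 thus ?thesis using assms(1) f(1,4) unfolding vsub_def by metis
qed

text \<open>Compare with a test function that is affine in the direction \<open>e\<close>, has slope slightly larger than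
  \<open>s\<close>, and penalises both the distance to the line and overshooting: its gradient is never in the
  sublevel set, so the maximum of the difference lies on the face through \<open>y\<close>.\<close>

lemma vsub_segment_bound:
 assumes u: "vsub u a" and c: "c \<in> A" and R: "ball y0 R \<subseteq> rng c" and e: "norm e = 1"
  and t: "0 <= t" "dist y0 y + t < R"
  and s: "!!z p. z \<in> ball y0 R ==> Hc c z p <= a ==> p \<bullet> e <= s"
 shows "u (ci c (y + t *\<^sub>R e)) - u (ci c y) <= s * t"
proof -
 let ?u = "%z. u (ci c z)"
 have cu: "continuous_on UNIV u" using u by (simp add: vsub_def)
 have cuc: "continuous_on (rng c) ?u"
  by (rule continuous_on_compose2[OF cu chart_inv_continuous[OF c]]) auto
 obtain B where B: "B > 0" "!!x. \<bar>u x\<bar> <= B" using bounded_continuous[OF cu] by blast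
 have yR: "y \<in> ball y0 R" using t by simp
 have ee: "e \<bullet> e = 1" using e by (simp add: dot_square_norm)
 have main: "?u (y + t *\<^sub>R e) - ?u y <= s * t + eps * (t + 1)" if "eps > 0" for eps
 proof -
  have "isCont ?u y" using cuc open_rng[OF c] yR R continuous_on_eq_continuous_at by blast
  then obtain d where d: "d > 0" "!!z. dist z y < d ==> dist (?u z) (?u y) < eps"
   using `eps > 0` unfolding continuous_at_eps_delta by blast
  define eta where "eta = min (d / 2) ((R - dist y0 y - t) / 3)"
  have eta: "eta > 0" "eta < d" "3 * eta <= R - dist y0 y - t" using d(1) t unfolding eta_def by (auto simp: min_def)
  \<comment> \<open>\<open>N\<close> exceeds the oscillation of \<open>u\<close> plus that of the
    linear term. A maximiser therefore pays less than \<open>N\<close> in penalties, which keeps it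
    off the faces where \<open>q\<close> equals the square of \<open>eta\<close> or \<open>l\<close>
    equals \<open>t + eta\<close>.\<close>
  define N where "N = 2 * B + 2 * ((\<bar>s\<bar> + eps) * (t + eta)) + 1"
  define K where "K = N / eta\<^sup>2"
  have "(\<bar>s\<bar> + eps) * (t + eta) >= 0" using t eta `eps > 0` by simp
  hence "N > 0" using B(1) by (simp add: N_def)
  hence "K > 0" using eta by (simp add: K_def)
  have KN: "K * eta\<^sup>2 = N" using eta by (simp add: K_def)
  define l where "l z = e \<bullet> (z - y)" for z
  \<comment> \<open>The squared distance to the line through \<open>y\<close> in direction
    \<open>e\<close>.\<close>
  define q where "q z = (z - y) \<bullet> (z - y) - (l z)\<^sup>2" for z
  define f where "f z = (s + eps) * l z + K * pos_sq (l z - t) + K * q z" for z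
  define Df where "Df z = (s + eps) *\<^sub>R e + K *\<^sub>R (2 * max 0 (l z - t)) *\<^sub>R e +
    K *\<^sub>R (2 *\<^sub>R (z - y) - (2 * l z) *\<^sub>R e)" for z
  have q0: "0 <= q z" for z
  proof -
   have "(l z)\<^sup>2 <= (norm e * norm (z - y))\<^sup>2"
    unfolding l_def using Cauchy_Schwarz_ineq2[of e "z - y"] by (simp add: power2_le_iff_abs_le)
   thus ?thesis using e by (simp add: q_def dot_square_norm)
  qed
  have C1l: "C1_grad UNIV l (%_. e)" unfolding l_def by (rule C1_grad_linear)
  have C1f: "C1_grad UNIV f Df"
  proof -
   have "C1_grad UNIV (%z. (s + eps) * l z + K * pos_sq (l z + - t) + K * ((z - y) \<bullet> (z - y) + (- 1) * (l z * l z)))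
    (%z. (s + eps) *\<^sub>R e + K *\<^sub>R ((2 * max 0 (l z + - t)) *\<^sub>R (e + 0)) + K *\<^sub>R (2 *\<^sub>R (z - y) + (- 1) *\<^sub>R (l z *\<^sub>R e + l z *\<^sub>R e)))"
    by (intro C1_grad_add C1_grad_cmult C1_grad_pos_sq C1_grad_mult C1l C1_grad_const C1_grad_norm_sq)
   thus ?thesis
    unfolding f_def[abs_def] Df_def[abs_def] q_def
    by (simp add: power2_eq_square scaleR_2[symmetric] scaleR_add_left[symmetric])
  qed
  have slope: "s < Df z \<bullet> e" for z
  proof -
   have "(z - y) \<bullet> e = l z" by (simp add: l_def inner_commute)
   hence "Df z \<bullet> e = s + eps + K * (2 * max 0 (l z - t))"
    by (simp add: Df_def inner_add_left inner_diff_left ee)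
   moreover have "0 <= K * (2 * max 0 (l z - t))" using `K > 0` by simp
   ultimately show ?thesis using `eps > 0` by linarith
  qed
  define D where "D = {z. 0 <= l z & l z <= t + eta & q z <= eta\<^sup>2}"
  have cl: "continuous_on UNIV l" "continuous_on UNIV q" unfolding l_def q_def by (intro continuous_intros)+
  have DR: "z \<in> ball y0 R" if "z \<in> D" for z
  proof -
   have "(norm (z - y))\<^sup>2 = q z + (l z)\<^sup>2" by (simp add: q_def dot_square_norm)
   also have "... <= eta\<^sup>2 + (t + eta)\<^sup>2" using that by (intro add_mono power_mono) (auto simp: D_def)
   also have "... <= (t + 2 * eta)\<^sup>2" using t eta by (simp add: power2_eq_square algebra_simps)
   finally have "norm (z - y) <= t + 2 * eta" using t eta by (simp add: power2_le_iff_abs_le)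
   moreover have "dist y0 z <= dist y0 y + norm (z - y)" by (metis dist_norm dist_triangle dist_commute)
   ultimately show ?thesis using eta t by simp
  qed
  have "D = {z. 0 <= l z} Int {z. l z <= t + eta} Int {z. q z <= eta\<^sup>2}" by (auto simp: D_def)
  hence "closed D" using cl by (auto intro!: closed_Int closed_Collect_le continuous_intros)
  moreover have "bounded D" by (rule bounded_subset[of "ball y0 R"]) (use DR in auto)
  ultimately have "compact D" by (simp add: compact_eq_bounded_closed)
  have l1: "l (y + t *\<^sub>R e) = t" and q1: "q (y + t *\<^sub>R e) = 0"
   by (simp_all add: q_def l_def ee power2_eq_square)
  hence inD: "y + t *\<^sub>R e \<in> D" using t eta by (simp add: D_def)
  have "D \<subseteq> rng c" using DR R by blast
  hence "continuous_on D (%z. ?u z - f z)"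
   using C1_grad_continuous[OF C1f] cuc by (intro continuous_intros) (auto intro: continuous_on_subset)
  then obtain z where z: "z \<in> D" "!!z'. z' \<in> D ==> ?u z' - f z' <= ?u z - f z"
   using continuous_attains_sup[OF `compact D`, of "%z. ?u z - f z"] inD by blast
  have f1: "f (y + t *\<^sub>R e) = (s + eps) * t" using l1 q1 by (simp add: f_def pos_sq_def)
  have le: "?u (y + t *\<^sub>R e) - (s + eps) * t <= ?u z - f z" using z(2)[OF inD] f1 by simp
  have st: "\<bar>(s + eps) * r\<bar> <= (\<bar>s\<bar> + eps) * (t + eta)" if "0 <= r" "r <= t + eta" for r
  proof -
   have "\<bar>(s + eps) * r\<bar> = \<bar>s + eps\<bar> * r" using that by (simp add: abs_mult)
   also have "... <= (\<bar>s\<bar> + eps) * (t + eta)" using that `eps > 0` by (intro mult_mono) auto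
   finally show ?thesis .
  qed
  have lz: "0 <= l z" "l z <= t + eta" "q z <= eta\<^sup>2" using z(1) by (auto simp: D_def)
  have P0: "0 <= K * pos_sq (l z - t)" "0 <= K * q z" using `K > 0` q0 by (auto simp: pos_sq_nonneg)
  have nopen: "K * pos_sq (l z - t) + K * q z < N"
  proof (rule ccontr)
   assume "~ ?thesis"
   hence "f z >= (s + eps) * l z + N" by (simp add: f_def)
   moreover have "\<bar>(s + eps) * l z\<bar> <= (\<bar>s\<bar> + eps) * (t + eta)" "\<bar>(s + eps) * t\<bar> <= (\<bar>s\<bar> + eps) * (t + eta)"
    using st[of "l z"] st[of t] lz t eta by auto
   moreover have "\<bar>?u z\<bar> <= B" "\<bar>?u (y + t *\<^sub>R e)\<bar> <= B" using B(2) by auto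
   ultimately show False using le unfolding N_def by linarith
  qed
  have qlt: "q z < eta\<^sup>2"
  proof (rule ccontr)
   assume "~ ?thesis"
   hence "K * eta\<^sup>2 <= K * q z" using `K > 0` by (intro mult_left_mono) auto
   thus False using nopen P0 KN by linarith
  qed
  have llt: "l z < t + eta"
  proof (rule ccontr)
   assume "~ ?thesis"
   hence "l z - t = eta" using lz by simp
   hence "K * pos_sq (l z - t) = N" using KN eta by (simp add: pos_sq_def)
   thus False using nopen P0 by linarith
  qed
  have "l z = 0"
  proof (rule ccontr)
   assume "l z ~= 0"
   let ?V = "{z'. 0 < l z'} Int {z'. l z' < t + eta} Int {z'. q z' < eta\<^sup>2}"
   have "open ?V" using cl by (intro open_Int open_Collect_less) (auto intro!: continuous_intros)
   moreover have "z \<in> ?V" using lz `l z ~= 0` qlt llt by auto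
   ultimately have "\<forall>\<^sub>F z' in nhds z. z' \<in> ?V" by (rule eventually_nhds_in_open)
   hence ev: "\<forall>\<^sub>F z' in nhds z. ?u z' - f z' <= ?u z - f z"
    by (rule eventually_mono) (rule z(2), auto simp: D_def)
   have "Hc c z (Df z) <= a"
    by (rule vsub_chart[OF u c open_ball DR[OF z(1)] R C1_grad_subset[OF C1f] ev]) simp
   from s[OF DR[OF z(1)] this] slope[of z] show False by simp
  qed
  hence "(norm (z - y))\<^sup>2 <= eta\<^sup>2" using lz by (simp add: q_def dot_square_norm)
  hence "norm (z - y) <= eta" using eta by (simp add: power2_le_iff_abs_le)
  hence "dist z y < d" using eta by (simp add: dist_norm)
  hence "?u z < ?u y + eps" using d(2)[of z] by (simp add: dist_real_def abs_less_iff)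
  moreover have "f z >= 0" using `l z = 0` P0 t by (simp add: f_def)
  ultimately show ?thesis using le by (simp add: algebra_simps)
 qed
 show ?thesis
 proof (rule field_le_epsilon)
  fix eps :: real assume "eps > 0"
  from main[of "eps / (t + 1)"] show "?u (y + t *\<^sub>R e) - ?u y <= s * t + eps" using `eps > 0` t by simp
 qed
qed

text \<open>By \<open>vsub_segment_bound\<close> the increments of \<open>u\<close> near the centre
  are bounded by the support function of \<open>Z\<close>, the covectors lying in the sublevel set
  over some point of the ball. Hence \<open>u\<close> at \<open>z\<close> is the minimum over
  \<open>y\<close> of \<open>u\<close> at \<open>y\<close> plus that support function at
  \<open>z - y\<close>. Restricting points and covectors to finite nets and softening both extrema
  gives a C1 function whose gradients are convex combinations of members of \<open>Z\<close>, on
  which the Hamiltonian is at most \<open>a + eps\<close> by uniform continuity. The radius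
  \<open>rho\<close> is fixed before the accuracy \<open>eta\<close>, as the gluing
  requires.\<close>

lemma vsub_smooth_locally:
 assumes u: "vsub u a" and "eps > 0"
 shows "EX rho>0. cball (ctr x) rho \<subseteq> rng (ch x) & (ALL eta>0. EX F D. C1_grad UNIV F D &
  (ALL y:cball (ctr x) rho. \<bar>F y - u (ci (ch x) y)\<bar> <= eta & Hc (ch x) y (D y) <= a + eps))"
proof -
 define c y0 where "c = ch x" and "y0 = ctr x"
 have c: "c \<in> A" and y0: "y0 \<in> rng c" using chart_at by (auto simp: c_def y0_def)
 let ?u = "%z. u (ci c z)"
 obtain K r1 where K: "K > 0" "r1 > 0" "cball y0 r1 \<subseteq> rng c" "!!y p. y \<in> cball y0 r1 ==> Hc c y p <= a ==> norm p <= K"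
  using Hc_sublevel_bounded_locally[OF c y0, of a] by blast
 have "EX r>0. cball y0 r \<subseteq> rng c & (ALL y:cball y0 r. ALL y':cball y0 r. ALL p:cball 0 K. \<bar>Hc c y p - Hc c y' p\<bar> <= eps)"
  by (rule uniform_near_point[OF Hc_continuous[OF c] open_rng[OF c] y0]) (use `eps > 0` in auto)
 then obtain r2 where r2: "r2 > 0" "!!y y' p. y \<in> cball y0 r2 ==> y' \<in> cball y0 r2 ==> p \<in> cball 0 K ==> \<bar>Hc c y p - Hc c y' p\<bar> <= eps"
  by blast
 define r where "r = min r1 r2"
 have r: "r > 0" "cball y0 r \<subseteq> rng c" "cball y0 r \<subseteq> cball y0 r1" "cball y0 r \<subseteq> cball y0 r2"
  using K r2 by (auto simp: r_def)
 hence br: "ball y0 r \<subseteq> rng c" by (meson ball_subset_cball order_trans)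
 define rho where "rho = r / 4"
 have rho: "rho > 0" "3 * rho < r" using r(1) by (auto simp: rho_def)
 define Z where "Z = {p. EX z:ball y0 r. Hc c z p <= a}"
 have ZK: "norm p <= K" if "p \<in> Z" for p
  using that K(4) r(3) ball_subset_cball unfolding Z_def by blast
 have ZH: "Hc c y p <= a + eps" if "p \<in> Z" "y \<in> cball y0 rho" for p y
 proof -
  have "EX z:ball y0 r. Hc c z p <= a" using that(1) by (simp add: Z_def)
  then obtain z where z: "z \<in> ball y0 r" "Hc c z p <= a" by blast
  have "y \<in> cball y0 r" using that(2) rho by auto
  moreover have "z \<in> cball y0 r" using z(1) by simp
  ultimately have "y \<in> cball y0 r2" "z \<in> cball y0 r2" using r(4) by blast+
  hence "\<bar>Hc c y p - Hc c z p\<bar> <= eps"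
   using ZK[OF that(1)] by (intro r2(2)) auto
  thus ?thesis using z(2) by linarith
 qed
 have tri: "dist y0 y + norm (y' - y) < r" if "y \<in> cball y0 rho" "y' \<in> cball y0 rho" for y y'
 proof -
  have "norm (y' - y) <= dist y' y0 + dist y0 y" using dist_triangle[of y' y y0] by (simp add: dist_norm)
  thus ?thesis using that rho by (simp add: dist_commute)
 qed
 have "bounded Z" unfolding bounded_iff using ZK by blast
 \<comment> \<open>Without any covector in the sublevel set \<open>vsub_segment_bound\<close> would
   hold with every slope \<open>s\<close>, however negative.\<close>
 have Zne: "Z ~= {}"
 proof
  assume "Z = {}"
  obtain e :: 'e where e: "norm e = 1" using norm_Basis SOME_Basis by blast
  have le: "?u (y0 + rho *\<^sub>R e) - ?u y0 <= s * rho" for s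
   by (rule vsub_segment_bound[OF u c br e]) (use rho `Z = {}` in "auto simp: Z_def")
  show False using le[of "(?u (y0 + rho *\<^sub>R e) - ?u y0 - 1) / rho"] rho by simp
 qed
 have seg: "EX p:P. ?u y' - ?u y <= p \<bullet> (y' - y) + eta' * norm (y' - y)"
  if P: "finite P" "P \<subseteq> Z" "P ~= {}" "!!z. z \<in> Z ==> EX p:P. dist p z < eta'" and y: "y \<in> cball y0 rho" "y' \<in> cball y0 rho" for P eta' y y'
 proof (cases "y' = y")
  case True
  thus ?thesis using P(3) by auto
 next
  case False
  define t e where "t = norm (y' - y)" and "e = (1 / t) *\<^sub>R (y' - y)"
  have t: "t > 0" using False by (simp add: t_def)
  have e: "norm e = 1" "y + t *\<^sub>R e = y'" using t by (auto simp: e_def t_def)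
  obtain p where p: "p \<in> P" "!!q. q \<in> P ==> q \<bullet> e <= p \<bullet> e"
  proof -
   have "Max ((%q. q \<bullet> e) ` P) \<in> (%q. q \<bullet> e) ` P" using P(1,3) by (intro Max_in) auto
   then obtain p where "p \<in> P" "Max ((%q. q \<bullet> e) ` P) = p \<bullet> e" by (elim imageE) simp
   thus ?thesis using P(1) by (intro that[of p]) (auto simp: Max_ge dest: sym)
  qed
  have "?u (y + t *\<^sub>R e) - ?u y <= (p \<bullet> e + eta') * t"
  proof (rule vsub_segment_bound[OF u c br e(1)])
   show "0 <= t" "dist y0 y + t < r" using t tri[OF y] by (auto simp: t_def)
   fix z q assume "z \<in> ball y0 r" "Hc c z q <= a"
   hence "q \<in> Z" by (auto simp: Z_def)
   then obtain p' where p': "p' \<in> P" "dist p' q < eta'" using P(4) by blast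
   have "(q - p') \<bullet> e <= norm (q - p') * norm e" by (rule norm_cauchy_schwarz)
   hence "q \<bullet> e <= p' \<bullet> e + eta'" using p'(2) e(1) by (simp add: inner_diff_left dist_norm norm_minus_commute)
   thus "q \<bullet> e <= p \<bullet> e + eta'" using p(2)[OF p'(1)] by simp
  qed
  hence "?u y' - ?u y <= p \<bullet> (t *\<^sub>R e) + eta' * t" unfolding e(2) by (simp add: algebra_simps)
  also have "t *\<^sub>R e = y' - y" using t by (simp add: e_def)
  finally show ?thesis using p(1) unfolding t_def by (intro bexI[of _ p])
 qed
 have "EX F D. C1_grad UNIV F D & (ALL y:cball y0 rho. \<bar>F y - ?u y\<bar> <= eta & Hc c y (D y) <= a + eps)" if "eta > 0" for eta
 proof -
  \<comment> \<open>Sized so that the losses caused by the nets, \<open>2 * rho * eta'\<close> from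
    below and \<open>(2 * K + 1) * eta'\<close> from above, stay within
    \<open>eta / 2\<close>.\<close>
  define eta' where "eta' = min 1 (eta / (2 * (2 * rho + 2 * K + 1)))"
  have den: "0 < 2 * rho + 2 * K + 1" using rho K(1) by simp
  have eta': "eta' > 0" "eta' <= 1" "eta' * (2 * rho + 2 * K + 1) <= eta / 2"
  proof -
   show "eta' > 0" "eta' <= 1" using den `eta > 0` by (auto simp: eta'_def)
   have "eta' <= eta / (2 * (2 * rho + 2 * K + 1))" by (simp add: eta'_def)
   thus "eta' * (2 * rho + 2 * K + 1) <= eta / 2" using den by (simp add: pos_le_divide_eq mult.assoc mult.commute[of 2] del: distrib_left_numeral)
  qed
  obtain P where P: "finite P" "P \<subseteq> Z" "!!z. z \<in> Z ==> EX p:P. dist p z < eta'"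
   using finite_net[OF `bounded Z` eta'(1)] by metis
  have Pne: "P ~= {}" using Zne P(3) by blast
  obtain Y where Y: "finite Y" "Y \<subseteq> cball y0 rho" "!!z. z \<in> cball y0 rho ==> EX p:Y. dist p z < eta'"
   using finite_net[OF bounded_cball eta'(1)] by metis
  have Yne: "Y ~= {}" using Y(3)[of y0] rho by auto
  have sg: "EX p:P. ?u y' - ?u y <= p \<bullet> (y' - y) + eta' * norm (y' - y)" if "y \<in> cball y0 rho" "y' \<in> cball y0 rho" for y y'
   using seg[of P eta' y y'] P Pne that by blast
  \<comment> \<open>Keeps the error of each of the two soft extrema within
    \<open>eta / 2\<close>.\<close>
  define bet where "bet = 2 * (ln (card Y) + ln (card P) + 1) / eta"
  have lns: "0 <= ln (card Y)" "0 <= ln (card P)"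
   using Y(1) Yne P(1) Pne by (auto intro!: ln_ge_zero simp: Suc_le_eq card_gt_0_iff)
  have "bet > 0" using lns `eta > 0` unfolding bet_def by (intro divide_pos_pos) auto
  have lb: "ln (card Y) / bet <= eta / 2" "ln (card P) / bet <= eta / 2"
   using lns `eta > 0` by (auto simp: bet_def field_simps)
  \<comment> \<open>A soft maximum over \<open>P\<close>, standing for the support function of
    \<open>Z\<close> at \<open>z - y\<close>.\<close>
  define S where "S y z = - softmin bet P (%p. - (p \<bullet> (z - y)))" for y z
  define F where "F z = softmin bet Y (%y. ?u y + S y z)" for z
  define DS where "DS y z = (\<Sum>p\<in>P. softweight bet P (%p. - (p \<bullet> (z - y))) p *\<^sub>R p)" for y z
  define D where "D z = (\<Sum>y\<in>Y. softweight bet Y (%y. ?u y + S y z) y *\<^sub>R DS y z)" for z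
  have C1S: "C1_grad UNIV (S y) (DS y)" for y
  proof -
   have "C1_grad UNIV (%z. softmin bet P (%p. (- 1) * (p \<bullet> (z - y))))
     (%z. \<Sum>p\<in>P. softweight bet P (%p. (- 1) * (p \<bullet> (z - y))) p *\<^sub>R ((- 1) *\<^sub>R p))"
    by (rule C1_grad_softmin[OF P(1) Pne `bet > 0` C1_grad_cmult[OF C1_grad_linear]])
   from C1_grad_cmult[OF this, of "-1"] show ?thesis
    unfolding S_def[abs_def] DS_def[abs_def] by (simp add: sum_negf)
  qed
  have C1F: "C1_grad UNIV F D"
   unfolding F_def[abs_def] D_def[abs_def]
  proof (rule C1_grad_softmin[OF Y(1) Yne `bet > 0`])
   fix y show "C1_grad UNIV (%z. ?u y + S y z) (DS y)"
    using C1_grad_add[OF C1_grad_const C1S[of y]] by simp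
  qed
  have Sge: "p \<bullet> (z - y) <= S y z" if "p \<in> P" for p y z
   using softmin_le[OF P(1) that `bet > 0`, of "%p. - (p \<bullet> (z - y))"] by (simp add: S_def)
  have Sle: "S y z <= K * norm (z - y) + ln (card P) / bet" for y z
  proof -
   have "- (K * norm (z - y)) <= - (p \<bullet> (z - y))" if "p \<in> P" for p
   proof -
    have "p \<bullet> (z - y) <= norm p * norm (z - y)" by (rule norm_cauchy_schwarz)
    also have "... <= K * norm (z - y)" using ZK P(2) that by (intro mult_right_mono) auto
    finally show ?thesis by simp
   qed
   hence "- (K * norm (z - y)) - ln (card P) / bet <= softmin bet P (%p. - (p \<bullet> (z - y)))"
    by (intro softmin_ge[OF P(1) Pne `bet > 0`])
   thus ?thesis by (simp add: S_def)
  qed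
  have close: "\<bar>F z - ?u z\<bar> <= eta" if z: "z \<in> cball y0 rho" for z
  proof -
   have low: "?u z - 2 * rho * eta' <= ?u y + S y z" if "y \<in> Y" for y
   proof -
    have y: "y \<in> cball y0 rho" using that Y(2) by (rule_tac subsetD)
    obtain p where p: "p \<in> P" "?u z - ?u y <= p \<bullet> (z - y) + eta' * norm (z - y)" using sg[OF y z] by blast
    have "norm (z - y) <= dist z y0 + dist y0 y" using dist_triangle[of z y y0] by (simp add: dist_norm)
    hence "norm (z - y) <= 2 * rho" using y z by (simp add: dist_commute)
    hence "eta' * norm (z - y) <= eta' * (2 * rho)" using eta'(1) by (intro mult_left_mono) auto
    thus ?thesis using p(2) Sge[OF p(1), where y = y and z = z] by (simp add: algebra_simps)
   qed
   have "?u z - 2 * rho * eta' - ln (card Y) / bet <= F z"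
    unfolding F_def by (rule softmin_ge[OF Y(1) Yne `bet > 0` low])
   moreover have "2 * rho * eta' <= eta / 2" "2 * K * eta' + eta' <= eta / 2"
   proof -
    have "eta' * (2 * rho + 2 * K + 1) = 2 * rho * eta' + (2 * K * eta' + eta')" by (simp add: algebra_simps)
    moreover have "0 <= 2 * rho * eta'" "0 <= 2 * K * eta' + eta'" using rho K(1) eta'(1) by auto
    ultimately show "2 * rho * eta' <= eta / 2" "2 * K * eta' + eta' <= eta / 2" using eta'(3) by linarith+
   qed
   moreover have "F z <= ?u z + 2 * K * eta' + eta' + ln (card P) / bet"
   proof -
    obtain y where y: "y \<in> Y" "dist y z < eta'" using Y(3)[OF z] by blast
    have yb: "y \<in> cball y0 rho" using y(1) Y(2) by (rule_tac subsetD)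
    have n: "norm (z - y) <= eta'" "norm (y - z) <= eta'" using y(2) by (auto simp: dist_norm norm_minus_commute)
    obtain p where p: "p \<in> P" "?u y - ?u z <= p \<bullet> (y - z) + eta' * norm (y - z)" using sg[OF z yb] by blast
    have "p \<bullet> (y - z) <= norm p * norm (y - z)" by (rule norm_cauchy_schwarz)
    also have "... <= K * eta'" using ZK P(2) p(1) n K(1) by (intro mult_mono) auto
    finally have "p \<bullet> (y - z) <= K * eta'" .
    moreover have "eta' * norm (y - z) <= eta' * 1" using n eta' by (intro mult_left_mono) auto
    ultimately have "?u y <= ?u z + K * eta' + eta'" using p(2) by simp
    moreover have "F z <= ?u y + S y z" unfolding F_def by (rule softmin_le[OF Y(1) y(1) `bet > 0`])
    moreover have "K * norm (z - y) <= K * eta'" using n K(1) by (intro mult_left_mono) auto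
    ultimately show ?thesis using Sle[of y z] by simp
   qed
   ultimately show ?thesis using lb by linarith
  qed
  have "Hc c z (D z) <= a + eps" if z: "z \<in> cball y0 rho" for z
   unfolding D_def
  proof (rule convex_on_sum_le[OF Hc_convex Y(1) softweight_sum[OF Y(1) Yne] softweight_nonneg])
   fix y
   show "Hc c z (DS y z) <= a + eps" unfolding DS_def
    by (rule convex_on_sum_le[OF Hc_convex P(1) softweight_sum[OF P(1) Pne] softweight_nonneg])
     (use ZH[OF _ z] P(2) in auto)
  qed
  thus ?thesis using C1F close by blast
 qed
 moreover have "cball y0 rho \<subseteq> rng c" using r(2) rho by (auto simp: subset_iff)
 ultimately show ?thesis using rho(1) unfolding c_def y0_def by blast
qed

text \<open>Sublevel sets are bounded locally uniformly, so in coordinates the Hamiltonian is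
  uniformly continuous near them, and small multiples of finitely many fixed differentials move a
  covector by less than the modulus. Compactness makes \<open>eta\<close> independent of the
  point.\<close>

lemma G_perturbation:
 assumes X: "finite X" "!!i. i \<in> X ==> tht i \<in> C1" and "eps > 0"
 shows "EX eta>0. ALL z. ALL p s. G z p <= a & (ALL i:X. \<bar>s i\<bar> <= eta) -->
   G z (p + (\<Sum>i\<in>X. s i *\<^sub>R dif (tht i) z)) <= a + eps"
proof (rule uniform_by_compactness)
 fix z0
 define c y0 where "c = ch z0" and "y0 = ctr z0"
 have c: "c \<in> A" and y0: "y0 \<in> rng c" and z0: "z0 \<in> fst c" using chart_at by (auto simp: c_def y0_def)
 obtain K r where K: "K > 0" "r > 0" "cball y0 r \<subseteq> rng c" "!!y p. y \<in> cball y0 r ==> Hc c y p <= a ==> norm p <= K"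
  using Hc_sublevel_bounded_locally[OF c y0, of a] by blast
 have "ALL i. EX D. i \<in> X --> C1_grad (rng c) (tht i o ci c) D" using C1_functions_iff X(2) c by blast
 then obtain D where D: "!!i. i \<in> X ==> C1_grad (rng c) (tht i o ci c) (D i)" by metis
 have "EX B. ALL i:X. ALL y:cball y0 r. norm (D i y) <= B"
 proof -
  have "ALL i. EX B. i \<in> X --> (ALL y:cball y0 r. norm (D i y) <= B)"
  proof (intro allI)
   fix i
   show "EX B. i \<in> X --> (ALL y:cball y0 r. norm (D i y) <= B)"
   proof (cases "i \<in> X")
    case True
    hence "continuous_on (cball y0 r) (D i)"
     using D[OF True] K(3) unfolding C1_grad_def by (auto intro: continuous_on_subset)
    hence "bounded (D i ` cball y0 r)" by (intro compact_imp_bounded compact_continuous_image) auto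
    thus ?thesis unfolding bounded_iff by auto
   qed simp
  qed
  then obtain B where B: "!!i. i \<in> X ==> ALL y:cball y0 r. norm (D i y) <= B i" by metis
  have "ALL i:X. ALL y:cball y0 r. norm (D i y) <= (\<Sum>i\<in>X. \<bar>B i\<bar>)"
  proof (intro ballI)
   fix i y assume i: "i \<in> X" and y: "y \<in> cball y0 r"
   have "norm (D i y) <= \<bar>B i\<bar>" using B[OF i] y by force
   also have "... <= (\<Sum>i\<in>X. \<bar>B i\<bar>)" using X(1) i by (intro member_le_sum) auto
   finally show "norm (D i y) <= (\<Sum>i\<in>X. \<bar>B i\<bar>)" .
  qed
  thus ?thesis by blast
 qed
 then obtain B0 where B0: "!!i y. i \<in> X ==> y \<in> cball y0 r ==> norm (D i y) <= B0" by blast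
 define B where "B = \<bar>B0\<bar> + 1"
 have B: "B > 0" "!!i y. i \<in> X ==> y \<in> cball y0 r ==> norm (D i y) <= B"
 proof -
  show "B > 0" by (simp add: B_def)
  show "norm (D i y) <= B" if "i \<in> X" "y \<in> cball y0 r" for i y
   using B0[OF that] unfolding B_def by linarith
 qed
 let ?Q = "cball y0 r \<times> cball (0::'e) (K + 1)"
 let ?H = "%z. Hc c (fst z) (snd z)"
 have "continuous_on ?Q ?H" using continuous_on_subset[OF Hc_continuous[OF c], of ?Q] K(3) by (auto simp: case_prod_beta)
 hence "uniformly_continuous_on ?Q ?H" by (intro compact_uniformly_continuous compact_Times) auto
 then obtain d where d: "d > 0" "!!z z'. z \<in> ?Q ==> z' \<in> ?Q ==> dist z' z < d ==> dist (?H z') (?H z) < eps"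
  unfolding uniformly_continuous_on_def using `eps > 0` by meson
 \<comment> \<open>All summands together then move the covector by at most 1, so it stays in the
   larger ball, and by less than the modulus \<open>d\<close>.\<close>
 define eta where "eta = min 1 (d / 2) / (B * (card X + 1))"
 have BX: "B * (card X + 1) > 0" using B(1) by simp
 have eta: "eta > 0" using BX d(1) by (simp add: eta_def)
 have key: "G z (p + (\<Sum>i\<in>X. s i *\<^sub>R dif (tht i) z)) <= a + eps"
  if z: "z \<in> fst c" "snd c z \<in> cball y0 r" and p: "G z p <= a" and s: "ALL i:X. \<bar>s i\<bar> <= eta" for z p s
 proof -
  obtain p' where p': "p = blinfun_inner_right p' o\<^sub>L coord_change (ch z) c z" using covector_chart[OF c z(1)] by blast
  define y where "y = snd c z"
  have G_H: "G z (blinfun_inner_right q o\<^sub>L coord_change (ch z) c z) = Hc c y q" for q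
   by (simp add: Hc_def y_def chart_inv_chart[OF c z(1)])
  have yr: "y \<in> cball y0 r" using z by (simp add: y_def)
  have df: "dif (tht i) z = blinfun_inner_right (D i y) o\<^sub>L coord_change (ch z) c z" if "i \<in> X" for i
   by (rule differential_chart[OF c z(1)]) (use D[OF that] z in "auto simp: C1_grad_def y_def")
  define q where "q = (\<Sum>i\<in>X. s i *\<^sub>R D i y)"
  have "p + (\<Sum>i\<in>X. s i *\<^sub>R dif (tht i) z) = blinfun_inner_right (p' + q) o\<^sub>L coord_change (ch z) c z"
  proof (rule blinfun_eqI)
   fix v
   show "blinfun_apply (p + (\<Sum>i\<in>X. s i *\<^sub>R dif (tht i) z)) v =
     blinfun_apply (blinfun_inner_right (p' + q) o\<^sub>L coord_change (ch z) c z) v"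
    by (simp add: p' q_def df blinfun.add_left blinfun.scaleR_left blinfun.sum_left inner_add_left inner_sum_left
      cong: sum.cong)
  qed
  hence Gq: "G z (p + (\<Sum>i\<in>X. s i *\<^sub>R dif (tht i) z)) = Hc c y (p' + q)" by (simp add: G_H)
  have Gp: "Hc c y p' <= a" using p by (simp add: p' G_H)
  hence np: "norm p' <= K" by (rule K(4)[OF yr])
  have "norm q <= (\<Sum>i\<in>X. eta * B)"
   unfolding q_def using s B(2)[OF _ yr] eta by (intro sum_norm_le) (auto intro!: mult_mono)
  also have "... = card X * (eta * B)" by simp
  also have "... <= (card X + 1) * (eta * B)" using eta B(1) by (intro mult_right_mono) auto
  also have "... = min 1 (d / 2)" using BX by (simp add: eta_def field_simps)
  finally have nq: "norm q <= 1" "norm q < d" using d(1) by auto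
  have "norm (p' + q) <= K + 1" using norm_triangle_ineq[of p' q] np nq by simp
  moreover have "dist (y, p' + q) (y, p') < d" using nq by (simp add: dist_Pair_Pair dist_norm)
  ultimately have "dist (?H (y, p' + q)) (?H (y, p')) < eps" using np yr by (intro d(2)) auto
  thus ?thesis using Gq Gp by (simp add: dist_real_def)
 qed
 have "\<forall>\<^sub>F z in nhds z0. z \<in> fst c & snd c z \<in> ball y0 r"
  by (rule eventually_chart[OF c z0], rule eventually_nhds_in_open) (use K(2) in "auto simp: c_def y0_def")
 hence "\<forall>\<^sub>F z in nhds z0. ALL p s. G z p <= a & (ALL i:X. \<bar>s i\<bar> <= eta) -->
   G z (p + (\<Sum>i\<in>X. s i *\<^sub>R dif (tht i) z)) <= a + eps"
  by (rule eventually_mono) (use key in auto)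
 thus "EX eta>0. \<forall>\<^sub>F z in nhds z0. ALL p s. G z p <= a & (ALL i:X. \<bar>s i\<bar> <= eta) -->
   G z (p + (\<Sum>i\<in>X. s i *\<^sub>R dif (tht i) z)) <= a + eps" using eta by blast
next
 fix eta eta' :: real and z
 assume *: "ALL p s. G z p <= a & (ALL i:X. \<bar>s i\<bar> <= eta) --> G z (p + (\<Sum>i\<in>X. s i *\<^sub>R dif (tht i) z)) <= a + eps"
  and "0 < eta'" "eta' <= eta"
 thus "ALL p s. G z p <= a & (ALL i:X. \<bar>s i\<bar> <= eta') --> G z (p + (\<Sum>i\<in>X. s i *\<^sub>R dif (tht i) z)) <= a + eps"
  by (meson order_trans)
qed

text \<open>Convexity lets the local approximations be glued with a partition of unity: since the differentials
  of the partition functions sum to zero, gluing only adds the differences \<open>F - u\<close> times fixed covectors.\<close>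

theorem vsub_smooth:
 assumes u: "vsub u a" and "eps > 0"
 obtains f where "f \<in> C1" "!!x. \<bar>f x - u x\<bar> <= eps" "!!x. G x (dif f x) <= a + eps"
proof -
 have "ALL x. EX rho. rho > 0 & cball (ctr x) rho \<subseteq> rng (ch x) & (ALL eta>0. EX F D. C1_grad UNIV F D &
  (ALL y:cball (ctr x) rho. \<bar>F y - u (ci (ch x) y)\<bar> <= eta & Hc (ch x) y (D y) <= a + eps / 2))"
  using vsub_smooth_locally[OF u, of "eps / 2"] `eps > 0` by simp
 from choice[OF this] obtain rho where rho: "!!x. rho x > 0" "!!x. cball (ctr x) (rho x) \<subseteq> rng (ch x)"
  "!!x eta. eta > 0 ==> EX F D. C1_grad UNIV F D &
   (ALL y:cball (ctr x) (rho x). \<bar>F y - u (ci (ch x) y)\<bar> <= eta & Hc (ch x) y (D y) <= a + eps / 2)"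
  by blast
 have sub: "cball (ctr x) r \<subseteq> rng (ch x)" if "r <= rho x" for r x
  using rho(2) that by (meson order_trans subset_cball)
 obtain X where X: "finite X" "!!z. EX x:X. z \<in> fst (ch x) & snd (ch x) z \<in> ball (ctr x) (rho x / 8)"
 proof (rule finite_chart_cover[of "%x. rho x / 8"])
  show "0 < rho x / 8" for x using rho(1) by simp
  show "ball (ctr x) (rho x / 8) \<subseteq> rng (ch x)" for x
   by (rule order_trans[OF ball_subset_cball sub]) (use rho(1)[of x] in simp)
 qed blast
 \<comment> \<open>\<open>b x\<close> is 1 up to radius \<open>rho x / 8\<close>, where the charts
   cover, and is supported in radius \<open>rho x / 4\<close>; the cut-off approximation
   \<open>F x\<close> introduced below is unaltered up to radius \<open>rho x / 2\<close>. So the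
   cut-off in \<open>F x\<close> is invisible near the support of its partition function.\<close>
 define b where "b x = chart_bump x (rho x / 4) (%_. 1)" for x
 have r4: "rho x / 4 > 0" "cball (ctr x) (rho x / 4) \<subseteq> rng (ch x)" for x
  using rho(1)[of x] sub[of "rho x / 4" x] by auto
 have bC1: "b x \<in> C1" for x unfolding b_def by (rule chart_bump_C1[OF r4 C1_grad_const])
 have b0: "0 <= b x z" for x z by (simp add: b_def chart_bump_def bump_nonneg)
 define \<Theta> where "\<Theta> z = (\<Sum>x\<in>X. b x z)" for z
 have \<Theta>1: "1 <= \<Theta> z" for z
 proof -
  obtain x where x: "x \<in> X" "z \<in> fst (ch x)" "snd (ch x) z \<in> ball (ctr x) (rho x / 8)" using X(2) by blast
  have "b x z = 1" unfolding b_def by (subst chart_bump_eq[OF r4(1) x(2)]) (use x(3) in auto)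
  thus ?thesis unfolding \<Theta>_def using member_le_sum[OF x(1), of "%x. b x z"] b0 X(1) by simp
 qed
 have \<Theta>C1: "\<Theta> \<in> C1" unfolding \<Theta>_def[abs_def] by (rule C1_sum[OF X(1) bC1])
 have i\<Theta>: "(%z. inverse (\<Theta> z)) \<in> C1"
 proof (rule C1_compose[OF \<Theta>C1, where phi' = "%t. - (inverse (t ^ Suc (Suc 0)))"])
  fix z have "\<Theta> z ~= 0" using \<Theta>1[of z] by auto
  thus "(inverse has_real_derivative - (inverse (\<Theta> z ^ Suc (Suc 0)))) (at (\<Theta> z))"
   using DERIV_inverse[of "\<Theta> z" UNIV] by simp
 next
  show "continuous_on (range \<Theta>) (%t. - (inverse (t ^ Suc (Suc 0))))"
   using \<Theta>1 by (intro continuous_intros) (auto, metis not_one_le_zero)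
 qed
 define tht where "tht x z = b x z * inverse (\<Theta> z)" for x z
 have thtC1: "tht x \<in> C1" for x unfolding tht_def[abs_def] by (rule C1_mult[OF bC1 i\<Theta>])
 have tht0: "0 <= tht x z" for x z using b0 \<Theta>1[of z] by (simp add: tht_def)
 have tht1: "(\<Sum>x\<in>X. tht x z) = 1" for z
  using \<Theta>1[of z] unfolding tht_def sum_distrib_right[symmetric] \<Theta>_def[symmetric] by simp
 have dtht: "(\<Sum>x\<in>X. dif (tht x) z) = 0" for z
  using differential_sum[of X tht z] X(1) thtC1 differential_const[of 1 z] by (simp add: tht1)
 obtain eta0 where eta0: "eta0 > 0" "!!z p s. G z p <= a + eps / 2 ==> (ALL i:X. \<bar>s i\<bar> <= eta0) ==>
   G z (p + (\<Sum>i\<in>X. s i *\<^sub>R dif (tht i) z)) <= a + eps / 2 + eps / 2"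
  using G_perturbation[of X tht "eps / 2" "a + eps / 2"] X(1) thtC1 `eps > 0` by auto
 define eta where "eta = min eta0 eps"
 have "eta > 0" using eta0 `eps > 0` by (simp add: eta_def)
 have "ALL x. EX FD. C1_grad UNIV (fst FD) (snd FD) &
   (ALL y:cball (ctr x) (rho x). \<bar>fst FD y - u (ci (ch x) y)\<bar> <= eta & Hc (ch x) y (snd FD y) <= a + eps / 2)"
  using rho(3)[OF `eta > 0`] by simp
 from choice[OF this] obtain FD where FD: "!!x. C1_grad UNIV (fst (FD x)) (snd (FD x))"
   "!!x y. y \<in> cball (ctr x) (rho x) ==> \<bar>fst (FD x) y - u (ci (ch x) y)\<bar> <= eta"
   "!!x y. y \<in> cball (ctr x) (rho x) ==> Hc (ch x) y (snd (FD x) y) <= a + eps / 2" by blast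
 define F where "F x = chart_bump x (rho x) (fst (FD x))" for x
 have FC1: "F x \<in> C1" for x
  unfolding F_def by (rule chart_bump_C1[OF rho(1,2) C1_grad_subset[OF FD(1)]]) simp
 define supp where "supp x z \<longleftrightarrow> z \<in> fst (ch x) & snd (ch x) z \<in> cball (ctr x) (rho x / 4)" for x z
 have Fu: "\<bar>F x z - u z\<bar> <= eta" if "supp x z" for x z
 proof -
  have z: "z \<in> fst (ch x)" "snd (ch x) z \<in> cball (ctr x) (rho x / 2)" "snd (ch x) z \<in> cball (ctr x) (rho x)"
   using that rho(1)[of x] by (auto simp: supp_def)
  have "F x z = fst (FD x) (snd (ch x) z)" unfolding F_def by (rule chart_bump_eq[OF rho(1) z(1,2)])
  thus ?thesis using FD(2)[OF z(3)] chart_inv_chart[OF chart_at(1) z(1)] by simp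
 qed
 have FG: "G z (dif (F x) z) <= a + eps / 2" if "supp x z" for x z
 proof -
  have z: "z \<in> fst (ch x)" "snd (ch x) z \<in> cball (ctr x) (rho x)" "snd (ch x) z \<in> ball (ctr x) (rho x / 2)"
   using that rho(1)[of x] by (auto simp: supp_def)
  have "\<forall>\<^sub>F y in nhds (snd (ch x) z). y \<in> ball (ctr x) (rho x / 2)"
   using z(3) by (intro eventually_nhds_in_open) auto
  from eventually_chart[OF chart_at(1) z(1) this]
  have "\<forall>\<^sub>F z' in nhds z. F x z' = fst (FD x) (snd (ch x) z')"
   by (rule eventually_mono) (auto simp: F_def intro!: chart_bump_eq[OF rho(1)])
  from differential_cong_eventually[OF chart_at(1) z(1) this, of "snd (FD x) (snd (ch x) z)"]
  have "((F x o ci (ch x)) has_derivative (%w. snd (FD x) (snd (ch x) z) \<bullet> w)) (at (snd (ch x) z))"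
   using FD(1)[of x] by (simp add: C1_grad_def)
  from G_differential[OF chart_at(1) z(1) this] show ?thesis using FD(3)[OF z(2)] by simp
 qed
 have nsupp: "\<forall>\<^sub>F z' in nhds z. tht x z' = 0" if "~ supp x z" for x z
  using chart_bump_eventually_0[OF r4, of z x "%_. 1"] that unfolding supp_def b_def[symmetric]
  by (auto simp: tht_def elim: eventually_mono)
 have thtsupp: "supp x z" if "tht x z ~= 0" for x z
  using eventually_nhds_x_imp_x[OF nsupp[of x z]] that by blast
 define f where "f z = (\<Sum>x\<in>X. F x z * tht x z)" for z
 have fC1: "f \<in> C1" unfolding f_def[abs_def] by (rule C1_sum[OF X(1) C1_mult[OF FC1 thtC1]])
 show ?thesis
 proof (rule that[OF fC1])
  fix z
  have "f z - u z = (\<Sum>x\<in>X. (F x z - u z) * tht x z)"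
   using tht1[of z] by (simp add: f_def left_diff_distrib sum_subtractf sum_distrib_left[symmetric])
  also have "\<bar>...\<bar> <= (\<Sum>x\<in>X. eta * tht x z)"
  proof (rule order_trans[OF sum_abs sum_mono])
   fix x
   show "\<bar>(F x z - u z) * tht x z\<bar> <= eta * tht x z"
    using Fu[OF thtsupp, of x z] tht0[of x z] by (cases "tht x z = 0") (auto simp: abs_mult intro: mult_right_mono)
  qed
  also have "... = eta" using tht1[of z] by (simp add: sum_distrib_left[symmetric])
  finally show "\<bar>f z - u z\<bar> <= eps" by (simp add: eta_def)
  define p where "p = (\<Sum>x\<in>X. tht x z *\<^sub>R dif (F x) z)"
  \<comment> \<open>Off the support \<open>F x\<close> need not be near \<open>u\<close>, but there
    the differential of \<open>tht x\<close> vanishes, so the coefficient may be replaced by 0 to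
    meet the bound \<open>eta0\<close>.\<close>
  define s where "s x = (if supp x z then F x z - u z else 0)" for x
  have "dif f z = (\<Sum>x\<in>X. F x z *\<^sub>R dif (tht x) z + tht x z *\<^sub>R dif (F x) z)"
   unfolding f_def[abs_def] differential_sum[OF X(1) C1_mult[OF FC1 thtC1]] differential_mult[OF FC1 thtC1] ..
  also have "... = p + (\<Sum>x\<in>X. F x z *\<^sub>R dif (tht x) z) - u z *\<^sub>R (\<Sum>x\<in>X. dif (tht x) z)"
   unfolding dtht by (simp add: p_def sum.distrib)
  also have "... = p + (\<Sum>x\<in>X. (F x z - u z) *\<^sub>R dif (tht x) z)"
   by (simp add: scaleR_sum_right scaleR_diff_left sum_subtractf)
  also have "(\<Sum>x\<in>X. (F x z - u z) *\<^sub>R dif (tht x) z) = (\<Sum>x\<in>X. s x *\<^sub>R dif (tht x) z)"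
   by (intro sum.cong) (auto simp: s_def differential_eventually_0[OF nsupp])
  finally have df: "dif f z = p + (\<Sum>x\<in>X. s x *\<^sub>R dif (tht x) z)" .
  have "G z p <= a + eps / 2" unfolding p_def
   by (rule convex_on_sum_le[OF G_convex X(1) tht1 tht0]) (use FG thtsupp in auto)
  moreover have "ALL x:X. \<bar>s x\<bar> <= eta0" using Fu eta0(1) by (auto simp: s_def eta_def)
  ultimately have "G z (p + (\<Sum>x\<in>X. s x *\<^sub>R dif (tht x) z)) <= a + eps / 2 + eps / 2"
   by (rule eta0(2))
  thus "G z (dif f z) <= a + eps" by (simp add: df)
 qed
qed

end

section \<open>Curves and the minimal action\<close>

text \<open>Every interval is cut at \<open>m\<close> by clamping its end points with
  \<open>min\<close> and with \<open>max\<close>; the two halves of the sum are then estimated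
  separately.\<close>

lemma abs_continuous_on_combine:
 assumes 1: "abs_continuous_on a m f" and 2: "abs_continuous_on m b f" and "a <= m" "m <= b"
 shows "abs_continuous_on a b f"
proof -
 \<comment> \<open>\<open>k\<close> is one of the two clampings, monotone and 1-Lipschitz. Intervals
   that become equal under it have collapsed to a point and contribute nothing, so passing to the
   set of images loses no increment.\<close>
 have half: "(\<Sum>(s, t)\<in>I. norm (f (k t) - f (k s))) < eps"
  if I: "finite I" "ALL (s, t):I. a <= s & s <= t & t <= b" "disj_ivs I" "(\<Sum>(s, t)\<in>I. t - s) < dlt"
   and k: "!!s t. s <= t ==> k s <= k t" "!!s t. s <= t ==> k t - k s <= t - s" "!!s. a <= s ==> s <= b ==> a' <= k s & k s <= b'"
    "!!s t. {k s<..<k t} \<subseteq> {s<..<t}"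
   and d: "!!I. finite I & (ALL (s, t):I. a' <= s & s <= t & t <= b') & disj_ivs I &
     (\<Sum>(s, t)\<in>I. t - s) < dlt ==> (\<Sum>(s, t)\<in>I. norm (f t - f s)) < eps"
  for I :: "(real \<times> real) set" and k a' b' dlt eps
 proof -
  let ?j = "%(s, t). (k s, k t)"
  have Ib: "!!s t. (s, t) \<in> I ==> a <= s & s <= t & t <= b" using I(2) by auto
  have dj: "{s<..<t} Int {s'<..<t'} = {}" if "(s, t) \<in> I" "(s', t') \<in> I" "(s, t) ~= (s', t')" for s t s' t'
   using disjoint_family_onD[OF I(3) that] by (simp only: prod.case)
  have coll: "k s = k t" if "(s, t) \<in> I" "(s', t') \<in> I" "(s, t) ~= (s', t')" "k s = k s'" "k t = k t'" for s t s' t'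
  proof -
   have "{k s<..<k t} \<subseteq> {s'<..<t'}" using k(4)[of s' t'] that by simp
   hence "{k s<..<k t} \<subseteq> {s<..<t} Int {s'<..<t'}" by (rule Int_greatest[OF k(4)])
   hence "{k s<..<k t} = {}" using dj[OF that(1-3)] by (simp only: subset_empty)
   moreover have "k s <= k t" using k(1) Ib[OF that(1)] by auto
   ultimately show ?thesis by auto
  qed
  have re: "(\<Sum>i\<in>?j ` I. h i) = (\<Sum>i\<in>I. h (?j i))" if h: "!!s. h (s, s) = 0" for h :: "real \<times> real => real"
  proof (subst sum.reindex_nontrivial)
   fix i i' assume i: "i \<in> I" "i' \<in> I" "i ~= i'" "?j i = ?j i'"
   obtain s t s' t' where ii: "i = (s, t)" "i' = (s', t')" by (cases i; cases i') auto
   have "k s = k t" using coll[of s t s' t'] i ii by auto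
   thus "h (?j i) = 0" using h ii by auto
  qed (auto simp: I(1) comp_def)
  have "(\<Sum>(s, t)\<in>?j ` I. norm (f t - f s)) < eps"
  proof (rule d, intro conjI)
   show "finite (?j ` I)" using I(1) by simp
   show "ALL (s, t):?j ` I. a' <= s & s <= t & t <= b'"
   proof (clarify, intro conjI)
    fix s t assume "(s, t) \<in> I"
    hence st: "a <= s" "s <= t" "t <= b" using Ib by auto
    show "a' <= k s" "k s <= k t" "k t <= b'" using k(3)[of s] k(3)[of t] k(1)[of s t] st by auto
   qed
   show "disj_ivs (?j ` I)"
    unfolding disjoint_family_on_def
   proof (intro ballI impI)
    fix m n assume mn: "m \<in> ?j ` I" "n \<in> ?j ` I" "m ~= n"
    then obtain s t s' t' where *: "(s, t) \<in> I" "(s', t') \<in> I" "m = (k s, k t)" "n = (k s', k t')" by auto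
    hence "(s, t) ~= (s', t')" using mn by auto
    hence "{s<..<t} Int {s'<..<t'} = {}" using dj * by blast
    moreover have "{k s<..<k t} Int {k s'<..<k t'} \<subseteq> {s<..<t} Int {s'<..<t'}" by (rule Int_mono[OF k(4) k(4)])
    ultimately have "{k s<..<k t} Int {k s'<..<k t'} = {}" by (simp only: subset_empty)
    thus "(case m of (s, t) => {s<..<t}) Int (case n of (s, t) => {s<..<t}) = {}"
     using * by (simp only: prod.case)
   qed
   have "(\<Sum>(s, t)\<in>?j ` I. t - s) = (\<Sum>(s, t)\<in>I. k t - k s)"
    using re[of "%(s, t). t - s"] by (simp add: case_prod_beta)
   also have "... <= (\<Sum>(s, t)\<in>I. t - s)" using Ib k(2) by (intro sum_mono) auto
   finally show "(\<Sum>(s, t)\<in>?j ` I. t - s) < dlt" using I(4) by simp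
  qed
  thus ?thesis using re[of "%(s, t). norm (f t - f s)"] by (simp add: case_prod_beta)
 qed
 show ?thesis unfolding abs_continuous_on_def
 proof (intro allI impI)
  fix eps :: real assume "eps > 0"
  hence e2: "eps / 2 > 0" by simp
  obtain dlt1 where d1: "dlt1 > 0" "!!I. finite I & (ALL (s, t):I. a <= s & s <= t & t <= m) & disj_ivs I &
     (\<Sum>(s, t)\<in>I. t - s) < dlt1 ==> (\<Sum>(s, t)\<in>I. norm (f t - f s)) < eps / 2"
   by (rule abs_continuous_onD[OF 1 e2], rule that, assumption, blast)
  obtain dlt2 where d2: "dlt2 > 0" "!!I. finite I & (ALL (s, t):I. m <= s & s <= t & t <= b) & disj_ivs I &
     (\<Sum>(s, t)\<in>I. t - s) < dlt2 ==> (\<Sum>(s, t)\<in>I. norm (f t - f s)) < eps / 2"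
   by (rule abs_continuous_onD[OF 2 e2], rule that, assumption, blast)
  show "EX dlt>0. ALL I. finite I & (ALL (s, t):I. a <= s & s <= t & t <= b) & disj_ivs I &
    (\<Sum>(s, t)\<in>I. t - s) < dlt --> (\<Sum>(s, t)\<in>I. norm (f t - f s)) < eps"
  proof (intro exI[of _ "min dlt1 dlt2"] conjI allI impI)
   show "min dlt1 dlt2 > 0" using d1 d2 by simp
   fix I :: "(real \<times> real) set"
   assume "finite I & (ALL (s, t):I. a <= s & s <= t & t <= b) & disj_ivs I &
     (\<Sum>(s, t)\<in>I. t - s) < min dlt1 dlt2"
   hence I: "finite I" "ALL (s, t):I. a <= s & s <= t & t <= b" "disj_ivs I"
    "(\<Sum>(s, t)\<in>I. t - s) < dlt1" "(\<Sum>(s, t)\<in>I. t - s) < dlt2" by auto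
   have A: "(\<Sum>(s, t)\<in>I. norm (f (min t m) - f (min s m))) < eps / 2"
   proof (rule half[OF I(1,2,3,4), where k = "%s. min s m" and a' = a and b' = m])
    fix I :: "(real \<times> real) set"
    assume "finite I & (ALL (s, t):I. a <= s & s <= t & t <= m) & disj_ivs I &
     (\<Sum>(s, t)\<in>I. t - s) < dlt1"
    thus "(\<Sum>(s, t)\<in>I. norm (f t - f s)) < eps / 2" by (rule d1(2))
   qed (use `a <= m` in auto)
   have B: "(\<Sum>(s, t)\<in>I. norm (f (max t m) - f (max s m))) < eps / 2"
   proof (rule half[OF I(1,2,3,5), where k = "%s. max s m" and a' = m and b' = b])
    fix I :: "(real \<times> real) set"
    assume "finite I & (ALL (s, t):I. m <= s & s <= t & t <= b) & disj_ivs I &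
     (\<Sum>(s, t)\<in>I. t - s) < dlt2"
    thus "(\<Sum>(s, t)\<in>I. norm (f t - f s)) < eps / 2" by (rule d2(2))
   qed (use `m <= b` in auto)
   have "(\<Sum>(s, t)\<in>I. norm (f t - f s)) <= (\<Sum>(s, t)\<in>I. norm (f (min t m) - f (min s m)) + norm (f (max t m) - f (max s m)))"
   proof (rule sum_mono, clarify)
    fix s t assume "(s, t) \<in> I"
    hence "s <= t" using I(2) by auto
    have "norm (f t - f s) <= norm (f m - f s) + norm (f t - f m)"
     using norm_triangle_ineq[of "f m - f s" "f t - f m"] by simp
    thus "norm (f t - f s) <= norm (f (min t m) - f (min s m)) + norm (f (max t m) - f (max s m))"
     using `s <= t` by (auto simp: min_def max_def)
   qed
   also have "... = (\<Sum>(s, t)\<in>I. norm (f (min t m) - f (min s m))) + (\<Sum>(s, t)\<in>I. norm (f (max t m) - f (max s m)))"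
    by (simp add: sum.distrib case_prod_beta)
   finally show "(\<Sum>(s, t)\<in>I. norm (f t - f s)) < eps" using A B by linarith
  qed
 qed
qed

lemma abs_continuous_on_shift:
 assumes "abs_continuous_on (a + d) (b + d) f"
 shows "abs_continuous_on a b (%s. f (s + d))"
 unfolding abs_continuous_on_def
proof (intro allI impI)
 fix eps :: real assume "eps > 0"
 obtain dlt where d: "dlt > 0" "!!I. finite I & (ALL (s, t):I. a + d <= s & s <= t & t <= b + d) & disj_ivs I &
    (\<Sum>(s, t)\<in>I. t - s) < dlt ==> (\<Sum>(s, t)\<in>I. norm (f t - f s)) < eps"
  by (rule abs_continuous_onD[OF assms `eps > 0`], rule that, assumption, blast)
 show "EX dlt>0. ALL I. finite I & (ALL (s, t):I. a <= s & s <= t & t <= b) & disj_ivs I &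
    (\<Sum>(s, t)\<in>I. t - s) < dlt --> (\<Sum>(s, t)\<in>I. norm (f (t + d) - f (s + d))) < eps"
 proof (intro exI[of _ dlt] conjI allI impI d(1))
  fix I :: "(real \<times> real) set"
  assume I: "finite I & (ALL (s, t):I. a <= s & s <= t & t <= b) & disj_ivs I &
    (\<Sum>(s, t)\<in>I. t - s) < dlt"
  let ?j = "%(s, t). (s + d, t + d)"
  have inj: "inj_on ?j I" by (auto simp: inj_on_def)
  have "(\<Sum>(s, t)\<in>?j ` I. norm (f t - f s)) < eps"
  proof (rule d(2), intro conjI)
   show "finite (?j ` I)" using I by simp
   show "ALL (s, t):?j ` I. a + d <= s & s <= t & t <= b + d" using I by auto
   show "disj_ivs (?j ` I)"
    unfolding disjoint_family_on_def
   proof (intro ballI impI)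
    fix m n assume mn: "m \<in> ?j ` I" "n \<in> ?j ` I" "m ~= n"
    then obtain s t s' t' where *: "(s, t) \<in> I" "(s', t') \<in> I" "m = (s + d, t + d)" "n = (s' + d, t' + d)" by auto
    hence "(s, t) ~= (s', t')" using mn by auto
    moreover have "disj_ivs I" using I by blast
    ultimately have dj: "{s<..<t} Int {s'<..<t'} = {}" using * unfolding disjoint_family_on_def by fastforce
    show "(case m of (s, t) => {s<..<t}) Int (case n of (s, t) => {s<..<t}) = {}"
     using dj * by (auto simp: min_def max_def split: if_splits)
   qed
   show "(\<Sum>(s, t)\<in>?j ` I. t - s) < dlt" using I by (subst sum.reindex[OF inj]) (simp add: comp_def case_prod_beta)
  qed
  thus "(\<Sum>(s, t)\<in>I. norm (f (t + d) - f (s + d))) < eps"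
   by (subst (asm) sum.reindex[OF inj]) (simp add: comp_def case_prod_beta)
 qed
qed

lemma abs_continuous_on_cong:
 assumes "abs_continuous_on a b f" "!!s. a <= s ==> s <= b ==> f s = h s"
 shows "abs_continuous_on a b h"
proof (rule abs_continuous_on_lipschitz_compose[OF assms(1), of 1])
 fix s t assume st: "a <= s" "s <= t" "t <= b"
 have "f s = h s" "f t = h t" using st by (auto intro!: assms(2))
 thus "norm (h t - h s) <= 1 * norm (f t - f s)" by simp
qed simp

lemma has_vector_derivative_shift_iff:
 fixes f :: "real => 'a::real_normed_vector"
 shows "((%x. f (x + d)) has_vector_derivative D) (at s) \<longleftrightarrow> (f has_vector_derivative D) (at (s + d))"
proof
 assume *: "((%x. f (x + d)) has_vector_derivative D) (at s)"
 have "((%x. x - d) has_vector_derivative 1) (at (s + d))" by (auto intro!: derivative_eq_intros)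
 from vector_diff_chain_at[OF this, of "%x. f (x + d)" D] * show "(f has_vector_derivative D) (at (s + d))"
  by (simp add: comp_def)
next
 assume *: "(f has_vector_derivative D) (at (s + d))"
 have "((%x. x + d) has_vector_derivative 1) (at s)" by (auto intro!: derivative_eq_intros)
 from vector_diff_chain_at[OF this, of f D] * show "((%x. f (x + d)) has_vector_derivative D) (at s)"
  by (simp add: comp_def)
qed

lemma vector_derivative_eventually_cong:
 assumes "\<forall>\<^sub>F x in nhds s. f x = h x"
 shows "vector_derivative f (at s) = vector_derivative h (at s)"
proof -
 have sym: "\<forall>\<^sub>F x in nhds s. h x = f x" using assms by (rule eventually_mono) simp
 have "(f has_vector_derivative D) (at s) \<longleftrightarrow> (h has_vector_derivative D) (at s)" for D
  unfolding has_vector_derivative_def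
  using has_derivative_eventually_eq[of f _ s h] has_derivative_eventually_eq[of h _ s f] assms sym by blast
 thus ?thesis unfolding vector_derivative_def by simp
qed

text \<open>A lower bound on a finite measure space makes the negative part integrable. This
  excludes infinity minus infinity in \<open>ereal_integral\<close>, whose value is then below
  infinity only for integrable \<open>f\<close>.\<close>

lemma ereal_integral_real:
 assumes m: "f \<in> borel_measurable M" and fin: "finite_measure M" and low: "!!x. - \<Lambda> <= f x"
 shows "integrable M f ==> ereal_integral M (%x. ereal (f x)) = ereal (integral\<^sup>L M f)"
  and "ereal_integral M (%x. ereal (f x)) < \<infinity> ==> integrable M f"
proof -
 have e: "ereal_integral M (%x. ereal (f x)) =
   enn2ereal (\<integral>\<^sup>+x. ennreal (f x) \<partial>M) - enn2ereal (\<integral>\<^sup>+x. ennreal (- f x) \<partial>M)"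
  by (simp add: ereal_integral_def e2ennreal_ereal)
 have "(\<integral>\<^sup>+x. ennreal (- f x) \<partial>M) <= (\<integral>\<^sup>+x. ennreal \<Lambda> \<partial>M)"
 proof (intro nn_integral_mono ennreal_leI)
  fix x show "- f x <= \<Lambda>" using low[of x] by linarith
 qed
 also have "... < \<infinity>" using finite_measure.emeasure_finite[OF fin, of "space M"]
  by (simp add: ennreal_mult_less_top less_top)
 finally have neg: "(\<integral>\<^sup>+x. ennreal (- f x) \<partial>M) ~= \<infinity>" by auto
 show "ereal_integral M (%x. ereal (f x)) = ereal (integral\<^sup>L M f)" if i: "integrable M f"
 proof -
  have pos: "(\<integral>\<^sup>+x. ennreal (f x) \<partial>M) ~= \<infinity>" using i unfolding real_integrable_def by simp
  have "enn2ereal a = ereal (enn2real a)" if "a ~= \<infinity>" for a :: ennreal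
   using that by (cases a) (auto simp: enn2ereal_ennreal)
  thus ?thesis unfolding e real_lebesgue_integral_def[OF i] using pos neg by simp
 qed
 show "integrable M f" if "ereal_integral M (%x. ereal (f x)) < \<infinity>"
 proof -
  have "(\<integral>\<^sup>+x. ennreal (f x) \<partial>M) ~= \<infinity>"
  proof
   assume "(\<integral>\<^sup>+x. ennreal (f x) \<partial>M) = \<infinity>"
   thus False using that neg unfolding e by (cases "\<integral>\<^sup>+x. ennreal (- f x) \<partial>M") (auto simp: enn2ereal_ennreal)
  qed
  thus ?thesis using m neg unfolding real_integrable_def by simp
 qed
qed

section \<open>The Lagrangian along curves\<close>

context hamiltonian
begin

abbreviation LV :: "(real => 'm) => real => real" where
 "LV gam s \<equiv> lagrangian G (gam s) (velocity A gam s)"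

lemma LV_chart:
 assumes c: "c \<in> A" and x: "gam s \<in> fst c" and cont: "isCont gam s"
  and der: "((snd c o gam) has_vector_derivative w) (at s)"
 shows "LV gam s = Lc c (snd c (gam s)) w"
proof -
 let ?d = "ch (gam s)"
 have T: "((snd ?d o ci c) has_derivative blinfun_apply (coord_change c ?d (gam s))) (at ((snd c o gam) s))"
  using transition_derivative(1)[OF c chart_at(1) x chart_at(2)] by simp
 have "(((snd ?d o ci c) o (snd c o gam)) has_vector_derivative blinfun_apply (coord_change c ?d (gam s)) w) (at s)"
  unfolding has_vector_derivative_def
  using diff_chain_at[OF der[unfolded has_vector_derivative_def] T] by (simp add: comp_def blinfun.scaleR_right)
 moreover have "\<forall>\<^sub>F r in nhds s. ((snd ?d o ci c) o (snd c o gam)) r = (snd ?d o gam) r"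
 proof -
  have "(gam \<longlongrightarrow> gam s) (nhds s)" using cont by (simp add: isCont_def tendsto_at_iff_tendsto_nhds)
  hence "\<forall>\<^sub>F r in nhds s. gam r \<in> fst c" using open_dom[OF c] x by (rule topological_tendstoD)
  thus ?thesis by (rule eventually_mono) (simp add: chart_inv_chart[OF c])
 qed
 ultimately have "((snd ?d o gam) has_vector_derivative blinfun_apply (coord_change c ?d (gam s)) w) (at s)"
  unfolding has_vector_derivative_def by (rule has_derivative_eventually_eq)
 hence "velocity A gam s = blinfun_apply (coord_change c ?d (gam s)) w"
  unfolding velocity_def by (rule vector_derivative_at)
 thus ?thesis using lagrangian_chart[OF c x] by simp
qed

text \<open>Bolzano bisection of the parameter interval: by continuity short pieces of the curve
  stay in one closed chart ball, so a property stable under concatenation need only be shown for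
  such pieces.\<close>

lemma curve_induct:
 fixes t a b :: real and gam :: "real => 'm"
 assumes cont: "continuous_on {0..t} gam" and ab: "0 <= a" "a <= b" "b <= t"
  and trans: "!!a b c. 0 <= a ==> a <= b ==> b <= c ==> c <= t ==> P a b ==> P b c ==> P a c"
  and local: "!!a b c y r. c \<in> A ==> cball y r \<subseteq> rng c ==> 0 <= a ==> a <= b ==> b <= t ==>
    (!!s. s \<in> {a..b} ==> gam s \<in> fst c & snd c (gam s) \<in> cball y r) ==> P a b"
 shows "P a b"
proof -
 define Q where "Q a b \<longleftrightarrow> (0 <= a & a <= b & b <= t --> P a b)" for a b
 have "Q a b" using ab(2)
 proof (induction rule: Bolzano)
  case (trans x y z)
  thus ?case unfolding Q_def using assms(5) by auto
 next
  case (local x)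
  hence x: "0 <= x" "x <= t" using ab by auto
  define c where "c = ch (gam x)"
  have c: "c \<in> A" "gam x \<in> fst c" using chart_at by (auto simp: c_def)
  obtain r where r: "r > 0" "cball (snd c (gam x)) r \<subseteq> UNIV Int rng c"
   unfolding c_def by (rule chart_ball_exists[OF open_UNIV UNIV_I])
  define S where "S = fst c Int snd c -` ball (snd c (gam x)) r"
  have oS: "open S" unfolding S_def by (rule continuous_open_preimage[OF chart_continuous[OF c(1)] open_dom[OF c(1)] open_ball])
  have xS: "gam x \<in> S" using c r by (simp add: S_def)
  have xs: "x \<in> {0..t}" using x by simp
  obtain W where W: "open W" "x \<in> W" "ALL s:{0..t}. s \<in> W --> gam s \<in> S"
   using cont[unfolded continuous_on_topological, THEN bspec, OF xs, THEN spec, THEN mp, OF oS, THEN mp, OF xS]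
   by (elim exE conjE)
  obtain d where d: "d > 0" "ball x d \<subseteq> W" using W(1,2) by (rule openE)
  show ?case
  proof (intro exI[of _ d] conjI allI impI d(1))
   fix a' b' assume *: "a' <= x & x <= b' & b' - a' < d"
   show "Q a' b'" unfolding Q_def
   proof
    assume **: "0 <= a' & a' <= b' & b' <= t"
    show "P a' b'"
    proof (rule assms(6)[OF c(1)])
     show "cball (snd c (gam x)) r \<subseteq> rng c" using r by simp
     fix s assume s: "s \<in> {a'..b'}"
     hence "s \<in> ball x d" using * by (auto simp: dist_real_def)
     hence "s \<in> W" using d(2) by (rule_tac subsetD)
     moreover have "s \<in> {0..t}" using s ** by simp
     ultimately have "gam s \<in> S" using W(3) by simp
     thus "gam s \<in> fst c & snd c (gam s) \<in> cball (snd c (gam x)) r" by (auto simp: S_def)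
    qed (use ** in auto)
   qed
  qed
 qed
 thus ?thesis using ab by (simp add: Q_def)
qed

lemma curve_chart_piece:
 assumes gam: "abs_continuous_curve A t gam" and c: "c \<in> A" and ab: "0 <= a" "a <= b" "b <= t"
  and dom: "!!s. s \<in> {a..b} ==> gam s \<in> fst c"
 obtains N w where "negligible N" "{a, b} \<subseteq> N" "abs_continuous_on a b (snd c o gam)" "continuous_on {a..b} (snd c o gam)"
  "ALL s:{a..b} - N. ((snd c o gam) has_vector_derivative w s) (at s)"
  "ALL s:{a..b} - N. LV gam s = Lc c (snd c (gam s)) (w s)"
proof -
 have cont: "continuous_on {0..t} gam" using gam by (simp add: abs_continuous_curve_def)
 have "gam ` {a..b} \<subseteq> fst c" using dom by auto
 hence ac: "abs_continuous_on a b (snd c o gam)" using gam c ab unfolding abs_continuous_curve_def by blast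
 \<comment> \<open>The end points join the null set because derivatives are two-sided, while the
   chart is only known to contain the curve on \<open>{a..b}\<close>.\<close>
 define N where "N = {s\<in>{a..b}. ~ (snd c o gam) differentiable (at s)} \<union> {a, b}"
 define w where "w s = vector_derivative (snd c o gam) (at s)" for s
 have "negligible N" unfolding N_def
  by (intro negligible_Un abs_continuous_on_differentiable_ae[OF ac ab(2)]) auto
 moreover have d: "((snd c o gam) has_vector_derivative w s) (at s)" if "s \<in> {a..b} - N" for s
  using that unfolding N_def w_def by (simp add: vector_derivative_works[symmetric])
 moreover have "LV gam s = Lc c (snd c (gam s)) (w s)" if s: "s \<in> {a..b} - N" for s
 proof (rule LV_chart[OF c dom _ d[OF s]])
  have "s \<in> interior {0..t}" using s ab by (auto simp: N_def interior_atLeastAtMost_real)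
  thus "isCont gam s" using cont by (rule continuous_on_interior[rotated])
 qed (use s in auto)
 moreover have "continuous_on {a..b} (snd c o gam)"
  by (rule continuous_on_compose) (use cont ab dom chart_continuous[OF c] in "auto intro: continuous_on_subset")
 moreover have "{a, b} \<subseteq> N" by (simp add: N_def)
 ultimately show ?thesis using that[of N w] ac by blast
qed

text \<open>In a chart the velocity is almost everywhere the limit of difference quotients and
  \<open>Lc\<close> is continuous, so the integrand is almost everywhere a limit of continuous
  functions.\<close>

lemma LV_measurable:
 assumes gam: "abs_continuous_curve A t gam" and "0 <= t"
 shows "LV gam \<in> borel_measurable (lebesgue_on {0..t})"
proof -
 have cont: "continuous_on {0..t} gam" using gam by (simp add: abs_continuous_curve_def)
 define P where "P a b \<longleftrightarrow> (%s. if s \<in> {a..b} then LV gam s else 0) \<in> borel_measurable lebesgue" for a b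
 have "P 0 t"
 proof (rule curve_induct[OF cont order_refl `0 <= t` order_refl])
  fix a b c :: real assume "a <= b" "b <= c" and P: "P a b" "P b c"
  have "(%s. if s \<in> {a..b} then (if s \<in> {a..b} then LV gam s else 0) else (if s \<in> {b..c} then LV gam s else 0)) \<in> borel_measurable lebesgue"
   by (rule measurable_If_set[OF P[unfolded P_def]]) simp
  moreover have "(%s. if s \<in> {a..b} then (if s \<in> {a..b} then LV gam s else 0) else (if s \<in> {b..c} then LV gam s else 0)) =
    (%s. if s \<in> {a..c} then LV gam s else 0)" using `a <= b` `b <= c` by (auto simp: fun_eq_iff)
  ultimately show "P a c" unfolding P_def by simp
 next
  fix a b c y r
  assume c: "c \<in> A" and r: "cball y r \<subseteq> rng c" and ab: "0 <= a" "a <= b" "b <= t"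
   and dom: "!!s. s \<in> {a..b} ==> gam s \<in> fst c & snd c (gam s) \<in> cball y r"
  obtain N w where N: "negligible N" "{a, b} \<subseteq> N" "abs_continuous_on a b (snd c o gam)" "continuous_on {a..b} (snd c o gam)"
   "ALL s:{a..b} - N. ((snd c o gam) has_vector_derivative w s) (at s)"
   "ALL s:{a..b} - N. LV gam s = Lc c (snd c (gam s)) (w s)"
   by (rule curve_chart_piece[OF gam c ab dom[THEN conjunct1]])
  define f where "f = snd c o gam"
  \<comment> \<open>\<open>min b\<close> keeps the shifted argument in the interval on which
    \<open>f\<close> is continuous; at a point \<open>s < b\<close> it has no effect once
    \<open>n\<close> is large.\<close>
  define D where "D n s = real n *\<^sub>R (f (min b (s + 1 / real n)) - f s)" for n s
  have cf: "continuous_on {a..b} f" using N(4) by (simp add: f_def)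
  have cD: "continuous_on {a..b} (D n)" for n
   unfolding D_def using ab
   by (intro continuous_intros continuous_on_compose2[OF cf] cf) (auto simp: add_increasing2)
  have cL: "continuous_on {a..b} (%s. (%(y, w). Lc c y w) (f s, D n s))" for n
   by (rule continuous_on_compose2[OF Lc_continuous[OF c]]) (use cf cD dom in "auto intro!: continuous_intros simp: f_def")
  let ?S = "{a..b} - N"
  have Nl: "N \<in> sets lebesgue" using N(1) by (simp add: negligible_imp_sets)
  have Sl: "?S \<in> sets lebesgue" using Nl by auto
  have "LV gam \<in> borel_measurable (lebesgue_on ?S)"
  proof (rule borel_measurable_LIMSEQ_real)
   show "(%s. Lc c (f s) (D n s)) \<in> borel_measurable (lebesgue_on ?S)" for n
    using continuous_on_subset[OF cL[of n], of ?S] by (intro continuous_imp_measurable_on_sets_lebesgue Sl) auto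
   fix s assume "s \<in> space (lebesgue_on ?S)"
   hence s: "s \<in> ?S" by simp
   hence "s < b" "a < s" using N(2) by (auto simp: less_le)
   have dv: "(f has_vector_derivative w s) (at s)" using bspec[OF N(5) s] by (simp add: f_def)
   have "(%n. D n s) \<longlonglongrightarrow> w s"
   proof -
    have "((%h. norm (f (s + h) - f s - h *\<^sub>R w s) / norm h) \<longlongrightarrow> 0) (at 0)"
     using dv unfolding has_vector_derivative_def has_derivative_at by blast
    moreover have "filterlim (%n. 1 / real n) (at 0) sequentially"
     unfolding filterlim_at using lim_1_over_n by (auto simp: eventually_sequentially intro!: exI[of _ 1])
    ultimately have lim: "(%n. norm (f (s + 1 / real n) - f s - (1 / real n) *\<^sub>R w s) / norm (1 / real n)) \<longlonglongrightarrow> 0"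
     by (rule filterlim_compose)
    have "(%n. norm (D n s - w s)) \<longlonglongrightarrow> 0"
    proof (rule Lim_transform_eventually[OF lim])
     obtain n0 where n0: "0 < n0" "1 / real n0 < b - s"
      using `s < b` ex_inverse_of_nat_less[of "b - s"] by (auto simp: inverse_eq_divide)
     have "norm (f (s + 1 / real n) - f s - (1 / real n) *\<^sub>R w s) / norm (1 / real n) = norm (D n s - w s)" if "n0 <= n" for n
     proof -
      have "n > 0" using that n0 by simp
      have "1 / real n <= 1 / real n0" using that n0 by (intro divide_left_mono) auto
      hence m: "min b (s + 1 / real n) = s + 1 / real n" using n0 by simp
      have "D n s - w s = real n *\<^sub>R (f (s + 1 / real n) - f s - (1 / real n) *\<^sub>R w s)"
       using `n > 0` by (simp add: D_def m scaleR_diff_right)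
      thus ?thesis by simp
     qed
     thus "\<forall>\<^sub>F n in sequentially. norm (f (s + 1 / real n) - f s - (1 / real n) *\<^sub>R w s) / norm (1 / real n) = norm (D n s - w s)"
      unfolding eventually_sequentially by blast
    qed
    hence "(%n. D n s - w s) \<longlonglongrightarrow> 0" by (rule tendsto_norm_zero_cancel)
    thus ?thesis by (simp add: LIM_zero_iff)
   qed
   have fs: "f s \<in> rng c" using dom[of s] s by (auto simp: f_def)
   have "isCont (%(y, w). Lc c y w) (f s, w s)"
    by (rule bspec[OF continuous_on_eq_continuous_at[THEN iffD1, OF open_Times[OF open_rng[OF c] open_UNIV] Lc_continuous[OF c]]])
     (use fs in simp)
   moreover have "(%n. (f s, D n s)) \<longlonglongrightarrow> (f s, w s)" using `(%n. D n s) \<longlonglongrightarrow> w s` by (intro tendsto_intros)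
   ultimately have "(%n. (%(y, w). Lc c y w) (f s, D n s)) \<longlonglongrightarrow> (%(y, w). Lc c y w) (f s, w s)"
    by (rule isCont_tendsto_compose)
   thus "(%n. Lc c (f s) (D n s)) \<longlonglongrightarrow> LV gam s" using bspec[OF N(6) s] by (simp add: f_def)
  qed
  moreover have "?S = {a..b} - (N Int {a..b})" by auto
  moreover have "N Int {a..b} \<in> null_sets (lebesgue_on {a..b})"
   using negligible_subset[OF N(1), of "N Int {a..b}"] by (subst null_sets_restrict_space) (auto simp: negligible_iff_null_sets)
  ultimately have "LV gam \<in> borel_measurable (lebesgue_on {a..b})"
   using borel_measurable_diff_null[of "N Int {a..b}" "{a..b}" "LV gam"] by simp
  thus "P a b" unfolding P_def by (subst borel_measurable_if) auto
 qed
 thus ?thesis unfolding P_def by (subst (asm) borel_measurable_if) auto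
qed

end

context hamiltonian
begin

text \<open>In a chart the chain rule holds almost everywhere along the curve; the fundamental
  theorem for absolutely continuous functions and Fenchel's inequality then give the estimate, piece
  by piece.\<close>

lemma C1_along_curve:
 assumes f: "f \<in> C1" and gam: "abs_continuous_curve A t gam" and int: "LV gam integrable_on {0..t}"
  and ab: "0 <= a" "a <= b" "b <= t"
  and bound: "!!s. s \<in> {a..b} ==> G (gam s) (dif f (gam s)) <= alp"
 shows "f (gam b) - f (gam a) <= integral {a..b} (LV gam) + alp * (b - a)"
proof -
 have cont: "continuous_on {0..t} gam" using gam by (simp add: abs_continuous_curve_def)
 have sub: "LV gam integrable_on {a'..b'}" if "0 <= a'" "b' <= t" for a' b'
  using integrable_subinterval_real[OF int, of a' b'] that by auto
 define P where "P a b \<longleftrightarrow> ((ALL s:{a..b}. G (gam s) (dif f (gam s)) <= alp) -->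
   f (gam b) - f (gam a) <= integral {a..b} (LV gam) + alp * (b - a))" for a b
 have "P a b"
 proof (rule curve_induct[OF cont ab])
  fix a b c :: real assume o: "0 <= a" "a <= b" "b <= c" "c <= t" and P: "P a b" "P b c"
  have "integral {a..b} (LV gam) + integral {b..c} (LV gam) = integral {a..c} (LV gam)"
   using o by (intro Henstock_Kurzweil_Integration.integral_combine sub) auto
  moreover have "(ALL s:{a..c}. G (gam s) (dif f (gam s)) <= alp) ==> (ALL s:{a..b}. G (gam s) (dif f (gam s)) <= alp) & (ALL s:{b..c}. G (gam s) (dif f (gam s)) <= alp)"
   using o by simp
  moreover have "alp * (b - a) + alp * (c - b) = alp * (c - a)" by (simp add: algebra_simps)
  ultimately show "P a c" using P unfolding P_def by fastforce
 next
  fix a b c y r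
  assume c: "c \<in> A" and r: "cball y r \<subseteq> rng c" and ab: "0 <= a" "a <= b" "b <= t"
   and dom: "!!s. s \<in> {a..b} ==> gam s \<in> fst c & snd c (gam s) \<in> cball y r"
  obtain N w where N: "negligible N" "{a, b} \<subseteq> N" "abs_continuous_on a b (snd c o gam)" "continuous_on {a..b} (snd c o gam)"
   "ALL s:{a..b} - N. ((snd c o gam) has_vector_derivative w s) (at s)"
   "ALL s:{a..b} - N. LV gam s = Lc c (snd c (gam s)) (w s)"
   by (rule curve_chart_piece[OF gam c ab dom[THEN conjunct1]])
  obtain D where D: "C1_grad (rng c) (f o ci c) D" by (rule C1_gradE[OF f c])
  have dD: "((f o ci c) has_derivative (%w. D z \<bullet> w)) (at z)" if "z \<in> rng c" for z
   using D that unfolding C1_grad_def by blast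
  have "continuous_on (cball y r) D" using D r unfolding C1_grad_def by (auto intro: continuous_on_subset)
  hence "bounded (D ` cball y r)" by (intro compact_imp_bounded compact_continuous_image) auto
  hence "EX B. ALL z:cball y r. norm (D z) <= B" unfolding bounded_iff by simp
  then obtain B where "ALL z:cball y r. norm (D z) <= B" by (elim exE)
  note B = bspec[OF this]
  have lip: "norm ((f o ci c) z - (f o ci c) z') <= B * norm (z - z')" if "z \<in> cball y r" "z' \<in> cball y r" for z z'
  proof (rule differentiable_bound[OF convex_cball _ _ that])
   fix z assume z: "z \<in> cball y r"
   hence "z \<in> rng c" using r by (rule_tac subsetD)
   thus "((f o ci c) has_derivative (%w. D z \<bullet> w)) (at z within cball y r)"
    by (rule has_derivative_at_withinI[OF dD])
   show "onorm (%w. D z \<bullet> w) <= B"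
   proof (rule onorm_bound)
    show "0 <= B" by (rule order_trans[OF norm_ge_zero B[OF z]])
    fix w show "norm (D z \<bullet> w) <= B * norm w"
     using Cauchy_Schwarz_ineq2[of "D z" w] mult_right_mono[OF B[OF z], of "norm w"] by simp
   qed
  qed
  define F where "F s = f (gam s)" for s
  have F: "F s = (f o ci c) ((snd c o gam) s)" if "s \<in> {a..b}" for s
   using dom[OF that] chart_inv_chart[OF c] by (simp add: F_def)
  have B0: "0 <= B"
  proof -
   have "snd c (gam a) \<in> cball y r" using dom[of a] ab by simp
   thus ?thesis by (rule order_trans[OF norm_ge_zero B])
  qed
  have acF: "abs_continuous_on a b F"
  proof (rule abs_continuous_on_lipschitz_compose[OF N(3) B0])
   fix s t assume st: "a <= s" "s <= t" "t <= b"
   hence m: "s \<in> {a..b}" "t \<in> {a..b}" by auto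
   show "norm (F t - F s) <= B * norm ((snd c o gam) t - (snd c o gam) s)"
    unfolding F[OF m(1)] F[OF m(2)] by (rule lip) (use dom m in auto)
  qed
  \<comment> \<open>On the null set the value is set equal to the bound, so that the pointwise
    comparison of integrands holds everywhere.\<close>
  define g' where "g' s = (if s \<in> N then LV gam s + alp else D (snd c (gam s)) \<bullet> w s)" for s
  have "(g' has_integral (F b - F a)) {a..b}"
  proof (rule abs_continuous_on_has_integral[OF acF ab(2) N(1)])
   fix s assume s: "s \<in> {a..b} - N"
   have sab: "a < s" "s < b" using s N(2) by (auto simp: less_le)
   have zr: "(snd c o gam) s \<in> rng c" using dom[of s] s r by auto
   have "((snd c o gam) has_derivative (%x. x *\<^sub>R w s)) (at s)"
    using bspec[OF N(5) s] by (simp add: has_vector_derivative_def)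
   from diff_chain_at[OF this dD[OF zr]]
   have "(((f o ci c) o (snd c o gam)) has_derivative (%x. (D (snd c (gam s)) \<bullet> w s) * x)) (at s)"
    by (simp add: comp_def mult.commute)
   moreover have "\<forall>\<^sub>F x in nhds s. ((f o ci c) o (snd c o gam)) x = F x"
   proof -
    have "\<forall>\<^sub>F x in nhds s. x \<in> {a<..<b}" using sab by (intro eventually_nhds_in_open) auto
    thus ?thesis by (rule eventually_mono) (use F in auto)
   qed
   ultimately have "(F has_derivative (%x. (D (snd c (gam s)) \<bullet> w s) * x)) (at s)"
    by (rule has_derivative_eventually_eq)
   thus "(F has_real_derivative g' s) (at s)" using s by (simp add: g'_def has_field_derivative_def)
  qed
  show "P a b" unfolding P_def
  proof
   assume le: "ALL s:{a..b}. G (gam s) (dif f (gam s)) <= alp"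
   have "((%s. LV gam s + alp) has_integral (integral {a..b} (LV gam) + alp * (b - a))) {a..b}"
    using has_integral_add[OF integrable_integral[OF sub[OF ab(1,3)]] has_integral_const_real[of alp a b]] ab
    by (simp add: mult.commute)
   moreover have "g' s <= LV gam s + alp" if s: "s \<in> {a..b}" for s
   proof (cases "s \<in> N")
    case False
    have x: "gam s \<in> fst c" "snd c (gam s) \<in> rng c" using dom[OF s] by auto
    have "D (snd c (gam s)) \<bullet> w s - Hc c (snd c (gam s)) (D (snd c (gam s))) <= Lc c (snd c (gam s)) (w s)"
     by (rule Lc_ge[OF c x(2)])
    moreover have "G (gam s) (dif f (gam s)) = Hc c (snd c (gam s)) (D (snd c (gam s)))"
     by (rule G_differential[OF c x(1) dD[OF x(2)]])
    moreover have "LV gam s = Lc c (snd c (gam s)) (w s)" using N(6) s False by blast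
    moreover have "G (gam s) (dif f (gam s)) <= alp" using le s by blast
    ultimately show ?thesis using False unfolding g'_def by simp
   qed (simp add: g'_def)
   ultimately have "F b - F a <= integral {a..b} (LV gam) + alp * (b - a)"
    by (rule has_integral_le[OF `(g' has_integral (F b - F a)) {a..b}`])
   thus "f (gam b) - f (gam a) <= integral {a..b} (LV gam) + alp * (b - a)" by (simp add: F_def)
  qed
 qed
 thus ?thesis using bound unfolding P_def by blast
qed

section \<open>The minimal action\<close>

text \<open>As the Lagrangian is bounded below, these are exactly the absolutely continuous curves
  of finite action (\<open>adm_action\<close>, \<open>adm_if_finite_action\<close>), and for them
  the action is an ordinary integral.\<close>

definition adm :: "real => (real => 'm) => bool" where
 "adm t gam \<longleftrightarrow> abs_continuous_curve A t gam & LV gam integrable_on {0..t}"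

abbreviation h :: "real => 'm => 'm => ereal" where "h t x y \<equiv> minimal_action A G t x y"

lemma adm_action:
 assumes "adm t gam" "0 <= t"
 shows "ereal_integral (lebesgue_on {0..t}) (%s. ereal (LV gam s)) = ereal (integral {0..t} (LV gam))"
proof -
 obtain \<Lambda> where \<Lambda>: "!!x v. - \<Lambda> <= lagrangian G x v" using lagrangian_lower_bound by blast
 have m: "LV gam \<in> borel_measurable (lebesgue_on {0..t})"
  using assms by (intro LV_measurable) (auto simp: adm_def)
 have fin: "finite_measure (lebesgue_on {0..t})" by (rule finite_measure_lebesgue_on) auto
 have "(%s. LV gam s + \<Lambda>) integrable_on {0..t}" using assms by (auto simp: adm_def intro!: integrable_add integrable_const_ivl)
 hence "(%s. LV gam s + \<Lambda>) absolutely_integrable_on {0..t}"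
 proof (rule nonnegative_absolutely_integrable_1)
  fix s show "0 <= LV gam s + \<Lambda>" using \<Lambda>[of "gam s" "velocity A gam s"] by linarith
 qed
 hence "integrable (lebesgue_on {0..t}) (%s. LV gam s + \<Lambda>)" by (rule absolutely_integrable_imp_integrable) auto
 hence "integrable (lebesgue_on {0..t}) (%s. (LV gam s + \<Lambda>) - \<Lambda>)"
  using finite_measure.integrable_const[OF fin] by (intro Bochner_Integration.integrable_diff) auto
 hence i: "integrable (lebesgue_on {0..t}) (LV gam)" by simp
 show ?thesis
  using ereal_integral_real(1)[OF m fin _ i] \<Lambda> lebesgue_integral_eq_integral[OF i] by auto
qed

lemma adm_if_finite_action:
 assumes gam: "abs_continuous_curve A t gam" "0 <= t"
  and fin_act: "ereal_integral (lebesgue_on {0..t}) (%s. ereal (LV gam s)) < \<infinity>"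
 shows "adm t gam"
proof -
 obtain \<Lambda> where \<Lambda>: "!!x v. - \<Lambda> <= lagrangian G x v" using lagrangian_lower_bound by blast
 have "integrable (lebesgue_on {0..t}) (LV gam)"
  by (rule ereal_integral_real(2)[OF LV_measurable[OF gam] finite_measure_lebesgue_on _ fin_act]) (use \<Lambda> in auto)
 hence "LV gam integrable_on {0..t}" by (rule integrable_on_lebesgue_on) auto
 thus ?thesis using gam by (simp add: adm_def)
qed

lemma h_le:
 assumes "adm t gam" "0 <= t"
 shows "h t (gam 0) (gam t) <= ereal (integral {0..t} (LV gam))"
 unfolding minimal_action_def adm_action[OF assms, symmetric]
 by (rule INF_lower) (use assms in "auto simp: adm_def")

lemma h_curve:
 assumes "h t x y < ereal r" "0 <= t"
 obtains gam where "adm t gam" "gam 0 = x" "gam t = y" "integral {0..t} (LV gam) < r"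
proof -
 obtain gam where gam: "abs_continuous_curve A t gam" "gam 0 = x" "gam t = y"
  "ereal_integral (lebesgue_on {0..t}) (%s. ereal (LV gam s)) < ereal r"
  using assms(1) unfolding minimal_action_def INF_less_iff by blast
 have a: "adm t gam"
  by (rule adm_if_finite_action[OF gam(1) assms(2) less_trans[OF gam(4)]]) simp
 show ?thesis using that[OF a gam(2,3)] gam(4) adm_action[OF a assms(2)] by simp
qed

lemma velocity_shift: "velocity A (%r. gam (r + d)) s = velocity A gam (s + d)"
proof -
 have "((snd c o (%r. gam (r + d))) has_vector_derivative D) (at s) \<longleftrightarrow> ((snd c o gam) has_vector_derivative D) (at (s + d))" for c :: "('m, 'e) chart" and D
  using has_vector_derivative_shift_iff[of "snd c o gam" d D s] by (simp add: comp_def)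
 thus ?thesis unfolding velocity_def vector_derivative_def by simp
qed

lemma velocity_cong:
 assumes "\<forall>\<^sub>F r in nhds s. gam r = gam' r"
 shows "velocity A gam s = velocity A gam' s"
proof -
 have "gam s = gam' s" using eventually_nhds_x_imp_x[OF assms] .
 moreover have "\<forall>\<^sub>F r in nhds s. (snd c o gam) r = (snd c o gam') r" for c :: "('m, 'e) chart"
  using assms by (rule eventually_mono) simp
 ultimately show ?thesis unfolding velocity_def by (simp add: vector_derivative_eventually_cong)
qed

lemma adm_sub:
 assumes gam: "adm t gam" and s: "0 <= s" "s <= r" "r <= t"
 shows "adm (r - s) (%tau. gam (tau + s))" and "integral {0..r - s} (LV (%tau. gam (tau + s))) = integral {s..r} (LV gam)"
proof -
 have AC: "abs_continuous_curve A t gam" and int: "LV gam integrable_on {0..t}" using gam by (auto simp: adm_def)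
 have sub: "LV gam integrable_on {s..r}" using integrable_subinterval_real[OF int, of s r] s by auto
 have eq: "LV (%tau. gam (tau + s)) = (%tau. LV gam (tau + s))" by (simp add: velocity_shift)
 have im: "(%x. (1 / 1) *\<^sub>R x + - ((1 / 1) *\<^sub>R s)) ` cbox s r = {0..r - s}"
  using s by (simp add: image_add_atLeastAtMost')
 have "((%x. LV gam (1 *\<^sub>R x + s)) has_integral (1 / (\<bar>1\<bar> ^ DIM(real))) *\<^sub>R integral {s..r} (LV gam))
   ((%x. (1 / 1) *\<^sub>R x + - ((1 / 1) *\<^sub>R s)) ` cbox s r)"
  by (rule has_integral_affinity) (use integrable_integral[OF sub] in auto)
 hence hi: "(LV (%tau. gam (tau + s)) has_integral integral {s..r} (LV gam)) {0..r - s}"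
  unfolding im eq by simp
 thus "integral {0..r - s} (LV (%tau. gam (tau + s))) = integral {s..r} (LV gam)" by (rule integral_unique)
 have "abs_continuous_curve A (r - s) (%tau. gam (tau + s))"
  unfolding abs_continuous_curve_def
 proof (intro conjI ballI allI impI)
  have "continuous_on {0..t} gam" using AC by (simp add: abs_continuous_curve_def)
  thus "continuous_on {0..r - s} (%tau. gam (tau + s))"
   by (rule continuous_on_compose2) (use s in "auto intro!: continuous_intros")
  fix c a b assume c: "c \<in> A" and ab: "0 <= a & a <= b & b <= r - s & (%tau. gam (tau + s)) ` {a..b} \<subseteq> fst c"
  have "gam ` {a + s..b + s} = (%tau. gam (tau + s)) ` {a..b}"
   by (simp add: image_image[of gam "%tau. tau + s", symmetric])
  hence "abs_continuous_on (a + s) (b + s) (snd c o gam)"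
   using AC c ab s unfolding abs_continuous_curve_def by auto
  from abs_continuous_on_shift[OF this] show "abs_continuous_on a b (snd c o (%tau. gam (tau + s)))" by (simp add: comp_def)
 qed
 thus "adm (r - s) (%tau. gam (tau + s))" using hi unfolding adm_def by blast
qed

lemma h_le_sub:
 assumes "adm t gam" "0 <= s" "s <= r" "r <= t"
 shows "h (r - s) (gam s) (gam r) <= ereal (integral {s..r} (LV gam))"
 using h_le[OF adm_sub(1)[OF assms]] adm_sub(2)[OF assms] assms by simp

lemma adm_concat:
 assumes 1: "adm s gam1" and 2: "adm t gam2" and st: "0 <= s" "0 <= t" and eq: "gam1 s = gam2 0"
 defines "gam \<equiv> %tau. if tau <= s then gam1 tau else gam2 (tau - s)"
 shows "adm (s + t) gam" and "integral {0..s + t} (LV gam) = integral {0..s} (LV gam1) + integral {0..t} (LV gam2)"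
proof -
 have gam1: "gam tau = gam1 tau" if "tau <= s" for tau using that by (simp add: gam_def)
 have gam2: "gam tau = gam2 (tau - s)" if "s <= tau" for tau using that eq by (cases "tau = s") (auto simp: gam_def)
 have LV1: "LV gam tau = LV gam1 tau" if "tau < s" for tau
 proof -
  have "\<forall>\<^sub>F r in nhds tau. r \<in> {..<s}" using that by (intro eventually_nhds_in_open) auto
  hence "\<forall>\<^sub>F r in nhds tau. gam r = gam1 r" by (rule eventually_mono) (simp add: gam1)
  thus ?thesis using velocity_cong gam1 that by simp
 qed
 have LV2: "LV gam tau = LV gam2 (tau - s)" if "s < tau" for tau
 proof -
  have "\<forall>\<^sub>F r in nhds tau. r \<in> {s<..}" using that by (intro eventually_nhds_in_open) auto
  hence "\<forall>\<^sub>F r in nhds tau. gam r = gam2 (r + - s)" by (rule eventually_mono) (simp add: gam2)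
  hence "velocity A gam tau = velocity A gam2 (tau + - s)" using velocity_cong velocity_shift by metis
  thus ?thesis using gam2 that by simp
 qed
 have i1: "(LV gam has_integral integral {0..s} (LV gam1)) {0..s}"
 proof (rule has_integral_spike[of "{s}"])
  show "(LV gam1 has_integral integral {0..s} (LV gam1)) {0..s}" using 1 by (auto simp: adm_def)
 qed (use LV1 in auto)
 have i2: "(LV gam has_integral integral {0..t} (LV gam2)) {s..s + t}"
 proof (rule has_integral_spike[of "{s}"])
  have im: "(%x. (1 / 1) *\<^sub>R x + - ((1 / 1) *\<^sub>R (- s))) ` cbox 0 t = {s..s + t}"
   using st by (simp add: image_add_atLeastAtMost' add.commute)
  have "((%x. LV gam2 (1 *\<^sub>R x + - s)) has_integral (1 / (\<bar>1\<bar> ^ DIM(real))) *\<^sub>R integral {0..t} (LV gam2))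
   ((%x. (1 / 1) *\<^sub>R x + - ((1 / 1) *\<^sub>R (- s))) ` cbox 0 t)"
   by (rule has_integral_affinity) (use 2 in "auto simp: adm_def")
  thus "((%tau. LV gam2 (tau - s)) has_integral integral {0..t} (LV gam2)) {s..s + t}" unfolding im by simp
 qed (use LV2 in auto)
 have i: "(LV gam has_integral integral {0..s} (LV gam1) + integral {0..t} (LV gam2)) {0..s + t}"
  by (rule has_integral_combine[OF _ _ i1 i2]) (use st in auto)
 thus "integral {0..s + t} (LV gam) = integral {0..s} (LV gam1) + integral {0..t} (LV gam2)" by (rule integral_unique)
 have "abs_continuous_curve A (s + t) gam" unfolding abs_continuous_curve_def
 proof (intro conjI ballI allI impI)
  have c1: "continuous_on {0..s} gam1" and c2: "continuous_on {0..t} gam2"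
   using 1 2 by (auto simp: adm_def abs_continuous_curve_def)
  have "continuous_on {0..s} gam" by (rule continuous_on_eq[OF c1]) (simp add: gam1)
  moreover have "continuous_on {s..s + t} gam"
  proof (rule continuous_on_eq)
   show "continuous_on {s..s + t} (%tau. gam2 (tau - s))"
    by (rule continuous_on_compose2[OF c2]) (auto intro!: continuous_intros)
  qed (simp add: gam2)
  moreover have "{0..s + t} = {0..s} \<union> {s..s + t}" using st by auto
  ultimately show "continuous_on {0..s + t} gam" by (simp add: continuous_on_closed_Un)
  fix c a b assume c: "c \<in> A" and ab: "0 <= a & a <= b & b <= s + t & gam ` {a..b} \<subseteq> fst c"
  have A1: "abs_continuous_on a' b' (snd c o gam)" if "a <= a'" "a' <= b'" "b' <= b" "b' <= s" for a' b'
  proof (rule abs_continuous_on_cong)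
   have "gam1 ` {a'..b'} \<subseteq> fst c"
   proof
    fix x assume "x \<in> gam1 ` {a'..b'}"
    then obtain tau where "tau \<in> {a'..b'}" "x = gam1 tau" by auto
    hence "x = gam tau" "tau \<in> {a..b}" using that gam1[of tau] by auto
    thus "x \<in> fst c" using ab by auto
   qed
   thus "abs_continuous_on a' b' (snd c o gam1)"
    using 1 c ab that unfolding adm_def abs_continuous_curve_def by auto
  qed (use that gam1 in auto)
  have A2: "abs_continuous_on a' b' (snd c o gam)" if "a <= a'" "a' <= b'" "b' <= b" "s <= a'" for a' b'
  proof (rule abs_continuous_on_cong)
   have "gam2 ` {a' - s..b' - s} \<subseteq> fst c"
   proof
    fix x assume "x \<in> gam2 ` {a' - s..b' - s}"
    then obtain tau where "tau \<in> {a' - s..b' - s}" "x = gam2 tau" by auto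
    hence "x = gam (tau + s)" "tau + s \<in> {a..b}" using that gam2[of "tau + s"] by auto
    thus "x \<in> fst c" using ab by auto
   qed
   hence "abs_continuous_on (a' + - s) (b' + - s) (snd c o gam2)"
    using 2 c ab that unfolding adm_def abs_continuous_curve_def by auto
   from abs_continuous_on_shift[OF this] show "abs_continuous_on a' b' (%tau. (snd c o gam2) (tau + - s))" .
  qed (use that gam2 in auto)
  consider "b <= s" | "s <= a" | "a <= s" "s <= b" by linarith
  thus "abs_continuous_on a b (snd c o gam)"
  proof cases
   case 1 thus ?thesis using A1[of a b] ab by auto
  next
   case 2 thus ?thesis using A2[of a b] ab by auto
  next
   case 3 thus ?thesis using abs_continuous_on_combine[OF A1[of a s] A2[of s b]] by auto
  qed
 qed
 thus "adm (s + t) gam" using i unfolding adm_def by blast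
qed

text \<open>Here and below the extended real action is handled through real upper bounds, which
  avoids arithmetic with infinities.\<close>

lemma h_triangle:
 assumes "h s x y <= ereal r1" "h t y z <= ereal r2" "0 <= s" "0 <= t"
 shows "h (s + t) x z <= ereal (r1 + r2)"
proof (rule ereal_le_epsilon2)
 fix e :: real assume "e > 0"
 have l1: "h s x y < ereal (r1 + e / 2)" and l2: "h t y z < ereal (r2 + e / 2)"
  using assms `e > 0` by (auto elim: le_less_trans)
 obtain gam1 where 1: "adm s gam1" "gam1 0 = x" "gam1 s = y" "integral {0..s} (LV gam1) < r1 + e / 2" by (rule h_curve[OF l1 assms(3)])
 obtain gam2 where 2: "adm t gam2" "gam2 0 = y" "gam2 t = z" "integral {0..t} (LV gam2) < r2 + e / 2" by (rule h_curve[OF l2 assms(4)])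
 have eq: "gam1 s = gam2 0" using 1 2 by simp
 define gam where "gam tau = (if tau <= s then gam1 tau else gam2 (tau - s))" for tau
 have a: "adm (s + t) gam" "integral {0..s + t} (LV gam) = integral {0..s} (LV gam1) + integral {0..t} (LV gam2)"
  using adm_concat[OF 1(1) 2(1) assms(3,4) eq] unfolding gam_def by auto
 have "gam 0 = x" "gam (s + t) = z" using 1 2 assms by (auto simp: gam_def)
 hence "h (s + t) x z <= ereal (integral {0..s + t} (LV gam))" using h_le[OF a(1)] assms by simp
 also have "... <= ereal (r1 + r2 + e)" using a(2) 1(4) 2(4) by simp
 finally show "h (s + t) x z <= ereal (r1 + r2) + ereal e" by simp
qed

lemma h_split:
 assumes "h (s + t) x z < ereal r" "0 <= s" "0 <= t"
 obtains y r1 r2 where "h s x y <= ereal r1" "h t y z <= ereal r2" "r1 + r2 < r"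
proof -
 obtain gam where gam: "adm (s + t) gam" "gam 0 = x" "gam (s + t) = z" "integral {0..s + t} (LV gam) < r"
  by (rule h_curve[OF assms(1)]) (use assms in auto)
 have "h (s - 0) (gam 0) (gam s) <= ereal (integral {0..s} (LV gam))" by (rule h_le_sub[OF gam(1)]) (use assms in auto)
 moreover have "h (s + t - s) (gam s) (gam (s + t)) <= ereal (integral {s..s + t} (LV gam))" by (rule h_le_sub[OF gam(1)]) (use assms in auto)
 moreover have "integral {0..s} (LV gam) + integral {s..s + t} (LV gam) = integral {0..s + t} (LV gam)"
  using gam(1) assms by (intro Henstock_Kurzweil_Integration.integral_combine) (auto simp: adm_def)
 ultimately show ?thesis using that[of "gam s" "integral {0..s} (LV gam)" "integral {s..s + t} (LV gam)"] gam by simp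
qed

lemma C1_dominated:
 assumes "f \<in> C1" "!!x. G x (dif f x) <= a" "h t x y <= ereal r" "0 <= t"
 shows "f y - f x <= r + a * t"
proof (rule field_le_epsilon)
 fix e :: real assume "e > 0"
 hence l: "h t x y < ereal (r + e)" using assms(3) by (auto elim: le_less_trans)
 obtain gam where gam: "adm t gam" "gam 0 = x" "gam t = y" "integral {0..t} (LV gam) < r + e" by (rule h_curve[OF l assms(4)])
 have "f (gam t) - f (gam 0) <= integral {0..t} (LV gam) + a * (t - 0)"
  by (rule C1_along_curve[OF assms(1)]) (use gam(1) assms in "auto simp: adm_def")
 thus "f y - f x <= r + a * t + e" using gam by simp
qed

lemma h_lower_bound: "EX \<Lambda>>=0. ALL t x y r. 0 <= t --> h t x y <= ereal r --> - \<Lambda> * t <= r"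
proof -
 obtain B where B: "B > 0" "!!x. \<bar>G x (dif (%_. 0) x)\<bar> <= B"
  using bounded_continuous[OF G_differential_continuous[OF C1_const[of 0]]] by blast
 have "- B * t <= r" if "0 <= t" "h t x y <= ereal r" for t x y r
 proof -
  have "(0::real) - 0 <= r + B * t"
   by (rule C1_dominated[OF C1_const[of 0] _ that(2,1)]) (use B(2) in "auto simp: abs_le_iff")
  thus ?thesis by simp
 qed
 thus ?thesis using B(1) by (intro exI[of _ B]) auto
qed

definition dominated :: "('m => real) => real => bool" where
 "dominated u a \<longleftrightarrow> (ALL x y t r. 0 < t --> h t x y <= ereal r --> u y - u x <= r + a * t)"

text \<open>For C1 functions domination is integration along curves (\<open>C1_dominated\<close>); a
  subsolution inherits it from its C1 approximations.\<close>

lemma vsub_dominated: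
 assumes "vsub u a"
 shows "dominated u a"
 unfolding dominated_def
proof (intro allI impI)
 fix x y t r assume t: "0 < (t::real)" and h: "h t x y <= ereal r"
 show "u y - u x <= r + a * t"
 proof (rule field_le_epsilon)
  fix e :: real assume "e > 0"
  \<comment> \<open>One \<open>eps\<close> is lost at each end point and \<open>eps * t\<close>
    through the level.\<close>
  define eps where "eps = e / (2 + t)"
  have "eps > 0" using `e > 0` t by (simp add: eps_def)
  obtain f where f: "f \<in> C1" "!!x. \<bar>f x - u x\<bar> <= eps" "!!x. G x (dif f x) <= a + eps"
   by (rule vsub_smooth[OF assms `eps > 0`]) blast
  have "f y - f x <= r + (a + eps) * t" by (rule C1_dominated[OF f(1,3) h]) (use t in auto)
  moreover have "u y <= f y + eps" "f x <= u x + eps" using f(2)[of x] f(2)[of y] by auto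
  moreover have "eps * (2 + t) = e" using t by (simp add: eps_def)
  ultimately show "u y - u x <= r + a * t + e" by (simp add: algebra_simps)
 qed
qed

end

section \<open>Dominated functions and the Peierls barrier\<close>

lemma ereal_ge_if_real_bounds:
 assumes "!!r. x <= ereal r ==> b <= r"
 shows "ereal b <= x"
proof (cases x)
 case (real r)
 thus ?thesis using assms[of r] by simp
next
 case MInf
 thus ?thesis using assms[of "b - 1"] by simp
qed simp

section \<open>Short curves, and dominated functions as subsolutions\<close>

context hamiltonian
begin

text \<open>Traverse the coordinate segment at constant velocity. Absolute continuity has to hold in
  every chart; in another chart the curve is Lipschitz, since the transition map is C1 and only a
  compact piece of the segment is involved.\<close>

lemma h_segment:
 assumes c: "c \<in> A" and S: "cball y0 r \<subseteq> rng c" "y \<in> cball y0 r" "y' \<in> cball y0 r" and "tau > 0"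
  and B: "!!z. z \<in> closed_segment y y' ==> Lc c z ((1 / tau) *\<^sub>R (y' - y)) <= B"
 shows "h tau (ci c y) (ci c y') <= ereal (tau * B)"
proof -
 define w where "w = (1 / tau) *\<^sub>R (y' - y)"
 define line where "line s = y + s *\<^sub>R w" for s
 define gam where "gam s = ci c (line s)" for s
 have seg: "line s \<in> closed_segment y y'" if "s \<in> {0..tau}" for s
 proof -
  have "line s = (1 - s / tau) *\<^sub>R y + (s / tau) *\<^sub>R y'" by (simp add: line_def w_def algebra_simps)
  moreover have "0 <= s / tau" "s / tau <= 1" using that `tau > 0` by auto
  ultimately show ?thesis unfolding closed_segment_def by blast
 qed
 have "closed_segment y y' \<subseteq> cball y0 r" by (rule closed_segment_subset[OF S(2,3) convex_cball])
 hence line_rng: "line s \<in> rng c" if "s \<in> {0..tau}" for s using seg[OF that] S(1) by blast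
 have line_cont: "continuous_on X line" for X unfolding line_def by (intro continuous_intros)
 have line_der: "(line has_vector_derivative w) (at s within X)" for s X
  unfolding line_def by (auto intro!: derivative_eq_intros)
 have dom: "gam s \<in> fst c" "snd c (gam s) = line s" if "s \<in> {0..tau}" for s
  using chart_inv_in[OF c line_rng[OF that]] chart_chart_inv[OF c line_rng[OF that]] by (auto simp: gam_def)
 have cont: "continuous_on {0..tau} gam"
  unfolding gam_def by (rule continuous_on_compose2[OF chart_inv_continuous[OF c] line_cont]) (use line_rng in blast)
 have AC: "abs_continuous_curve A tau gam" unfolding abs_continuous_curve_def
 proof (intro conjI ballI allI impI cont)
  fix d a b assume d: "d \<in> A" and ab: "0 <= a & a <= b & b <= tau & gam ` {a..b} \<subseteq> fst d"
  let ?T = "snd d o ci c"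
  have sub: "s \<in> {0..tau}" if "s \<in> {a..b}" for s using that ab by auto
  have g: "gam s \<in> fst c" "gam s \<in> fst d" "snd c (gam s) = line s" if "s \<in> {a..b}" for s
   using dom[OF sub[OF that]] ab that by auto
  have der: "((snd d o gam) has_derivative (%x. x *\<^sub>R frechet_derivative ?T (at (line s)) w)) (at s within {a..b})" if s: "s \<in> {a..b}" for s
  proof -
   have T: "(?T has_derivative frechet_derivative ?T (at (line s))) (at (line s))"
    using transition_derivative(1,3)[OF c d g(1,2)[OF s]] g(3)[OF s] by simp
   have "((?T o line) has_derivative (frechet_derivative ?T (at (line s)) o (%x. x *\<^sub>R w))) (at s within {a..b})"
    by (rule diff_chain_within[OF line_der[unfolded has_vector_derivative_def] has_derivative_at_withinI[OF T]])
   moreover have "snd d o gam = ?T o line" by (simp add: gam_def comp_def)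
   moreover have "frechet_derivative ?T (at (line s)) o (%x. x *\<^sub>R w) = (%x. x *\<^sub>R frechet_derivative ?T (at (line s)) w)"
    using linear_scale[OF has_derivative_linear[OF T]] by (simp add: comp_def)
   ultimately show ?thesis by simp
  qed
  show "abs_continuous_on a b (snd d o gam)"
  proof -
   have "continuous_on {a..b} (%s. frechet_derivative ?T (at (line s)) w)"
   proof (rule continuous_on_compose2[OF _ line_cont])
    have a: "a \<in> {a..b}" using ab by simp
    show "continuous_on (snd c ` (fst c Int fst d)) (%y. frechet_derivative ?T (at y) w)"
     by (rule transition_derivative(2)[OF c d g(1,2)[OF a]])
    show "line ` {a..b} \<subseteq> snd c ` (fst c Int fst d)"
    proof
     fix z assume "z \<in> line ` {a..b}"
     then obtain s where s: "s \<in> {a..b}" "z = line s" by (elim imageE)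
     show "z \<in> snd c ` (fst c Int fst d)"
      by (rule image_eqI[of _ _ "gam s"]) (use g[OF s(1)] s(2) in auto)
    qed
   qed
   hence "bounded ((%s. frechet_derivative ?T (at (line s)) w) ` {a..b})"
    by (intro compact_imp_bounded compact_continuous_image) auto
   then obtain K where K: "K > 0" "ALL v:(%s. frechet_derivative ?T (at (line s)) w) ` {a..b}. norm v <= K"
    unfolding bounded_pos by (elim exE conjE)
   show ?thesis
   proof (rule abs_continuous_on_lipschitz_compose[OF abs_continuous_on_ident less_imp_le[OF K(1)]])
    fix s t assume st: "a <= s" "s <= t" "t <= b"
    show "norm ((snd d o gam) t - (snd d o gam) s) <= K * norm (t - s)"
    proof (rule differentiable_bound[OF _ der])
     fix s assume s: "s \<in> {a..b}"
     have n: "norm (frechet_derivative ?T (at (line s)) w) <= K" using K(2) s by (metis imageI)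
     show "onorm (%x. x *\<^sub>R frechet_derivative ?T (at (line s)) w) <= K"
     proof (rule onorm_bound)
      show "0 <= K" using K(1) by simp
      fix x :: real
      show "norm (x *\<^sub>R frechet_derivative ?T (at (line s)) w) <= K * norm x"
       using mult_right_mono[OF n, of "\<bar>x\<bar>"] by (simp add: mult.commute)
     qed
    qed (use st in auto)
   qed
  qed
 qed
 have LV: "LV gam s = Lc c (line s) w" if s: "s \<in> {0<..<tau}" for s
 proof -
  have s': "s \<in> {0..tau}" using s by simp
  have "isCont gam s" by (rule continuous_on_interior[OF cont]) (use s in "simp add: interior_atLeastAtMost_real")
  moreover have "((snd c o gam) has_vector_derivative w) (at s)"
  proof -
   have "\<forall>\<^sub>F x in nhds s. x \<in> {0<..<tau}" using s by (intro eventually_nhds_in_open) auto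
   hence "\<forall>\<^sub>F x in nhds s. line x = (snd c o gam) x" by (rule eventually_mono) (simp add: dom(2))
   thus ?thesis unfolding has_vector_derivative_def
    by (rule has_derivative_eventually_eq[OF line_der[unfolded has_vector_derivative_def]])
  qed
  ultimately have "LV gam s = Lc c (snd c (gam s)) w" by (rule LV_chart[of c gam s w, OF c dom(1)[OF s']])
  thus ?thesis by (simp add: dom(2)[OF s'])
 qed
 have "continuous_on {0..tau} (%s. (%(y, w). Lc c y w) (line s, w))"
  by (rule continuous_on_compose2[OF Lc_continuous[OF c]]) (use line_rng in "auto intro!: continuous_intros line_cont")
 hence "(%s. Lc c (line s) w) integrable_on {0..tau}" using integrable_continuous_real by simp
 then obtain I where I: "((%s. Lc c (line s) w) has_integral I) {0..tau}" unfolding integrable_on_def by blast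
 have LVI: "(LV gam has_integral I) {0..tau}"
  by (rule has_integral_spike[of "{0, tau}", OF _ _ I]) (use LV in auto)
 have "I <= tau * B"
 proof (rule has_integral_le[OF I])
  show "((%_. B) has_integral tau * B) {0..tau}" using has_integral_const_real[of B 0 tau] `tau > 0` by simp
  fix s assume "s \<in> {0..tau}"
  from B[OF seg[OF this]] show "Lc c (line s) w <= B" by (simp add: w_def)
 qed
 have adm: "adm tau gam" using AC LVI unfolding adm_def by blast
 have "h tau (gam 0) (gam tau) <= ereal (integral {0..tau} (LV gam))" by (rule h_le[OF adm]) (use `tau > 0` in simp)
 also have "... <= ereal (tau * B)" using integral_unique[OF LVI] `I <= tau * B` by simp
 finally show ?thesis using `tau > 0` by (simp add: gam_def line_def w_def)
qed

text \<open>Two points closer than \<open>tau\<close> in coordinates are joined in time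
  \<open>tau\<close> with speed at most 1, at a cost bounded by the Lagrangian on velocities in the
  unit ball. The neighbourhood shrinks with \<open>tau\<close>, but \<open>C\<close> comes from a
  finite cover and serves all points and durations.\<close>

lemma h_short:
 obtains C where "C > 0"
  "!!tau x0. tau > 0 ==> EX U. open U & x0 \<in> U & (ALL z:U. ALL z':U. h tau z z' <= ereal (C * tau))"
proof -
 have "ALL x. EX rC. 0 < fst rC & cball (ctr x) (fst rC) \<subseteq> rng (ch x) &
   (ALL y:cball (ctr x) (fst rC). ALL w:cball 0 1. Lc (ch x) y w <= snd rC)"
 proof
  fix x
  obtain r where r: "r > 0" "cball (ctr x) r \<subseteq> UNIV Int rng (ch x)"
   by (rule chart_ball_exists[OF open_UNIV UNIV_I])
  let ?Q = "cball (ctr x) r \<times> cball (0::'e) 1"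
  have "continuous_on ?Q (%(y, w). Lc (ch x) y w)"
   by (rule continuous_on_subset[OF Lc_continuous[OF chart_at(1)]]) (use r in auto)
  hence "bounded ((%(y, w). Lc (ch x) y w) ` ?Q)"
   by (intro compact_imp_bounded compact_continuous_image compact_Times) auto
  then obtain C where C: "ALL v:(%(y, w). Lc (ch x) y w) ` ?Q. norm v <= C" unfolding bounded_iff by (elim exE)
  have "Lc (ch x) y w <= C" if "y \<in> cball (ctr x) r" "w \<in> cball 0 1" for y w
  proof -
   have "(%(y, w). Lc (ch x) y w) (y, w) \<in> (%(y, w). Lc (ch x) y w) ` ?Q" using that by (intro imageI) simp
   from bspec[OF C this] show ?thesis by simp
  qed
  thus "EX rC. 0 < fst rC & cball (ctr x) (fst rC) \<subseteq> rng (ch x) &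
   (ALL y:cball (ctr x) (fst rC). ALL w:cball 0 1. Lc (ch x) y w <= snd rC)"
   using r by (intro exI[of _ "(r, C)"]) simp
 qed
 from choice[OF this] obtain rC where rC: "!!x. 0 < fst (rC x)" "!!x. cball (ctr x) (fst (rC x)) \<subseteq> rng (ch x)"
   "!!x y w. y \<in> cball (ctr x) (fst (rC x)) ==> w \<in> cball 0 1 ==> Lc (ch x) y w <= snd (rC x)" by blast
 obtain X where X: "finite X" "!!z. EX x:X. z \<in> fst (ch x) & snd (ch x) z \<in> ball (ctr x) (fst (rC x))"
 proof (rule finite_chart_cover[of "%x. fst (rC x)"])
  show "ball (ctr x) (fst (rC x)) \<subseteq> rng (ch x)" for x by (rule order_trans[OF ball_subset_cball rC(2)])
 qed (use rC(1) in blast)+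
 define C where "C = (\<Sum>x\<in>X. \<bar>snd (rC x)\<bar>) + 1"
 have "C > 0" unfolding C_def by (intro add_nonneg_pos sum_nonneg) auto
 show ?thesis
 proof (rule that[OF `C > 0`])
  fix tau :: real and x0 assume "tau > 0"
  obtain x where x: "x \<in> X" "x0 \<in> fst (ch x)" "snd (ch x) x0 \<in> ball (ctr x) (fst (rC x))" using X(2) by blast
  let ?c = "ch x"
  define V where "V = ball (snd ?c x) (fst (rC x)) Int ball (snd ?c x0) (tau / 2)"
  define U where "U = fst ?c Int snd ?c -` V"
  have "open V" by (simp add: V_def open_Int)
  hence "open U" unfolding U_def by (rule continuous_open_preimage[OF chart_continuous[OF chart_at(1)] open_dom[OF chart_at(1)]])
  moreover have "x0 \<in> U" using x `tau > 0` by (simp add: U_def V_def)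
  moreover have "h tau z z' <= ereal (C * tau)" if z: "z \<in> U" "z' \<in> U" for z z'
  proof -
   define y y' where "y = snd ?c z" and "y' = snd ?c z'"
   have y: "y \<in> cball (snd ?c x) (fst (rC x))" "y' \<in> cball (snd ?c x) (fst (rC x))"
    "dist (snd ?c x0) y < tau / 2" "dist (snd ?c x0) y' < tau / 2" and d: "z \<in> fst ?c" "z' \<in> fst ?c"
    using z by (auto simp: U_def V_def y_def y'_def)
   have "dist y y' < tau" using dist_triangle2[of y y' "snd ?c x0"] y(3,4) by (simp add: dist_commute)
   hence w: "(1 / tau) *\<^sub>R (y' - y) \<in> cball 0 1" using `tau > 0` by (simp add: dist_norm norm_minus_commute)
   have "h tau (ci ?c y) (ci ?c y') <= ereal (tau * C)"
   proof (rule h_segment[OF chart_at(1) rC(2) y(1,2) `tau > 0`])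
    fix z assume "z \<in> closed_segment y y'"
    hence "z \<in> cball (snd ?c x) (fst (rC x))" using closed_segment_subset[OF y(1,2) convex_cball] by blast
    hence "Lc ?c z ((1 / tau) *\<^sub>R (y' - y)) <= snd (rC x)" by (rule rC(3)[OF _ w])
    also have "... <= \<bar>snd (rC x)\<bar>" by simp
    also have "... <= C" unfolding C_def using member_le_sum[OF x(1), of "%x. \<bar>snd (rC x)\<bar>"] X(1) by simp
    finally show "Lc ?c z ((1 / tau) *\<^sub>R (y' - y)) <= C" .
   qed
   thus ?thesis unfolding y_def y'_def chart_inv_chart[OF chart_at(1) d(1)] chart_inv_chart[OF chart_at(1) d(2)]
    by (simp add: mult.commute)
  qed
  ultimately show "EX U. open U & x0 \<in> U & (ALL z:U. ALL z':U. h tau z z' <= ereal (C * tau))" by blast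
 qed
qed

text \<open>Nearby points are joined cheaply in both directions by \<open>h_short\<close>.\<close>

lemma dominated_continuous:
 assumes "dominated u a"
 shows "continuous_on UNIV u"
proof (intro continuous_at_imp_continuous_on ballI)
 fix x0
 obtain C where C: "C > 0" "!!tau x0. tau > 0 ==> EX U. open U & x0 \<in> U & (ALL z:U. ALL z':U. h tau z z' <= ereal (C * tau))"
  by (rule h_short) blast
 show "isCont u x0" unfolding isCont_def
 proof (rule tendstoI)
  fix e :: real assume "e > 0"
  define tau where "tau = e / (2 * (C + \<bar>a\<bar>))"
  have Ca: "C + \<bar>a\<bar> > 0" using C(1) by simp
  have "tau > 0" using `e > 0` Ca by (simp add: tau_def)
  have "k * (e / (2 * k)) = e / 2" if "k > 0" for k :: real using that by simp
  from this[OF Ca] have "(C + \<bar>a\<bar>) * tau = e / 2" by (simp only: tau_def)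
  moreover have "a * tau <= \<bar>a\<bar> * tau" using `tau > 0` by (intro mult_right_mono) auto
  ultimately have ct: "C * tau + a * tau < e" using `e > 0` by (simp add: distrib_right)
  obtain U where U: "open U" "x0 \<in> U" "ALL z:U. ALL z':U. h tau z z' <= ereal (C * tau)" using C(2)[OF `tau > 0`, of x0] by blast
  have D: "u z' - u z <= C * tau + a * tau" if "z \<in> U" "z' \<in> U" for z z'
   using assms `tau > 0` U(3) that unfolding dominated_def by blast
  have "\<forall>\<^sub>F z in nhds x0. z \<in> U" using U(1,2) by (rule eventually_nhds_in_open)
  hence "\<forall>\<^sub>F z in nhds x0. dist (u z) (u x0) < e"
  proof (rule eventually_mono)
   fix z assume "z \<in> U"
   thus "dist (u z) (u x0) < e" using D[of z x0] D[of x0 z] U(2) ct by (simp add: dist_real_def abs_less_iff)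
  qed
  thus "\<forall>\<^sub>F z in at x0. dist (u z) (u x0) < e" by (simp add: eventually_nhds_conv_at)
 qed
qed

text \<open>Short coordinate segments arriving at \<open>x\<close> with velocity \<open>w\<close>
  turn domination into the bound of \<open>D y0 \<bullet> w\<close> by the Lagrangian plus
  \<open>a\<close>. This holds for every \<open>w\<close>, so \<open>Hc_le_if_Fenchel\<close>
  applies.\<close>

lemma dominated_vsub:
 assumes "dominated u a"
 shows "vsub u a"
 unfolding vsub_def
proof (intro conjI ballI allI impI dominated_continuous[OF assms])
 fix f x assume f: "f \<in> C1" and max: "\<forall>\<^sub>F y in nhds x. u y - f y <= u x - f x"
 define c y0 where "c = ch x" and "y0 = ctr x"
 have c: "c \<in> A" and x: "x \<in> fst c" and y0: "y0 = snd c x" "y0 \<in> rng c" "ci c y0 = x"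
  using chart_at chart_inv_chart[OF chart_at] by (auto simp: c_def y0_def)
 obtain D where D: "C1_grad (rng c) (f o ci c) D" by (rule C1_gradE[OF f c])
 have der: "((f o ci c) has_derivative (%w. D y0 \<bullet> w)) (at y0)" using D y0(2) unfolding C1_grad_def by blast
 have GH: "G x (dif f x) = Hc c y0 (D y0)" unfolding y0(1)
  by (rule G_differential[OF c x]) (use der y0(1) in simp)
 have "Hc c y0 (D y0) <= a"
 proof (rule Hc_le_if_Fenchel[OF c y0(2)], rule field_le_epsilon)
  fix w and eps :: real assume "eps > 0"
  have "EX r>0. cball y0 r \<subseteq> rng c & (ALL y:cball y0 r. ALL y':cball y0 r. ALL p:{w}. \<bar>Lc c y p - Lc c y' p\<bar> <= eps)"
   by (rule uniform_near_point[OF Lc_continuous[OF c] open_rng[OF c] y0(2)]) (use `eps > 0` in auto)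
  then obtain r where r: "r > 0" "cball y0 r \<subseteq> rng c" and Lr: "ALL y:cball y0 r. ALL y':cball y0 r. ALL p:{w}. \<bar>Lc c y p - Lc c y' p\<bar> <= eps"
   by (elim exE conjE)
  have ev1: "\<forall>\<^sub>F y in nhds y0. y \<in> rng c & u (ci c y) - f (ci c y) <= u x - f x"
   unfolding y0(1) by (rule eventually_chart_inv[OF c x max])
  have ev2: "\<forall>\<^sub>F y in nhds y0. y \<in> ball y0 r" using r(1) by (intro eventually_nhds_in_open) auto
  have lim: "((%tau. y0 - tau *\<^sub>R w) \<longlongrightarrow> y0) (at_right 0)"
   by (rule tendsto_eq_intros refl | simp)+
  have ev: "\<forall>\<^sub>F tau in at_right (0::real). - (Lc c y0 w + eps + a) <= ((f o ci c) (y0 - tau *\<^sub>R w) - (f o ci c) y0) / tau"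
   using filterlim_iff[THEN iffD1, OF lim, rule_format, OF ev1] filterlim_iff[THEN iffD1, OF lim, rule_format, OF ev2]
    eventually_at_right_less[of 0]
  proof eventually_elim
   case (elim tau)
   define y where "y = y0 - tau *\<^sub>R w"
   have tau: "tau > 0" and yr: "y \<in> cball y0 r" and y: "u (ci c y) - f (ci c y) <= u x - f x"
    using elim by (auto simp: y_def)
   have w: "(1 / tau) *\<^sub>R (y0 - y) = w" using tau by (simp add: y_def)
   have y0r: "y0 \<in> cball y0 r" using r(1) by simp
   have "h tau (ci c y) (ci c y0) <= ereal (tau * (Lc c y0 w + eps))"
   proof (rule h_segment[OF c r(2) yr y0r tau], unfold w)
    fix z assume "z \<in> closed_segment y y0"
    hence "z \<in> cball y0 r" using closed_segment_subset[OF yr y0r convex_cball] by blast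
    hence "\<bar>Lc c z w - Lc c y0 w\<bar> <= eps" using Lr y0r by blast
    thus "Lc c z w <= Lc c y0 w + eps" by linarith
   qed
   hence "u x - u (ci c y) <= tau * (Lc c y0 w + eps) + a * tau"
    using assms tau unfolding dominated_def y0(3) by blast
   hence "f x - f (ci c y) <= tau * (Lc c y0 w + eps + a)" using y by (simp add: algebra_simps)
   hence "- (tau * (Lc c y0 w + eps + a)) / tau <= (f (ci c y) - f x) / tau"
    using tau by (intro divide_right_mono) auto
   thus ?case using tau y0(3) by (simp add: y_def)
  qed
  have "((%tau. y0 - tau *\<^sub>R w) has_derivative (%tau. - (tau *\<^sub>R w))) (at 0)" by (auto intro!: derivative_eq_intros)
  from diff_chain_at[OF this, of "f o ci c" "%w. D y0 \<bullet> w"] der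
  have "((%tau. (f o ci c) (y0 - tau *\<^sub>R w)) has_derivative (%tau. - (D y0 \<bullet> w) * tau)) (at 0)"
   by (simp add: comp_def mult.commute)
  hence "((%tau. (f o ci c) (y0 - tau *\<^sub>R w)) has_real_derivative - (D y0 \<bullet> w)) (at 0)"
   unfolding has_field_derivative_def by (rule has_derivative_eq_rhs) (rule ext, rule refl)
  hence "((%tau. ((f o ci c) (y0 - tau *\<^sub>R w) - (f o ci c) y0) / tau) \<longlongrightarrow> - (D y0 \<bullet> w)) (at 0)"
   by (simp add: has_field_derivative_iff)
  hence "((%tau. ((f o ci c) (y0 - tau *\<^sub>R w) - (f o ci c) y0) / tau) \<longlongrightarrow> - (D y0 \<bullet> w)) (at_right 0)"
   by (rule tendsto_within_subset) simp
  from tendsto_lowerbound[OF this ev] show "D y0 \<bullet> w <= Lc c y0 w + a + eps" by simp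
 qed
 thus "G x (dif f x) <= a" using GH by simp
qed

section \<open>Almost calibrated functions are solutions\<close>

text \<open>Instead of a calibrated curve ending at \<open>x\<close>, only starting points are asked
  for from which the action nearly realises domination, separately for each duration and
  error.\<close>

definition weak_KAM :: "('m => real) => bool" where
 "weak_KAM u \<longleftrightarrow> dominated u cv &
   (ALL x t eps. 0 < t --> 0 < eps --> (EX z r. h t z x <= ereal r & u z + r + cv * t <= u x + eps))"

text \<open>If the supersolution test failed, the test function, made strict by subtracting a quadratic bump,
  would grow too slowly along an almost optimal curve for that curve to leave a small ball, and also for it
  to stay there.\<close>

lemma weak_KAM_viscosity:
 assumes "weak_KAM u"
 shows "viscosity_solution A G cv u"
 unfolding viscosity_solution_iff
proof
 have dom: "dominated u cv" using assms by (simp add: weak_KAM_def)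
 thus "vsub u cv" by (rule dominated_vsub)
 have cu: "continuous_on UNIV u" by (rule dominated_continuous[OF dom])
 show "vsup u cv" unfolding vsup_def
 proof (intro conjI ballI allI impI cu, rule ccontr)
  fix f x assume f: "f \<in> C1" and min: "\<forall>\<^sub>F y in nhds x. u x - f x <= u y - f y"
   and "~ cv <= G x (dif f x)"
  hence lt: "G x (dif f x) < cv" by simp
  define kap where "kap = (cv - G x (dif f x)) / 2"
  have "kap > 0" using lt by (simp add: kap_def)
  define c y0 where "c = ch x" and "y0 = ctr x"
  have c: "c \<in> A" and x: "x \<in> fst c" and y0: "y0 = snd c x" "y0 \<in> rng c" "ci c y0 = x"
   using chart_at chart_inv_chart[OF chart_at] by (auto simp: c_def y0_def)
  obtain r0 where r0: "r0 > 0" "cball (ctr x) r0 \<subseteq> UNIV Int rng (ch x)" by (rule chart_ball_exists[OF open_UNIV UNIV_I])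
  define q where "q = chart_bump x r0 (%y. (y - y0) \<bullet> (y - y0))"
  have q: "q \<in> C1" unfolding q_def
   by (rule chart_bump_C1[OF r0(1) _ C1_grad_norm_sq]) (use r0 in simp)
  have q_eq: "q z = (norm (snd c z - y0))\<^sup>2" if "z \<in> fst c" "snd c z \<in> cball y0 (r0 / 2)" for z
   unfolding q_def using chart_bump_eq[OF r0(1), of z x] that by (simp add: c_def y0_def dot_square_norm)
  have qx: "q x = 0" using q_eq[OF x] r0(1) y0(1) by simp
  define f2 where "f2 z = f z + (- 1) * q z" for z
  have mq: "(%z. (- 1) * q z) \<in> C1" by (rule C1_mult[OF C1_const q])
  have f2: "f2 \<in> C1" unfolding f2_def by (rule C1_add[OF f mq])
  have dq: "dif q x = 0"
  proof -
   have "\<forall>\<^sub>F y in nhds (snd c x). y \<in> ball y0 (r0 / 2)" using r0(1) y0(1) by (intro eventually_nhds_in_open) auto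
   from eventually_chart[OF c x this]
   have "\<forall>\<^sub>F z in nhds x. q z = (%y. (y - y0) \<bullet> (y - y0)) (snd c z)"
    by (rule eventually_mono) (simp add: q_eq dot_square_norm)
   moreover have "((%y. (y - y0) \<bullet> (y - y0)) has_derivative (%w. 0 \<bullet> w)) (at (snd c x))"
   proof -
    have "((%y. (y - y0) \<bullet> (y - y0)) has_derivative (%w. (2 *\<^sub>R (snd c x - y0)) \<bullet> w)) (at (snd c x))"
     using C1_grad_norm_sq[of UNIV y0] unfolding C1_grad_def by blast
    thus ?thesis using y0(1) by simp
   qed
   ultimately have "((q o ci c) has_derivative (%w. 0 \<bullet> w)) (at (snd c x))"
    by (rule differential_cong_eventually[OF c x])
   from differential_chart[OF c x this] show ?thesis by (simp add: blinfun_eqI)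
  qed
  have "dif (%z. (- 1) * q z) x = 0"
   using differential_mult[OF C1_const[of "-1"] q, of x] by (simp add: dq differential_const)
  hence df2: "dif f2 x = dif f x"
   unfolding f2_def[abs_def] using differential_add[OF f mq, of x] by simp
  have "isCont (%z. G z (dif f2 z)) x"
   using G_differential_continuous[OF f2] by (simp add: continuous_on_eq_continuous_at)
  hence "((%z. G z (dif f2 z)) \<longlongrightarrow> G x (dif f2 x)) (nhds x)"
   unfolding isCont_def by (rule tendsto_at_iff_tendsto_nhds[THEN iffD1])
  hence "\<forall>\<^sub>F z in nhds x. G z (dif f2 z) < cv - kap"
   by (rule order_tendstoD(2)) (use lt in "simp add: df2 kap_def field_simps")
  with min have "\<forall>\<^sub>F z in nhds x. u x - f x <= u z - f z & G z (dif f2 z) < cv - kap"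
   by (rule eventually_conj)
  from eventually_chart_inv[OF c x this] obtain S where S: "open S" "snd c x \<in> S"
   "ALL y:S. y \<in> rng c & u x - f x <= u (ci c y) - f (ci c y) & G (ci c y) (dif f2 (ci c y)) < cv - kap"
   unfolding eventually_nhds by (elim exE conjE)
  have o: "open (S Int ball y0 (r0 / 2))" and i: "y0 \<in> S Int ball y0 (r0 / 2)" using S r0 y0(1) by auto
  from open_contains_cball_eq[OF o, THEN spec, THEN iffD1, OF i]
  obtain rho where rho: "rho > 0" "cball y0 rho \<subseteq> S Int ball y0 (r0 / 2)" by (elim exE conjE)
  have rhoS: "y \<in> S" "y \<in> cball y0 (r0 / 2)" "y \<in> rng c" if "y \<in> cball y0 rho" for y
   using that rho(2) S(3) ball_subset_cball by blast+
  define K where "K = ci c ` cball y0 rho"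
  define Bo where "Bo = ci c ` ball y0 rho"
  have BK: "Bo \<subseteq> K" unfolding Bo_def K_def by (intro image_mono ball_subset_cball)
  have clK: "closed K" unfolding K_def
   by (intro compact_imp_closed compact_continuous_image continuous_on_subset[OF chart_inv_continuous[OF c]]) (use rhoS in auto)
  have oB: "open Bo" unfolding Bo_def by (rule open_chart_image[OF c]) (use rhoS(3) in auto)
  have xB: "x \<in> Bo" unfolding Bo_def using rho(1) y0(3) by (metis centre_in_ball imageI)
  have K1: "u x - f2 x <= u z - f2 z" "G z (dif f2 z) <= cv - kap" if "z \<in> K" for z
  proof -
   obtain y where y: "z = ci c y" "y \<in> cball y0 rho" using `z \<in> K` unfolding K_def by (elim imageE)
   have zc: "z \<in> fst c" "snd c z = y" using chart_inv_in[OF c rhoS(3)[OF y(2)]] chart_chart_inv[OF c rhoS(3)[OF y(2)]] y(1) by auto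
   have qz: "q z = (norm (y - y0))\<^sup>2" using q_eq[OF zc(1)] zc(2) rhoS(2)[OF y(2)] by simp
   have "u x - f x <= u z - f z" "G z (dif f2 z) < cv - kap" using S(3) rhoS(1)[OF y(2)] y(1) by auto
   thus "u x - f2 x <= u z - f2 z" "G z (dif f2 z) <= cv - kap"
    using qz qx zero_le_power2[of "norm (y - y0)"] unfolding f2_def by linarith+
  qed
  have K2: "u x - f2 x + rho\<^sup>2 <= u z - f2 z" if "z \<in> K" "z \<notin> Bo" for z
  proof -
   obtain y where y: "z = ci c y" "y \<in> cball y0 rho" using `z \<in> K` unfolding K_def by (elim imageE)
   have "y \<notin> ball y0 rho" using `z \<notin> Bo` y(1) unfolding Bo_def by blast
   hence n: "norm (y - y0) = rho" using y(2) by (simp add: dist_norm norm_minus_commute)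
   have zc: "z \<in> fst c" "snd c z = y" using chart_inv_in[OF c rhoS(3)[OF y(2)]] chart_chart_inv[OF c rhoS(3)[OF y(2)]] y(1) by auto
   have qz: "q z = rho\<^sup>2" using q_eq[OF zc(1)] zc(2) rhoS(2)[OF y(2)] n by simp
   have "u x - f x <= u z - f z" using S(3) rhoS(1)[OF y(2)] y(1) by auto
   thus ?thesis using qz qx unfolding f2_def by simp
  qed
  \<comment> \<open>Below both gains that produce the contradiction: \<open>rho\<close> squared if
    the curve meets the boundary sphere, and \<open>kap\<close> if it spends the whole unit of time
    in the ball.\<close>
  define eps where "eps = min (rho\<^sup>2) kap / 2"
  have eps: "eps > 0" "eps < rho\<^sup>2" "eps < kap" using `kap > 0` rho(1) by (auto simp: eps_def min_def)
  obtain z rr where z: "h 1 z x <= ereal rr" "u z + rr + cv * 1 <= u x + eps / 2"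
   using assms eps(1) unfolding weak_KAM_def by (meson half_gt_zero zero_less_one)
  have "h 1 z x < ereal (rr + eps / 2)" by (rule le_less_trans[OF z(1)]) (use eps in simp)
  from h_curve[OF this] obtain gam where gam: "adm 1 gam" "gam 0 = z" "gam 1 = x" "integral {0..1} (LV gam) < rr + eps / 2" by auto
  have AC: "abs_continuous_curve A 1 gam" and int: "LV gam integrable_on {0..1}" and cont: "continuous_on {0..1} gam"
   using gam(1) by (auto simp: adm_def abs_continuous_curve_def)
  \<comment> \<open>Domination on the initial part is subtracted from almost calibration on the
    whole curve, so every final part is almost calibrated too.\<close>
  have cal: "integral {s..1} (LV gam) + cv * (1 - s) - eps <= u x - u (gam s)" if s: "0 <= s" "s <= 1" for s
  proof -
   have "u (gam s) - u z <= integral {0..s} (LV gam) + cv * s"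
   proof (cases "s = 0")
    case False
    have "h (s - 0) (gam 0) (gam s) <= ereal (integral {0..s} (LV gam))" by (rule h_le_sub[OF gam(1)]) (use s in auto)
    thus ?thesis using dom False s gam(2) unfolding dominated_def by auto
   qed (use gam(2) in simp)
   moreover have "integral {0..s} (LV gam) + integral {s..1} (LV gam) = integral {0..1} (LV gam)"
    using s int by (intro Henstock_Kurzweil_Integration.integral_combine)
   ultimately show ?thesis using z(2) gam(4) by (simp add: algebra_simps)
  qed
  have stay: "f2 x - f2 (gam s) <= u x - u (gam s) + eps - kap * (1 - s)" if s: "0 <= s" "s <= 1" and K: "!!r. r \<in> {s..1} ==> gam r \<in> K" for s
  proof -
   have "f2 (gam 1) - f2 (gam s) <= integral {s..1} (LV gam) + (cv - kap) * (1 - s)"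
    by (rule C1_along_curve[OF f2 AC int s(1,2) order_refl K1(2)[OF K]])
   thus ?thesis using cal[OF s] gam(3) by (simp add: algebra_simps)
  qed
  \<comment> \<open>If the curve is ever outside the open ball, \<open>s0\<close> is the last such
    time; afterwards it stays in \<open>K\<close>, and by closedness also at \<open>s0\<close>,
    where it lies on the sphere.\<close>
  define bad where "bad = {0..1} Int gam -` (- Bo)"
  have "closed bad" unfolding bad_def using oB by (intro continuous_closed_preimage[OF cont]) auto
  hence "compact bad" using compact_Int_closed[of "{0..1::real}" bad] bad_def by (simp add: Int_absorb1)
  show False
  proof (cases "bad = {}")
   case True
   hence "gam r \<in> Bo" if "r \<in> {0..1}" for r using that unfolding bad_def by auto
   hence K: "gam r \<in> K" if "r \<in> {0..1}" for r using that BK by blast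
   have "f2 x - f2 (gam 0) <= u x - u (gam 0) + eps - kap * (1 - 0)" by (rule stay[OF _ _ K]) auto
   moreover have "u x - f2 x <= u (gam 0) - f2 (gam 0)" by (rule K1(1)[OF K]) simp
   ultimately show False using eps by simp
  next
   case False
   obtain s0 where s0: "s0 \<in> bad" "!!s. s \<in> bad ==> s <= s0" using compact_attains_sup[OF `compact bad` False] by blast
   have s01: "0 <= s0" "s0 <= 1" "gam s0 \<notin> Bo" using s0(1) by (auto simp: bad_def)
   have "s0 < 1" using s01 gam(3) xB by (metis less_le)
   have after: "gam r \<in> K" if r: "s0 < r" "r <= 1" for r
   proof -
    have "r \<notin> bad" using s0(2)[of r] r by auto
    hence "gam r \<in> Bo" using r s01 by (simp add: bad_def)
    thus ?thesis using BK by blast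
   qed
   have "closed ({0..1} Int gam -` K)" by (rule continuous_closed_preimage[OF cont _ clK]) simp
   moreover have "{s0<..<1} \<subseteq> {0..1} Int gam -` K" using after s01 by auto
   ultimately have "closure {s0<..<1} \<subseteq> {0..1} Int gam -` K" by (rule closure_minimal[rotated])
   hence K: "gam r \<in> K" if "r \<in> {s0..1}" for r using that `s0 < 1` by (auto simp: closure_greaterThanLessThan)
   have "f2 x - f2 (gam s0) <= u x - u (gam s0) + eps - kap * (1 - s0)" by (rule stay[OF s01(1,2) K])
   moreover have "u x - f2 x + rho\<^sup>2 <= u (gam s0) - f2 (gam s0)" by (rule K2[OF K s01(3)]) (use s01 in simp)
   moreover have "0 <= kap * (1 - s0)" using `kap > 0` s01 by simp
   ultimately show False using eps by linarith
  qed
 qed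
qed

end

section \<open>Growth of the minimal action at the critical rate\<close>

locale weak_kam = hamiltonian A g G
 for A :: "('m::{t2_space, second_countable_topology}, 'e::euclidean_space) chart set" and g G +
 assumes connected_UNIV: "connected (UNIV :: 'm set)"
begin

text \<open>Being joined in both directions, in all times from some threshold on and at cost rate
  \<open>C\<close>, is an equivalence relation with open classes, hence holds for all pairs by
  connectedness; compactness makes the threshold uniform. All later times are available because a
  point can be joined to itself in any positive time at rate \<open>C\<close>.\<close>

lemma h_connect:
 obtains T C where "T > 0" "!!t x y. t >= T ==> h t x y <= ereal (C * t)"
proof -
 obtain C where C: "C > 0" "!!tau x0. tau > 0 ==> EX U. open U & x0 \<in> U & (ALL z:U. ALL z':U. h tau z z' <= ereal (C * tau))"
  by (rule h_short) blast
 define R where "R x y n \<longleftrightarrow> (ALL t>=n. h t x y <= ereal (C * t) & h t y x <= ereal (C * t))" for x y and n :: real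
 have tri: "h t x z <= ereal (C * t)" if "h s x y <= ereal (C * s)" "h (t - s) y z <= ereal (C * (t - s))" "0 < s" "s < t" for s t x y z
  using h_triangle[OF that(1,2)] that(3,4) by (simp add: algebra_simps)
 have trans: "R x z (n + m)" if "R x y n" "R y z m" "n > 0" "m > 0" for x y z n m
  unfolding R_def
 proof (intro allI impI)
  fix t assume t: "n + m <= t"
  show "h t x z <= ereal (C * t) & h t z x <= ereal (C * t)"
   using tri[of n x y t z] tri[of "t - n" z y t x] that t unfolding R_def by auto
 qed
 have loc: "EX U. open U & x \<in> U & (ALL y:U. R x y 2)" for x
 proof -
  obtain U where U: "open U" "x \<in> U" "ALL z:U. ALL z':U. h 1 z z' <= ereal (C * 1)" using C(2)[of 1 x] by auto
  have refl: "h s z z <= ereal (C * s)" if "s > 0" for s z using C(2)[OF that, of z] by blast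
  have "R x y 2" if "y \<in> U" for y
   unfolding R_def
  proof (intro allI impI)
   fix t :: real assume "2 <= t"
   thus "h t x y <= ereal (C * t) & h t y x <= ereal (C * t)"
    using tri[of 1 x y t y] tri[of 1 y x t x] U(2,3) that refl[of "t - 1" x] refl[of "t - 1" y] by auto
  qed
  thus ?thesis using U by blast
 qed
 have con: "EX n>0. R x y n" for x y
 proof (rule connected_equivalence_relation[OF connected_UNIV, of x y "%x y. EX n>0. R x y n"])
  show "EX n>0. R y x n" if "EX n>0. R x y n" for x y using that unfolding R_def by blast
  show "EX n>0. R x z n" if "EX n>0. R x y n" "EX n>0. R y z n" for x y z
   using that trans add_pos_pos by blast
  show "EX T. openin (top_of_set UNIV) T & x \<in> T & (ALL y:T. EX n>0. R x y n)" for x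
  proof -
   obtain U where "open U" "x \<in> U" "ALL y:U. R x y 2" using loc[of x] by blast
   thus ?thesis by (intro exI[of _ U] conjI ballI exI[of _ "2::real"]) auto
  qed
 qed auto
 obtain x0 :: 'm where True by simp
 have "EX eta>0. ALL z. R x0 z (1 / eta)"
 proof (rule uniform_by_compactness)
  fix z0
  obtain n where n: "n > 0" "R x0 z0 n" using con by blast
  obtain U where U: "open U" "z0 \<in> U" "ALL y:U. R z0 y 2" using loc[of z0] by blast
  have "\<forall>\<^sub>F z in nhds z0. z \<in> U" using U(1,2) by (rule eventually_nhds_in_open)
  hence "\<forall>\<^sub>F z in nhds z0. R x0 z (1 / (1 / (n + 2)))"
   by (rule eventually_mono) (use trans[OF n(2)] n(1) U(3) in simp)
  thus "EX eta>0. \<forall>\<^sub>F z in nhds z0. R x0 z (1 / eta)" using n(1) by (intro exI[of _ "1 / (n + 2)"]) simp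
 next
  fix eta eta' :: real and z assume "R x0 z (1 / eta)" "0 < eta'" "eta' <= eta"
  moreover have "1 / eta <= 1 / eta'" using calculation by (intro divide_left_mono) auto
  ultimately show "R x0 z (1 / eta')" unfolding R_def by auto
 qed
 then obtain eta where eta: "eta > 0" "!!z. R x0 z (1 / eta)" by blast
 show thesis
 proof (rule that[of "1 / eta + 1 / eta" C])
  fix t x y assume t: "t >= 1 / eta + 1 / eta"
  have "R x x0 (1 / eta)" using eta(2)[of x] unfolding R_def by blast
  hence "R x y (1 / eta + 1 / eta)" by (rule trans[OF _ eta(2)]) (use eta(1) in auto)
  thus "h t x y <= ereal (C * t)" using t unfolding R_def by blast
 qed (use eta(1) in simp)
qed

text \<open>An almost critical C1 function bounds the action from below by its oscillation, and the
  oscillation is bounded independently of the approximation by running domination along a connecting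
  curve of fixed duration \<open>T\<close>.\<close>

lemma h_cv_ge:
 obtains C where "!!t x y r. t > 0 ==> h t x y <= ereal r ==> - C <= r + cv * t"
proof -
 obtain T C where T: "T > 0" "!!t x y. t >= T ==> h t x y <= ereal (C * t)" by (rule h_connect) blast
 show thesis
 proof (rule that[of "C * T + (cv + 1) * T"])
  fix t x y r assume t: "t > 0" and h: "h t x y <= ereal r"
  show "- (C * T + (cv + 1) * T) <= r + cv * t"
  proof (rule field_le_epsilon)
   fix e :: real assume "e > 0"
   \<comment> \<open>\<open>eps * t\<close> must stay within \<open>e\<close>, and
     \<open>eps <= 1\<close> keeps the bound on the oscillation fixed.\<close>
   define eps where "eps = min 1 (e / t)"
   have eps: "eps > 0" "eps <= 1" "eps * t <= e" using t `e > 0` unfolding eps_def by (auto simp: min_def field_simps)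
   obtain f where f: "f \<in> C1" "!!x. G x (dif f x) <= cv + eps"
    by (rule critical_value_approx[OF eps(1)]) blast
   have 1: "f x - f y <= C * T + (cv + eps) * T" by (rule C1_dominated[OF f T(2)]) (use T(1) in auto)
   have 2: "f y - f x <= r + (cv + eps) * t" by (rule C1_dominated[OF f h]) (use t in auto)
   have "(cv + eps) * T <= (cv + 1) * T" using eps(2) T(1) by (intro mult_right_mono) auto
   thus "- (C * T + (cv + 1) * T) <= r + cv * t + e" using 1 2 eps(3) by (simp add: distrib_right)
  qed
 qed
qed

text \<open>If every curve of duration \<open>T\<close> cost more than \<open>eta - cv * T\<close>,
  domination would be possible at the lower level \<open>a\<close>: the infimum \<open>v\<close>,
  over all durations, of the action from a fixed point plus \<open>a * t\<close> is finite and
  dominated at level \<open>a\<close>, hence a subsolution, and its C1 approximations contradict the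
  definition of the critical value.\<close>

lemma h_cv_small:
 assumes "T > 0" "eta > 0"
 shows "EX x y. h T x y <= ereal (eta - cv * T)"
proof (rule ccontr)
 assume neg: "~ ?thesis"
 define a where "a = cv - eta / T"
 have aT: "a * T = cv * T - eta" using assms by (simp add: a_def left_diff_distrib)
 have T: "0 <= r + a * T" if "h T x y <= ereal r" for x y r
 proof (rule ccontr)
  assume "~ ?thesis"
  hence "r <= eta - cv * T" using aT by simp
  hence "ereal r <= ereal (eta - cv * T)" by simp
  with that have "h T x y <= ereal (eta - cv * T)" by (rule order_trans)
  with neg show False by blast
 qed
 obtain \<Lambda> where \<Lambda>: "\<Lambda> >= 0" "ALL t x y r. 0 <= t --> h t x y <= ereal r --> - \<Lambda> * t <= r" using h_lower_bound by blast
 define B where "B = (\<Lambda> + \<bar>a\<bar>) * T"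
 \<comment> \<open>Initial pieces of duration \<open>T\<close> have nonnegative cost once
   \<open>a * T\<close> is added; cutting them off reduces to durations at most \<open>T\<close>,
   where the crude linear bound gives \<open>B\<close>.\<close>
 have low: "ALL t x y r. 0 <= t & t <= real (Suc n) * T & h t x y <= ereal r --> - B <= r + a * t" for n
 proof (induction n)
  case 0
  have "- B <= r + a * t" if "0 <= t" "t <= T" "h t x y <= ereal r" for t x y r
  proof -
   have "- \<Lambda> * t <= r" using \<Lambda>(2) that by blast
   moreover have "(- \<bar>a\<bar>) * t <= a * t" using that(1) by (intro mult_right_mono) auto
   moreover have "(\<Lambda> + \<bar>a\<bar>) * t <= B" unfolding B_def using \<Lambda>(1) that by (intro mult_left_mono) auto
   ultimately show ?thesis by (simp add: distrib_right)
  qed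
  thus ?case by auto
 next
  case (Suc n)
  show ?case
  proof (intro allI impI, elim conjE)
   fix t x y r assume t: "0 <= t" "t <= real (Suc (Suc n)) * T" and h: "h t x y <= ereal r"
   show "- B <= r + a * t"
   proof (cases "t <= T")
    case True
    have "T * 1 <= T * real (Suc n)" using assms(1) by (intro mult_left_mono) auto
    hence "t <= real (Suc n) * T" using True by (simp add: algebra_simps)
    thus ?thesis using Suc.IH t(1) h by blast
   next
    case False
    show ?thesis
    proof (rule field_le_epsilon)
     fix e :: real assume "e > 0"
     hence "h (T + (t - T)) x y < ereal (r + e)" using h by (auto elim: le_less_trans)
     then obtain z r1 r2 where z: "h T x z <= ereal r1" "h (t - T) z y <= ereal r2" "r1 + r2 < r + e"
      by (rule h_split) (use False assms(1) in auto)
     have "t - T <= real (Suc n) * T" using t(2) by (simp add: algebra_simps)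
     hence "- B <= r2 + a * (t - T)" using Suc.IH z(2) False by auto
     thus "- B <= r + a * t + e" using T[OF z(1)] z(3) by (simp add: algebra_simps)
    qed
   qed
  qed
 qed
 have low': "- B <= r + a * t" if "0 <= t" "h t x y <= ereal r" for t x y r
 proof -
  obtain n where "t / T <= real n" using real_arch_simple by blast
  hence "t <= real (Suc n) * T" using assms(1) by (simp add: field_simps)
  thus ?thesis using low that by blast
 qed
 obtain x0 :: 'm where True by simp
 define S where "S x = {r + a * t | r t. 0 < t & h t x0 x <= ereal r}" for x
 define v where "v x = Inf (S x)" for x
 have bd: "bdd_below (S x)" for x unfolding S_def by (rule bdd_belowI[of _ "- B"]) (use low' in auto)
 obtain T0 C where T0: "T0 > 0" "!!t x y. t >= T0 ==> h t x y <= ereal (C * t)" by (rule h_connect) blast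
 have ne: "S x ~= {}" for x using T0(1) T0(2)[OF order_refl, of x0 x] unfolding S_def by blast
 have "dominated v a" unfolding dominated_def
 proof (intro allI impI)
  fix x y t r assume t: "0 < (t::real)" and h: "h t x y <= ereal r"
  have "v y - (r + a * t) <= v x" unfolding v_def[of x]
  proof (rule cInf_greatest[OF ne])
   fix s assume "s \<in> S x"
   then obtain r' t' where s: "s = r' + a * t'" "0 < t'" "h t' x0 x <= ereal r'" unfolding S_def by blast
   have "h (t' + t) x0 y <= ereal (r' + r)" by (rule h_triangle[OF s(3) h]) (use t s in auto)
   moreover have "0 < t' + t" using t s(2) by simp
   ultimately have "(r' + r) + a * (t' + t) \<in> S y" unfolding S_def by blast
   hence "v y <= (r' + r) + a * (t' + t)" unfolding v_def by (rule cInf_lower[OF _ bd])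
   thus "v y - (r + a * t) <= s" by (simp add: s algebra_simps)
  qed
  thus "v y - v x <= r + a * t" by simp
 qed
 hence "vsub v a" by (rule dominated_vsub)
 moreover have e: "eta / T / 2 > 0" using assms by simp
 ultimately obtain f where "f \<in> C1" "!!x. G x (dif f x) <= a + eta / T / 2"
  by (rule vsub_smooth) blast
 hence "cv <= a + eta / T / 2" by (rule critical_value_le)
 thus False using e by (simp add: a_def)
qed

text \<open>The cheap curve of \<open>h_cv_small\<close> is prolonged at both ends by connecting
  curves of fixed duration, so as to reach arbitrary end points.\<close>

lemma h_cv_le:
 obtains C T where "T > 0" "!!t x y. t >= T ==> h t x y <= ereal (C - cv * t)"
proof -
 obtain T C where T: "T > 0" "!!t x y. t >= T ==> h t x y <= ereal (C * t)" by (rule h_connect) blast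
 show thesis
 proof (rule that[of "2 * T + 1" "2 * C * T + 1 + 2 * T * cv"])
  fix t x y assume t: "t >= 2 * T + 1"
  obtain x' y' where x': "h (t - 2 * T) x' y' <= ereal (1 - cv * (t - 2 * T))" using h_cv_small[of "t - 2 * T" 1] t by auto
  have "h (T + (t - 2 * T)) x y' <= ereal (C * T + (1 - cv * (t - 2 * T)))" by (rule h_triangle[OF T(2) x']) (use t T in auto)
  hence "h (T + (t - 2 * T) + T) x y <= ereal (C * T + (1 - cv * (t - 2 * T)) + C * T)" by (rule h_triangle[OF _ T(2)]) (use t T in auto)
  thus "h t x y <= ereal (2 * C * T + 1 + 2 * T * cv - cv * t)" by (simp add: algebra_simps)
 qed (use T in simp)
qed

section \<open>The Peierls barrier\<close>

definition kp :: "'m => 'm => real" where "kp x y = real_of_ereal (peierls_barrier A G x y)"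

lemma h_plus_le: "h t x y + ereal b <= ereal r \<longleftrightarrow> h t x y <= ereal (r - b)"
 by (cases "h t x y") auto

lemma peierls_eq: "peierls_barrier A G x y = ereal (kp x y)"
proof -
 obtain C where C: "!!t x y r. t > 0 ==> h t x y <= ereal r ==> - C <= r + cv * t" by (rule h_cv_ge) blast
 obtain C' T where C': "T > 0" "!!t x y. t >= T ==> h t x y <= ereal (C' - cv * t)" by (rule h_cv_le) blast
 have "ereal (- C) <= h t x y + ereal (cv * t)" if "t > 0" for t
  by (rule ereal_ge_if_real_bounds) (use C[OF that] in "force simp: h_plus_le")
 hence "ereal (- C) <= peierls_barrier A G x y" unfolding peierls_barrier_def
  by (intro Liminf_bounded eventually_mono[OF eventually_gt_at_top[of 0]])
 moreover have "peierls_barrier A G x y <= ereal C'"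
 proof (rule ccontr)
  assume "~ ?thesis"
  hence "\<forall>\<^sub>F t in at_top. ereal C' < h t x y + ereal (cv * t)" unfolding peierls_barrier_def
   by (intro less_LiminfD) simp
  moreover have "\<forall>\<^sub>F t in at_top. h t x y + ereal (cv * t) <= ereal C'"
   using eventually_ge_at_top[of T] by (rule eventually_mono) (simp add: C' h_plus_le)
  ultimately have "\<forall>\<^sub>F t::real in at_top. False" by eventually_elim auto
  thus False by simp
 qed
 ultimately show ?thesis unfolding kp_def by (cases "peierls_barrier A G x y") auto
qed

lemma kp_approx:
 assumes "eps > 0"
 shows "EX t>=T. h t x y <= ereal (kp x y + eps - cv * t)"
proof (rule ccontr)
 assume neg: "~ ?thesis"
 have "ereal (kp x y + eps) <= h t x y + ereal (cv * t)" if t: "t >= T" for t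
 proof (rule ccontr)
  assume "~ ?thesis"
  hence "h t x y + ereal (cv * t) <= ereal (kp x y + eps)" by simp
  hence "h t x y <= ereal (kp x y + eps - cv * t)" by (simp only: h_plus_le)
  with neg t show False by blast
 qed
 hence "ereal (kp x y + eps) <= peierls_barrier A G x y" unfolding peierls_barrier_def
  by (intro Liminf_bounded eventually_mono[OF eventually_ge_at_top[of T]])
 thus False using assms by (simp add: peierls_eq)
qed

lemma kp_eventually:
 assumes "eps > 0"
 shows "EX T>0. ALL t>=T. ALL r. h t x y <= ereal r --> kp x y - eps <= r + cv * t"
proof -
 have "\<forall>\<^sub>F t in at_top. ereal (kp x y - eps) < h t x y + ereal (cv * t)"
  by (rule less_LiminfD) (use assms in "simp add: peierls_barrier_def[symmetric] peierls_eq")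
 then obtain T where T: "ALL t>=T. ereal (kp x y - eps) < h t x y + ereal (cv * t)" unfolding eventually_at_top_linorder by blast
 have "kp x y - eps <= r + cv * t" if "t >= max T 1" "h t x y <= ereal r" for t r
 proof -
  have "h t x y + ereal (cv * t) <= ereal (r + cv * t)" using that(2) by (simp add: h_plus_le)
  moreover have "ereal (kp x y - eps) < h t x y + ereal (cv * t)" using T that(1) by simp
  ultimately have "ereal (kp x y - eps) < ereal (r + cv * t)" by (rule less_le_trans[rotated])
  thus ?thesis by simp
 qed
 thus ?thesis by (intro exI[of _ "max T 1"]) auto
qed

lemma kp_le:
 assumes "!!eps T. eps > 0 ==> EX t>=T. EX r. h t x y <= ereal r & r + cv * t <= a + eps"
 shows "kp x y <= a"
proof (rule field_le_epsilon)
 fix e :: real assume "e > 0"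
 hence e: "e / 2 > 0" by simp
 obtain T where T: "ALL t>=T. ALL r. h t x y <= ereal r --> kp x y - e / 2 <= r + cv * t" using kp_eventually[OF e] by blast
 obtain t r where t: "t >= T" "h t x y <= ereal r" "r + cv * t <= a + e / 2" using assms[OF e, of T] by blast
 hence "kp x y - e / 2 <= r + cv * t" using T by blast
 thus "kp x y <= a + e" using t(3) by simp
qed

lemma kp_right:
 assumes "h t y z <= ereal r" "0 <= t"
 shows "kp x z <= kp x y + r + cv * t"
proof (rule kp_le)
 fix eps T :: real assume "eps > 0"
 then obtain s where s: "s >= max T 0" "h s x y <= ereal (kp x y + eps - cv * s)" using kp_approx[of eps "max T 0" x y] by blast
 have "h (s + t) x z <= ereal (kp x y + eps - cv * s + r)" by (rule h_triangle[OF s(2) assms(1)]) (use s assms in auto)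
 thus "EX t'>=T. EX r'. h t' x z <= ereal r' & r' + cv * t' <= kp x y + r + cv * t + eps"
  by (intro exI[of _ "s + t"] conjI exI[of _ "kp x y + eps - cv * s + r"]) (use s assms in "auto simp: algebra_simps")
qed

lemma kp_left:
 assumes "h t x y <= ereal r" "0 <= t"
 shows "kp x z <= r + cv * t + kp y z"
proof (rule kp_le)
 fix eps T :: real assume "eps > 0"
 then obtain s where s: "s >= max T 0" "h s y z <= ereal (kp y z + eps - cv * s)" using kp_approx[of eps "max T 0" y z] by blast
 have "h (t + s) x z <= ereal (r + (kp y z + eps - cv * s))" by (rule h_triangle[OF assms(1) s(2)]) (use s assms in auto)
 thus "EX t'>=T. EX r'. h t' x z <= ereal r' & r' + cv * t' <= r + cv * t + kp y z + eps"
  by (intro exI[of _ "t + s"] conjI exI[of _ "r + (kp y z + eps - cv * s)"]) (use s assms in "auto simp: algebra_simps")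
qed

text \<open>The second half, on the first argument of the barrier, is what later makes
  \<open>kp y i - kp y x\<close> a difference of subsolutions in \<open>y\<close>.\<close>

lemma kp_vsub: "vsub (kp x) cv" "vsub (%y. - kp y x) cv"
proof -
 have "dominated (kp x) cv" unfolding dominated_def
 proof (intro allI impI)
  fix y z t r assume "0 < t" "h t y z <= ereal r"
  thus "kp x z - kp x y <= r + cv * t" using kp_right[of t y z r x] by simp
 qed
 thus "vsub (kp x) cv" by (rule dominated_vsub)
 have "dominated (%y. - kp y x) cv" unfolding dominated_def
 proof (intro allI impI)
  fix y z t r assume "0 < t" "h t y z <= ereal r"
  thus "- kp z x - - kp y x <= r + cv * t" using kp_left[of t y z r x] by simp
 qed
 thus "vsub (%y. - kp y x) cv" by (rule dominated_vsub)
qed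

lemma vsub_le_kp:
 assumes "vsub u cv"
 shows "u y - u x <= kp x y"
proof (rule field_le_epsilon)
 fix e :: real assume "e > 0"
 then obtain t where t: "t >= 1" "h t x y <= ereal (kp x y + e - cv * t)" using kp_approx[of e 1 x y] by blast
 have "0 < t" using t(1) by simp
 hence "u y - u x <= (kp x y + e - cv * t) + cv * t"
  using vsub_dominated[OF assms] t(2) unfolding dominated_def by blast
 thus "u y - u x <= kp x y + e" by simp
qed

lemma h_near:
 assumes "eps > 0"
 obtains tau U where "tau > 0" "open U" "x0 \<in> U" "!!z z'. z \<in> U ==> z' \<in> U ==> h tau z z' <= ereal (eps - cv * tau)"
proof -
 obtain C where C: "C > 0" "!!tau x0. tau > 0 ==> EX U. open U & x0 \<in> U & (ALL z:U. ALL z':U. h tau z z' <= ereal (C * tau))"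
  by (rule h_short) blast
 define k where "k = C + \<bar>cv\<bar>"
 have k: "k > 0" using C(1) by (simp add: k_def)
 define tau where "tau = eps / k"
 have tau: "tau > 0" "k * tau = eps" using k assms by (auto simp: tau_def)
 have "cv * tau <= \<bar>cv\<bar> * tau" using tau(1) by (intro mult_right_mono) auto
 hence le: "C * tau <= eps - cv * tau" using tau(2) by (simp add: k_def distrib_right)
 obtain U where U: "open U" "x0 \<in> U" "ALL z:U. ALL z':U. h tau z z' <= ereal (C * tau)" using C(2)[OF tau(1), of x0] by blast
 show thesis
 proof (rule that[OF tau(1) U(1,2)])
  fix z z' assume "z \<in> U" "z' \<in> U"
  hence "h tau z z' <= ereal (C * tau)" using U(3) by blast
  also have "... <= ereal (eps - cv * tau)" using le by simp
  finally show "h tau z z' <= ereal (eps - cv * tau)" .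
 qed
qed

text \<open>The estimate is uniform in the other argument because only a short curve at the moved
  end is spliced in.\<close>

lemma kp_equicontinuous:
 assumes "eps > 0"
 obtains U where "open U" "x0 \<in> U" "!!z z' y. z \<in> U ==> z' \<in> U ==> \<bar>kp y z - kp y z'\<bar> <= eps"
  "!!z z' y. z \<in> U ==> z' \<in> U ==> \<bar>kp z y - kp z' y\<bar> <= eps"
proof -
 obtain tau U where U: "tau > 0" "open U" "x0 \<in> U" "!!z z'. z \<in> U ==> z' \<in> U ==> h tau z z' <= ereal (eps - cv * tau)"
  by (rule h_near[OF assms]) blast
 show thesis
 proof (rule that[OF U(2,3)])
  fix z z' y assume "z \<in> U" "z' \<in> U"
  with kp_right[OF U(4), of z z' y] kp_right[OF U(4), of z' z y] show "\<bar>kp y z - kp y z'\<bar> <= eps" using U(1) by auto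
 next
  fix z z' y assume "z \<in> U" "z' \<in> U"
  with kp_left[OF U(4), of z z' y] kp_left[OF U(4), of z' z y] show "\<bar>kp z y - kp z' y\<bar> <= eps" using U(1) by auto
 qed
qed

text \<open>The lower limit bounds actions from below only beyond a threshold depending on the end
  points. Moving an end point slightly takes a short time and costs little (\<open>h_near\<close>),
  so the threshold is locally uniform; compactness is used first for the left end point, then for
  the right one.\<close>

lemma kp_uniform:
 assumes "eps > 0"
 obtains T where "T > 0" "!!t x y r. t >= T ==> h t x y <= ereal r ==> kp x y - eps <= r + cv * t"
proof -
 define Q where "Q e T x y \<longleftrightarrow> (ALL t>=T. ALL r. h t x y <= ereal r --> kp x y - e <= r + cv * t)" for e T :: real and x y
 have mono: "Q e T' x y" if "Q e T x y" "T <= T'" for e T T' x y using that unfolding Q_def by auto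
 have Qinv: "Q e (1 / eta') x y" if "Q e (1 / eta) x y" "0 < eta'" "eta' <= eta" for e eta eta' x y
  by (rule mono[OF that(1)]) (use that in "auto intro!: divide_left_mono")
 \<comment> \<open>One \<open>e\<close> for the threshold at a fixed pair, and two for each of the
   two end points that are moved: one for the action, one for the barrier.\<close>
 define e where "e = eps / 5"
 have e: "e > 0" using assms by (simp add: e_def)
 have 1: "EX eta>0. ALL x. Q (3 * e) (1 / eta) x y" for y
 proof (rule uniform_by_compactness[OF _ Qinv])
  fix x0
  obtain T where T: "T > 0" "Q e T x0 y" using kp_eventually[OF e] unfolding Q_def by blast
  obtain tau U where U: "tau > 0" "open U" "x0 \<in> U" "!!z z'. z \<in> U ==> z' \<in> U ==> h tau z z' <= ereal (e - cv * tau)"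
   by (rule h_near[OF e]) blast
  have "Q (3 * e) (1 / (1 / T)) x y" if x: "x \<in> U" for x
   unfolding Q_def
  proof (intro allI impI)
   fix t r assume t: "1 / (1 / T) <= t" and h: "h t x y <= ereal r"
   have "h (tau + t) x0 y <= ereal (e - cv * tau + r)" by (rule h_triangle[OF U(4)[OF U(3) x] h]) (use U(1) T t in auto)
   moreover have "T <= tau + t" using U(1) t by simp
   ultimately have "kp x0 y - e <= e - cv * tau + r + cv * (tau + t)" using T(2) unfolding Q_def by blast
   moreover have "kp x y <= (e - cv * tau) + cv * tau + kp x0 y" by (rule kp_left[OF U(4)[OF x U(3)]]) (use U(1) in simp)
   ultimately show "kp x y - 3 * e <= r + cv * t" by (simp add: algebra_simps)
  qed
  moreover have "\<forall>\<^sub>F x in nhds x0. x \<in> U" using U(2,3) by (rule eventually_nhds_in_open)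
  ultimately have "\<forall>\<^sub>F x in nhds x0. Q (3 * e) (1 / (1 / T)) x y" by (auto elim: eventually_mono)
  thus "EX eta>0. \<forall>\<^sub>F x in nhds x0. Q (3 * e) (1 / eta) x y" using T(1) by (intro exI[of _ "1 / T"]) simp
 qed auto
 have "EX eta>0. ALL y. ALL x. Q (5 * e) (1 / eta) x y"
 proof (rule uniform_by_compactness)
  fix y0
  obtain eta where T: "eta > 0" "!!x. Q (3 * e) (1 / eta) x y0" using 1 by blast
  obtain tau U where U: "tau > 0" "open U" "y0 \<in> U" "!!z z'. z \<in> U ==> z' \<in> U ==> h tau z z' <= ereal (e - cv * tau)"
   by (rule h_near[OF e]) blast
  have "Q (5 * e) (1 / eta) x y" if y: "y \<in> U" for x y
   unfolding Q_def
  proof (intro allI impI)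
   fix t r assume t: "1 / eta <= t" and h: "h t x y <= ereal r"
   have "0 < t" using T(1) t less_le_trans[of 0 "1 / eta" t] by simp
   hence "h (t + tau) x y0 <= ereal (r + (e - cv * tau))" by (intro h_triangle[OF h U(4)[OF y U(3)]]) (use U(1) in auto)
   moreover have "1 / eta <= t + tau" using U(1) t by simp
   ultimately have "kp x y0 - 3 * e <= r + (e - cv * tau) + cv * (t + tau)" using T(2) unfolding Q_def by blast
   moreover have "kp x y <= kp x y0 + (e - cv * tau) + cv * tau" by (rule kp_right[OF U(4)[OF U(3) y]]) (use U(1) in simp)
   ultimately show "kp x y - 5 * e <= r + cv * t" by (simp add: algebra_simps)
  qed
  moreover have "\<forall>\<^sub>F y in nhds y0. y \<in> U" using U(2,3) by (rule eventually_nhds_in_open)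
  ultimately have "\<forall>\<^sub>F y in nhds y0. ALL x. Q (5 * e) (1 / eta) x y" by (auto elim: eventually_mono)
  thus "EX eta>0. \<forall>\<^sub>F y in nhds y0. ALL x. Q (5 * e) (1 / eta) x y" using T(1) by blast
 qed (use Qinv in blast)
 then obtain eta where eta: "eta > 0" "ALL y x. Q eps (1 / eta) x y" by (auto simp: e_def)
 show thesis by (rule that[of "1 / eta"]) (use eta in "auto simp: Q_def")
qed

text \<open>Cut an almost optimal long curve at time \<open>t\<close> before its end. The first part
  is still long, and its cost is bounded below by the barrier at the cutting point; that point is
  not known in advance, which is why the threshold of \<open>kp_uniform\<close> must not depend on
  it.\<close>

lemma kp_calibrated:
 assumes "t > 0" "eps > 0"
 shows "EX z r. h t z x <= ereal r & kp y z + r + cv * t <= kp y x + eps"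
proof -
 have e: "eps / 4 > 0" using assms by simp
 obtain T where T: "T > 0" "!!t x y r. t >= T ==> h t x y <= ereal r ==> kp x y - eps / 4 <= r + cv * t"
  by (rule kp_uniform[OF e]) blast
 obtain s where s: "s >= T + t" "h s y x <= ereal (kp y x + eps / 4 - cv * s)" using kp_approx[OF e] by blast
 have "ereal (kp y x + eps / 4 - cv * s) < ereal (kp y x + eps / 2 - cv * s)" using assms by simp
 with s(2) have "h ((s - t) + t) y x < ereal (kp y x + eps / 2 - cv * s)" by (simp add: le_less_trans)
 then obtain z r1 r2 where z: "h (s - t) y z <= ereal r1" "h t z x <= ereal r2" "r1 + r2 < kp y x + eps / 2 - cv * s"
  by (rule h_split) (use s assms T in auto)
 have "kp y z - eps / 4 <= r1 + cv * (s - t)" by (rule T(2)[OF _ z(1)]) (use s in simp)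
 hence "kp y z + r2 + cv * t <= kp y x + eps" using z(3) assms by (simp add: algebra_simps)
 thus ?thesis using z(2) by blast
qed

end

section \<open>Mather measures\<close>

context hamiltonian begin

text \<open>Continuity for \<open>tangent_topology A\<close>, tested in all bundle charts.\<close>

definition tcont :: "('m \<times> 'e => real) => bool" where
 "tcont phi \<longleftrightarrow> (ALL c:A. continuous_on (rng c \<times> UNIV) (%z. phi (toc c z)))"

lemma space_tangent_borel: "space (tangent_borel A) = UNIV"
 by (simp add: tangent_borel_def space_measure_of_conv)

lemma sets_tangent_borelI:
 assumes "!!c. c \<in> A ==> open ((rng c \<times> UNIV) Int toc c -` W)"
 shows "W \<in> sets (tangent_borel A)"
proof -
 have "W \<in> {W. openin (tangent_topology A) W}" using assms by (simp add: openin_tangent_topology)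
 thus ?thesis unfolding tangent_borel_def by (subst sets_measure_of) (auto intro: sigma_sets.Basic)
qed

lemma tcont_measurable:
 assumes "tcont phi"
 shows "phi \<in> borel_measurable (tangent_borel A)"
proof (rule borel_measurableI)
 fix S :: "real set" assume S: "open S"
 have "phi -` S \<in> sets (tangent_borel A)"
 proof (rule sets_tangent_borelI)
  fix c assume c: "c \<in> A"
  have "open ((rng c \<times> UNIV) Int (%z. phi (toc c z)) -` S)"
   using assms c open_rng[OF c] S unfolding tcont_def by (intro continuous_open_preimage open_Times) auto
  thus "open ((rng c \<times> UNIV) Int toc c -` phi -` S)" by (simp add: vimage_def)
 qed
 thus "phi -` S Int space (tangent_borel A) \<in> sets (tangent_borel A)" by (simp add: space_tangent_borel)
qed

lemma fst_tangent_measurable: "fst \<in> measurable (tangent_borel A) borel"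
proof (rule borel_measurableI)
 fix S :: "'m set" assume S: "open S"
 have "(fst :: 'm \<times> 'e => 'm) -` S \<in> sets (tangent_borel A)"
 proof (rule sets_tangent_borelI)
  fix c assume c: "c \<in> A"
  have "open ((rng c Int ci c -` S) \<times> (UNIV :: 'e set))"
   using c S by (intro open_Times continuous_open_preimage chart_inv_continuous open_rng) auto
  also have "(rng c Int ci c -` S) \<times> UNIV = (rng c \<times> UNIV) Int toc c -` fst -` S"
   by (auto simp: tangent_of_chart_def Let_def)
  finally show "open ((rng c \<times> UNIV) Int toc c -` fst -` S)" .
 qed
 thus "fst -` S Int space (tangent_borel A) \<in> sets (tangent_borel A)" by (simp add: space_tangent_borel)
qed

lemma tcontI:
 assumes "!!c. c \<in> A ==> EX psi. continuous_on (rng c \<times> UNIV) psi & (ALL x:fst c. ALL w.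
  phi (x, blinfun_apply (coord_change c (ch x) x) w) = psi (snd c x, w))"
 shows "tcont phi"
 unfolding tcont_def
proof
 fix c assume c: "c \<in> A"
 then obtain psi where psi: "continuous_on (rng c \<times> UNIV) psi" "ALL x:fst c. ALL w.
  phi (x, blinfun_apply (coord_change c (ch x) x) w) = psi (snd c x, w)" using assms by blast
 have "phi (toc c z) = psi z" if "z \<in> rng c \<times> UNIV" for z
  using psi(2)[THEN bspec, OF chart_inv_in[OF c, of "fst z"]] chart_chart_inv[OF c, of "fst z"] that
  by (auto simp: tangent_of_chart_def Let_def)
 thus "continuous_on (rng c \<times> UNIV) (%z. phi (toc c z))"
  using psi(1) by (simp cong: continuous_on_cong)
qed

lemma differential_coordinates:
 assumes "c \<in> A" "x \<in> fst c" "C1_grad (rng c) (f o ci c) D"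
 shows "blinfun_apply (dif f x) (blinfun_apply (coord_change c (ch x) x) w) = D (snd c x) \<bullet> w"
proof -
 have "((f o ci c) has_derivative (%w. D (snd c x) \<bullet> w)) (at (snd c x))"
  using assms unfolding C1_grad_def by blast
 from differential_chart[OF assms(1,2) this] show ?thesis
  by (simp add: coord_change_inverse[OF assms(1) chart_at(1) assms(2) chart_at(2)])
qed

lemma tcont_differential:
 assumes "f \<in> C1"
 shows "tcont (%(x, v). blinfun_apply (dif f x) v)"
proof (rule tcontI)
 fix c assume c: "c \<in> A"
 obtain D where D: "C1_grad (rng c) (f o ci c) D" using C1_gradE[OF assms c] by blast
 have "continuous_on (rng c \<times> UNIV) (%z. D (fst z) \<bullet> snd z)"
  using D unfolding C1_grad_def
  by (intro continuous_intros continuous_on_compose2[of "rng c" D _ fst]) auto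
 thus "EX psi. continuous_on (rng c \<times> UNIV) psi & (ALL x:fst c. ALL w.
  (case (x, blinfun_apply (coord_change c (ch x) x) w) of (x, v) => blinfun_apply (dif f x) v) = psi (snd c x, w))"
  by (intro exI[of _ "%z. D (fst z) \<bullet> snd z"]) (simp add: differential_coordinates[OF c _ D])
qed

lemma tcont_lagrangian: "tcont (%(x, v). lagrangian G x v)"
proof (rule tcontI)
 fix c assume c: "c \<in> A"
 thus "EX psi. continuous_on (rng c \<times> UNIV) psi & (ALL x:fst c. ALL w.
  (case (x, blinfun_apply (coord_change c (ch x) x) w) of (x, v) => lagrangian G x v) = psi (snd c x, w))"
  by (intro exI[of _ "%(y, w). Lc c y w"]) (simp add: Lc_continuous lagrangian_chart)
qed

lemma tcont_fst:
 assumes "continuous_on UNIV u"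
 shows "tcont (%z. u (fst z))"
proof (rule tcontI)
 fix c assume c: "c \<in> A"
 have "continuous_on (rng c \<times> UNIV) (%z. u (ci c (fst z)))"
  by (rule continuous_on_compose2[OF assms continuous_on_compose2[OF chart_inv_continuous[OF c]]])
   (auto intro: continuous_intros)
 thus "EX psi. continuous_on (rng c \<times> UNIV) psi & (ALL x:fst c. ALL w.
  u (fst (x, blinfun_apply (coord_change c (ch x) x) w)) = psi (snd c x, w))"
  by (intro exI[of _ "%z. u (ci c (fst z))"]) (simp add: chart_inv_chart[OF c])
qed

lemma tcont_tangent_norm: "tcont (%(x, v). tangent_norm g x v)"
proof (rule tcontI)
 fix c assume c: "c \<in> A"
 define a where "a i j y = g (ci c y) (snd (toc c (y, i))) (snd (toc c (y, j)))" for i j y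
 have bil: "bilinear (g x)" for x using metric unfolding riemannian_metric_def by auto
 have "Ck_on 0 (rng c) (a i j)" for i j
  using metric c unfolding riemannian_metric_def smooth_on_def a_def by blast
 hence "continuous_on (rng c \<times> UNIV) (%z. a i j (fst z))" for i j
  by (intro continuous_on_compose2[of "rng c" "a i j" _ fst]) (auto intro: continuous_intros)
 hence "continuous_on (rng c \<times> UNIV) (%z. sqrt (\<Sum>i\<in>Basis. \<Sum>j\<in>Basis. (snd z \<bullet> i) * ((snd z \<bullet> j) * a i j (fst z))))"
  by (intro continuous_intros)
 moreover have "tangent_norm g x (blinfun_apply (coord_change c (ch x) x) w) =
   sqrt (\<Sum>i\<in>Basis. \<Sum>j\<in>Basis. (w \<bullet> i) * ((w \<bullet> j) * a i j (snd c x)))" if x: "x \<in> fst c" for x w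
 proof -
  let ?T = "blinfun_apply (coord_change c (ch x) x)"
  have "?T w = (\<Sum>i\<in>Basis. (w \<bullet> i) *\<^sub>R ?T i)"
   by (subst euclidean_representation[of w, symmetric]) (simp only: blinfun.sum_right blinfun.scaleR_right)
  moreover have "g x (\<Sum>i\<in>Basis. (w \<bullet> i) *\<^sub>R ?T i) (\<Sum>j\<in>Basis. (w \<bullet> j) *\<^sub>R ?T j) =
    (\<Sum>i\<in>Basis. \<Sum>j\<in>Basis. (w \<bullet> i) * ((w \<bullet> j) * g x (?T i) (?T j)))"
   by (simp add: bilinear_sum[OF bil] sum.cartesian_product[symmetric] bilinear_lmul[OF bil] bilinear_rmul[OF bil] mult.left_commute)
  ultimately show ?thesis unfolding tangent_norm_def
   by (simp add: a_def tangent_of_chart_def Let_def chart_inv_chart[OF c x])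
 qed
 ultimately show "EX psi. continuous_on (rng c \<times> UNIV) psi & (ALL x:fst c. ALL w.
  (case (x, blinfun_apply (coord_change c (ch x) x) w) of (x, v) => tangent_norm g x v) = psi (snd c x, w))"
  by (intro exI[of _ "%z. sqrt (\<Sum>i\<in>Basis. \<Sum>j\<in>Basis. (snd z \<bullet> i) * ((snd z \<bullet> j) * a i j (fst z)))"]) simp
qed

text \<open>The points are encoded in a Euclidean space by their coordinates together with the number of the chart.\<close>

lemma tangent_weak_limit:
 fixes xi :: "nat => nat => 'm \<times> 'e"
 assumes X: "finite X" "!!i. i \<in> X ==> cball (ctr i) (rho i) \<subseteq> rng (ch i)" and N: "!!n. 0 < N n"
  and xi: "!!n k. k < N n ==> EX i:X. EX y:cball (ctr i) (rho i). EX w:cball 0 R. xi n k = toc (ch i) (y, w)"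
 obtains r mu where "strict_mono r" "prob_space mu" "sets mu = sets (tangent_borel A)"
  "!!phi. tcont phi ==> integrable mu phi &
    (%j. (\<Sum>k<N (r j). phi (xi (r j) k)) / N (r j)) \<longlonglongrightarrow> integral\<^sup>L mu phi"
proof -
 obtain e :: "'m => nat" where e: "inj_on e X" using finite_imp_inj_to_nat_seg[OF X(1)] by blast
 define K where "K i = cball (ctr i) (rho i) \<times> cball (0::'e) R" for i
 define Qi where "Qi i = {real (e i)} \<times> K i" for i
 define Q where "Q = (\<Union>i\<in>X. Qi i)"
 have cQi: "compact (Qi i)" for i unfolding Qi_def K_def by (intro compact_Times) auto
 have cQ: "compact Q" unfolding Q_def using X(1) cQi by (intro compact_UN) auto
 \<comment> \<open>Decoding: the first coordinate is the number of the chart, recovered by rounding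
   and inverting \<open>e\<close>.\<close>
 define \<Psi> where "\<Psi> q = toc (ch (inv_into X e (nat \<lfloor>fst q\<rfloor>))) (snd q)" for q :: "real \<times> 'e \<times> 'e"
 have \<Psi>: "\<Psi> q = toc (ch i) (snd q)" if "q \<in> Qi i" "i \<in> X" for q i
  using that e by (auto simp: \<Psi>_def Qi_def)
 have K: "K i \<subseteq> rng (ch i) \<times> UNIV" if "i \<in> X" for i using X(2)[OF that] by (auto simp: K_def)
 have cont: "continuous_on Q (%q. phi (\<Psi> q))" if "tcont phi" for phi :: "'m \<times> 'e => real"
  unfolding Q_def
 proof (rule continuous_on_closed_Union[OF X(1)])
  fix i assume i: "i \<in> X"
  have "continuous_on (rng (ch i) \<times> UNIV) (%z. phi (toc (ch i) z))"
   using that chart_at(1) unfolding tcont_def by blast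
  from continuous_on_compose2[OF this continuous_on_snd[OF continuous_on_id], of "Qi i"] K[OF i]
  have "continuous_on (Qi i) (%q. phi (toc (ch i) (snd q)))" by (auto simp: Qi_def)
  thus "continuous_on (Qi i) (%q. phi (\<Psi> q))" using \<Psi>[OF _ i] by (simp cong: continuous_on_cong)
 qed (rule compact_imp_closed[OF cQi])
 have "EX q. k < N n --> q \<in> Q & xi n k = \<Psi> q" for n k
 proof (cases "k < N n")
  case True
  then obtain i y w where *: "i \<in> X" "y \<in> cball (ctr i) (rho i)" "w \<in> cball 0 R" "xi n k = toc (ch i) (y, w)"
   using xi by blast
  hence "(real (e i), y, w) \<in> Qi i" by (simp add: Qi_def K_def)
  with * \<Psi>[OF this *(1)] have "(real (e i), y, w) \<in> Q & xi n k = \<Psi> (real (e i), y, w)" unfolding Q_def by auto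
  thus ?thesis by blast
 qed simp
 hence "ALL p. EX q. snd p < N (fst p) --> q \<in> Q & xi (fst p) (snd p) = \<Psi> q" by blast
 from choice[OF this] obtain z where z: "ALL p. snd p < N (fst p) --> z p \<in> Q & xi (fst p) (snd p) = \<Psi> (z p)" by blast
 define zet where "zet n k = z (n, k)" for n k
 have zet: "zet n k \<in> Q" "xi n k = \<Psi> (zet n k)" if "k < N n" for n k using z that by (auto simp: zet_def)
 have "EX r M. strict_mono r & prob_space M & sets M = sets borel & (AE x in M. x \<in> Q) &
  (ALL F :: real \<times> 'e \<times> 'e => real. continuous_on Q F -->
    (%j. (\<Sum>k<N (r j). F (zet (r j) k)) / N (r j)) \<longlonglongrightarrow> (\<integral>x. indicator Q x * F x \<partial>M))"
  by (rule empirical_measures_weak_limit[OF cQ, of N zet, OF N zet(1)], assumption) (intro exI conjI allI impI, assumption+)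
 then obtain r M where M: "strict_mono r" "prob_space M" "sets M = sets borel" "AE x in M. x \<in> Q"
  "ALL F :: real \<times> 'e \<times> 'e => real. continuous_on Q F -->
    (%j. (\<Sum>k<N (r j). F (zet (r j) k)) / N (r j)) \<longlonglongrightarrow> (\<integral>x. indicator Q x * F x \<partial>M)"
  by (elim exE conjE)
 \<comment> \<open>The decoding is only controlled on \<open>Q\<close>; a constant value elsewhere
   makes it measurable, and the limit measure lives on \<open>Q\<close>.\<close>
 define \<Psi>' where "\<Psi>' q = (if q \<in> Q then \<Psi> q else undefined)" for q
 have meas: "\<Psi>' \<in> measurable M (tangent_borel A)" unfolding tangent_borel_def
 proof (rule measurable_measure_of)
  fix W assume "W \<in> {W. openin (tangent_topology A) W}"
  hence W: "open ((rng (ch i) \<times> UNIV) Int toc (ch i) -` W)" for i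
   using chart_at(1) by (auto simp: openin_tangent_topology)
  have sp: "space M = UNIV" using sets_eq_imp_space_eq[OF M(3)] by simp
  define S where "S i = Qi i Int (UNIV \<times> ((rng (ch i) \<times> UNIV) Int toc (ch i) -` W))" for i
  have "S i \<in> sets borel" for i unfolding S_def
   using cQi[of i] W[of i] by (intro sets.Int borel_compact borel_open open_Times open_UNIV)
  hence 1: "(\<Union>i\<in>X. S i) \<in> sets borel" using X(1) by (intro sets.finite_UN) auto
  have 2: "(if undefined \<in> W then - Q else {}) \<in> sets borel"
   using borel_open[OF open_Compl[OF compact_imp_closed[OF cQ]]] by simp
  have S: "q \<in> S i \<longleftrightarrow> q \<in> Qi i & \<Psi> q \<in> W" if "i \<in> X" for i q
  proof (cases "q \<in> Qi i")
   case True
   hence "snd q \<in> rng (ch i) \<times> UNIV" using K[OF that] by (auto simp: Qi_def)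
   thus ?thesis using True \<Psi>[OF True that] by (simp add: S_def mem_Times_iff)
  qed (simp add: S_def)
  have "q \<in> Q \<longleftrightarrow> (EX i:X. q \<in> Qi i)" for q by (simp add: Q_def)
  moreover have "q \<in> (\<Union>i\<in>X. S i) \<longleftrightarrow> (EX i:X. q \<in> Qi i) & \<Psi> q \<in> W" for q using S by simp
  ultimately have "\<Psi>' -` W Int space M = (\<Union>i\<in>X. S i) \<union> (if undefined \<in> W then - Q else {})"
   by (intro set_eqI) (simp add: sp \<Psi>'_def)
  thus "\<Psi>' -` W Int space M \<in> sets M" using 1 2 M(3) by simp
 qed auto
 define mu where "mu = distr M (tangent_borel A) \<Psi>'"
 interpret M: prob_space M by (rule M(2))
 show thesis
 proof (rule that[OF M(1)])
  show "prob_space mu" unfolding mu_def by (rule M.prob_space_distr[OF meas])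
  show "sets mu = sets (tangent_borel A)" by (simp add: mu_def)
  fix phi assume phi: "tcont phi"
  have m1: "(%q. phi (\<Psi>' q)) \<in> borel_measurable M" by (rule measurable_compose[OF meas tcont_measurable[OF phi]])
  have m2: "(%q. indicator Q q * phi (\<Psi> q)) \<in> borel_measurable M"
   using borel_measurable_continuous_on_indicator[OF borel_compact[OF cQ] cont[OF phi]] M(3)
   by (simp cong: measurable_cong_sets)
  have "compact ((%q. phi (\<Psi> q)) ` Q)" by (rule compact_continuous_image[OF cont[OF phi] cQ])
  then obtain B where "ALL t:(%q. phi (\<Psi> q)) ` Q. norm t <= B" using compact_imp_bounded bounded_iff by blast
  hence B: "\<bar>phi (\<Psi>' q)\<bar> <= B" if "q \<in> Q" for q using that by (simp add: \<Psi>'_def)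
  have int: "integrable M (%q. phi (\<Psi>' q))"
   by (rule M.integrable_const_bound[OF _ m1, of B]) (rule eventually_mono[OF M(4)], simp add: B)
  have eq: "integral\<^sup>L mu phi = (\<integral>q. indicator Q q * phi (\<Psi> q) \<partial>M)"
   unfolding mu_def integral_distr[OF meas tcont_measurable[OF phi]]
   by (rule integral_cong_AE[OF m1 m2]) (rule eventually_mono[OF M(4)], simp add: \<Psi>'_def)
  have "(\<Sum>k<N (r j). phi (xi (r j) k)) = (\<Sum>k<N (r j). phi (\<Psi> (zet (r j) k)))" for j
   by (rule sum.cong) (use zet(2) in auto)
  hence "(%j. (\<Sum>k<N (r j). phi (xi (r j) k)) / N (r j)) \<longlonglongrightarrow> integral\<^sup>L mu phi"
   unfolding eq using M(5)[THEN spec, THEN mp, OF cont[OF phi]] by simp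
  moreover have "integrable mu phi" unfolding mu_def using int integrable_distr_eq[OF meas tcont_measurable[OF phi]] by blast
  ultimately show "integrable mu phi & (%j. (\<Sum>k<N (r j). phi (xi (r j) k)) / N (r j)) \<longlonglongrightarrow> integral\<^sup>L mu phi" by blast
 qed
qed


section \<open>Short steps along which a solution decreases at the optimal rate\<close>

lemma vsup_chart:
 assumes "vsup u a" "c \<in> A" "open U" "y \<in> U" "U \<subseteq> rng c" "C1_grad U F D"
  and min: "\<forall>\<^sub>F z in nhds y. u (ci c y) - F y <= u (ci c z) - F z"
 shows "a <= Hc c y (D y)"
proof -
 obtain f where f: "f \<in> C1" "\<forall>\<^sub>F z in nhds (ci c y). z \<in> fst c & f z = F (snd c z)"
  "f (ci c y) = F y" "G (ci c y) (dif f (ci c y)) = Hc c y (D y)"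
  by (rule chart_test_function[OF assms(2-6)])
 have y: "y \<in> rng c" using assms(4,5) by (rule_tac subsetD)
 have "\<forall>\<^sub>F z in nhds (ci c y). z \<in> fst c & u (ci c y) - F y <= u (ci c (snd c z)) - F (snd c z)"
  by (rule eventually_chart[OF assms(2) chart_inv_in[OF assms(2) y]])
   (use min chart_chart_inv[OF assms(2) y] in simp)
 with f(2) have "\<forall>\<^sub>F z in nhds (ci c y). u z - f z >= u (ci c y) - f (ci c y)"
  by eventually_elim (use f(3) chart_inv_chart[OF assms(2)] in auto)
 thus ?thesis using assms(1) f(1,4) unfolding vsup_def by metis
qed

lemma vsub_lipschitz_chart:
 assumes u: "vsub u a" and c: "c \<in> A" and y0: "y0 \<in> rng c"
 obtains K r where "K > 0" "r > 0" "cball y0 r \<subseteq> rng c"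
  "!!y y'. y \<in> cball y0 r ==> y' \<in> cball y0 r ==> u (ci c y') - u (ci c y) <= K * norm (y' - y)"
proof -
 obtain R r where R: "R > 0" "r > 0" "cball y0 r \<subseteq> rng c" "ALL y:cball y0 r. ALL p. Hc c y p <= a --> norm p <= R"
  using Hc_sublevel_bounded_locally[OF c y0, of a] by blast
 have br: "ball y0 r \<subseteq> rng c" using R(3) ball_subset_cball by blast
 show thesis
 \<comment> \<open>Points of the ball of radius \<open>r / 4\<close> are at most
   \<open>r / 2\<close> apart, so segments starting in it stay in the ball of radius
   \<open>r\<close>.\<close>
 proof (rule that[of R "r / 4"])
  show "cball y0 (r / 4) \<subseteq> rng c" using R(2,3) subset_cball[of "r / 4" r y0] by force
  fix y y' assume y: "y \<in> cball y0 (r / 4)" "y' \<in> cball y0 (r / 4)"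
  show "u (ci c y') - u (ci c y) <= R * norm (y' - y)"
  proof (cases "y' = y")
   case False
   define t e where "t = norm (y' - y)" and "e = (1 / t) *\<^sub>R (y' - y)"
   have t: "t > 0" using False by (simp add: t_def)
   have "t <= dist y y0 + dist y0 y'" unfolding t_def using dist_triangle[of y y' y0] by (simp add: dist_norm norm_minus_commute)
   hence "dist y0 y + t < r" using y R(2) by (simp add: dist_commute)
   moreover have e: "norm e = 1" using t by (simp add: e_def t_def)
   moreover have "p \<bullet> e <= R" if "z \<in> ball y0 r" "Hc c z p <= a" for z p
   proof -
    have "norm p <= R" using R(4) that by auto
    thus ?thesis using Cauchy_Schwarz_ineq2[of p e] e by simp
   qed
   ultimately have "u (ci c (y + t *\<^sub>R e)) - u (ci c y) <= R * t"
    using t by (intro vsub_segment_bound[OF u c br]) auto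
   thus ?thesis using t by (simp add: e_def t_def)
  qed simp
 qed (use R in auto)
qed

text \<open>Comparison with the soft minimum over a finite set of covectors \<open>p\<close> of the affine functions
  \<open>p \<bullet> (y - y\<^sub>1) + s (H(y\<^sub>1, p) - a + 2 dlt)\<close> of \<open>(s, y)\<close>, strict subsolutions of the evolution equation: by the
  supersolution test the minimum of the difference over \<open>0 \<le> s \<le> tau\<close> is only attained at \<open>s = tau\<close>.\<close>

lemma vsup_step:
 assumes u: "vsub u a" "vsup u a" and c: "c \<in> A" and y0: "y0 \<in> rng c"
 shows "EX r>0. EX R>0. cball y0 (2 * r) \<subseteq> rng c & (ALL eps>0. EX tau\<^sub>0>0. ALL tau y. 0 < tau & tau <= tau\<^sub>0 & y \<in> cball y0 r -->
  (EX w. norm w <= R & y - tau *\<^sub>R w \<in> cball y0 (2 * r) &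
   tau * (Lc c y w + a - eps) <= u (ci c y) - u (ci c (y - tau *\<^sub>R w))))"
proof -
 obtain K r1 where K: "K > 0" "r1 > 0" "cball y0 r1 \<subseteq> rng c"
  "!!y y'. y \<in> cball y0 r1 ==> y' \<in> cball y0 r1 ==> u (ci c y') - u (ci c y) <= K * norm (y' - y)"
  by (rule vsub_lipschitz_chart[OF u(1) c y0]) blast
 have "compact ((%(y, p). Hc c y p) ` (cball y0 r1 \<times> cball 0 (K + 2)))"
  by (intro compact_continuous_image compact_Times compact_cball continuous_on_subset[OF Hc_continuous[OF c]]) (use K(3) in auto)
 then obtain Hm where "ALL t:(%(y, p). Hc c y p) ` (cball y0 r1 \<times> cball 0 (K + 2)). norm t <= Hm"
  using compact_imp_bounded bounded_iff by blast
 hence Hm: "\<bar>Hc c y p\<bar> <= Hm" if "y \<in> cball y0 r1" "norm p <= K + 2" for y p using that by fastforce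
 have "0 <= Hm" using Hm[of y0 0] K by auto
 \<comment> \<open>Large enough that on the lateral boundary the excess slope, at least one half
   after the error of the net, outweighs the time cost \<open>Hm + \<bar>a\<bar> + 2\<close>, with
   \<open>2 * tau\<close> to spare.\<close>
 define R where "R = 2 * (Hm + \<bar>a\<bar> + 4)"
 have R: "R > 0" using `0 <= Hm` by (simp add: R_def)
 obtain R' r2 where R': "R' > 0" "r2 > 0" "cball y0 r2 \<subseteq> rng c" "ALL y:cball y0 r2. ALL w. norm w <= R -->
  (EX p. norm p <= R' & Lc c y w = p \<bullet> w - Hc c y p) & (ALL q. q \<bullet> w - Hc c y q <= Lc c y w)"
  using Lc_attained_locally[OF c y0, of R] R by auto
 define r where "r = min r1 r2 / 2"
 have r: "r > 0" using K(2) R'(2) by (simp add: r_def)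
 have sub: "cball y0 (2 * r) \<subseteq> cball y0 r1" "cball y0 (2 * r) \<subseteq> cball y0 r2" by (auto simp: r_def)
 have rr: "cball y0 r \<subseteq> cball y0 (2 * r)" using r by auto
 \<comment> \<open>Leaves room both for the maximising covectors of
   \<open>Lc_attained_locally\<close> and for inward slopes of norm \<open>K + 1\<close>.\<close>
 define Pm where "Pm = max R' (K + 1)"
 have "EX tau\<^sub>0>0. ALL tau y. 0 < tau & tau <= tau\<^sub>0 & y \<in> cball y0 r -->
  (EX w. norm w <= R & y - tau *\<^sub>R w \<in> cball y0 (2 * r) &
   tau * (Lc c y w + a - eps) <= u (ci c y) - u (ci c (y - tau *\<^sub>R w)))" if "eps > 0" for eps
 proof -
  define dlt where "dlt = min 1 (eps / 5)"
  have dlt: "0 < dlt" "dlt <= 1" "5 * dlt <= eps" using that by (auto simp: dlt_def)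
  have "uniformly_continuous_on (cball y0 (2 * r) \<times> cball 0 Pm) (%(y, p). Hc c y p)"
   by (intro compact_uniformly_continuous compact_Times compact_cball continuous_on_subset[OF Hc_continuous[OF c]])
    (use K(3) sub(1) in auto)
  then obtain d where d: "d > 0" "ALL z:cball y0 (2 * r) \<times> cball 0 Pm. ALL z':cball y0 (2 * r) \<times> cball 0 Pm.
    dist z' z < d --> dist ((%(y, p). Hc c y p) z') ((%(y, p). Hc c y p) z) < dlt"
   using dlt(1) unfolding uniformly_continuous_on_def by blast
  have dy: "\<bar>Hc c y p - Hc c y' p\<bar> < dlt" if "y \<in> cball y0 (2 * r)" "y' \<in> cball y0 (2 * r)" "norm p <= Pm" "dist y y' < d" for y y' p
   using d(2)[THEN bspec, of "(y', p)", THEN bspec, of "(y, p)"] that by (simp add: dist_Pair_Pair dist_real_def)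
  have dp: "\<bar>Hc c y p - Hc c y p'\<bar> < dlt" if "y \<in> cball y0 (2 * r)" "norm p <= Pm" "norm p' <= Pm" "dist p p' < d" for y p p'
   using d(2)[THEN bspec, of "(y, p')", THEN bspec, of "(y, p)"] that by (simp add: dist_Pair_Pair dist_real_def)
  define eta where "eta = min d (min (1 / 2) (dlt / R))"
  have eta: "eta > 0" "eta <= d" "eta <= 1 / 2" "eta <= dlt / R"
  proof -
   show "eta > 0" unfolding eta_def using d(1) dlt(1) R by simp
   show "eta <= d" unfolding eta_def by (rule min.cobounded1)
   have "eta <= min (1 / 2) (dlt / R)" unfolding eta_def by (rule min.cobounded2)
   thus "eta <= 1 / 2" "eta <= dlt / R" unfolding min.bounded_iff by blast+
  qed
  hence etaR: "eta * R <= dlt" using R by (simp add: pos_le_divide_eq)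
  obtain P :: "'e set" where P: "finite P" "P \<subseteq> cball 0 Pm" "!!z. z \<in> cball 0 Pm ==> EX p:P. dist p z < eta"
   by (rule finite_net[OF bounded_cball eta(1), of "0::'e" Pm]) blast
  have Pm: "0 < Pm" "R' <= Pm" "K + 1 <= Pm" using R'(1) by (auto simp: Pm_def)
  have Pne: "P ~= {}" using P(3)[of 0] Pm(1) by auto
  have Pn: "norm p <= Pm" if "p \<in> P" for p using P(2) that by auto
  define tau\<^sub>0 where "tau\<^sub>0 = min (r / R) (d / (2 * R))"
  have "tau\<^sub>0 > 0" using r R d(1) by (simp add: tau\<^sub>0_def)
  moreover have "EX w. norm w <= R & y1 - tau *\<^sub>R w \<in> cball y0 (2 * r) &
   tau * (Lc c y1 w + a - eps) <= u (ci c y1) - u (ci c (y1 - tau *\<^sub>R w))"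
   if tau: "0 < tau" "tau <= tau\<^sub>0" and y1: "y1 \<in> cball y0 r" for tau y1
  proof -
   have tauR: "0 < tau * R" "tau * R <= r" "tau * R < d"
   proof -
    show "0 < tau * R" using tau R by simp
    have "tau <= r / R" "tau <= d / (2 * R)" using tau(2) by (auto simp: tau\<^sub>0_def)
    hence "tau * R <= r" "tau * R <= d / 2" using R by (auto simp: field_simps)
    thus "tau * R <= r" "tau * R < d" using d(1) by auto
   qed
   have B: "y \<in> cball y0 (2 * r)" if "y \<in> cball y1 (tau * R)" for y
    using dist_triangle[of y0 y y1] that y1 tauR(2) by simp
   have y1': "y1 \<in> cball y0 (2 * r)" using rr y1 by blast
   define U where "U y = u (ci c y)" for y
   have lip: "U y1 - U y <= K * norm (y1 - y)" if "y \<in> cball y1 (tau * R)" for y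
    using K(4) B[OF that] y1' sub(1) unfolding U_def by blast
   \<comment> \<open>Of the margin \<open>2 * dlt\<close>, one \<open>dlt\<close> is used up when
     the Hamiltonian at the gradient \<open>D\<close> is moved from \<open>ys\<close> to
     \<open>y1\<close>; the other keeps the time derivative of \<open>f\<close> positive.\<close>
   define k where "k p = Hc c y1 p - a + 2 * dlt" for p
   define v where "v s y p = p \<bullet> (y - y1) + s * k p" for s y p
   define bet where "bet = (ln (card P) + 1) / (tau * dlt)"
   have "card P >= 1" using P(1) Pne by (simp add: Suc_le_eq card_gt_0_iff)
   hence lnP: "ln (card P) >= 0" by simp
   hence bet: "bet > 0" using tau dlt by (simp add: bet_def)
   have err: "ln (card P) / bet <= tau * dlt" using tau dlt lnP by (simp add: bet_def field_simps)
   define f where "f s y = softmin bet P (v s y)" for s y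
   define S where "S = {0..tau} \<times> cball y1 (tau * R)"
   have cU: "continuous_on (cball y0 (2 * r)) U" unfolding U_def
    by (rule continuous_on_compose2[OF _ continuous_on_subset[OF chart_inv_continuous[OF c]], of UNIV u])
     (use u(1) K(3) sub(1) in "auto simp: vsub_def")
   have "continuous_on S (%z. U (snd z) - f (fst z) (snd z))"
   proof (rule continuous_on_diff)
    show "continuous_on S (%z. U (snd z))"
     by (rule continuous_on_compose2[OF cU]) (use B in "auto simp: S_def intro: continuous_intros")
    show "continuous_on S (%z. f (fst z) (snd z))"
     unfolding f_def softmin_def v_def using softmin_sum_pos[OF P(1) Pne]
     by (intro continuous_intros ballI) (use bet in "auto simp: less_imp_neq[THEN not_sym]")
   qed
   moreover have "compact S" unfolding S_def by (intro compact_Times) auto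
   moreover have S0: "(0, y1) \<in> S" using tau R by (simp add: S_def)
   ultimately obtain z where z: "z \<in> S" "ALL z':S. U (snd z) - f (fst z) (snd z) <= U (snd z') - f (fst z') (snd z')"
    using continuous_attains_inf[of S "%z. U (snd z) - f (fst z) (snd z)"] by blast
   define s0 ys where "s0 = fst z" and "ys = snd z"
   have s0: "0 <= s0" "s0 <= tau" and ys: "ys \<in> cball y1 (tau * R)" using z(1) by (auto simp: S_def s0_def ys_def)
   have min: "U ys - f s0 ys <= U y - f s y" if "0 <= s" "s <= tau" "y \<in> cball y1 (tau * R)" for s y
    using z(2)[THEN bspec, of "(s, y)"] that by (simp add: S_def s0_def ys_def)
   have "0 - ln (card P) / bet <= f 0 y1" unfolding f_def by (rule softmin_ge[OF P(1) Pne bet]) (simp add: v_def)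
   hence val: "U ys - f s0 ys <= U y1 + tau * dlt" using min[of 0 y1] tau R err by auto
   have f_le: "f s y <= v s y p" if "p \<in> P" for s y p unfolding f_def by (rule softmin_le[OF P(1) that bet])
   \<comment> \<open>On the lateral boundary a slope of norm \<open>K + 1\<close> pointing back to
     \<open>y1\<close> beats the Lipschitz constant \<open>K\<close>, so the difference there
     exceeds its value at \<open>(0, y1)\<close>.\<close>
   have inner: "norm (ys - y1) < tau * R"
   proof (rule ccontr)
    assume "~ ?thesis"
    hence n: "norm (ys - y1) = tau * R" using ys by (simp add: dist_norm norm_minus_commute)
    define q where "q = (- (K + 1) / (tau * R)) *\<^sub>R (ys - y1)"
    have nq: "norm q = K + 1"
    proof -
     have "norm q = (K + 1) / (tau * R) * norm (ys - y1)" unfolding q_def norm_scaleR using tauR(1) K(1) by simp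
     thus ?thesis using tau(1) R unfolding n by simp
    qed
    then obtain p where p: "p \<in> P" "dist p q < eta" using P(3)[of q] Pm(3) by auto
    have "norm p <= norm q + norm (p - q)" using norm_triangle_sub[of p q] by simp
    hence "norm p <= K + 2" using p(2) nq eta(3) by (simp add: dist_norm)
    hence "\<bar>Hc c y1 p\<bar> <= Hm" using Hm y1' sub(1) by blast
    hence "\<bar>k p\<bar> <= Hm + \<bar>a\<bar> + 2" using dlt by (simp add: k_def)
    hence "s0 * k p <= s0 * (Hm + \<bar>a\<bar> + 2)" using s0(1) by (intro mult_left_mono) auto
    also have "... <= tau * (Hm + \<bar>a\<bar> + 2)" using s0 `0 <= Hm` by (intro mult_right_mono) auto
    finally have "s0 * k p <= tau * (Hm + \<bar>a\<bar> + 2)" .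
    moreover have "q \<bullet> (ys - y1) = - (K + 1) * (tau * R)"
    proof -
     have "q \<bullet> (ys - y1) = (- (K + 1) / (tau * R)) * (norm (ys - y1))\<^sup>2" by (simp add: q_def power2_norm_eq_inner)
     thus ?thesis using tauR(1) by (simp add: n power2_eq_square)
    qed
    moreover have "(p - q) \<bullet> (ys - y1) <= 1 / 2 * (tau * R)"
    proof -
     have "(p - q) \<bullet> (ys - y1) <= norm (p - q) * norm (ys - y1)" by (rule norm_cauchy_schwarz)
     also have "... <= 1 / 2 * (tau * R)" unfolding n using p(2) eta(3) tauR(1) by (intro mult_right_mono) (auto simp: dist_norm)
     finally show ?thesis .
    qed
    ultimately have "v s0 ys p <= - (K + 1) * (tau * R) + 1 / 2 * (tau * R) + tau * (Hm + \<bar>a\<bar> + 2)"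
     by (simp add: v_def inner_diff_left)
    moreover have "U y1 - U ys <= K * (tau * R)" using lip[OF ys] n by (simp add: norm_minus_commute)
    moreover have "tau * R = 2 * (tau * (Hm + \<bar>a\<bar> + 2)) + 4 * tau" by (simp add: R_def algebra_simps)
    moreover have "tau * dlt <= tau * 1" using tau dlt by (intro mult_left_mono) auto
    ultimately show False using val f_le[OF p(1), of s0 ys] tau(1) by (simp add: algebra_simps)
   qed
   have "s0 = tau"
   proof (rule ccontr)
    assume "s0 ~= tau"
    hence s0': "s0 < tau" using s0 by simp
    define W where "W = softweight bet P (v s0 ys)"
    have W: "!!p. 0 <= W p" "(\<Sum>p\<in>P. W p) = 1" unfolding W_def by (simp_all add: softweight_nonneg softweight_sum[OF P(1) Pne])
    define D where "D = (\<Sum>p\<in>P. W p *\<^sub>R p)"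
    have gy: "C1_grad (ball y1 (tau * R)) (f s0) (%y. \<Sum>p\<in>P. softweight bet P (v s0 y) p *\<^sub>R (p + 0))"
     unfolding f_def v_def by (intro C1_grad_softmin[OF P(1) Pne bet] C1_grad_add C1_grad_linear C1_grad_const)
    have "a <= Hc c ys (\<Sum>p\<in>P. softweight bet P (v s0 ys) p *\<^sub>R (p + 0))"
    proof (rule vsup_chart[OF u(2) c open_ball _ _ gy])
     show "ys \<in> ball y1 (tau * R)" using inner by (simp add: dist_norm norm_minus_commute)
     hence "\<forall>\<^sub>F y in nhds ys. y \<in> ball y1 (tau * R)" by (intro eventually_nhds_in_open) auto
     thus "\<forall>\<^sub>F y in nhds ys. u (ci c ys) - f s0 ys <= u (ci c y) - f s0 y"
      by (rule eventually_mono) (use min[OF s0] in "simp add: U_def")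
     have "ball y1 (tau * R) \<subseteq> cball y0 (2 * r)" using B ball_subset_cball by blast
     thus "ball y1 (tau * R) \<subseteq> rng c" using K(3) sub(1) by (blast intro: subset_trans)
    qed
    hence HD: "a <= Hc c ys D" by (simp add: D_def W_def)
    have "D \<in> cball 0 Pm" unfolding D_def by (rule convex_sum[OF P(1) convex_cball W(2)]) (use P(2) W(1) in auto)
    hence "\<bar>Hc c ys D - Hc c y1 D\<bar> < dlt"
     by (intro dy B[OF ys] y1') (use inner tauR(3) in "auto simp: dist_norm")
    moreover have "Hc c y1 D <= (\<Sum>p\<in>P. W p * Hc c y1 p)" unfolding D_def
     by (rule convex_on_sum[OF P(1) Pne Hc_convex W(2) W(1)]) auto
    moreover have "(\<Sum>p\<in>P. W p * k p) = (\<Sum>p\<in>P. W p * Hc c y1 p) + (2 * dlt - a) * (\<Sum>p\<in>P. W p)"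
    proof -
     have "(\<Sum>p\<in>P. W p * k p) = (\<Sum>p\<in>P. W p * Hc c y1 p + (2 * dlt - a) * W p)"
      by (rule sum.cong) (simp_all add: k_def algebra_simps)
     thus ?thesis by (simp only: sum.distrib sum_distrib_left)
    qed
    ultimately have pos: "0 < (\<Sum>p\<in>P. W p * k p)" using HD dlt(1) by (simp add: W(2))
    have "C1_grad UNIV (%s. f s ys) (%s. \<Sum>p\<in>P. softweight bet P (v s ys) p *\<^sub>R k p)"
     unfolding f_def
    proof (rule C1_grad_softmin[OF P(1) Pne bet])
     show "C1_grad UNIV (%s. v s ys p) (%s. k p)" for p
      unfolding C1_grad_def v_def by (auto intro!: derivative_eq_intros continuous_intros)
    qed
    hence "((%s. f s ys) has_derivative (%w. (\<Sum>p\<in>P. W p *\<^sub>R k p) \<bullet> w)) (at s0)"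
     unfolding C1_grad_def W_def by blast
    hence "((%s. f s ys) has_real_derivative (\<Sum>p\<in>P. W p * k p)) (at s0)"
     unfolding has_field_derivative_def by (rule has_derivative_eq_rhs) (simp add: fun_eq_iff)
    from DERIV_pos_inc_right[OF this pos] obtain d' where d': "d' > 0" "ALL t>0. t < d' --> f s0 ys < f (s0 + t) ys" by blast
    define t where "t = min (d' / 2) (tau - s0)"
    have t: "0 < t" "t < d'" "s0 + t <= tau" using d'(1) s0' by (auto simp: t_def)
    have "f s0 ys < f (s0 + t) ys" using d'(2) t by blast
    thus False using min[of "s0 + t" ys] s0(1) ys t by simp
   qed
   define w where "w = (1 / tau) *\<^sub>R (y1 - ys)"
   have w1: "tau *\<^sub>R w = y1 - ys" using tau(1) by (simp add: w_def)
   hence "tau * norm w = norm (ys - y1)" using tau(1) by (metis norm_scaleR abs_of_pos norm_minus_commute)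
   hence "tau * norm w <= tau * R" using inner by simp
   hence w: "y1 - tau *\<^sub>R w = ys" "norm w <= R" "ys - y1 = - (tau *\<^sub>R w)" using tau(1) w1 by simp_all
   \<comment> \<open>A net point \<open>p'\<close> near the maximiser \<open>p\<close> for the
     velocity \<open>w\<close> turns the value at the minimum into a bound by \<open>Lc\<close>. The
     errors add up to five \<open>dlt\<close>: two from \<open>k\<close>, two from replacing
     \<open>p\<close> by \<open>p'\<close>, one from the soft minimum at the start.\<close>
   obtain p where p: "norm p <= R'" "Lc c y1 w = p \<bullet> w - Hc c y1 p"
    using R'(4) y1' sub(2) w(2) by blast
   then obtain p' where p': "p' \<in> P" "dist p' p < eta" using P(3)[of p] Pm(2) by auto
   have "\<bar>Hc c y1 p' - Hc c y1 p\<bar> < dlt" by (rule dp[OF y1']) (use p p' Pm(2) Pn eta(2) in auto)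
   moreover have "(p - p') \<bullet> w <= dlt"
   proof -
    have "(p - p') \<bullet> w <= norm (p - p') * norm w" by (rule norm_cauchy_schwarz)
    also have "... <= eta * R" using p'(2) w(2) eta(1) by (intro mult_mono) (auto simp: dist_norm norm_minus_commute)
    finally show ?thesis using etaR by simp
   qed
   ultimately have "Lc c y1 w + a - 4 * dlt <= p' \<bullet> w - k p'" unfolding p(2) k_def by (simp add: inner_diff_left)
   hence "tau * (Lc c y1 w + a - 4 * dlt) <= tau * (p' \<bullet> w - k p')" using tau(1) by (intro mult_left_mono) auto
   moreover have "f tau ys <= - (tau * (p' \<bullet> w)) + tau * k p'" using f_le[OF p'(1), of tau ys] by (simp add: v_def w(3))
   moreover have "tau * (5 * dlt) <= tau * eps" using tau(1) dlt(3) by (intro mult_left_mono) auto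
   ultimately have "tau * (Lc c y1 w + a - eps) <= U y1 - U ys" using val `s0 = tau` by (simp add: algebra_simps)
   thus ?thesis using w B[OF ys] unfolding U_def by (intro exI[of _ w]) simp
  qed
  ultimately show ?thesis by blast
 qed
 moreover have "cball y0 (2 * r) \<subseteq> rng c" using sub(1) K(3) by blast
 ultimately show ?thesis using r R by blast
qed

text \<open>Realises the steps of \<open>vsup_step\<close> by curves whose action is close to the
  duration times the Lagrangian at the end point.\<close>

lemma h_step:
 assumes c: "c \<in> A" and r: "cball y0 r \<subseteq> rng c" and "R > 0" "eps > 0"
 shows "EX tau\<^sub>0>0. ALL tau y w. 0 < tau & tau <= tau\<^sub>0 & y \<in> cball y0 r & norm w <= R & y - tau *\<^sub>R w \<in> cball y0 r -->
  h tau (ci c (y - tau *\<^sub>R w)) (ci c y) <= ereal (tau * (Lc c y w + eps))"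
proof -
 have "uniformly_continuous_on (cball y0 r \<times> cball 0 R) (%(y, w). Lc c y w)"
  by (intro compact_uniformly_continuous compact_Times compact_cball continuous_on_subset[OF Lc_continuous[OF c]])
   (use r in auto)
 then obtain d where d: "d > 0" "ALL z:cball y0 r \<times> cball 0 R. ALL z':cball y0 r \<times> cball 0 R.
   dist z' z < d --> dist ((%(y, p). Lc c y p) z') ((%(y, p). Lc c y p) z) < eps"
  using `eps > 0` unfolding uniformly_continuous_on_def by blast
 have "h tau (ci c (y - tau *\<^sub>R w)) (ci c y) <= ereal (tau * (Lc c y w + eps))"
  if t: "0 < tau" "tau <= d / (2 * R)" and y: "y \<in> cball y0 r" and w: "norm w <= R" and y': "y - tau *\<^sub>R w \<in> cball y0 r" for tau y w
 proof (rule h_segment[OF c r y' y t(1)])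
  fix z assume z: "z \<in> closed_segment (y - tau *\<^sub>R w) y"
  hence zr: "z \<in> cball y0 r" using closed_segment_subset[OF y' y convex_cball] by blast
  have "dist z y <= norm (tau *\<^sub>R w)" using segment_bound(2)[OF z] by (simp add: dist_norm norm_minus_commute)
  also have "... <= d / (2 * R) * R" using t w unfolding norm_scaleR by (intro mult_mono) auto
  also have "... < d" using d(1) `R > 0` by simp
  finally have "dist z y < d" .
  hence "\<bar>Lc c z w - Lc c y w\<bar> < eps"
   using d(2)[THEN bspec, of "(y, w)", THEN bspec, of "(z, w)"] y zr w by (simp add: dist_Pair_Pair dist_real_def)
  thus "Lc c z ((1 / tau) *\<^sub>R (y - (y - tau *\<^sub>R w))) <= Lc c y w + eps" using t(1) by simp
 qed
 moreover have "d / (2 * R) > 0" using d(1) `R > 0` by simp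
 ultimately show ?thesis by blast
qed

text \<open>First-order expansion, uniform over bounded velocities; in the limit it makes the
  empirical measures closed.\<close>

lemma C1_step:
 assumes f: "f \<in> C1" and c: "c \<in> A" and r: "cball y0 r \<subseteq> rng c" and "R > 0" "eps > 0"
 shows "EX tau\<^sub>0>0. ALL tau y w. 0 < tau & tau <= tau\<^sub>0 & y \<in> cball y0 r & norm w <= R & y - tau *\<^sub>R w \<in> cball y0 r -->
  \<bar>f (ci c y) - f (ci c (y - tau *\<^sub>R w)) -
   tau * (case toc c (y, w) of (x, v) => blinfun_apply (dif f x) v)\<bar> <= tau * eps"
proof -
 obtain D where D: "C1_grad (rng c) (f o ci c) D" using C1_gradE[OF f c] by blast
 have "uniformly_continuous_on (cball y0 r) D"
  using D r unfolding C1_grad_def by (intro compact_uniformly_continuous compact_cball) (auto intro: continuous_on_subset)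
 moreover have "eps / R > 0" using assms by simp
 ultimately obtain d where d: "d > 0" "ALL z:cball y0 r. ALL z':cball y0 r. dist z' z < d --> dist (D z') (D z) < eps / R"
  unfolding uniformly_continuous_on_def by blast
 have "\<bar>f (ci c y) - f (ci c (y - tau *\<^sub>R w)) -
   tau * (case toc c (y, w) of (x, v) => blinfun_apply (dif f x) v)\<bar> <= tau * eps"
  if t: "0 < tau" "tau <= d / (2 * R)" and y: "y \<in> cball y0 r" and w: "norm w <= R" and y': "y - tau *\<^sub>R w \<in> cball y0 r" for tau y w
 proof -
  define S where "S = closed_segment (y - tau *\<^sub>R w) y"
  have S: "S \<subseteq> cball y0 r" unfolding S_def by (rule closed_segment_subset[OF y' y convex_cball])
  have near: "norm (D z - D y) <= eps / R" if z: "z \<in> S" for z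
  proof -
   have "dist z y <= norm (tau *\<^sub>R w)" using segment_bound(2)[OF z[unfolded S_def]] by (simp add: dist_norm norm_minus_commute)
   also have "... <= d / (2 * R) * R" using t w unfolding norm_scaleR by (intro mult_mono) auto
   also have "... < d" using d(1) `R > 0` by simp
   finally have "dist (D z) (D y) < eps / R" using d(2) y S z by blast
   thus ?thesis by (simp add: dist_norm)
  qed
  define F where "F z = (f o ci c) z - D y \<bullet> z" for z
  have "norm (F y - F (y - tau *\<^sub>R w)) <= eps / R * norm (y - (y - tau *\<^sub>R w))"
  proof (rule differentiable_bound[of S F "%z w. D z \<bullet> w - D y \<bullet> w"])
   show "convex S" by (simp add: S_def)
   show "(F has_derivative (%w. D z \<bullet> w - D y \<bullet> w)) (at z within S)" if "z \<in> S" for z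
   proof -
    have "z \<in> rng c" using that S r by blast
    hence "((f o ci c) has_derivative (%w. D z \<bullet> w)) (at z)" using D unfolding C1_grad_def by blast
    thus ?thesis unfolding F_def
     by (rule has_derivative_diff[OF has_derivative_at_withinI has_derivative_inner_right[OF has_derivative_ident]])
   qed
   show "onorm (%w. D z \<bullet> w - D y \<bullet> w) <= eps / R" if "z \<in> S" for z
   proof (rule onorm_le)
    fix w
    have "norm (D z \<bullet> w - D y \<bullet> w) <= norm (D z - D y) * norm w"
     unfolding inner_diff_left[symmetric] real_norm_def by (rule Cauchy_Schwarz_ineq2)
    also have "... <= eps / R * norm w" by (intro mult_right_mono near that) simp
    finally show "norm (D z \<bullet> w - D y \<bullet> w) <= eps / R * norm w" .
   qed
  qed (auto simp: S_def)
  also have "... = eps / R * (tau * norm w)" using t by simp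
  also have "... <= eps / R * (tau * R)" using t w assms by (intro mult_left_mono) auto
  also have "... = tau * eps" using `R > 0` by simp
  finally have 1: "norm (F y - F (y - tau *\<^sub>R w)) <= tau * eps" .
  have yr: "y \<in> rng c" using y r by blast
  have "(case toc c (y, w) of (x, v) => blinfun_apply (dif f x) v) = D y \<bullet> w"
   using differential_coordinates[OF c chart_inv_in[OF c yr] D, of w] by (simp add: tangent_of_chart_def Let_def chart_chart_inv[OF c yr])
  thus ?thesis using 1 by (simp add: F_def inner_diff_right)
 qed
 moreover have "d / (2 * R) > 0" using d(1) `R > 0` by simp
 ultimately show ?thesis by blast
qed

end

lemma eventually_at_right_0I:
 assumes "finite X" "!!i. i \<in> X ==> EX t0>0. ALL t y w. 0 < t & t <= t0 & P i t y w --> R i t y w"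
 shows "\<forall>\<^sub>F t in at_right (0::real). ALL i:X. ALL y w. P i t y w --> R i t y w"
proof (intro eventually_ball_finite[OF assms(1)] ballI)
 fix i assume "i \<in> X"
 from assms(2)[OF this] obtain t0 where t0: "t0 > 0" "ALL t y w. 0 < t & t <= t0 & P i t y w --> R i t y w"
  by (elim exE conjE)
 thus "\<forall>\<^sub>F t in at_right (0::real). ALL y w. P i t y w --> R i t y w"
  unfolding eventually_at_right_field by (intro exI[of _ t0] conjI) (simp_all add: less_imp_le)
qed

context hamiltonian begin

abbreviation LT :: "'m \<times> 'e => real" where "LT z \<equiv> (case z of (x, v) => lagrangian G x v)"
abbreviation dT :: "('m => real) => 'm \<times> 'e => real" where
 "dT f z \<equiv> (case z of (x, v) => blinfun_apply (dif f x) v)"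

text \<open>Iterates the step of \<open>vsup_step\<close> backwards from \<open>x\<close>. A finite
  cover makes all coordinate velocities at most \<open>R\<close>, so the points
  \<open>xi n k\<close> of the tangent bundle stay in a compact set. The tolerance
  \<open>1 / (real n + 1)\<^sup>2\<close> per unit of time remains negligible when summed over a
  total time of order \<open>n\<close>.\<close>

lemma calibrated_chains:
 assumes u: "viscosity_solution A G cv u"
 obtains X rho R tau q xi where "finite X" "ALL i:X. cball (ctr i) (rho i) \<subseteq> rng (ch i)"
  "ALL n k. EX i:X. EX y:cball (ctr i) (rho i). EX w:cball 0 R. xi n k = toc (ch i) (y, w)"
  "ALL n. 0 < tau n & tau n <= 1" "ALL n k. fst (xi n k) = q n k" "ALL n::nat. q n (0::nat) = x"
  "ALL n k. tau n * (LT (xi n k) + cv - 1 / (real n + 1)\<^sup>2) <= u (q n k) - u (q n (Suc k))"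
  "ALL n k. h (tau n) (q n (Suc k)) (q n k) <= ereal (tau n * (LT (xi n k) + 1 / (real n + 1)\<^sup>2))"
  "ALL f:C1. ALL eps>0. \<forall>\<^sub>F n in sequentially. ALL k. \<bar>f (q n k) - f (q n (Suc k)) - tau n * dT f (xi n k)\<bar> <= tau n * eps"
proof -
 have us: "vsub u cv" "vsup u cv" using u by (auto simp: viscosity_solution_iff)
 define st where "st c y0 r eps tau y w \<longleftrightarrow> y - tau *\<^sub>R w \<in> cball y0 (2 * r) &
   tau * (Lc c y w + cv - eps) <= u (ci c y) - u (ci c (y - tau *\<^sub>R w))"
  for c :: "('m, 'e) chart" and y0 r eps tau y w
 have "ALL i. EX rR. 0 < fst rR & 0 < snd rR & cball (ctr i) (2 * fst rR) \<subseteq> rng (ch i) &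
   (ALL eps>0. EX tau\<^sub>0>0. ALL tau y. 0 < tau & tau <= tau\<^sub>0 & y \<in> cball (ctr i) (fst rR) -->
    (EX w. norm w <= snd rR & st (ch i) (ctr i) (fst rR) eps tau y w))"
 proof
  fix i
  note * = vsup_step[OF us chart_at(1)[of i] imageI[OF chart_at(2)], folded st_def]
  then obtain r R where "r > 0" "R > 0" "cball (ctr i) (2 * r) \<subseteq> rng (ch i)"
   "ALL eps>0. EX tau\<^sub>0>0. ALL tau y. 0 < tau & tau <= tau\<^sub>0 & y \<in> cball (ctr i) r -->
    (EX w. norm w <= R & st (ch i) (ctr i) r eps tau y w)"
   by (elim exE conjE)
  thus "EX rR. 0 < fst rR & 0 < snd rR & cball (ctr i) (2 * fst rR) \<subseteq> rng (ch i) &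
   (ALL eps>0. EX tau\<^sub>0>0. ALL tau y. 0 < tau & tau <= tau\<^sub>0 & y \<in> cball (ctr i) (fst rR) -->
    (EX w. norm w <= snd rR & st (ch i) (ctr i) (fst rR) eps tau y w))" by (intro exI[of _ "(r, R)"]) simp
 qed
 from choice[OF this] obtain rR where rR: "ALL i. 0 < fst (rR i) & 0 < snd (rR i) & cball (ctr i) (2 * fst (rR i)) \<subseteq> rng (ch i) &
   (ALL eps>0. EX tau\<^sub>0>0. ALL tau y. 0 < tau & tau <= tau\<^sub>0 & y \<in> cball (ctr i) (fst (rR i)) -->
    (EX w. norm w <= snd (rR i) & st (ch i) (ctr i) (fst (rR i)) eps tau y w))" by (elim exE)
 define rho Rf where "rho i = fst (rR i)" and "Rf i = snd (rR i)" for i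
 have rho: "0 < rho i" "0 < Rf i" "cball (ctr i) (2 * rho i) \<subseteq> rng (ch i)" for i using rR by (auto simp: rho_def Rf_def)
 have rho': "cball (ctr i) (rho i) \<subseteq> rng (ch i)" "ball (ctr i) (rho i) \<subseteq> rng (ch i)" for i
 proof -
  have "cball (ctr i) (rho i) \<subseteq> cball (ctr i) (2 * rho i)" using rho(1)[of i] by (intro subset_cball) simp
  thus "cball (ctr i) (rho i) \<subseteq> rng (ch i)" using rho(3) by (rule subset_trans)
  thus "ball (ctr i) (rho i) \<subseteq> rng (ch i)" by (rule subset_trans[OF ball_subset_cball])
 qed
 obtain X where X: "finite X" "!!z. EX i:X. z \<in> fst (ch i) & snd (ch i) z \<in> ball (ctr i) (rho i)"
  by (rule finite_chart_cover[OF rho(1) rho'(2)]) blast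
 define R where "R = (\<Sum>i\<in>X. Rf i) + 1"
 have R: "Rf i <= R" if "i \<in> X" for i
  using member_le_sum[OF that, of Rf] rho(2) X(1) by (simp add: R_def less_imp_le)
 have R0: "R > 0" using rho(2) by (simp add: R_def sum_nonneg less_imp_le add_nonneg_pos)
 define S where "S tau z xi z' \<longleftrightarrow> (EX i:X. EX y:cball (ctr i) (rho i). EX w:cball 0 R. y - tau *\<^sub>R w \<in> cball (ctr i) (2 * rho i) &
   z = ci (ch i) y & z' = ci (ch i) (y - tau *\<^sub>R w) & xi = toc (ch i) (y, w))" for tau z xi z'
 define T where "T tau eps z xi z' \<longleftrightarrow> S tau z xi z' & tau * (LT xi + cv - eps) <= u z - u z' & h tau z' z <= ereal (tau * (LT xi + eps))" for tau eps z xi z'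
 have E1: "\<forall>\<^sub>F tau in at_right 0. ALL z. EX xiz. T tau eps z (fst xiz) (snd xiz)" if "eps > 0" for eps
 proof -
  define Q where "Q i tau y \<longleftrightarrow> (EX w. norm w <= Rf i & st (ch i) (ctr i) (rho i) eps tau y w)" for i tau y
  have rR': "EX tau\<^sub>0>0. ALL tau y. 0 < tau & tau <= tau\<^sub>0 & y \<in> cball (ctr i) (rho i) --> Q i tau y" for i
   using rR[THEN spec, of i] that unfolding Q_def rho_def Rf_def by (elim conjE) (erule allE, erule mp)
  have "\<forall>\<^sub>F tau in at_right 0. ALL i:X. ALL y z::unit. y \<in> cball (ctr i) (rho i) --> Q i tau y"
   by (rule eventually_at_right_0I[OF X(1)]) (use rR' in blast)
  moreover have "\<forall>\<^sub>F tau in at_right 0. ALL i:X. ALL y w. y \<in> cball (ctr i) (2 * rho i) & norm w <= R & y - tau *\<^sub>R w \<in> cball (ctr i) (2 * rho i) -->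
    h tau (ci (ch i) (y - tau *\<^sub>R w)) (ci (ch i) y) <= ereal (tau * (Lc (ch i) y w + eps))"
   by (rule eventually_at_right_0I[OF X(1)], rule h_step[OF chart_at(1) rho(3) R0 that])
  ultimately show ?thesis
  proof eventually_elim
   case (elim tau)
   show ?case
   proof
    fix z
    obtain i where i: "i \<in> X" "z \<in> fst (ch i)" "snd (ch i) z \<in> ball (ctr i) (rho i)" using X(2) by blast
    define y where "y = snd (ch i) z"
    have y: "y \<in> cball (ctr i) (rho i)" "y \<in> cball (ctr i) (2 * rho i)" "y \<in> rng (ch i)"
     using i rho(1)[of i] by (auto simp: y_def)
    obtain w where w: "norm w <= Rf i" "y - tau *\<^sub>R w \<in> cball (ctr i) (2 * rho i)"
     "tau * (Lc (ch i) y w + cv - eps) <= u (ci (ch i) y) - u (ci (ch i) (y - tau *\<^sub>R w))"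
     using elim(1) i(1) y(1) unfolding Q_def st_def by blast
    have wR: "norm w <= R" using w(1) R[OF i(1)] by simp
    have h: "h tau (ci (ch i) (y - tau *\<^sub>R w)) (ci (ch i) y) <= ereal (tau * (Lc (ch i) y w + eps))"
     using elim(2) i(1) y(2) wR w(2) by blast
    have z: "ci (ch i) y = z" using chart_inv_chart[OF chart_at(1) i(2)] by (simp add: y_def)
    have L: "LT (toc (ch i) (y, w)) = Lc (ch i) y w"
     using lagrangian_chart[OF chart_at(1) i(2), of w] unfolding y_def[symmetric] by (simp add: tangent_of_chart_def Let_def z)
    have "S tau z (toc (ch i) (y, w)) (ci (ch i) (y - tau *\<^sub>R w))"
     unfolding S_def using i(1) y(1) wR w(2) z by (intro bexI[of _ i] bexI[of _ y] bexI[of _ w]) auto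
    hence "T tau eps z (toc (ch i) (y, w)) (ci (ch i) (y - tau *\<^sub>R w))"
     unfolding T_def L using w(3) h by (simp only: z)
    thus "EX xiz. T tau eps z (fst xiz) (snd xiz)"
     by (intro exI[of _ "(toc (ch i) (y, w), ci (ch i) (y - tau *\<^sub>R w))"]) simp
   qed
  qed
 qed
 have "ALL n. EX taus. 0 < fst taus & fst taus < 1 / (real n + 1) & (ALL z. T (fst taus) (1 / (real n + 1)\<^sup>2) z (fst (snd taus z)) (snd (snd taus z)))"
 proof
  fix n :: nat
  have "\<forall>\<^sub>F tau in at_right 0. (ALL z. EX xiz. T tau (1 / (real n + 1)\<^sup>2) z (fst xiz) (snd xiz)) & tau \<in> {0<..<1 / (real n + 1)}"
   by (intro eventually_conj E1 eventually_at_right_real) auto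
  then obtain tau where tau: "ALL z. EX xiz. T tau (1 / (real n + 1)\<^sup>2) z (fst xiz) (snd xiz)" "tau \<in> {0<..<1 / (real n + 1)}"
   using eventually_happens'[OF trivial_limit_at_right_real] by blast
  from choice[OF tau(1)] obtain s where "ALL z. T tau (1 / (real n + 1)\<^sup>2) z (fst (s z)) (snd (s z))" by blast
  thus "EX taus. 0 < fst taus & fst taus < 1 / (real n + 1) & (ALL z. T (fst taus) (1 / (real n + 1)\<^sup>2) z (fst (snd taus z)) (snd (snd taus z)))"
   using tau(2) by (intro exI[of _ "(tau, s)"]) simp
 qed
 from choice[OF this] obtain taus where taus: "ALL n. 0 < fst (taus n) & fst (taus n) < 1 / (real n + 1) &
  (ALL z. T (fst (taus n)) (1 / (real n + 1)\<^sup>2) z (fst (snd (taus n) z)) (snd (snd (taus n) z)))" by blast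
 define tau where "tau n = fst (taus n)" for n
 define q where "q n k = ((%z. snd (snd (taus n) z)) ^^ k) x" for n k
 define xi where "xi n k = fst (snd (taus n) (q n k))" for n k
 have Tq: "T (tau n) (1 / (real n + 1)\<^sup>2) (q n k) (xi n k) (q n (Suc k))" for n k
  using taus by (simp add: tau_def q_def xi_def)
 have Sq: "S (tau n) (q n k) (xi n k) (q n (Suc k))" for n k using Tq unfolding T_def by blast
 have tau: "0 < tau n" "tau n < 1 / (real n + 1)" for n using taus by (auto simp: tau_def)
 have "1 / (real n + 1) <= 1" for n by simp
 hence tau1: "tau n <= 1" for n using tau(2)[of n] by (meson less_imp_le order_trans)
 have "tau \<longlonglongrightarrow> 0"
  by (rule tendsto_sandwich[OF _ _ tendsto_const LIMSEQ_inverse_real_of_nat])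
   (use tau in "auto simp: inverse_eq_divide add.commute intro!: always_eventually less_imp_le")
 hence tau0: "filterlim tau (at_right 0) sequentially" using tau(1) by (simp add: filterlim_at always_eventually less_imp_neq[THEN not_sym])
 show thesis
 proof (rule that[of X rho R xi tau q, OF X(1)])
  show "ALL n k. fst (xi n k) = q n k"
  proof (intro allI)
   fix n k
   obtain i y w where "q n k = ci (ch i) y" "xi n k = toc (ch i) (y, w)" using Sq[of n k] unfolding S_def by blast
   thus "fst (xi n k) = q n k" by (simp add: tangent_of_chart_def Let_def)
  qed
  show "ALL n k. EX i:X. EX y:cball (ctr i) (rho i). EX w:cball 0 R. xi n k = toc (ch i) (y, w)"
   using Sq unfolding S_def by blast
  show "ALL f:C1. ALL eps>0. \<forall>\<^sub>F n in sequentially. ALL k. \<bar>f (q n k) - f (q n (Suc k)) - tau n * dT f (xi n k)\<bar> <= tau n * eps"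
  proof (intro ballI allI impI)
   fix f and eps :: real assume f: "f \<in> C1" and "eps > 0"
   have "\<forall>\<^sub>F t in at_right 0. ALL i:X. ALL y w. y \<in> cball (ctr i) (2 * rho i) & norm w <= R & y - t *\<^sub>R w \<in> cball (ctr i) (2 * rho i) -->
    \<bar>f (ci (ch i) y) - f (ci (ch i) (y - t *\<^sub>R w)) - t * dT f (toc (ch i) (y, w))\<bar> <= t * eps"
    by (rule eventually_at_right_0I[OF X(1)], rule C1_step[OF f chart_at(1) rho(3) R0 `eps > 0`])
   hence "\<forall>\<^sub>F n in sequentially. ALL i:X. ALL y w. y \<in> cball (ctr i) (2 * rho i) & norm w <= R & y - tau n *\<^sub>R w \<in> cball (ctr i) (2 * rho i) -->
    \<bar>f (ci (ch i) y) - f (ci (ch i) (y - tau n *\<^sub>R w)) - tau n * dT f (toc (ch i) (y, w))\<bar> <= tau n * eps"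
    using tau0 by (rule eventually_compose_filterlim)
   thus "\<forall>\<^sub>F n in sequentially. ALL k. \<bar>f (q n k) - f (q n (Suc k)) - tau n * dT f (xi n k)\<bar> <= tau n * eps"
   proof (eventually_elim, intro allI)
    fix n k assume E: "ALL i:X. ALL y w. y \<in> cball (ctr i) (2 * rho i) & norm w <= R & y - tau n *\<^sub>R w \<in> cball (ctr i) (2 * rho i) -->
     \<bar>f (ci (ch i) y) - f (ci (ch i) (y - tau n *\<^sub>R w)) - tau n * dT f (toc (ch i) (y, w))\<bar> <= tau n * eps"
    obtain i y w where i: "i \<in> X" "y \<in> cball (ctr i) (rho i)" "w \<in> cball 0 R" "y - tau n *\<^sub>R w \<in> cball (ctr i) (2 * rho i)"
     "q n k = ci (ch i) y" "q n (Suc k) = ci (ch i) (y - tau n *\<^sub>R w)" "xi n k = toc (ch i) (y, w)"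
     using Sq[of n k] unfolding S_def by blast
    have "y \<in> cball (ctr i) (2 * rho i)" "norm w <= R" using i(2,3) rho(1)[of i] by auto
    thus "\<bar>f (q n k) - f (q n (Suc k)) - tau n * dT f (xi n k)\<bar> <= tau n * eps"
     using E i(1,4) unfolding i(5,6,7) by blast
   qed
  qed
  show "ALL i:X. cball (ctr i) (rho i) \<subseteq> rng (ch i)" using rho'(1) by blast
  show "ALL n. 0 < tau n & tau n <= 1" using tau(1) tau1 by blast
  show "ALL n. q n 0 = x" by (simp add: q_def)
 qed (use Tq in "simp_all add: T_def")
qed

text \<open>Integrate Fenchel's inequality against an almost critical C1 function, whose
  differential has integral zero.\<close>

lemma lagrangian_integral_ge:
 assumes mu: "closed_measure A g mu" and L: "integrable mu LT"
  and d: "!!f. f \<in> C1 ==> integrable mu (dT f)"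
 shows "- cv <= integral\<^sup>L mu LT"
proof (rule field_le_epsilon)
 fix e :: real assume "e > 0"
 interpret prob_space mu using mu by (simp add: closed_measure_def)
 obtain f where f: "f \<in> C1" "!!x. G x (dif f x) <= cv + e"
  by (rule critical_value_approx[OF `e > 0`]) blast
 have "integral\<^sup>L mu (dT f) <= integral\<^sup>L mu (%z. LT z + (cv + e))"
 proof (rule integral_mono[OF d[OF f(1)]])
  show "dT f z <= LT z + (cv + e)" for z
   using Fenchel[of "dif f (fst z)" "snd z" "fst z"] f(2)[of "fst z"] by (simp add: case_prod_beta)
 qed (use L in simp)
 moreover have "integral\<^sup>L mu (dT f) = 0" using mu f(1) unfolding closed_measure_def by blast
 ultimately show "- cv <= integral\<^sup>L mu LT + e" using L by (simp add: prob_space)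
qed

end

section \<open>Mather measures from backward chains\<close>

context weak_kam begin

text \<open>Telescoping the decrease of \<open>u\<close> shows that the averaged Lagrangian is at
  most \<open>- cv\<close> up to errors of order 1/n; closed measures satisfy the reverse
  inequality. For the barrier: the chain from \<open>q n k\<close> to \<open>x\<close>, with
  \<open>cv\<close> times its duration added to its action, costs at most
  \<open>u x - u (q n k)\<close> plus a small error. Once its duration exceeds the uniform threshold
  \<open>T\<close> this bounds \<open>kp (q n k) x\<close>, and the earlier indices have vanishing
  weight.\<close>

lemma viscosity_mather:
 assumes u: "viscosity_solution A G cv u"
 obtains mu where "mather mu" "integrable mu (%z. kp (fst z) x + u (fst z) - u x)"
  "(\<integral>z. kp (fst z) x + u (fst z) - u x \<partial>mu) <= 0"
proof -
 have us: "vsub u cv" using u by (simp add: viscosity_solution_iff)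
 obtain X rho R tau q xi where X: "finite X" "ALL i:X. cball (ctr i) (rho i) \<subseteq> rng (ch i)"
  "ALL n k. EX i:X. EX y:cball (ctr i) (rho i). EX w:cball 0 R. xi n k = toc (ch i) (y, w)"
  and tau: "ALL n. 0 < tau n & tau n <= 1" and q: "ALL n k. fst (xi n k) = q n k" "ALL n::nat. q n (0::nat) = x"
  and dec: "ALL n k. tau n * (LT (xi n k) + cv - 1 / (real n + 1)\<^sup>2) <= u (q n k) - u (q n (Suc k))"
  and hst: "ALL n k. h (tau n) (q n (Suc k)) (q n k) <= ereal (tau n * (LT (xi n k) + 1 / (real n + 1)\<^sup>2))"
  and dst: "ALL f:C1. ALL eps>0. \<forall>\<^sub>F n in sequentially. ALL k. \<bar>f (q n k) - f (q n (Suc k)) - tau n * dT f (xi n k)\<bar> <= tau n * eps"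
  by (rule calibrated_chains[OF u, of x])
 \<comment> \<open>The number of steps for which the total time lies between \<open>n + 1\<close>
   and \<open>n + 2\<close>.\<close>
 define N where "N n = nat \<lceil>(real n + 1) / tau n\<rceil>" for n
 define eps where "eps n = 1 / (real n + 1)\<^sup>2" for n :: nat
 have Npos: "(real n + 1) / tau n > 0" for n using tau by simp
 have N: "real n + 1 <= real (N n) * tau n" "real (N n) * tau n <= real n + 2" for n
 proof -
  have "(real n + 1) / tau n <= real (N n)" "real (N n) < (real n + 1) / tau n + 1"
   using Npos[of n] unfolding N_def by linarith+
  from this(1) this(2)[THEN less_imp_le]
  have "(real n + 1) / tau n * tau n <= real (N n) * tau n" "real (N n) * tau n <= ((real n + 1) / tau n + 1) * tau n"
   using tau[THEN spec, of n] by (intro mult_right_mono; simp only: less_imp_le)+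
  moreover have "(real n + 1) / tau n * tau n = real n + 1" using tau[THEN spec, of n] by simp
  ultimately show "real n + 1 <= real (N n) * tau n" "real (N n) * tau n <= real n + 2"
   using tau[THEN spec, of n] by (simp_all add: distrib_right)
 qed
 have N0: "0 < N n" for n using N(1)[of n] by (cases "N n = 0") auto
 have "EX r mu. strict_mono r & prob_space mu & sets mu = sets (tangent_borel A) & (ALL phi. tcont phi --> integrable mu phi &
    (%j. (\<Sum>k<N (r j). phi (xi (r j) k)) / N (r j)) \<longlonglongrightarrow> integral\<^sup>L mu phi)"
  by (rule tangent_weak_limit[where X = X and rho = rho and N = N and R = R and xi = xi, OF X(1) X(2)[THEN bspec] N0 X(3)[THEN spec, THEN spec]], assumption) blast
 then obtain r mu where r: "strict_mono r" and mu: "prob_space mu" "sets mu = sets (tangent_borel A)"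
  and lim: "!!phi. tcont phi ==> integrable mu phi" "!!phi. tcont phi ==> (%j. (\<Sum>k<N (r j). phi (xi (r j) k)) / N (r j)) \<longlonglongrightarrow> integral\<^sup>L mu phi"
  by blast
 have le: "integral\<^sup>L mu phi <= l" if "tcont phi" and ev: "\<forall>\<^sub>F n in sequentially. (\<Sum>k<N n. phi (xi n k)) / N n <= b n" and "b \<longlonglongrightarrow> l" for phi b l
 proof (rule tendsto_le[OF trivial_limit_sequentially _ lim(2)[OF that(1)]])
  show "(%j. b (r j)) \<longlonglongrightarrow> l" using LIMSEQ_subseq_LIMSEQ[OF that(3) r] by (simp add: comp_def)
  show "\<forall>\<^sub>F j in sequentially. (\<Sum>k<N (r j). phi (xi (r j) k)) / N (r j) <= b (r j)"
   by (rule eventually_subseq[OF r ev])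
 qed
 obtain B where B: "B > 0" "!!z. \<bar>u z\<bar> <= B" using bounded_continuous us unfolding vsub_def by blast
 have small: "(%n. K / (real n + 1)) \<longlonglongrightarrow> 0" for K :: real
  using tendsto_mult_right_zero[OF LIMSEQ_inverse_real_of_nat, of K] by (simp add: divide_inverse add.commute)
 have eps: "eps n <= 1 / (real n + 1)" "eps n * (real n + 2) <= 2 / (real n + 1)" for n
 proof -
  have "(real n + 1) * 1 <= (real n + 1) * (real n + 1)" by (intro mult_left_mono) auto
  thus "eps n <= 1 / (real n + 1)" unfolding eps_def power2_eq_square by (intro divide_left_mono) auto
  have "eps n * (real n + 2) <= eps n * (2 * (real n + 1))" unfolding eps_def by (intro mult_left_mono) auto
  also have "... = 2 / (real n + 1)"
  proof -
   have "1 / m\<^sup>2 * (2 * m) = 2 / m" if "m > 0" for m :: real using that by (simp add: power2_eq_square)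
   from this[of "real n + 1"] show ?thesis unfolding eps_def by simp
  qed
  finally show "eps n * (real n + 2) <= 2 / (real n + 1)" .
 qed
 have avg: "t / real (N n) <= b" if "tau n * t <= b * (real (N n) * tau n)" for t b n
 proof -
  have "tau n * t <= tau n * (b * real (N n))" using that by (simp add: mult_ac)
  hence "t <= b * real (N n)" using tau[THEN spec, of n] by simp
  thus ?thesis using N0[of n] by (simp add: divide_le_eq)
 qed
 \<comment> \<open>A bounded boundary term amounts to at most \<open>K / (n + 1)\<close> per unit of
   the total time.\<close>
 have absorb: "K <= K / (real n + 1) * (real (N n) * tau n)" if "K >= 0" for K n
 proof -
  have "K / (real n + 1) * (real n + 1) <= K / (real n + 1) * (real (N n) * tau n)" using N(1) that by (intro mult_left_mono) auto
  thus ?thesis by simp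
 qed
 have tel: "(\<Sum>j<k. f (q n j) - f (q n (Suc j))) = f x - f (q n k)" for f :: "'m => real" and n k
  using sum_lessThan_telescope'[of "%j. f (q n j)" k] q(2) by simp
 have sumL: "tau n * (\<Sum>j<k. LT (xi n j)) <= u x - u (q n k) - (cv - eps n) * (real k * tau n)" for n k
 proof -
  have "(\<Sum>j<k. tau n * (LT (xi n j) + cv - eps n)) <= (\<Sum>j<k. u (q n j) - u (q n (Suc j)))"
   by (rule sum_mono) (use dec in "simp add: eps_def")
  moreover have "(\<Sum>j<k. tau n * (LT (xi n j) + cv - eps n)) = tau n * (\<Sum>j<k. LT (xi n j)) + (cv - eps n) * (real k * tau n)"
   by (simp add: sum_distrib_left[symmetric] sum.distrib sum_subtractf algebra_simps)
  ultimately show ?thesis by (simp add: tel)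
 qed
 have act: "h (real (Suc k) * tau n) (q n (Suc k)) x <= ereal (tau n * (\<Sum>j<Suc k. LT (xi n j)) + eps n * (real (Suc k) * tau n))" for n k
 proof (induction k)
  case 0
  thus ?case using hst[THEN spec, THEN spec, of n 0] q(2) by (simp add: eps_def algebra_simps)
 next
  case (Suc k)
  have "h (tau n + real (Suc k) * tau n) (q n (Suc (Suc k))) x <=
    ereal (tau n * (LT (xi n (Suc k)) + eps n) + (tau n * (\<Sum>j<Suc k. LT (xi n j)) + eps n * (real (Suc k) * tau n)))"
   by (rule h_triangle[OF _ Suc.IH]) (use hst tau in "auto simp: eps_def less_imp_le")
  thus ?case by (simp add: algebra_simps)
 qed
 have act': "h (real (Suc k) * tau n) (q n (Suc k)) x <= ereal (u x - u (q n (Suc k)) + 2 * eps n * (real (Suc k) * tau n) - cv * (real (Suc k) * tau n))" for n k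
  by (rule order_trans[OF act]) (use sumL[of n "Suc k"] in "simp add: algebra_simps")
 have cl: "closed_measure A g mu" unfolding closed_measure_def
 proof (intro conjI ballI mu lim(1)[OF tcont_tangent_norm])
  fix f assume f: "f \<in> C1"
  obtain Bf where Bf: "Bf > 0" "!!z. \<bar>f z\<bar> <= Bf" by (rule bounded_continuous[OF C1_functions_continuous[OF f]]) blast
  have tf: "tcont (dT f)" by (rule tcont_differential[OF f])
  hence tm: "tcont (%z. - dT f z)" unfolding tcont_def by (intro ballI continuous_on_minus) blast
  have "\<bar>integral\<^sup>L mu (dT f)\<bar> <= e" if "e > 0" for e
  proof -
   have ev: "\<forall>\<^sub>F n in sequentially. \<bar>(\<Sum>k<N n. dT f (xi n k))\<bar> / N n <= e + 2 * Bf / (real n + 1)"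
    using dst[THEN bspec, OF f, THEN spec, THEN mp, OF that]
   proof eventually_elim
    case (elim n)
    have "\<bar>tau n * (\<Sum>k<N n. dT f (xi n k)) - (f x - f (q n (N n)))\<bar> = \<bar>\<Sum>k<N n. f (q n k) - f (q n (Suc k)) - tau n * dT f (xi n k)\<bar>"
     by (simp add: sum_subtractf[of "%k. f (q n k) - f (q n (Suc k))"] tel sum_distrib_left[symmetric] abs_minus_commute)
    also have "... <= (\<Sum>k<N n. tau n * e)" by (rule order_trans[OF sum_abs sum_mono]) (use elim in blast)
    also have "... = e * (real (N n) * tau n)" by simp
    finally have 1: "\<bar>tau n * (\<Sum>k<N n. dT f (xi n k)) - (f x - f (q n (N n)))\<bar> <= e * (real (N n) * tau n)" .
    have "\<bar>f x - f (q n (N n))\<bar> <= 2 * Bf" using Bf(2)[of x] Bf(2)[of "q n (N n)"] by linarith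
    also have "... <= 2 * Bf / (real n + 1) * (real (N n) * tau n)" by (rule absorb) (use Bf(1) in simp)
    finally have "\<bar>tau n * (\<Sum>k<N n. dT f (xi n k))\<bar> <= (e + 2 * Bf / (real n + 1)) * (real (N n) * tau n)"
     using 1 unfolding distrib_right by linarith
    hence "tau n * \<bar>\<Sum>k<N n. dT f (xi n k)\<bar> <= (e + 2 * Bf / (real n + 1)) * (real (N n) * tau n)"
     using tau[THEN spec, of n] by (simp add: abs_mult)
    thus ?case by (rule avg)
   qed
   have lim: "(%n. e + 2 * Bf / (real n + 1)) \<longlonglongrightarrow> e" using tendsto_add[OF tendsto_const small, of e] by simp
   have ev1: "\<forall>\<^sub>F n in sequentially. (\<Sum>k<N n. dT f (xi n k)) / N n <= e + 2 * Bf / (real n + 1)"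
    using ev by (rule eventually_mono) (erule order_trans[rotated], intro divide_right_mono, auto)
   have ev2: "\<forall>\<^sub>F n in sequentially. (\<Sum>k<N n. - dT f (xi n k)) / N n <= e + 2 * Bf / (real n + 1)"
    using ev by (rule eventually_mono) (erule order_trans[rotated], unfold sum_negf, intro divide_right_mono, auto)
   show ?thesis using le[OF tf ev1 lim] le[OF tm ev2 lim] by (auto simp: abs_le_iff)
  qed
  hence "\<bar>integral\<^sup>L mu (dT f)\<bar> <= 0" by (rule field_le_epsilon) simp
  thus "integral\<^sup>L mu (dT f) = 0" by simp
 qed
 have "integral\<^sup>L mu LT <= - cv"
 proof (rule le[OF tcont_lagrangian])
  show "\<forall>\<^sub>F n in sequentially. (\<Sum>k<N n. LT (xi n k)) / N n <= (2 * B + 1) / (real n + 1) - cv"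
  proof (intro always_eventually allI avg)
   fix n
   have "u x - u (q n (N n)) <= 2 * B" using B(2)[of x] B(2)[of "q n (N n)"] by linarith
   also have "... <= 2 * B / (real n + 1) * (real (N n) * tau n)" by (rule absorb) (use B(1) in simp)
   finally have "tau n * (\<Sum>k<N n. LT (xi n k)) <= 2 * B / (real n + 1) * (real (N n) * tau n) - (cv - eps n) * (real (N n) * tau n)"
    using sumL[of n "N n"] by linarith
   moreover have "eps n * (real (N n) * tau n) <= 1 / (real n + 1) * (real (N n) * tau n)"
    using eps(1) tau[THEN spec, of n] by (intro mult_right_mono) auto
   ultimately show "tau n * (\<Sum>k<N n. LT (xi n k)) <= ((2 * B + 1) / (real n + 1) - cv) * (real (N n) * tau n)"
    unfolding left_diff_distrib add_divide_distrib distrib_right by linarith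
  qed
  show "(%n. (2 * B + 1) / (real n + 1) - cv) \<longlonglongrightarrow> - cv" using tendsto_diff[OF small tendsto_const, of "2 * B + 1" cv] by simp
 qed
 moreover have "- cv <= integral\<^sup>L mu LT"
  by (rule lagrangian_integral_ge[OF cl]) (simp_all add: lim(1) tcont_lagrangian tcont_differential)
 ultimately have "has_bochner_integral mu LT (- cv)"
  using lim(1)[OF tcont_lagrangian] by (simp add: has_bochner_integral_iff)
 hence M: "mather mu" unfolding mather_measure_def using cl by simp
 define F where "F y = kp y x + u y - u x" for y
 have "continuous_on UNIV (%y. - kp y x)" "continuous_on UNIV u" using kp_vsub(2)[of x] us unfolding vsub_def by blast+
 from continuous_on_diff[OF continuous_on_add[OF continuous_on_minus[OF this(1)] this(2)] continuous_on_const[of _ "u x"]]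
 have "continuous_on UNIV (%y. - (- kp y x) + u y - u x)" .
 hence cF: "continuous_on UNIV F" by (simp add: F_def[abs_def])
 obtain FB where FB: "FB > 0" "!!y. \<bar>F y\<bar> <= FB" by (rule bounded_continuous[OF cF]) blast
 have "(\<integral>z. F (fst z) \<partial>mu) <= 0"
 proof (rule field_le_epsilon)
  fix dlt :: real assume "dlt > 0"
  then obtain T where T: "T > 0" "!!t z y r. t >= T ==> h t z y <= ereal r ==> kp z y - dlt <= r + cv * t"
   by (rule kp_uniform) blast
  have "(\<integral>z. F (fst z) \<partial>mu) <= dlt"
  proof (rule le[OF tcont_fst[OF cF]])
   show "\<forall>\<^sub>F n in sequentially. (\<Sum>k<N n. F (fst (xi n k))) / N n <= dlt + (4 + FB * (T + 1)) / (real n + 1)"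
   proof (intro always_eventually allI avg)
    fix n
    have Fk: "F (q n k) <= (dlt + 4 / (real n + 1)) + FB * (if real k * tau n < T then 1 else 0)" if "k < N n" for k
    proof (cases "real k * tau n < T")
     case True
     have "0 <= dlt + 4 / (real n + 1)" using `dlt > 0` by (intro add_nonneg_nonneg) auto
     thus ?thesis using FB(2)[of "q n k"] True by (simp add: abs_le_iff)
    next
     case False
     then obtain k' where k': "k = Suc k'" using T(1) by (cases k) auto
     have "kp (q n k) x - dlt <= u x - u (q n k) + 2 * eps n * (real k * tau n) - cv * (real k * tau n) + cv * (real k * tau n)"
      unfolding k' by (rule T(2)[OF _ act']) (use False k' in simp)
     moreover have "eps n * (real k * tau n) <= eps n * (real n + 2)"
     proof (rule mult_left_mono)
      have "real k * tau n <= real (N n) * tau n" using that tau[THEN spec, of n] by (intro mult_right_mono) auto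
      thus "real k * tau n <= real n + 2" using N(2)[of n] by simp
     qed (simp add: eps_def)
     ultimately show ?thesis using eps(2)[of n] False by (simp add: F_def)
    qed
    \<comment> \<open>Counts the indices before time \<open>T\<close>, at most
      \<open>T / tau n + 1\<close> of them; multiplied by \<open>tau n\<close> this is bounded, so
      their share of the total time tends to zero.\<close>
    define I where "I = (\<Sum>k<N n. (if real k * tau n < T then 1 else 0 :: real))"
    have ceil: "real k < t ==> k < nat \<lceil>t\<rceil>" "0 < t ==> real (nat \<lceil>t\<rceil>) <= t + 1" for k :: nat and t :: real by linarith+
    have "I = real (card {k \<in> {..<N n}. real k * tau n < T})"
     by (simp add: I_def sum.If_cases Int_def)
    also have "... <= real (card {..<nat \<lceil>T / tau n\<rceil>})"
    proof (intro of_nat_mono card_mono)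
     show "{k \<in> {..<N n}. real k * tau n < T} \<subseteq> {..<nat \<lceil>T / tau n\<rceil>}"
     proof
      fix k assume "k \<in> {k \<in> {..<N n}. real k * tau n < T}"
      hence "real k < T / tau n" using tau[THEN spec, of n] by (simp add: pos_less_divide_eq)
      thus "k \<in> {..<nat \<lceil>T / tau n\<rceil>}" by (simp add: ceil(1))
     qed
    qed simp
    also have "... <= T / tau n + 1"
    proof -
     have "0 < T / tau n" using T(1) tau by simp
     thus ?thesis by (simp add: ceil(2))
    qed
    finally have card: "I <= T / tau n + 1" .
    have "tau n * I <= tau n * (T / tau n + 1)"
     using tau[THEN spec, of n] by (intro mult_left_mono[OF card]) simp
    also have "... <= T + 1" using tau[THEN spec, of n] by (simp add: distrib_left)
    finally have "tau n * I <= T + 1" .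
    hence card': "FB * (tau n * I) <= FB * (T + 1)"
     using FB(1) by (intro mult_left_mono) auto
    have "(\<Sum>k<N n. F (fst (xi n k))) <= (\<Sum>k<N n. (dlt + 4 / (real n + 1)) + FB * (if real k * tau n < T then 1 else 0))"
    proof (rule sum_mono)
     fix k assume "k \<in> {..<N n}"
     thus "F (fst (xi n k)) <= (dlt + 4 / (real n + 1)) + FB * (if real k * tau n < T then 1 else 0)"
      using Fk[of k] unfolding q(1)[THEN spec, THEN spec] lessThan_iff by blast
    qed
    also have "... = real (N n) * (dlt + 4 / (real n + 1)) + FB * I"
     by (simp only: I_def sum.distrib sum_constant card_lessThan sum_distrib_left distrib_left)
    finally have "(\<Sum>k<N n. F (fst (xi n k))) <= real (N n) * (dlt + 4 / (real n + 1)) + FB * I" .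
    hence "tau n * (\<Sum>k<N n. F (fst (xi n k))) <= tau n * (real (N n) * (dlt + 4 / (real n + 1)) + FB * I)"
     by (rule mult_left_mono) (use tau in "simp add: less_imp_le")
    also have "... = (dlt + 4 / (real n + 1)) * (real (N n) * tau n) + FB * (tau n * I)" by (simp only: algebra_simps)
    also have "... <= (dlt + 4 / (real n + 1)) * (real (N n) * tau n) + FB * (T + 1)" using card' by (rule add_left_mono)
    also have "... <= (dlt + 4 / (real n + 1)) * (real (N n) * tau n) + FB * (T + 1) / (real n + 1) * (real (N n) * tau n)"
     by (intro add_left_mono absorb) (use FB(1) T(1) in simp)
    also have "... = (dlt + (4 + FB * (T + 1)) / (real n + 1)) * (real (N n) * tau n)"
     by (simp only: add_divide_distrib distrib_right add.assoc)
    finally show "tau n * (\<Sum>k<N n. F (fst (xi n k))) <= (dlt + (4 + FB * (T + 1)) / (real n + 1)) * (real (N n) * tau n)" .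
   qed
   show "(%n. dlt + (4 + FB * (T + 1)) / (real n + 1)) \<longlonglongrightarrow> dlt" using tendsto_add[OF tendsto_const small, of dlt] by simp
  qed
  thus "(\<integral>z. F (fst z) \<partial>mu) <= 0 + dlt" by simp
 qed
 thus thesis using that[OF M] lim(1)[OF tcont_fst[OF cF]] by (simp add: F_def)
qed

end

section \<open>Invariant sets of Mather measures\<close>

context hamiltonian begin

lemma mather_facts:
 assumes "mather mu"
 shows "prob_space mu" "sets mu = sets (tangent_borel A)" "integrable mu LT" "integral\<^sup>L mu LT = - cv"
  and "f \<in> C1 ==> integral\<^sup>L mu (dT f) = 0" and "f \<in> C1 ==> integrable mu (dT f)"
  and "tcont phi ==> phi \<in> borel_measurable mu"
proof -
 have "has_bochner_integral mu LT (- cv)" using assms unfolding mather_measure_def by blast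
 thus L: "integrable mu LT" and "integral\<^sup>L mu LT = - cv" by (auto simp: has_bochner_integral_iff)
 show p: "prob_space mu" and s: "sets mu = sets (tangent_borel A)" using assms unfolding mather_measure_def closed_measure_def by blast+
 interpret prob_space mu by (rule p)
 show m: "phi \<in> borel_measurable mu" if "tcont phi" for phi
  using tcont_measurable[OF that] measurable_cong_sets[OF s refl] by blast
 assume f: "f \<in> C1"
 show "integral\<^sup>L mu (dT f) = 0" using assms f unfolding mather_measure_def closed_measure_def by blast
 \<comment> \<open>Fenchel bounds the differentials of \<open>f\<close> and of \<open>- f\<close> by
   the Lagrangian plus a constant, which gives an integrable bound on both sides.\<close>
 have f': "(%x. (- 1) * f x) \<in> C1" by (rule C1_mult[OF C1_const f])
 have df': "dif (%x. (- 1) * f x) x = - dif f x" for x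
  using differential_mult[OF C1_const[of "- 1"] f, of x] by (simp add: differential_const)
 obtain B1 where B1: "!!x. \<bar>G x (dif f x)\<bar> <= B1" by (rule bounded_continuous[OF G_differential_continuous[OF f]]) blast
 obtain B2 where B2: "!!x. \<bar>G x (dif (%x. (- 1) * f x) x)\<bar> <= B2" by (rule bounded_continuous[OF G_differential_continuous[OF f']]) blast
 have bd: "\<bar>dT f z\<bar> <= LT z + (\<bar>B1\<bar> + \<bar>B2\<bar>)" for z
 proof -
  have "dT f z <= LT z + \<bar>B1\<bar>"
   using Fenchel[of "dif f (fst z)" "snd z" "fst z"] B1[of "fst z"] by (simp add: case_prod_beta)
  moreover have "- dT f z <= LT z + \<bar>B2\<bar>"
   using Fenchel[of "- dif f (fst z)" "snd z" "fst z"] B2[of "fst z", unfolded df'] by (simp add: case_prod_beta blinfun.minus_left)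
  ultimately show ?thesis by linarith
 qed
 have "integrable mu (%z. LT z + (\<bar>B1\<bar> + \<bar>B2\<bar>))" using L by simp
 thus "integrable mu (dT f)"
 proof (rule Bochner_Integration.integrable_bound)
  show "AE z in mu. norm (dT f z) <= norm (LT z + (\<bar>B1\<bar> + \<bar>B2\<bar>))" using bd by (intro AE_I2) (simp add: order_trans[OF _ abs_ge_self])
 qed (rule m[OF tcont_differential[OF f]])
qed

text \<open>For \<open>B\<close> of positive measure this says that \<open>mu\<close> restricted to
  \<open>B\<close> and normalised is again a Mather measure (\<open>invariant_restrict\<close>); no
  flow is involved.\<close>

definition invariant :: "('m \<times> 'e) measure => ('m \<times> 'e) set => bool" where
 "invariant mu B \<longleftrightarrow> B \<in> sets mu & (ALL f:C1. (\<integral>z. indicator B z * dT f z \<partial>mu) = 0) &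
   (\<integral>z. indicator B z * (LT z + cv) \<partial>mu) = 0"

lemma integrable_indicator_mult:
 fixes f :: "_ => real"
 assumes "integrable mu f" "B \<in> sets mu"
 shows "integrable mu (%z. indicator B z * f z)"
 using integrable_mult_indicator[OF assms(2,1)] by simp

lemma invariant_Diff:
 assumes mu: "mather mu" and B: "invariant mu B" "invariant mu B'" "B' \<subseteq> B"
 shows "invariant mu (B - B')"
proof -
 interpret prob_space mu by (rule mather_facts(1)[OF mu])
 have s: "B \<in> sets mu" "B' \<in> sets mu" using B unfolding invariant_def by blast+
 have ind: "indicator (B - B') z * t = indicator B z * t - indicator B' z * t" for z and t :: real
  using B(3) by (auto simp: indicator_def)
 have int: "(\<integral>z. indicator (B - B') z * f z \<partial>mu) = (\<integral>z. indicator B z * f z \<partial>mu) - (\<integral>z. indicator B' z * f z \<partial>mu)"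
  if "integrable mu f" for f :: "_ => real"
  unfolding ind by (intro Bochner_Integration.integral_diff integrable_indicator_mult that s)
 have Li: "integrable mu (%z. LT z + cv)" using mather_facts(3)[OF mu] by simp
 show ?thesis unfolding invariant_def
 proof (intro conjI ballI)
  show "B - B' \<in> sets mu" using s by (rule sets.Diff)
  show "(\<integral>z. indicator (B - B') z * (LT z + cv) \<partial>mu) = 0" using B(1,2) int[OF Li] unfolding invariant_def by simp
  fix f assume f: "f \<in> C1"
  thus "(\<integral>z. indicator (B - B') z * dT f z \<partial>mu) = 0" using B(1,2) int[OF mather_facts(6)[OF mu f]] unfolding invariant_def by simp
 qed
qed

text \<open>By Fenchel the difference of the Lagrangian plus \<open>cv\<close> and the differential
  of an approximant is at least minus the tolerance, and its integral against a Mather measure is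
  zero; so it is small in the mean.\<close>

lemma vsub_approximants:
 assumes mu: "mather mu" and v: "vsub v cv"
 obtains f where "f \<in> C1" "!!x. \<bar>f x - v x\<bar> <= 1 / (real n + 1)"
  "integrable mu (%z. \<bar>LT z + cv - dT f z\<bar>)" "(\<integral>z. \<bar>LT z + cv - dT f z\<bar> \<partial>mu) <= 2 / (real n + 1)"
proof -
 interpret prob_space mu by (rule mather_facts(1)[OF mu])
 define e where "e = 1 / (real n + 1)"
 have e: "e > 0" by (simp add: e_def)
 obtain f where f: "f \<in> C1" "!!x. \<bar>f x - v x\<bar> <= e" "!!x. G x (dif f x) <= cv + e"
  by (rule vsub_smooth[OF v e]) blast
 have int: "integrable mu (%z. LT z + cv - dT f z)" using mather_facts(3)[OF mu] mather_facts(6)[OF mu f(1)] by simp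
 have "\<bar>LT z + cv - dT f z\<bar> <= (LT z + cv - dT f z) + 2 * e" for z
  using Fenchel[of "dif f (fst z)" "snd z" "fst z"] f(3)[of "fst z"] e by (simp add: case_prod_beta abs_if)
 hence "(\<integral>z. \<bar>LT z + cv - dT f z\<bar> \<partial>mu) <= (\<integral>z. (LT z + cv - dT f z) + 2 * e \<partial>mu)"
  using int by (intro integral_mono) auto
 also have "... = 2 * e" using int mather_facts(3-6)[OF mu] f(1) by (simp add: prob_space)
 finally show thesis using that[OF f(1)] f(2) int by (simp add: e_def)
qed

text \<open>The dilations of this C1 function converge to the indicator of the positive reals,
  matching the strict inequality in \<open>invariant_less\<close>; its bounded derivative controls
  both the replacement of \<open>v\<close>, \<open>v'\<close> by approximants and the derivative
  term.\<close>

lemma smooth_step: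
 obtains tht tht' :: "real => real" where "!!t. (tht has_real_derivative tht' t) (at t)" "continuous_on UNIV tht'" "!!t. \<bar>tht' t\<bar> <= 1"
  "!!t. 0 <= tht t & tht t <= 1" "!!t. (%m. tht (real m * t)) \<longlonglongrightarrow> (if 0 < t then 1 else 0)"
proof -
 define tht where "tht t = pos_sq t / (1 + pos_sq t)" for t
 define tht' where "tht' t = 2 * max 0 t / (1 + pos_sq t)\<^sup>2" for t
 have p: "1 + pos_sq t > 0" for t using pos_sq_nonneg[of t] by simp
 show thesis
 proof (rule that[of tht tht'])
  fix t
  show "(tht has_real_derivative tht' t) (at t)" unfolding tht_def tht'_def
   using p[of t] by (auto intro!: derivative_eq_intros DERIV_pos_sq simp: field_simps power2_eq_square)
  have "2 * max 0 t <= 1 + pos_sq t" using sum_squares_bound[of 1 "max 0 t"] by (simp add: pos_sq_def)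
  also have "... <= (1 + pos_sq t)\<^sup>2" using pos_sq_nonneg[of t] by (simp add: power2_eq_square algebra_simps)
  finally show "\<bar>tht' t\<bar> <= 1" using p[of t] by (simp add: tht'_def)
  show "0 <= tht t & tht t <= 1" using pos_sq_nonneg[of t] by (simp add: tht_def)
  show "(%m. tht (real m * t)) \<longlonglongrightarrow> (if 0 < t then 1 else 0)"
  proof (cases "0 < t")
   case True
   have "(%m. (real m * t)\<^sup>2 / (1 + (real m * t)\<^sup>2)) \<longlonglongrightarrow> 1" using True by real_asymp
   thus ?thesis using True by (simp add: tht_def pos_sq_def max_def)
  next
   case False
   hence "real m * t <= 0" for m by (simp add: mult_nonneg_nonpos)
   thus ?thesis using False by (simp add: tht_def pos_sq_eq_0)
  qed
 next
  have "continuous_on UNIV (%t. 2 * max 0 t / (1 + (max 0 t)\<^sup>2)\<^sup>2 :: real)"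
   by (intro continuous_intros) (simp add: add_pos_nonneg less_imp_neq[THEN not_sym])
  thus "continuous_on UNIV tht'" by (simp add: tht'_def[abs_def] pos_sq_def)
 qed
qed

text \<open>If \<open>f\<^sub>n\<close>, \<open>f'\<^sub>n\<close> are C1 approximations of \<open>v\<close>, \<open>v'\<close>, then \<open>df\<^sub>n\<close> and \<open>df'\<^sub>n\<close> have the same
  limit \<open>L + c\<close> in \<open>L\<^sup>1(mu)\<close>, so that the derivative of \<open>\<chi>(f\<^sub>n - f'\<^sub>n)\<close> drops out of the closedness relation
  for \<open>\<chi>(f\<^sub>n - f'\<^sub>n) f\<close> in the limit.\<close>

lemma invariant_less:
 assumes mu: "mather mu" and B: "invariant mu B" and v: "vsub v cv" "vsub v' cv"
 shows "invariant mu (B Int {z. v (fst z) - v' (fst z) < a})"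
proof -
 interpret prob_space mu by (rule mather_facts(1)[OF mu])
 have Bs: "B \<in> sets mu" and Bf: "!!f. f \<in> C1 ==> (\<integral>z. indicator B z * dT f z \<partial>mu) = 0"
  using B unfolding invariant_def by blast+
 define w where "w x = v x - v' x" for x
 define C where "C = B Int {z. w (fst z) < a}"
 have cw: "continuous_on UNIV w" unfolding w_def using v unfolding vsub_def by (intro continuous_on_diff) blast+
 have mw: "(%z. w (fst z)) \<in> borel_measurable mu" by (rule mather_facts(7)[OF mu tcont_fst[OF cw]])
 have "{z \<in> space mu. w (fst z) < a} \<in> sets mu" using mw by measurable
 moreover have "space mu = UNIV" using sets_eq_imp_space_eq[OF mather_facts(2)[OF mu]] space_tangent_borel by simp
 ultimately have Cs: "C \<in> sets mu" using Bs unfolding C_def by auto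
 obtain tht tht' :: "real => real" where tht: "!!t. (tht has_real_derivative tht' t) (at t)" "continuous_on UNIV tht'" "!!t. \<bar>tht' t\<bar> <= 1"
  "!!t. 0 <= tht t & tht t <= 1" "!!t. (%m. tht (real m * t)) \<longlonglongrightarrow> (if 0 < t then 1 else 0)" by (rule smooth_step) blast
 have lip: "\<bar>tht s - tht t\<bar> <= \<bar>s - t\<bar>" for s t
  using field_differentiable_bound[of UNIV tht tht' 1 s t] tht(1,3) by simp
 have main: "(\<integral>z. indicator C z * dT f z \<partial>mu) = 0" if f: "f \<in> C1" for f
 proof -
  have fi: "integrable mu (dT f)" by (rule mather_facts(6)[OF mu f])
  obtain Fb where Fb: "Fb > 0" "!!x. \<bar>f x\<bar> <= Fb" by (rule bounded_continuous[OF C1_functions_continuous[OF f]]) blast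
  define psi where "psi m z = indicator B z * (tht (real m * (a - w (fst z))) * dT f z)" for m z
  have zero: "(\<integral>z. psi m z \<partial>mu) = 0" for m
  proof -
   \<comment> \<open>For fixed \<open>m\<close> the approximation error tends to zero with
     \<open>n\<close>. Only afterwards does \<open>m\<close> tend to infinity, since
     \<open>K\<close> grows with it.\<close>
   define K where "K = real m * (2 * (\<integral>z. \<bar>dT f z\<bar> \<partial>mu) + 4 * Fb)"
   have "\<bar>\<integral>z. psi m z \<partial>mu\<bar> <= K / (real n + 1)" for n
   proof -
    define e where "e = 1 / (real n + 1)"
    obtain p where p: "p \<in> C1" "!!x. \<bar>p x - v x\<bar> <= e" "integrable mu (%z. \<bar>LT z + cv - dT p z\<bar>)"
     "(\<integral>z. \<bar>LT z + cv - dT p z\<bar> \<partial>mu) <= 2 * e" by (rule vsub_approximants[OF mu v(1), of n]) (simp add: e_def)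
    obtain p' where p': "p' \<in> C1" "!!x. \<bar>p' x - v' x\<bar> <= e" "integrable mu (%z. \<bar>LT z + cv - dT p' z\<bar>)"
     "(\<integral>z. \<bar>LT z + cv - dT p' z\<bar> \<partial>mu) <= 2 * e" by (rule vsub_approximants[OF mu v(2), of n]) (simp add: e_def)
    \<comment> \<open>The C1 counterpart of \<open>real m * (a - w x)\<close>.\<close>
    define s where "s x = real m * a + (- real m) * (p x + (- 1) * p' x)" for x
    have mp': "(%x. (- 1) * p' x) \<in> C1" by (rule C1_mult[OF C1_const p'(1)])
    have pp: "(%x. p x + (- 1) * p' x) \<in> C1" by (rule C1_add[OF p(1) mp'])
    have mpp: "(%x. (- real m) * (p x + (- 1) * p' x)) \<in> C1" by (rule C1_mult[OF C1_const pp])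
    have s: "s \<in> C1" unfolding s_def[abs_def] by (rule C1_add[OF C1_const mpp])
    have ds: "dif s x = (- real m) *\<^sub>R (dif p x - dif p' x)" for x
    proof -
     have 1: "dif (%x. (- 1) * p' x) x = - dif p' x"
      using differential_mult[OF C1_const[of "- 1"] p'(1), of x] by (simp add: differential_const)
     have 2: "dif (%x. (- real m) * (p x + (- 1) * p' x)) x = (- real m) *\<^sub>R dif (%x. p x + (- 1) * p' x) x"
      using differential_mult[OF C1_const[of "- real m"] pp, of x] by (simp only: differential_const scaleR_zero_right add_0_right)
     show ?thesis unfolding s_def[abs_def] differential_add[OF C1_const mpp] 2 differential_add[OF p(1) mp'] 1 by (simp add: differential_const)
    qed
    have thts: "(%x. tht (s x)) \<in> C1" by (rule C1_compose[OF s tht(1) continuous_on_subset[OF tht(2)]]) simp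
    have d: "dif (%x. tht (s x) * f x) x = tht (s x) *\<^sub>R dif f x + f x *\<^sub>R (tht' (s x) *\<^sub>R dif s x)" for x
     unfolding differential_mult[OF thts f] differential_compose[OF s tht(1)] ..
    define q where "q = (%x. tht (s x) * f x)"
    have q: "q \<in> C1" unfolding q_def by (rule C1_mult[OF thts f])
    have dq: "dT q z = tht (s (fst z)) * dT f z - real m * f (fst z) * tht' (s (fst z)) * (dT p z - dT p' z)" for z
     unfolding q_def case_prod_beta d ds by (simp add: blinfun.add_left blinfun.scaleR_left blinfun.diff_left blinfun.minus_left algebra_simps)
    have close: "\<bar>psi m z - indicator B z * dT q z\<bar> <= real m * (2 * e * \<bar>dT f z\<bar> + Fb * (\<bar>LT z + cv - dT p z\<bar> + \<bar>LT z + cv - dT p' z\<bar>))" for z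
    proof -
     have "s (fst z) - real m * (a - w (fst z)) = real m * ((v (fst z) - p (fst z)) + (p' (fst z) - v' (fst z)))"
      by (simp add: s_def w_def algebra_simps)
     hence "\<bar>real m * (a - w (fst z)) - s (fst z)\<bar> = real m * \<bar>(v (fst z) - p (fst z)) + (p' (fst z) - v' (fst z))\<bar>"
      by (simp add: abs_minus_commute[of _ "s (fst z)"] abs_mult)
     also have "... <= real m * (2 * e)" using p(2)[of "fst z"] p'(2)[of "fst z"] by (intro mult_left_mono) linarith+
     finally have "\<bar>tht (real m * (a - w (fst z))) - tht (s (fst z))\<bar> <= real m * (2 * e)" by (rule order_trans[OF lip])
     hence 1: "\<bar>(tht (real m * (a - w (fst z))) - tht (s (fst z))) * dT f z\<bar> <= real m * (2 * e) * \<bar>dT f z\<bar>"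
      unfolding abs_mult by (rule mult_right_mono) simp
     have "\<bar>f (fst z) * tht' (s (fst z))\<bar> <= Fb * 1" unfolding abs_mult by (rule mult_mono[OF Fb(2) tht(3)]) (use Fb(1) in auto)
     hence "\<bar>f (fst z) * tht' (s (fst z)) * (dT p z - dT p' z)\<bar> <= Fb * (\<bar>LT z + cv - dT p z\<bar> + \<bar>LT z + cv - dT p' z\<bar>)"
     proof -
      have "\<bar>dT p z - dT p' z\<bar> <= \<bar>LT z + cv - dT p z\<bar> + \<bar>LT z + cv - dT p' z\<bar>" by linarith
      with `_ <= Fb * 1` show ?thesis
       unfolding abs_mult[of "f (fst z) * tht' (s (fst z))"] mult_1_right by (rule mult_mono) (use Fb(1) in auto)
     qed
     hence 2: "real m * \<bar>f (fst z) * tht' (s (fst z)) * (dT p z - dT p' z)\<bar> <= real m * (Fb * (\<bar>LT z + cv - dT p z\<bar> + \<bar>LT z + cv - dT p' z\<bar>))"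
      by (rule mult_left_mono) simp
     have "psi m z - indicator B z * dT q z = indicator B z * ((tht (real m * (a - w (fst z))) - tht (s (fst z))) * dT f z
       + real m * (f (fst z) * tht' (s (fst z)) * (dT p z - dT p' z)))" (is "_ = _ * ?r")
      unfolding psi_def dq by (simp add: algebra_simps)
     hence "\<bar>psi m z - indicator B z * dT q z\<bar> <= \<bar>?r\<bar>" by (simp add: indicator_def)
     also have "... <= real m * (2 * e) * \<bar>dT f z\<bar> + real m * (Fb * (\<bar>LT z + cv - dT p z\<bar> + \<bar>LT z + cv - dT p' z\<bar>))"
      by (rule order_trans[OF abs_triangle_ineq add_mono[OF 1]]) (use 2 in "simp add: abs_mult")
     finally show ?thesis by (simp only: distrib_left mult.assoc)
    qed
    have psii: "integrable mu (psi m)"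
    proof (rule Bochner_Integration.integrable_bound[OF fi])
     have "(%z. tht (real m * (a - w (fst z)))) \<in> borel_measurable mu"
     proof (rule mather_facts(7)[OF mu tcont_fst[of "%x. tht (real m * (a - w x))"]])
      have "continuous_on UNIV tht" using DERIV_isCont[OF tht(1)] by (simp add: continuous_on_eq_continuous_at)
      thus "continuous_on UNIV (%x. tht (real m * (a - w x)))" by (rule continuous_on_compose2) (intro continuous_intros cw, simp)
     qed
     thus "psi m \<in> borel_measurable mu" unfolding psi_def using Bs fi by measurable
     show "AE z in mu. norm (psi m z) <= norm (dT f z)"
      unfolding psi_def norm_mult by (intro AE_I2 order_trans[OF mult_left_le_one_le mult_left_le_one_le]) (use tht(4) in "auto simp: indicator_def")
    qed
    have qi: "integrable mu (%z. indicator B z * dT q z)" by (rule integrable_indicator_mult[OF mather_facts(6)[OF mu q] Bs])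
    have "\<bar>\<integral>z. psi m z \<partial>mu\<bar> = \<bar>\<integral>z. psi m z - indicator B z * dT q z \<partial>mu\<bar>" using psii qi Bf[OF q] by simp
    also have "... <= (\<integral>z. \<bar>psi m z - indicator B z * dT q z\<bar> \<partial>mu)" by (rule integral_abs_bound)
    also have "... <= (\<integral>z. real m * (2 * e * \<bar>dT f z\<bar> + Fb * (\<bar>LT z + cv - dT p z\<bar> + \<bar>LT z + cv - dT p' z\<bar>)) \<partial>mu)"
     using psii qi fi p(3) p'(3) close by (intro integral_mono) auto
    also have "... = real m * (2 * e * (\<integral>z. \<bar>dT f z\<bar> \<partial>mu) + Fb * ((\<integral>z. \<bar>LT z + cv - dT p z\<bar> \<partial>mu) + (\<integral>z. \<bar>LT z + cv - dT p' z\<bar> \<partial>mu)))"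
     using fi p(3) p'(3) by simp
    also have "... <= real m * (2 * e * (\<integral>z. \<bar>dT f z\<bar> \<partial>mu) + Fb * (2 * e + 2 * e))"
     by (intro mult_left_mono add_mono order_refl p(4) p'(4)) (use Fb(1) in auto)
    also have "... = K / (real n + 1)" by (simp add: K_def e_def algebra_simps add_divide_distrib)
    finally show ?thesis .
   qed
   moreover have "(%n. K / (real n + 1)) \<longlonglongrightarrow> 0"
    using tendsto_mult_right_zero[OF LIMSEQ_inverse_real_of_nat, of K] by (simp add: divide_inverse add.commute)
   ultimately have "\<bar>\<integral>z. psi m z \<partial>mu\<bar> <= 0" by (intro LIMSEQ_le_const[of "%n. K / (real n + 1)"]) auto
   thus ?thesis by simp
  qed
  have "(%m. integral\<^sup>L mu (psi m)) \<longlonglongrightarrow> (\<integral>z. indicator C z * dT f z \<partial>mu)"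
  proof (rule integral_dominated_convergence[where w = "%z. \<bar>dT f z\<bar>"])
   show "(%z. indicator C z * dT f z) \<in> borel_measurable mu" using integrable_indicator_mult[OF fi Cs] by (rule borel_measurable_integrable)
   have ctht: "continuous_on UNIV tht" using DERIV_isCont[OF tht(1)] by (simp add: continuous_on_eq_continuous_at)
   show "psi m \<in> borel_measurable mu" for m
   proof -
    have "(%z. tht (real m * (a - w (fst z)))) \<in> borel_measurable mu"
     by (rule borel_measurable_continuous_on[OF ctht]) (use mw in measurable)
    thus ?thesis unfolding psi_def using Bs fi by measurable
   qed
   show "integrable mu (%z. \<bar>dT f z\<bar>)" using fi by simp
   show "AE z in mu. (%m. psi m z) \<longlonglongrightarrow> indicator C z * dT f z"
   proof (rule AE_I2)
    fix z
    have "(%m. psi m z) \<longlonglongrightarrow> indicator B z * ((if 0 < a - w (fst z) then 1 else 0) * dT f z)"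
     unfolding psi_def by (intro tendsto_mult tendsto_const tht(5))
    moreover have "indicator B z * ((if 0 < a - w (fst z) then 1 else 0) * dT f z) = indicator C z * dT f z"
     by (auto simp: C_def indicator_def)
    ultimately show "(%m. psi m z) \<longlonglongrightarrow> indicator C z * dT f z" by (simp only:)
   qed
   show "AE z in mu. norm (psi m z) <= \<bar>dT f z\<bar>" for m
    unfolding psi_def real_norm_def abs_mult by (intro AE_I2 order_trans[OF mult_left_le_one_le mult_left_le_one_le]) (use tht(4) in "auto simp: indicator_def")
  qed
  hence "(%m::nat. 0) \<longlonglongrightarrow> (\<integral>z. indicator C z * dT f z \<partial>mu)" by (simp add: zero)
  thus ?thesis using LIMSEQ_unique[OF tendsto_const] by metis
 qed
 \<comment> \<open>For the action over \<open>C\<close>, the Lagrangian plus \<open>cv\<close> is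
   replaced by the differential of an approximant of \<open>v\<close>, whose integral over
   \<open>C\<close> vanishes by \<open>main\<close>.\<close>
 have Li: "integrable mu (%z. LT z + cv)" using mather_facts(3)[OF mu] by simp
 have "\<bar>\<integral>z. indicator C z * (LT z + cv) \<partial>mu\<bar> <= 2 / (real n + 1)" for n
 proof -
  obtain p where p: "p \<in> C1" "!!x. \<bar>p x - v x\<bar> <= 1 / (real n + 1)" "integrable mu (%z. \<bar>LT z + cv - dT p z\<bar>)"
   "(\<integral>z. \<bar>LT z + cv - dT p z\<bar> \<partial>mu) <= 2 / (real n + 1)" by (rule vsub_approximants[OF mu v(1), of n]) blast
  have pi: "integrable mu (dT p)" by (rule mather_facts(6)[OF mu p(1)])
  have "(\<integral>z. indicator C z * (LT z + cv) \<partial>mu) = (\<integral>z. indicator C z * (LT z + cv) - indicator C z * dT p z \<partial>mu)"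
   using integrable_indicator_mult[OF Li Cs] integrable_indicator_mult[OF pi Cs] main[OF p(1)] by simp
  also have "\<bar>...\<bar> <= (\<integral>z. \<bar>indicator C z * (LT z + cv) - indicator C z * dT p z\<bar> \<partial>mu)" by (rule integral_abs_bound)
  also have "... <= (\<integral>z. \<bar>LT z + cv - dT p z\<bar> \<partial>mu)"
   by (rule integral_mono[OF integrable_abs[OF Bochner_Integration.integrable_diff[OF integrable_indicator_mult[OF Li Cs] integrable_indicator_mult[OF pi Cs]]] p(3)])
    (simp add: indicator_def)
  finally show ?thesis using p(4) by simp
 qed
 moreover have "(%n. 2 / (real n + 1)) \<longlonglongrightarrow> 0"
  using tendsto_mult_right_zero[OF LIMSEQ_inverse_real_of_nat, of 2] by (simp add: divide_inverse add.commute)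
 ultimately have "\<bar>\<integral>z. indicator C z * (LT z + cv) \<partial>mu\<bar> <= 0" by (intro LIMSEQ_le_const[of "%n. 2 / (real n + 1)"]) auto
 thus ?thesis using Cs main unfolding invariant_def C_def w_def by simp
qed

lemma invariant_restrict:
 assumes mu: "mather mu" and B: "invariant mu B" and pos: "0 < measure mu B"
 obtains nu where "mather nu" "AE z in nu. z \<in> B"
  "!!F. integrable mu F ==> integral\<^sup>L nu F = (\<integral>z. indicator B z * F z \<partial>mu) / measure mu B"
proof -
 interpret prob_space mu by (rule mather_facts(1)[OF mu])
 have Bs: "B \<in> sets mu" using B unfolding invariant_def by blast
 define d where "d z = indicator B z / measure mu B" for z
 have dm: "d \<in> borel_measurable mu" unfolding d_def using Bs by measurable
 have d0: "0 <= d z" for z by (simp add: d_def)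
 define nu where "nu = density mu d"
 have int: "has_bochner_integral nu F ((\<integral>z. indicator B z * F z \<partial>mu) / measure mu B)" if F: "integrable mu F" for F :: "_ => real"
  unfolding nu_def
 proof (rule has_bochner_integral_density[OF _ dm])
  have "has_bochner_integral mu (%z. indicator B z * F z) (\<integral>z. indicator B z * F z \<partial>mu)"
   using integrable_indicator_mult[OF F Bs] by (rule has_bochner_integral_integrable)
  from has_bochner_integral_divide_zero[OF this, of "measure mu B"]
  show "has_bochner_integral mu (%z. d z *\<^sub>R F z) ((\<integral>z. indicator B z * F z \<partial>mu) / measure mu B)" by (simp add: d_def)
 qed (use F d0 in auto)
 have sets: "sets nu = sets mu" by (simp add: nu_def)
 have "emeasure nu (space nu) = (\<integral>\<^sup>+z. ennreal (d z) * indicator (space mu) z \<partial>mu)"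
  unfolding nu_def space_density using dm by (intro emeasure_density) auto
 also have "... = (\<integral>\<^sup>+z. ennreal (d z) \<partial>mu)" by (rule nn_integral_cong) simp
 also have "... = ennreal (\<integral>z. d z \<partial>mu)"
 proof (rule nn_integral_eq_integral)
  show "integrable mu d" unfolding d_def divide_inverse
   using Bs by (intro integrable_mult_left integrable_real_indicator) (auto simp: emeasure_eq_measure)
 qed (use d0 in simp)
 also have "(\<integral>z. d z \<partial>mu) = 1" using Bs pos by (simp add: d_def)
 finally have ps: "prob_space nu" by (intro prob_spaceI) simp
 have cm: "closed_measure A g nu" unfolding closed_measure_def
 proof (intro conjI ballI ps)
  show "sets nu = sets (tangent_borel A)" using sets mather_facts(2)[OF mu] by simp
  have "integrable mu (%(x, v). tangent_norm g x v)" using mu unfolding mather_measure_def closed_measure_def by blast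
  from int[OF this] show "integrable nu (%(x, v). tangent_norm g x v)" unfolding has_bochner_integral_iff by (rule conjunct1)
  fix f assume f: "f \<in> C1"
  have "(\<integral>z. indicator B z * dT f z \<partial>mu) = 0" using B f unfolding invariant_def by blast
  thus "integral\<^sup>L nu (dT f) = 0" using int[OF mather_facts(6)[OF mu f]] by (simp add: has_bochner_integral_iff)
 qed
 have "has_bochner_integral nu (%z. LT z + cv) 0"
  using int[of "%z. LT z + cv"] mather_facts(3)[OF mu] B unfolding invariant_def by simp
 moreover have "has_bochner_integral nu (%z. - cv) (- cv)"
  using prob_space.prob_space[OF ps] finite_measure.integrable_const[OF prob_space.finite_measure[OF ps]] by (simp add: has_bochner_integral_iff)
 ultimately have "has_bochner_integral nu (%z. LT z + cv + - cv) (0 + - cv)" by (rule has_bochner_integral_add)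
 hence "mather nu" unfolding mather_measure_def using cm by simp
 moreover have "AE z in nu. z \<in> B" unfolding nu_def
  by (subst AE_density) (use dm in measurable, auto simp: d_def indicator_def split: if_splits)
 ultimately show thesis using that int by (simp add: has_bochner_integral_iff)
qed

end

section \<open>The operator with weight\<close>

locale weighted_kam = weak_kam A g G
 for A :: "('m::{t2_space, second_countable_topology}, 'e::euclidean_space) chart set" and g G +
 fixes \<sigma> :: "'m => real"
 assumes \<sigma>_continuous: "continuous_on UNIV \<sigma>" and \<sigma>_pos: "!!x. \<sigma> x > 0"
begin

text \<open>Computed on the tangent bundle instead of with the projected measure, because the
  splitting takes place there.\<close>

definition wavg :: "('m \<times> 'e) measure => ('m => real) => real" where
 "wavg mu F = (\<integral>z. \<sigma> (fst z) * F (fst z) \<partial>mu) / (\<integral>z. \<sigma> (fst z) \<partial>mu)"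

lemma integrable_fst:
 fixes F :: "'m => real"
 assumes mu: "mather mu" and F: "continuous_on UNIV F"
 shows "integrable mu (%z. F (fst z))"
proof -
 interpret prob_space mu by (rule mather_facts(1)[OF mu])
 obtain B where B: "!!x. \<bar>F x\<bar> <= B" by (rule bounded_continuous[OF F]) blast
 show ?thesis by (rule integrable_const_bound[of _ B]) (use B mather_facts(7)[OF mu tcont_fst[OF F]] in auto)
qed

lemma integral_\<sigma>_pos:
 assumes mu: "mather mu"
 shows "0 < (\<integral>z. \<sigma> (fst z) \<partial>mu)"
proof -
 interpret prob_space mu by (rule mather_facts(1)[OF mu])
 have i: "integrable mu (%z. \<sigma> (fst z))" by (rule integrable_fst[OF mu \<sigma>_continuous])
 have p: "AE z in mu. 0 <= \<sigma> (fst z)" using \<sigma>_pos by (intro AE_I2) (simp add: less_imp_le)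
 have "(\<integral>z. \<sigma> (fst z) \<partial>mu) ~= 0"
 proof
  assume "(\<integral>z. \<sigma> (fst z) \<partial>mu) = 0"
  hence "AE z in mu. \<sigma> (fst z) = 0" using integral_nonneg_eq_0_iff_AE[OF i p] by blast
  hence "AE z in mu. False" by (rule eventually_mono) (use \<sigma>_pos in "metis less_irrefl")
  thus False by simp
 qed
 moreover have "0 <= (\<integral>z. \<sigma> (fst z) \<partial>mu)" using p by (rule integral_nonneg_AE)
 ultimately show ?thesis by simp
qed

text \<open>Comparing a normalised average with \<open>b\<close> comes down to the sign of an
  integral that is additive over a splitting of \<open>mu\<close>, which the averages themselves are
  not.\<close>

lemma wavg_excess:
 assumes mu: "mather mu" and F: "continuous_on UNIV F"
 shows "(\<integral>z. \<sigma> (fst z) * (F (fst z) - b) \<partial>mu) = (wavg mu F - b) * (\<integral>z. \<sigma> (fst z) \<partial>mu)"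
proof -
 have i: "integrable mu (%z. \<sigma> (fst z))" "integrable mu (%z. \<sigma> (fst z) * F (fst z))"
  using integrable_fst[OF mu \<sigma>_continuous] integrable_fst[OF mu continuous_on_mult[OF \<sigma>_continuous F]] by blast+
 have "(\<integral>z. \<sigma> (fst z) * (F (fst z) - b) \<partial>mu) = (\<integral>z. \<sigma> (fst z) * F (fst z) - b * \<sigma> (fst z) \<partial>mu)"
  by (rule Bochner_Integration.integral_cong) (simp_all add: algebra_simps)
 also have "... = (\<integral>z. \<sigma> (fst z) * F (fst z) \<partial>mu) - b * (\<integral>z. \<sigma> (fst z) \<partial>mu)" using i by simp
 finally show ?thesis unfolding wavg_def using integral_\<sigma>_pos[OF mu] by (simp add: left_diff_distrib)
qed

lemma wavg_mono:
 assumes mu: "mather mu" and F: "continuous_on UNIV F" "continuous_on UNIV F'"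
  and le: "AE z in mu. F (fst z) <= F' (fst z) + b"
 shows "wavg mu F <= wavg mu F' + b"
proof -
 have i: "integrable mu (%z. \<sigma> (fst z))" "integrable mu (%z. \<sigma> (fst z) * F (fst z))" "integrable mu (%z. \<sigma> (fst z) * F' (fst z))"
  using integrable_fst[OF mu] \<sigma>_continuous continuous_on_mult[OF \<sigma>_continuous F(1)] continuous_on_mult[OF \<sigma>_continuous F(2)] by blast+
 have "(\<integral>z. \<sigma> (fst z) * F (fst z) \<partial>mu) <= (\<integral>z. \<sigma> (fst z) * F' (fst z) + b * \<sigma> (fst z) \<partial>mu)"
 proof (rule integral_mono_AE)
  show "AE z in mu. \<sigma> (fst z) * F (fst z) <= \<sigma> (fst z) * F' (fst z) + b * \<sigma> (fst z)"
   using le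
  proof (rule eventually_mono)
   fix z assume "F (fst z) <= F' (fst z) + b"
   hence "\<sigma> (fst z) * F (fst z) <= \<sigma> (fst z) * (F' (fst z) + b)" using \<sigma>_pos[of "fst z"] by (intro mult_left_mono) auto
   thus "\<sigma> (fst z) * F (fst z) <= \<sigma> (fst z) * F' (fst z) + b * \<sigma> (fst z)" by (simp add: algebra_simps)
  qed
 qed (use i in simp_all)
 also have "... = (\<integral>z. \<sigma> (fst z) * F' (fst z) \<partial>mu) + b * (\<integral>z. \<sigma> (fst z) \<partial>mu)" using i by simp
 finally show ?thesis using integral_\<sigma>_pos[OF mu] unfolding wavg_def
  by (simp add: divide_le_eq distrib_right)
qed

lemma wavg_const: "mather mu ==> wavg mu (%_. b) = b"
 using integral_\<sigma>_pos[of mu] by (simp add: wavg_def)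

definition opP :: "('m => real) => 'm => real" where
 "opP phi x = (INF mu\<in>Collect (mather). wavg mu (%y. kp y x + phi y))"

lemma kp_continuous: "continuous_on UNIV (kp y)" "continuous_on UNIV (%y. kp y x)"
proof -
 show "continuous_on UNIV (kp y)" using kp_vsub(1)[of y] unfolding vsub_def by blast
 have "continuous_on UNIV (%y. - kp y x)" using kp_vsub(2)[of x] unfolding vsub_def by blast
 from continuous_on_minus[OF this] show "continuous_on UNIV (%y. kp y x)" by simp
qed

lemma kp_viscosity: "viscosity_solution A G cv (kp y)"
proof (rule weak_KAM_viscosity)
 show "weak_KAM (kp y)" unfolding weak_KAM_def using vsub_dominated[OF kp_vsub(1)] kp_calibrated by blast
qed

text \<open>The functions \<open>kp y\<close> are solutions available from the start, so the chain
  construction applies to them; the infimum in \<open>opP\<close> thus runs over a nonempty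
  set.\<close>

lemma mather_exists: "Collect (mather) ~= {}"
 using viscosity_mather[OF kp_viscosity] by blast

context
 fixes phi :: "'m => real"
 assumes phi: "continuous_on UNIV phi"
begin

lemma cont_kp_plus: "continuous_on UNIV (%y. kp y x + phi y)" by (intro continuous_on_add kp_continuous phi)

lemma opP_bdd: "bdd_below ((%mu. wavg mu (%y. kp y x + phi y)) ` Collect (mather))"
proof -
 obtain B where B: "!!y. \<bar>kp y x + phi y\<bar> <= B" by (rule bounded_continuous[OF cont_kp_plus]) blast
 have "- B <= wavg mu (%y. kp y x + phi y)" if "mather mu" for mu
 proof -
  have "wavg mu (%_. - B) <= wavg mu (%y. kp y x + phi y) + 0"
  proof (rule wavg_mono[OF that continuous_on_const cont_kp_plus], rule AE_I2)
   fix z :: "'m \<times> 'e" show "- B <= kp (fst z) x + phi (fst z) + 0" using B[of "fst z"] by simp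
  qed
  thus ?thesis by (simp add: wavg_const[OF that])
 qed
 thus ?thesis by (intro bdd_belowI[of _ "- B"]) auto
qed

lemma opP_le: "mather mu ==> opP phi x <= wavg mu (%y. kp y x + phi y)"
 unfolding opP_def by (rule cINF_lower[OF opP_bdd]) simp

lemma opP_ge: "(!!mu. mather mu ==> b <= wavg mu (%y. kp y x + phi y)) ==> b <= opP phi x"
 unfolding opP_def by (rule cINF_greatest[OF mather_exists]) simp

lemma opP_dominated: "dominated (opP phi) cv"
 unfolding dominated_def
proof (intro allI impI)
 fix x y t r assume t: "0 < (t::real)" and h: "h t x y <= ereal r"
 have "opP phi y - (r + cv * t) <= opP phi x"
 proof (rule opP_ge)
  fix mu assume mu: "mather mu"
  have "wavg mu (%z. kp z y + phi z) <= wavg mu (%z. kp z x + phi z) + (r + cv * t)"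
  proof (rule wavg_mono[OF mu cont_kp_plus cont_kp_plus], rule AE_I2)
   fix z :: "'m \<times> 'e"
   show "kp (fst z) y + phi (fst z) <= kp (fst z) x + phi (fst z) + (r + cv * t)"
    using kp_right[OF h less_imp_le[OF t], of "fst z"] by simp
  qed
  thus "opP phi y - (r + cv * t) <= wavg mu (%z. kp z x + phi z)" using opP_le[OF mu, of y] by simp
 qed
 thus "opP phi y - opP phi x <= r + cv * t" by simp
qed

text \<open>Splitting a Mather measure into invariant cells on which the functions \<open>k(y, \<cdot>)\<close> almost agree up to
  additive constants, one of the pieces has a weighted average at \<open>x\<close> that is at most the given one.\<close>

lemma opP_calibrated:
 assumes t: "0 < t" and e: "0 < eps"
 shows "EX z r. h t z x <= ereal r & opP phi z + r + cv * t <= opP phi x + eps"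
proof -
 \<comment> \<open>The errors below add up to five \<open>dlt\<close>: one for the choice of
   \<open>mu\<close> and four for the step.\<close>
 define dlt where "dlt = eps / 20"
 have dlt: "dlt > 0" using e by (simp add: dlt_def)
 have "opP phi x < opP phi x + dlt" using dlt by simp
 then obtain mu where mu: "mather mu" "wavg mu (%y. kp y x + phi y) < opP phi x + dlt"
  unfolding opP_def[of phi x] cINF_less_iff[OF mather_exists opP_bdd] by auto
 interpret prob_space mu by (rule mather_facts(1)[OF mu(1)])
 have "ALL x0. EX U. open U & x0 \<in> U & (ALL z:U. ALL y. \<bar>kp y z - kp y x0\<bar> <= dlt)"
 proof
  fix x0
  obtain U where "open U" "x0 \<in> U" "!!z z' y. z \<in> U ==> z' \<in> U ==> \<bar>kp y z - kp y z'\<bar> <= dlt"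
   by (rule kp_equicontinuous[OF dlt, of x0]) blast
  thus "EX U. open U & x0 \<in> U & (ALL z:U. ALL y. \<bar>kp y z - kp y x0\<bar> <= dlt)" by blast
 qed
 from choice[OF this] obtain U where U: "ALL x0. open (U x0) & x0 \<in> U x0 & (ALL z:U x0. ALL y. \<bar>kp y z - kp y x0\<bar> <= dlt)" by blast
 have oU: "open (U i)" if "i \<in> UNIV" for i using U by blast
 have "UNIV \<subseteq> (\<Union>x0\<in>UNIV. U x0)" using U by blast
 from compactE_image[OF compact_UNIV oU this] obtain I where I: "finite I" "UNIV \<subseteq> (\<Union>x0\<in>I. U x0)" by metis
 \<comment> \<open>By equicontinuity the finitely many \<open>i\<close> represent every starting
   point \<open>z\<close>, uniformly in \<open>y\<close>; the increments \<open>D i\<close> thus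
   determine \<open>kp y z - kp y x\<close> up to errors of order \<open>dlt\<close>.\<close>
 define D where "D i y = kp y i - kp y x" for i y
 define cell where "cell y = restrict (%i. \<lfloor>D i y / dlt\<rfloor>) I" for y
 define Cl where "Cl J q = {z :: 'm \<times> 'e. ALL i:J. \<lfloor>D i (fst z) / dlt\<rfloor> = q i}" for J and q :: "'m => int"
 have sp: "space mu = UNIV" using sets_eq_imp_space_eq[OF mather_facts(2)[OF mu(1)]] space_tangent_borel by simp
 \<comment> \<open>Fixing the integer part of \<open>D j / dlt\<close> confines \<open>D j\<close>
   to a half-open interval, so it is the difference of two strict sublevel sets of the kind treated
   in \<open>invariant_less\<close>.\<close>
 have inv: "invariant mu (Cl J q)" if "finite J" for J q
  using that
 proof (induction J)
  case empty
  have "(\<integral>z. LT z + cv \<partial>mu) = 0" using mather_facts(3,4)[OF mu(1)] by (simp add: prob_space)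
  moreover have "UNIV \<in> sets mu" using sets.top[of mu] sp by simp
  ultimately show ?case using mather_facts(5)[OF mu(1)] by (simp add: invariant_def Cl_def)
 next
  case (insert j J)
  have step: "invariant mu (Cl J q Int {z. - kp (fst z) x - (- kp (fst z) j) < b})" for b
   by (rule invariant_less[OF mu(1) insert.IH kp_vsub(2) kp_vsub(2)])
  have "invariant mu ((Cl J q Int {z. - kp (fst z) x - (- kp (fst z) j) < dlt * (q j + 1)}) -
    (Cl J q Int {z. - kp (fst z) x - (- kp (fst z) j) < dlt * q j}))"
   using dlt by (intro invariant_Diff[OF mu(1) step step]) (auto simp: algebra_simps)
  also have "(Cl J q Int {z. - kp (fst z) x - (- kp (fst z) j) < dlt * (q j + 1)}) -
    (Cl J q Int {z. - kp (fst z) x - (- kp (fst z) j) < dlt * q j}) = Cl (insert j J) q"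
  proof -
   have fl: "\<lfloor>s / dlt\<rfloor> = k \<longleftrightarrow> ~ s < dlt * k & s < dlt * (k + 1)" for s :: real and k :: int
    unfolding floor_eq_iff not_less pos_le_divide_eq[OF dlt] pos_divide_less_eq[OF dlt] by (simp add: mult.commute)
   show ?thesis unfolding Cl_def D_def ball_simps(7) fl by (auto simp: add.commute)
  qed
  finally show ?case .
 qed
 have "EX B. ALL i:I. ALL y. \<bar>D i y\<bar> <= B"
 proof -
  have "EX B. ALL y. \<bar>D i y\<bar> <= B" for i
   using bounded_continuous[OF continuous_on_diff[OF kp_continuous(2) kp_continuous(2)], of i x] unfolding D_def by blast
  hence "ALL i. EX B. ALL y. \<bar>D i y\<bar> <= B" by blast
  from choice[OF this] obtain Bf where Bf: "ALL i y. \<bar>D i y\<bar> <= Bf i" by blast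
  have "\<bar>D i y\<bar> <= (\<Sum>i\<in>I. Bf i)" if "i \<in> I" for i y
  proof -
   have "0 <= Bf j" for j by (rule order_trans[OF abs_ge_zero]) (use Bf in blast)
   hence "Bf i <= (\<Sum>i\<in>I. Bf i)" using member_le_sum[OF that, of Bf] I(1) by simp
   thus ?thesis using Bf[THEN spec, THEN spec, of i y] by simp
  qed
  thus ?thesis by blast
 qed
 then obtain B where B: "ALL i:I. ALL y. \<bar>D i y\<bar> <= B" by blast
 \<comment> \<open>The \<open>D i\<close> are bounded, so finitely many labels occur.\<close>
 define Q where "Q = I \<rightarrow>\<^sub>E {\<lfloor>- B / dlt\<rfloor>..\<lfloor>B / dlt\<rfloor>}"
 have fQ: "finite Q" unfolding Q_def using I(1) by (intro finite_PiE) auto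
 have cQ: "cell y \<in> Q" for y unfolding Q_def cell_def
 proof (rule restrict_PiE_iff[THEN iffD2], rule ballI)
  fix i assume "i \<in> I"
  hence "\<bar>D i y\<bar> <= B" using B by blast
  hence "- B / dlt <= D i y / dlt" "D i y / dlt <= B / dlt" using dlt by (intro divide_right_mono; linarith)+
  thus "\<lfloor>D i y / dlt\<rfloor> \<in> {\<lfloor>- B / dlt\<rfloor>..\<lfloor>B / dlt\<rfloor>}" by (simp add: floor_mono)
 qed
 have mem: "z \<in> Cl I q \<longleftrightarrow> cell (fst z) = q" if "q \<in> Q" for z q
 proof
  assume "z \<in> Cl I q"
  thus "cell (fst z) = q"
   by (intro PiE_ext[OF cQ[unfolded Q_def] that[unfolded Q_def]]) (simp add: Cl_def cell_def)
 next
  assume "cell (fst z) = q"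
  thus "z \<in> Cl I q" by (auto simp: Cl_def cell_def)
 qed
 have part: "(\<Sum>q\<in>Q. indicator (Cl I q) z) = (1::real)" for z
 proof -
  have "(\<Sum>q\<in>Q. indicator (Cl I q) z) = (\<Sum>q\<in>Q. if q = cell (fst z) then 1 else 0 :: real)"
   by (rule sum.cong) (auto simp: indicator_def mem)
  thus ?thesis using fQ cQ by simp
 qed
 have Cs: "Cl I q \<in> sets mu" for q using inv[OF I(1)] unfolding invariant_def by blast
 define rho where "rho = wavg mu (%y. kp y x + phi y)"
 \<comment> \<open>The weighted excess over the average has total integral zero; hence on some cell
   of positive measure its integral is at most 0, and the restricted measure has an average no
   larger than \<open>rho\<close>.\<close>
 define F where "F y = \<sigma> y * (kp y x + phi y - rho)" for y
 have cF: "continuous_on UNIV F" unfolding F_def by (intro continuous_on_mult continuous_on_diff \<sigma>_continuous cont_kp_plus continuous_on_const)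
 have iF: "integrable mu (%z. F (fst z))" by (rule integrable_fst[OF mu(1) cF])
 have F0: "(\<integral>z. F (fst z) \<partial>mu) = 0" unfolding F_def wavg_excess[OF mu(1) cont_kp_plus] rho_def by simp
 have "EX q:Q. 0 < measure mu (Cl I q) & (\<integral>z. indicator (Cl I q) z * F (fst z) \<partial>mu) <= 0"
 proof (rule ccontr)
  assume no: "~ ?thesis"
  have neg: "0 < (\<integral>z. indicator (Cl I q) z * F (fst z) \<partial>mu)" if "q \<in> Q" "0 < measure mu (Cl I q)" for q
  proof (rule ccontr)
   assume "~ ?thesis"
   hence "(\<integral>z. indicator (Cl I q) z * F (fst z) \<partial>mu) <= 0" by (simp only: not_less)
   with no that show False by blast
  qed
  have null: "(\<integral>z. indicator (Cl I q) z * F (fst z) \<partial>mu) = 0" if "~ 0 < measure mu (Cl I q)" for q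
  proof -
   have "measure mu (Cl I q) = 0" using that by (simp add: zero_less_measure_iff)
   hence "AE z in mu. z \<notin> Cl I q" using Cs by (intro AE_not_in) (simp add: null_sets_def emeasure_eq_measure)
   hence "AE z in mu. indicator (Cl I q) z * F (fst z) = 0" by (rule eventually_mono) simp
   thus ?thesis by (rule integral_eq_zero_AE)
  qed
  have ge: "0 <= (\<integral>z. indicator (Cl I q) z * F (fst z) \<partial>mu)" if "q \<in> Q" for q
   using neg[OF that] null[of q] by (cases "0 < measure mu (Cl I q)") auto
  have "(\<Sum>q\<in>Q. (\<integral>z. indicator (Cl I q) z * F (fst z) \<partial>mu)) = (\<integral>z. (\<Sum>q\<in>Q. indicator (Cl I q) z * F (fst z)) \<partial>mu)"
   using integrable_indicator_mult[OF iF Cs] by (simp add: Bochner_Integration.integral_sum)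
  also have "... = (\<integral>z. F (fst z) \<partial>mu)" by (simp only: sum_distrib_right[symmetric] part mult_1)
  finally have z: "(\<Sum>q\<in>Q. (\<integral>z. indicator (Cl I q) z * F (fst z) \<partial>mu)) = 0" using F0 by simp
  have "(\<integral>z. indicator (Cl I q) z * F (fst z) \<partial>mu) = 0" if "q \<in> Q" for q
   by (rule sum_nonneg_0[of Q "%q. \<integral>z. indicator (Cl I q) z * F (fst z) \<partial>mu", OF fQ ge z that])
  hence "~ 0 < measure mu (Cl I q)" if "q \<in> Q" for q using neg that by force
  hence m0: "measure mu (Cl I q) = 0" if "q \<in> Q" for q using that by (simp add: zero_less_measure_iff)
  have "1 = (\<integral>z. (\<Sum>q\<in>Q. indicator (Cl I q) z :: real) \<partial>mu)" by (simp only: part) (simp add: prob_space)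
  also have "... = (\<Sum>q\<in>Q. measure mu (Cl I q))" using Cs by (subst Bochner_Integration.integral_sum) (auto simp: emeasure_eq_measure)
  also have "... = 0" using m0 by simp
  finally show False by simp
 qed
 then obtain q where q: "q \<in> Q" "0 < measure mu (Cl I q)" "(\<integral>z. indicator (Cl I q) z * F (fst z) \<partial>mu) <= 0" by blast
 obtain nu where nu: "mather nu" "AE z in nu. z \<in> Cl I q"
  "!!F. integrable mu F ==> integral\<^sup>L nu F = (\<integral>z. indicator (Cl I q) z * F z \<partial>mu) / measure mu (Cl I q)"
  by (rule invariant_restrict[OF mu(1) inv[OF I(1)] q(2)]) blast
 have "integral\<^sup>L nu (%z. F (fst z)) <= 0" unfolding nu(3)[OF iF] using q(2,3) by (simp add: divide_nonpos_pos)
 hence nurho: "wavg nu (%y. kp y x + phi y) <= rho"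
  unfolding F_def wavg_excess[OF nu(1) cont_kp_plus] using integral_\<sigma>_pos[OF nu(1)] by (simp add: mult_le_0_iff)
 have "Cl I q ~= {}" using q(2) by auto
 then obtain zs where zs: "zs \<in> Cl I q" by blast
 define ys where "ys = fst zs"
 \<comment> \<open>One almost calibrated step for the single function \<open>kp ys\<close> serves
   all \<open>y\<close> of the cell.\<close>
 obtain z r where z: "h t z x <= ereal r" "kp ys z + r + cv * t <= kp ys x + dlt" using kp_calibrated[OF t dlt] by blast
 obtain i where i: "i \<in> I" "z \<in> U i" using I(2) by blast
 have net: "\<bar>kp y z - kp y i\<bar> <= dlt" for y using U i(2) by blast
 \<comment> \<open>Two \<open>dlt\<close> pay for replacing \<open>z\<close> by the net point
   \<open>i\<close>, one for the width of the cell and one for the calibration of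
   \<open>kp ys\<close>.\<close>
 have "wavg nu (%y. kp y z + phi y) <= wavg nu (%y. kp y x + phi y) + (4 * dlt - (r + cv * t))"
 proof (rule wavg_mono[OF nu(1) cont_kp_plus cont_kp_plus])
  show "AE y in nu. kp (fst y) z + phi (fst y) <= kp (fst y) x + phi (fst y) + (4 * dlt - (r + cv * t))"
   using nu(2)
  proof (rule eventually_mono)
   fix y assume "y \<in> Cl I q"
   hence "\<lfloor>D i (fst y) / dlt\<rfloor> = \<lfloor>D i ys / dlt\<rfloor>" using zs i(1) unfolding Cl_def ys_def by simp
   hence "D i (fst y) / dlt - D i ys / dlt < 1" by linarith
   hence "(D i (fst y) - D i ys) / dlt < 1" by (simp only: diff_divide_distrib)
   hence "D i (fst y) - D i ys < dlt" using dlt by (simp add: pos_divide_less_eq)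
   thus "kp (fst y) z + phi (fst y) <= kp (fst y) x + phi (fst y) + (4 * dlt - (r + cv * t))"
    using net[of "fst y"] net[of ys] z(2) unfolding D_def by (simp add: abs_le_iff)
  qed
 qed
 hence "opP phi z + r + cv * t <= opP phi x + eps"
  using opP_le[OF nu(1), of z] nurho mu(2) e unfolding rho_def[symmetric] dlt_def by simp
 thus ?thesis using z(1) by blast
qed

lemma opP_viscosity: "viscosity_solution A G cv (opP phi)"
 by (rule weak_KAM_viscosity) (unfold weak_KAM_def, use opP_dominated opP_calibrated in blast)

lemma weighted_peierls_eq: "weighted_peierls A g G \<sigma> phi x = ereal (opP phi x)"
proof -
 have eq: "ereal_integral nu (%y. ereal (\<sigma> y) * peierls_barrier A G y x) / ereal (\<integral>y. \<sigma> y \<partial>nu) +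
   ereal ((\<integral>y. \<sigma> y * phi y \<partial>nu) / (\<integral>y. \<sigma> y \<partial>nu)) = ereal (wavg mu (%y. kp y x + phi y))"
  if mu: "mather mu" and nu: "nu = distr mu borel fst" for mu nu
 proof -
  interpret prob_space mu by (rule mather_facts(1)[OF mu])
  have m: "fst \<in> measurable mu borel"
   using fst_tangent_measurable measurable_cong_sets[OF mather_facts(2)[OF mu] refl] by blast
  have c: "continuous_on UNIV (%y. \<sigma> y * kp y x)" by (intro continuous_on_mult \<sigma>_continuous kp_continuous)
  have int: "F \<in> borel_measurable borel" "integrable nu F" "integral\<^sup>L nu F = (\<integral>z. F (fst z) \<partial>mu)" if "continuous_on UNIV F" for F :: "'m => real"
  proof -
   show F: "F \<in> borel_measurable borel" using that by (rule borel_measurable_continuous_onI)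
   show "integrable nu F" unfolding nu using integrable_distr_eq[OF m F] integrable_fst[OF mu that] by blast
   show "integral\<^sup>L nu F = (\<integral>z. F (fst z) \<partial>mu)" unfolding nu by (rule integral_distr[OF m F])
  qed
  obtain B where B: "!!y. \<bar>\<sigma> y * kp y x\<bar> <= B" by (rule bounded_continuous[OF c]) blast
  have "ereal_integral nu (%y. ereal (\<sigma> y * kp y x)) = ereal (\<integral>y. \<sigma> y * kp y x \<partial>nu)"
  proof (rule ereal_integral_real(1)[of _ _ B])
   show "(%y. \<sigma> y * kp y x) \<in> borel_measurable nu" using int(1)[OF c] by (simp add: nu)
   show "finite_measure nu" unfolding nu by (rule prob_space.finite_measure[OF prob_space_distr[OF m]])
   show "integrable nu (%y. \<sigma> y * kp y x)" by (rule int(2)[OF c])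
   show "- B <= \<sigma> y * kp y x" for y using B[of y] by linarith
  qed
  hence "ereal_integral nu (%y. ereal (\<sigma> y) * peierls_barrier A G y x) = ereal (\<integral>z. \<sigma> (fst z) * kp (fst z) x \<partial>mu)"
   unfolding peierls_eq times_ereal.simps int(3)[OF c] .
  moreover have "(\<integral>y. \<sigma> y \<partial>nu) = (\<integral>z. \<sigma> (fst z) \<partial>mu)" by (rule int(3)[OF \<sigma>_continuous])
  moreover have "(\<integral>y. \<sigma> y * phi y \<partial>nu) = (\<integral>z. \<sigma> (fst z) * phi (fst z) \<partial>mu)"
   by (rule int(3)) (intro continuous_on_mult \<sigma>_continuous phi)
  moreover have "(\<integral>z. \<sigma> (fst z) * (kp (fst z) x + phi (fst z)) \<partial>mu) = (\<integral>z. \<sigma> (fst z) * kp (fst z) x \<partial>mu) + (\<integral>z. \<sigma> (fst z) * phi (fst z) \<partial>mu)"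
   unfolding distrib_left by (intro Bochner_Integration.integral_add integrable_fst[OF mu, of "%y. \<sigma> y * kp y x"] integrable_fst[OF mu, of "%y. \<sigma> y * phi y"] c continuous_on_mult \<sigma>_continuous phi)
  ultimately show ?thesis using integral_\<sigma>_pos[OF mu] unfolding wavg_def by (simp add: add_divide_distrib)
 qed
 define T where "T nu = ereal_integral nu (%y. ereal (\<sigma> y) * peierls_barrier A G y x) / ereal (\<integral>y. \<sigma> y \<partial>nu) +
   ereal ((\<integral>y. \<sigma> y * phi y \<partial>nu) / (\<integral>y. \<sigma> y \<partial>nu))" for nu
 have img: "projected_mather_measures A g G = (%mu. distr mu borel fst) ` Collect (mather)"
  unfolding projected_mather_measures_def by blast
 have "weighted_peierls A g G \<sigma> phi x = (INF mu\<in>Collect (mather). T (distr mu borel fst))"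
  unfolding weighted_peierls_def img T_def[symmetric] image_image ..
 also have "... = (INF mu\<in>Collect (mather). ereal (wavg mu (%y. kp y x + phi y)))"
  by (rule INF_cong) (use eq in "auto simp: T_def")
 also have "... = ereal (opP phi x)"
 proof -
  have "(%mu. wavg mu (%y. kp y x + phi y)) ` Collect (mather) ~= {}" using mather_exists by simp
  from ereal_Inf'[OF opP_bdd this] show ?thesis unfolding opP_def image_image by (rule sym)
 qed
 finally show ?thesis .
qed

lemma opP_fixed_point: "viscosity_solution A G cv phi ==> opP phi x = phi x"
proof (rule antisym)
 assume v: "viscosity_solution A G cv phi"
 hence vs: "vsub phi cv" by (simp add: viscosity_solution_iff)
 have ge: "phi x <= kp y x + phi y" for y using vsub_le_kp[OF vs, of x y] by simp
 show "phi x <= opP phi x"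
 proof (rule opP_ge)
  fix mu assume mu: "mather mu"
  have "wavg mu (%_. phi x) <= wavg mu (%y. kp y x + phi y) + 0"
   by (rule wavg_mono[OF mu continuous_on_const cont_kp_plus], rule AE_I2) (use ge in simp)
  thus "phi x <= wavg mu (%y. kp y x + phi y)" by (simp add: wavg_const[OF mu])
 qed
 obtain mu where mu: "mather mu" "integrable mu (%z. kp (fst z) x + phi (fst z) - phi x)"
  "(\<integral>z. kp (fst z) x + phi (fst z) - phi x \<partial>mu) <= 0" by (rule viscosity_mather[OF v])
 \<comment> \<open>The integrand is nonnegative with integral at most 0, so it vanishes almost
   everywhere, which also determines the average with weight.\<close>
 have nn: "AE z in mu. 0 <= kp (fst z) x + phi (fst z) - phi x" using ge by (intro AE_I2) simp
 have "(\<integral>z. kp (fst z) x + phi (fst z) - phi x \<partial>mu) = 0" using mu(3) integral_nonneg_AE[OF nn] by simp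
 hence "AE z in mu. kp (fst z) x + phi (fst z) - phi x = 0" using integral_nonneg_eq_0_iff_AE[OF mu(2) nn] by blast
 hence "AE z in mu. kp (fst z) x + phi (fst z) <= phi x + 0" by (rule eventually_mono) simp
 hence "wavg mu (%y. kp y x + phi y) <= wavg mu (%_. phi x) + 0"
  by (rule wavg_mono[OF mu(1) cont_kp_plus continuous_on_const])
 thus "opP phi x <= phi x" using opP_le[OF mu(1), of x] by (simp add: wavg_const[OF mu(1)])
qed

end

lemma opP_nonexpansive:
 assumes "continuous_on UNIV phi" "continuous_on UNIV psi" "!!y. phi y <= psi y + b"
 shows "opP phi x <= opP psi x + b"
proof -
 have "opP phi x - b <= opP psi x"
 proof (rule opP_ge[OF assms(2)])
  fix mu assume mu: "mather mu"
  have "wavg mu (%y. kp y x + phi y) <= wavg mu (%y. kp y x + psi y) + b"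
   by (rule wavg_mono[OF mu cont_kp_plus[OF assms(1)] cont_kp_plus[OF assms(2)]], rule AE_I2) (use assms(3) in simp)
  thus "opP phi x - b <= wavg mu (%y. kp y x + psi y)" using opP_le[OF assms(1) mu, of x] by simp
 qed
 thus ?thesis by simp
qed

end

theorem theorem3:
  fixes A :: "('m::{t2_space, second_countable_topology}, 'e::euclidean_space) chart set"
    and g :: "'m \<Rightarrow> 'e \<Rightarrow> 'e \<Rightarrow> real"
    and G :: "'m \<Rightarrow> ('e \<Rightarrow>\<^sub>L real) \<Rightarrow> real"
    and \<sigma> :: "'m \<Rightarrow> real"
  assumes "compact (UNIV :: 'm set)" and "connected (UNIV :: 'm set)"
    and "smooth_atlas A" and "riemannian_metric A g"
    and "continuous_map (cotangent_topology A) euclideanreal (\<lambda>(x, p). G x p)"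
    and "\<And>x. convex_on UNIV (G x)"
    and "superlinear g G"
    and "continuous_on UNIV \<sigma>" and "\<And>x. \<sigma> x > 0"
  shows "\<exists>P :: ('m \<Rightarrow>\<^sub>C real) \<Rightarrow> ('m \<Rightarrow>\<^sub>C real).
    (\<forall>\<phi> x. ereal (apply_bcontfun (P \<phi>) x) = weighted_peierls A g G \<sigma> (apply_bcontfun \<phi>) x) \<and>
    (\<forall>\<phi>\<^sub>1 \<phi>\<^sub>2. norm (P \<phi>\<^sub>1 - P \<phi>\<^sub>2) \<le> norm (\<phi>\<^sub>1 - \<phi>\<^sub>2)) \<and>
    (\<forall>\<phi>. viscosity_solution A G (critical_value A G) (apply_bcontfun (P \<phi>))) \<and>
    (\<forall>u. viscosity_solution A G (critical_value A G) (apply_bcontfun u) \<longleftrightarrow> P u = u)"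
proof -
 interpret weighted_kam A g G \<sigma> by unfold_locales (fact assms)+
 have c: "continuous_on UNIV (apply_bcontfun phi)" for phi :: "'m \<Rightarrow>\<^sub>C real" by simp
 define P where "P phi = Bcontfun (opP (apply_bcontfun phi))" for phi :: "'m \<Rightarrow>\<^sub>C real"
 have P: "apply_bcontfun (P phi) = opP (apply_bcontfun phi)" for phi
 proof -
  have co: "continuous_on UNIV (opP (apply_bcontfun phi))" by (rule dominated_continuous[OF opP_dominated[OF c]])
  obtain B where "!!x. \<bar>opP (apply_bcontfun phi) x\<bar> <= B" by (rule bounded_continuous[OF co]) blast
  thus ?thesis unfolding P_def by (intro Bcontfun_inverse bcontfun_normI[OF co, of B]) simp
 qed
 show ?thesis
 proof (intro exI[of _ P] conjI allI)
  fix phi x show "ereal (apply_bcontfun (P phi) x) = weighted_peierls A g G \<sigma> (apply_bcontfun phi) x"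
   by (simp add: P weighted_peierls_eq)
 next
  fix phi\<^sub>1 phi\<^sub>2 :: "'m \<Rightarrow>\<^sub>C real"
  have le: "apply_bcontfun phi y <= apply_bcontfun psi y + dist phi psi" for phi psi :: "'m \<Rightarrow>\<^sub>C real" and y
   using dist_bounded[of phi y psi] by (simp add: dist_real_def)
  have "dist (P phi\<^sub>1) (P phi\<^sub>2) <= dist phi\<^sub>1 phi\<^sub>2"
  proof (rule dist_bound)
   fix x show "dist (apply_bcontfun (P phi\<^sub>1) x) (apply_bcontfun (P phi\<^sub>2) x) <= dist phi\<^sub>1 phi\<^sub>2"
    using opP_nonexpansive[OF c[of phi\<^sub>1] c[of phi\<^sub>2] le, of x] opP_nonexpansive[OF c[of phi\<^sub>2] c[of phi\<^sub>1] le, of x]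
    by (simp add: P dist_real_def dist_commute[of phi\<^sub>2])
  qed
  thus "norm (P phi\<^sub>1 - P phi\<^sub>2) <= norm (phi\<^sub>1 - phi\<^sub>2)" by (simp add: dist_norm)
 next
  fix phi show "viscosity_solution A G (critical_value A G) (apply_bcontfun (P phi))" by (simp add: P opP_viscosity)
 next
  fix u show "viscosity_solution A G (critical_value A G) (apply_bcontfun u) \<longleftrightarrow> P u = u"
  proof
   assume "viscosity_solution A G (critical_value A G) (apply_bcontfun u)"
   thus "P u = u" by (intro bcontfun_eqI) (simp add: P opP_fixed_point)
  next
   assume "P u = u"
   thus "viscosity_solution A G (critical_value A G) (apply_bcontfun u)" using opP_viscosity[OF c, of u] by (simp add: P[symmetric])
  qed
 qed
qed

end
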